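(* Let $f\in C_b(\mathbb{R}^N)$, $\lambda>0$ and $s\in(0,1)$. Consider the equation $$\lambda u-Lu=f,\qquad( * )$$ where $L$ is the generator of the Ornstein–Uhlenbeck semigroup with fractional diffusion of order $s$ described in the context. (a) If $s\ne1/2$, equation $( * )$ has a unique solution $u\in C^{2s}_b(\mathbb{R}^N)$, and there is $C>0$, independent of $f$, such that $\|u\|_{C^{2s}_b(\mathbb{R}^N)}\le C\|f\|_\infty$. (b) If $s=1/2$, equation $( * )$ has a unique solution in $Z^1_b(\mathbb{R}^N)$, and there is $C>0$, independent of $f$, such that $\|u\|_{Z^1_b(\mathbb{R}^N)}\le C\|f\|_\infty$. (c) If in addition $f\in C^\alpha_b(\mathbb{R}^N)$ with $\alpha\in(0,1)$ and $\alpha+2s\notin\{1,2\}$, then $u\in C^{\alpha+2s}_b(\mathbb{R}^N)$, and there is $C>0$, independent of $f$, such that $\|u\|_{C^{\alpha+2s}_b(\mathbb{R}^N)}\le C\|f\|_{C^\alpha_b(\mathbb{R}^N)}$. (d) If in addition $f\in C^\alpha_b(\mathbb{R}^N)$ with $\alpha\in(0,1)$ and $\alpha+2s=k\in\{1,2\}$, then $u\in Z^k_b(\mathbb{R}^N)$, and there is $C>0$, independent of $f$, such that $\|u\|_{Z^k_b(\mathbb{R}^N)}\le C\|f\|_{C^\alpha_b(\mathbb{R}^N)}$.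
   Context: The operator. $Q$ is a symmetric positive definite $N\times N$ real matrix, $B$ is any $N\times N$ real matrix. For $t>0$ set $$g_t(z)=\frac1{(2\pi)^N}\int_{\mathbb{R}^N}\exp\Big(-\tfrac12\int_0^t|Q^{1/2}e^{-\sigma B^*}\xi|^{2s}\,d\sigma\Big)e^{-i\langle\xi,z\rangle}\,d\xi,$$ which is a probability density on $\mathbb{R}^N$, and $P_tf(x)=\int_{\mathbb{R}^N}f(e^{-tB}x+z)g_t(z)\,dz$, $P_0=I$, $f\in C_b(\mathbb{R}^N)$. $(P_t)$ is a semigroup on $C_b(\mathbb{R}^N)$; its generator $L$ is the unique closed operator in $C_b(\mathbb{R}^N)$ with $R(\lambda,L)f(x)=\int_0^\infty e^{-\lambda t}P_tf(x)\,dt$ for $\lambda>0$ (heuristically $Lu=\frac12\mathrm{Tr}^s(QD^2u)-\langle Bx,\nabla u\rangle$, where $\mathrm{Tr}^s(QD^2)$ has symbol $-\langle Q\xi,\xi\rangle^s$). The solution of $\lambda u-Lu=f$ is $u=R(\lambda,L)f$ (unique in the domain of $L$). Function spaces. $C_b(\mathbb{R}^N)$: bounded continuous functions with sup norm. For $\sigma\in(0,1)$, $C^\sigma_b(\mathbb{R}^N)$: bounded $\sigma$-Hölder continuous functions, norm $\|f\|_\infty+\sup_{x,\,h\ne0}|f(x+h)-f(x)|/|h|^\sigma$. For $n\in\mathbb{N}$, $C^n_b(\mathbb{R}^N)$: functions with bounded continuous derivatives up to order $n$, norm given by sum of sup norms; $C^{n+\sigma}_b(\mathbb{R}^N)$: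 $f\in C^n_b$ whose $n$-th order derivative is $\sigma$-Hölder, norm $\|f\|_{C^n_b}$ plus the $\sigma$-Hölder seminorm of $D^nf$. $Z^1_b(\mathbb{R}^N)$: bounded continuous $f$ with $[f]_{Z^1}=\sup_{x,\,h\ne0}|f(x+2h)-2f(x+h)+f(x)|/|h|<\infty$, norm $\|f\|_\infty+[f]_{Z^1}$. $Z^2_b(\mathbb{R}^N)$: $f\in C^1_b$ with $[Df]_{Z^1}<\infty$, norm $\|f\|_{C^1_b}+[Df]_{Z^1}$. *)

theory Defs
  imports "HOL-Analysis.Analysis"
begin

section \<open>Matrix functions\<close>

definition symmetric_mat :: "real^'n^'n \<Rightarrow> bool" where
  "symmetric_mat A \<longleftrightarrow> transpose A = A"

definition pos_def_mat :: "real^'n^'n \<Rightarrow> bool" where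
  "pos_def_mat A \<longleftrightarrow> (\<forall>x. x \<noteq> 0 \<longrightarrow> 0 < (A *v x) \<bullet> x)"

definition mat_sqrt :: "real^'n^'n \<Rightarrow> real^'n^'n" where
  "mat_sqrt A = (THE R. symmetric_mat R \<and> pos_def_mat R \<and> R ** R = A)"

text \<open>The library product \<open>*\<close> and power \<open>^\<close> on vectors are componentwise, so \<open>exp\<close> is not the
  matrix exponential; powers are taken with respect to \<open>**\<close>.\<close>

definition mat_power :: "real^'n^'n \<Rightarrow> nat \<Rightarrow> real^'n^'n" where
  "mat_power A k = (((**) A) ^^ k) (mat 1)"

definition mat_exp :: "real^'n^'n \<Rightarrow> real^'n^'n" where
  "mat_exp A = (\<Sum>k. (1 / fact k) *\<^sub>R mat_power A k)"


section \<open>The Ornstein--Uhlenbeck semigroup and its generator\<close>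

text \<open>The integrand of the outer integral is Hermitian in \<open>\<xi>\<close>, so the integral is real and
  \<open>Re\<close> only changes the type.\<close>

definition ou_density :: "real^'n^'n \<Rightarrow> real^'n^'n \<Rightarrow> real \<Rightarrow> real \<Rightarrow> real^'n \<Rightarrow> real" where
  "ou_density Q B s t z =
     Re (1 / (2 * of_real pi) ^ CARD('n) *
        (\<integral>\<xi>. of_real (exp (- (1/2) *
                 (LINT \<sigma>:{0..t}|lborel.
                    norm (mat_sqrt Q *v (mat_exp ((- \<sigma>) *\<^sub>R transpose B) *v \<xi>)) powr (2 * s))))
             * exp (- \<i> * of_real (\<xi> \<bullet> z)) \<partial>lborel))"

definition ou_semigroup ::
  "real^'n^'n \<Rightarrow> real^'n^'n \<Rightarrow> real \<Rightarrow> real \<Rightarrow> (real^'n \<Rightarrow> real) \<Rightarrow> real^'n \<Rightarrow> real" where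
  "ou_semigroup Q B s t f x =
     (if t = 0 then f x
      else (\<integral>z. f (mat_exp ((- t) *\<^sub>R B) *v x + z) * ou_density Q B s t z \<partial>lborel))"

text \<open>An operator in a normed space, with domain a linear subspace, is given by its graph
  \<open>L\<close>: \<open>(u, w) \<in> L\<close> means that \<open>u\<close> is in the domain and \<open>L u = w\<close>.\<close>

definition closed_operator :: "('v::real_normed_vector \<times> 'v) set \<Rightarrow> bool" where
  "closed_operator L \<longleftrightarrow> subspace L \<and> single_valued L \<and> closed L"

text \<open>\<open>u\<close> lies in the domain of \<open>L\<close> and \<open>\<lambda> u - L u = f\<close>.\<close>

definition solves_resolvent_eq ::
  "('v::real_normed_vector \<times> 'v) set \<Rightarrow> real \<Rightarrow> 'v \<Rightarrow> 'v \<Rightarrow> bool" where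
  "solves_resolvent_eq L lam f u \<longleftrightarrow> (\<exists>w. (u, w) \<in> L \<and> lam *\<^sub>R u - w = f)"

text \<open>\<open>lam\<close> is in the resolvent set of \<open>L\<close> and \<open>R\<close> is the resolvent operator
  \<open>R(\<lambda>, L) = (\<lambda> - L)\<^sup>-\<^sup>1\<close>, everywhere defined and bounded.\<close>

definition is_resolvent ::
  "('v::real_normed_vector \<times> 'v) set \<Rightarrow> real \<Rightarrow> ('v \<Rightarrow> 'v) \<Rightarrow> bool" where
  "is_resolvent L lam R \<longleftrightarrow>
     bounded_linear R \<and> (\<forall>f u. solves_resolvent_eq L lam f u \<longleftrightarrow> u = R f)"

text \<open>The space \<open>C\<^sub>b\<close> with the sup norm is the library type of bounded continuous functions.\<close>

definition is_ou_generator ::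
  "real^'n^'n \<Rightarrow> real^'n^'n \<Rightarrow> real
     \<Rightarrow> (((real^'n) \<Rightarrow>\<^sub>C real) \<times> ((real^'n) \<Rightarrow>\<^sub>C real)) set \<Rightarrow> bool" where
  "is_ou_generator Q B s L \<longleftrightarrow>
     closed_operator L \<and>
     (\<forall>lam>0. \<exists>R. is_resolvent L lam R \<and>
        (\<forall>f x. apply_bcontfun (R f) x =
           (LINT t:{0..}|lborel. exp (- lam * t) * ou_semigroup Q B s t (apply_bcontfun f) x)))"

definition ou_generator ::
  "real^'n^'n \<Rightarrow> real^'n^'n \<Rightarrow> real \<Rightarrow> (((real^'n) \<Rightarrow>\<^sub>C real) \<times> ((real^'n) \<Rightarrow>\<^sub>C real)) set" where
  "ou_generator Q B s = (THE L. is_ou_generator Q B s L)"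


section \<open>Hoelder and Zygmund spaces\<close>

definition partial :: "'n \<Rightarrow> (real^'n \<Rightarrow> real) \<Rightarrow> real^'n \<Rightarrow> real" where
  "partial i f x = frechet_derivative f (at x) (axis i 1)"

primrec partials :: "'n list \<Rightarrow> (real^'n \<Rightarrow> real) \<Rightarrow> real^'n \<Rightarrow> real" where
  "partials [] f = f"
| "partials (i # js) f = partial i (partials js f)"

text \<open>The \<open>k\<close>-th derivative \<open>D\<^sup>k f(x)\<close> is the tensor of the \<open>partials js f x\<close> with
  \<open>length js = k\<close>; tensors of order \<open>k\<close> carry the Euclidean norm.\<close>

definition tensor_norm :: "nat \<Rightarrow> ('n::finite list \<Rightarrow> real) \<Rightarrow> real" where
  "tensor_norm k T = L2_set T {js. length js = k}"

definition Cnb :: "nat \<Rightarrow> (real^'n \<Rightarrow> real) set" where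
  "Cnb n = {f. \<forall>js. length js \<le> n \<longrightarrow>
       continuous_on UNIV (partials js f) \<and> bounded (range (partials js f)) \<and>
       (length js < n \<longrightarrow> (\<forall>x. partials js f differentiable (at x)))}"

definition Cnb_norm :: "nat \<Rightarrow> (real^'n \<Rightarrow> real) \<Rightarrow> real" where
  "Cnb_norm n f = (\<Sum>k\<le>n. SUP x. tensor_norm k (\<lambda>js. partials js f x))"

text \<open>Difference quotients of \<open>D\<^sup>k f\<close>. In both cases the suprema below run over all \<open>x\<close> and
  all \<open>h \<noteq> 0\<close>; a real supremum is meaningful only if it is finite, which is part of
  membership in the space.\<close>

definition hoelder_quot :: "nat \<Rightarrow> real \<Rightarrow> (real^'n \<Rightarrow> real) \<Rightarrow> (real^'n) \<times> (real^'n) \<Rightarrow> real" where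
  "hoelder_quot k \<sigma> f = (\<lambda>(x, h).
     tensor_norm k (\<lambda>js. partials js f (x + h) - partials js f x) / norm h powr \<sigma>)"

definition zygmund_quot :: "nat \<Rightarrow> (real^'n \<Rightarrow> real) \<Rightarrow> (real^'n) \<times> (real^'n) \<Rightarrow> real" where
  "zygmund_quot k f = (\<lambda>(x, h).
     tensor_norm k (\<lambda>js. partials js f (x + 2 *\<^sub>R h) - 2 * partials js f (x + h) + partials js f x)
       / norm h)"

text \<open>\<open>C\<^sup>\<theta>\<^sub>b\<close> for non-integer \<open>\<theta> > 0\<close>, written as \<open>\<theta> = n + \<sigma>\<close> with \<open>n\<close> the integer part and
  \<open>\<sigma> \<in> (0, 1)\<close>. Not meant for integer \<open>\<theta>\<close>.\<close>

definition hoelder_space :: "real \<Rightarrow> (real^'n \<Rightarrow> real) set" where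
  "hoelder_space \<theta> = {f \<in> Cnb (nat \<lfloor>\<theta>\<rfloor>).
     bdd_above (hoelder_quot (nat \<lfloor>\<theta>\<rfloor>) (frac \<theta>) f ` (UNIV \<times> (- {0})))}"

definition hoelder_norm :: "real \<Rightarrow> (real^'n \<Rightarrow> real) \<Rightarrow> real" where
  "hoelder_norm \<theta> f = Cnb_norm (nat \<lfloor>\<theta>\<rfloor>) f +
     (SUP p\<in>UNIV \<times> (- {0}). hoelder_quot (nat \<lfloor>\<theta>\<rfloor>) (frac \<theta>) f p)"

text \<open>\<open>Z\<^sup>k\<^sub>b\<close> for \<open>k \<ge> 1\<close>: functions in \<open>C\<^sup>k\<^sup>-\<^sup>1\<^sub>b\<close> whose derivative of order \<open>k - 1\<close> satisfies the
  Zygmund condition.\<close>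

definition zygmund_space :: "nat \<Rightarrow> (real^'n \<Rightarrow> real) set" where
  "zygmund_space k = {f \<in> Cnb (k - 1). bdd_above (zygmund_quot (k - 1) f ` (UNIV \<times> (- {0})))}"

definition zygmund_norm :: "nat \<Rightarrow> (real^'n \<Rightarrow> real) \<Rightarrow> real" where
  "zygmund_norm k f = Cnb_norm (k - 1) f + (SUP p\<in>UNIV \<times> (- {0}). zygmund_quot (k - 1) f p)"

end

theory Submission
  imports Defs "HOL-Probability.Probability"
begin

text \<open>In Fourier variables the semigroup multiplies by the exponential of \<open>- 1/2\<close> times the integral
  of \<open>q(\<sigma>, \<xi>)^(2s)\<close> over \<open>[0, t]\<close>, where \<open>q(\<sigma>, \<xi>) = |Q^(1/2) e^(-\<sigma>B*) \<xi>|\<close>, up to the linear flow.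
  Since \<open>r^s\<close> is a mixture of the functions \<open>1 - exp (- \<tau> r)\<close> with weight \<open>\<tau>^(-1-s) d\<tau>\<close>, this symbol
  is a compound Poisson limit of Gaussian characteristic functions; a Gaussian jump of variance at
  least of order \<open>t^(1/s)\<close> occurs with a fixed probability, whence
  \<open>|P\<^sub>t f(x + h) - P\<^sub>t f(x)| \<le> K |h| t^(-1/(2s)) sup |f|\<close> for \<open>0 < t \<le> 1\<close>. Three such steps bound the
  third differences of \<open>P\<^sub>t f\<close> by \<open>|h|^3 t^(-3/(2s)) sup |f|\<close>; for \<open>f\<close> in \<open>C\<^sup>\<alpha>\<close> an inf-convolution at
  scale \<open>t^(1/(2s))\<close> gains a factor \<open>t^(\<alpha>/(2s))\<close>. Splitting the Laplace transform at
  \<open>t = |h|^(2s)\<close> shows that the third differences of \<open>u\<close> are \<open>O(|h|^(\<alpha> + 2s))\<close>, and because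
  \<open>\<alpha> + 2s < 3\<close>, dyadic descent to lower differences and to derivatives turns this single estimate
  into all the Hoelder and Zygmund bounds.\<close>

section \<open>Matrix exponential and matrix square root\<close>

text \<open>The forms \<open>q \<sigma>\<close> change with \<sigma> and need not be proportional to
  each other, so the transition density has no self-similarity to exploit, and the symbol is in
  general not smooth at the origin, which obstructs bounds obtained by differentiating it. Gaussian
  mixtures avoid both obstacles: for a single \<sigma> a linear change of variables is enough, and
  averaging over \<sigma> and \<tau> preserves the bound. This is carried out on the Fourier side,
  with multiplier norms tested on integrable functions; probability densities come from inversion,
  because norm 1 together with value 1 at the origin already forces positivity. Merely bounded data
  are not a separate case: the Hoelder hypothesis is used in the form
  \<open>|f y - f z| <= 2 F |y - z|^\<alpha>\<close> with \<open>F\<close> a bound of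
  \<open>f\<close>, which for \<alpha> = 0 follows from boundedness. Third differences are taken
  with three independent increments, since a derivative is recovered by spending one increment in a
  coordinate direction while the other two stay free.\<close>

text \<open>Endomorphisms under composition form a Banach algebra, which gives access to the
  library exponential; neither vectors nor bounded linear functions carry that algebra structure.\<close>

typedef (overloaded) 'a endo = "UNIV :: ('a::euclidean_space \<Rightarrow>\<^sub>L 'a) set"
  morphisms endo_fun Endo ..

setup_lifting type_definition_endo

instantiation endo :: (euclidean_space) real_normed_algebra_1
begin

lift_definition zero_endo :: "'a endo" is 0 .
lift_definition one_endo :: "'a endo" is id_blinfun .
lift_definition plus_endo :: "'a endo \<Rightarrow> 'a endo \<Rightarrow> 'a endo" is plus .
lift_definition minus_endo :: "'a endo \<Rightarrow> 'a endo \<Rightarrow> 'a endo" is minus .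
lift_definition uminus_endo :: "'a endo \<Rightarrow> 'a endo" is uminus .
lift_definition times_endo :: "'a endo \<Rightarrow> 'a endo \<Rightarrow> 'a endo" is blinfun_compose .
lift_definition scaleR_endo :: "real \<Rightarrow> 'a endo \<Rightarrow> 'a endo" is scaleR .
lift_definition norm_endo :: "'a endo \<Rightarrow> real" is norm .

definition dist_endo :: "'a endo \<Rightarrow> 'a endo \<Rightarrow> real" where "dist_endo x y = norm (x - y)"
definition sgn_endo :: "'a endo \<Rightarrow> 'a endo" where "sgn_endo x = inverse (norm x) *\<^sub>R x"
definition uniformity_endo :: "('a endo \<times> 'a endo) filter" where
  "uniformity_endo = (INF e\<in>{0 <..}. principal {(x, y). dist x y < e})"
definition open_endo :: "'a endo set \<Rightarrow> bool" where
  "open_endo U \<longleftrightarrow> (\<forall>x\<in>U. \<forall>\<^sub>F (x', y) in uniformity. x' = x \<longrightarrow> y \<in> U)"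

instance
proof
  fix a b c :: "'a endo" and r q :: real and U :: "'a endo set"
  show "a + b + c = a + (b + c)" "a + b = b + a" "0 + a = a" "- a + a = 0" "a - b = a + - b"
    by (transfer; simp)+
  show "r *\<^sub>R (a + b) = r *\<^sub>R a + r *\<^sub>R b" "(r + q) *\<^sub>R a = r *\<^sub>R a + q *\<^sub>R a"
    "r *\<^sub>R q *\<^sub>R a = (r * q) *\<^sub>R a" "1 *\<^sub>R a = a"
    by (transfer; simp add: algebra_simps)+
  show "a * b * c = a * (b * c)" "1 * a = a" "a * 1 = a"
    "(a + b) * c = a * c + b * c" "a * (b + c) = a * b + a * c"
    "r *\<^sub>R a * b = r *\<^sub>R (a * b)" "a * r *\<^sub>R b = r *\<^sub>R (a * b)"
    by (transfer; simp add: blinfun_eqI blinfun.bilinear_simps)+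
  show "(0::'a endo) \<noteq> 1"
    by transfer (metis norm_blinfun_id norm_zero zero_neq_one)
  show "dist a b = norm (a - b)" by (simp add: dist_endo_def)
  show "sgn a = inverse (norm a) *\<^sub>R a" by (simp add: sgn_endo_def)
  show "(uniformity :: ('a endo \<times> 'a endo) filter) = (INF e\<in>{0 <..}. principal {(x, y). dist x y < e})"
    by (simp add: uniformity_endo_def)
  show "open U = (\<forall>x\<in>U. \<forall>\<^sub>F (x', y) in uniformity. x' = x \<longrightarrow> y \<in> U)"
    by (simp add: open_endo_def)
  show "(norm a = 0) = (a = 0)" "norm (a + b) \<le> norm a + norm b" "norm (r *\<^sub>R a) = \<bar>r\<bar> * norm a"
    by (transfer; simp add: norm_triangle_ineq)+
  show "norm (a * b) \<le> norm a * norm b" by transfer (rule norm_blinfun_compose)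
  show "norm (1::'a endo) = 1" by transfer simp
qed

end

lift_definition endo_apply :: "'a::euclidean_space endo \<Rightarrow> 'a \<Rightarrow> 'a" is blinfun_apply .

lemma endo_apply_simps [simp]:
  "endo_apply 0 x = 0" "endo_apply 1 x = x" "endo_apply (a + b) x = endo_apply a x + endo_apply b x"
  "endo_apply (a - b) x = endo_apply a x - endo_apply b x"
  "endo_apply (a * b) x = endo_apply a (endo_apply b x)"
  "endo_apply (r *\<^sub>R a) x = r *\<^sub>R endo_apply a x"
  by (transfer; simp add: blinfun.bilinear_simps)+

lemma endo_eqI: "(\<And>x. endo_apply a x = endo_apply b x) \<Longrightarrow> a = b"
  by transfer (rule blinfun_eqI)

lemma norm_endo_apply: "norm (endo_apply a x) \<le> norm a * norm x"
  by transfer (rule norm_blinfun)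

lemma norm_endo_le:
  assumes "0 \<le> c" "\<And>x. norm (endo_apply a x) \<le> c * norm x"
  shows "norm a \<le> c"
  using assms by transfer (rule norm_blinfun_bound)

lemma linear_endo_apply: "linear (endo_apply a)"
  by transfer (simp add: blinfun.bounded_linear_right bounded_linear.linear)

lemma bounded_bilinear_endo_apply: "bounded_bilinear endo_apply"
proof
  fix a b :: "'a::euclidean_space endo" and x y :: 'a and r :: real
  show "endo_apply (a + b) x = endo_apply a x + endo_apply b x" by simp
  show "endo_apply a (x + y) = endo_apply a x + endo_apply a y"
    by (rule linear_add[OF linear_endo_apply])
  show "endo_apply (r *\<^sub>R a) x = r *\<^sub>R endo_apply a x" by simp
  show "endo_apply a (r *\<^sub>R x) = r *\<^sub>R endo_apply a x"
    by (rule linear_scale[OF linear_endo_apply])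
  show "\<exists>K. \<forall>a x. norm (endo_apply a x :: 'a) \<le> norm a * norm x * K"
    by (rule exI[of _ 1]) (simp add: norm_endo_apply)
qed

instance endo :: (euclidean_space) banach
proof
  fix X :: "nat \<Rightarrow> 'a endo"
  assume "Cauchy X"
  then have "Cauchy (\<lambda>n. endo_fun (X n))"
    unfolding Cauchy_def dist_norm by transfer
  then obtain l where l: "(\<lambda>n. endo_fun (X n)) \<longlonglongrightarrow> l"
    using Cauchy_convergent convergent_def by blast
  then have "(\<lambda>n. norm (endo_fun (X n) - l)) \<longlonglongrightarrow> 0"
    using LIM_zero tendsto_norm_zero by blast
  moreover have "norm (endo_fun (X n) - l) = norm (X n - Endo l)" for n
    by (simp add: norm_endo.rep_eq minus_endo.rep_eq Endo_inverse)
  ultimately have "X \<longlonglongrightarrow> Endo l"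
    by (simp add: LIM_zero_iff tendsto_norm_zero_iff)
  then show "convergent X" by (rule convergentI)
qed

section \<open>Passage between matrices and endomorphisms\<close>

definition mat_endo :: "real^'n^'n \<Rightarrow> (real^'n) endo" where
  "mat_endo A = Endo (Blinfun ((*v) A))"

lemma mat_endo_apply [simp]: "endo_apply (mat_endo A) x = A *v x"
  by (simp add: mat_endo_def endo_apply.rep_eq Endo_inverse bounded_linear_Blinfun_apply)

definition endo_mat :: "(real^'n) endo \<Rightarrow> real^'n^'n" where
  "endo_mat a = matrix (endo_apply a)"

lemma endo_mat_mult [simp]: "endo_mat a *v x = endo_apply a x"
  by (simp add: endo_mat_def linear_endo_apply)

lemma mat_endo_mat [simp]: "mat_endo (endo_mat a) = a"
  by (rule endo_eqI) simp

lemma endo_mat_endo [simp]: "endo_mat (mat_endo A) = A"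
  by (simp add: matrix_eq)

lemma mat_endo_simps:
  "mat_endo (A ** B) = mat_endo A * mat_endo B" "mat_endo (mat 1) = 1"
  "mat_endo (r *\<^sub>R A) = r *\<^sub>R mat_endo A" "mat_endo (- A) = - mat_endo A"
  "mat_endo (A - B) = mat_endo A - mat_endo B"
proof -
  show "mat_endo (r *\<^sub>R A) = r *\<^sub>R mat_endo A" for r
    by (rule endo_eqI) (simp add: scaleR_matrix_vector_assoc)
  from this[of "-1"] show "mat_endo (- A) = - mat_endo A" by simp
qed (rule endo_eqI; simp add: matrix_vector_mul_assoc matrix_vector_mult_diff_rdistrib)+

lemma mat_endo_power: "mat_endo (mat_power A k) = mat_endo A ^ k"
  by (induction k) (simp_all add: mat_power_def mat_endo_simps)

text \<open>Continuity is the point: it lets the exponential series, summed in the Banach algebra of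
  endomorphisms, be mapped term by term to the matrix series in \<open>mat_exp\<close>. The constant
  comes from bounding every entry by \<open>norm a\<close> and summing the entries.\<close>

lemma bounded_linear_endo_mat: "bounded_linear (endo_mat :: (real^'n) endo \<Rightarrow> real^'n^'n)"
proof (rule bounded_linear_intro[where K="real CARD('n) * real CARD('n)"])
  fix a b :: "(real^'n) endo" and r :: real
  show "endo_mat (a + b) = endo_mat a + endo_mat b"
    by (simp add: matrix_eq matrix_vector_mult_add_rdistrib)
  show "endo_mat (r *\<^sub>R a) = r *\<^sub>R endo_mat a"
    by (simp add: matrix_eq flip: scaleR_matrix_vector_assoc)
  have "\<bar>endo_mat a $ i $ j\<bar> \<le> norm a" for i j
  proof -
    have "endo_mat a $ i $ j = endo_apply a (axis j 1) $ i"
      by (simp add: endo_mat_def matrix_def)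
    also have "\<bar>\<dots>\<bar> \<le> norm (endo_apply a (axis j 1))" by (rule component_le_norm_cart)
    also have "\<dots> \<le> norm a" using norm_endo_apply[of a "axis j 1"] by (simp add: norm_axis_1)
    finally show ?thesis .
  qed
  then have "norm (endo_mat a $ i) \<le> real CARD('n) * norm a" for i
    using norm_le_l1_cart[of "endo_mat a $ i"] sum_bounded_above[of UNIV "\<lambda>j. \<bar>endo_mat a $ i $ j\<bar>" "norm a"]
    by force
  then have "(\<Sum>i\<in>UNIV. norm (endo_mat a $ i)) \<le> real CARD('n) * (real CARD('n) * norm a)"
    using sum_bounded_above[of UNIV "\<lambda>i. norm (endo_mat a $ i)" "real CARD('n) * norm a"] by force
  moreover have "norm (endo_mat a) \<le> (\<Sum>i\<in>UNIV. norm (endo_mat a $ i))"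
    unfolding norm_vec_def[of "endo_mat a"] by (rule L2_set_le_sum) simp
  ultimately show "norm (endo_mat a) \<le> norm a * (real CARD('n) * real CARD('n))"
    by (simp add: mult.commute mult.left_commute)
qed

lemma mat_exp_eq: "mat_exp A = endo_mat (exp (mat_endo A))"
proof -
  have "(\<lambda>k. mat_endo A ^ k /\<^sub>R fact k) sums exp (mat_endo A)" by (rule exp_converges)
  then have "(\<lambda>k. endo_mat (mat_endo A ^ k /\<^sub>R fact k)) sums endo_mat (exp (mat_endo A))"
    by (rule bounded_linear.sums[OF bounded_linear_endo_mat])
  moreover have "endo_mat (mat_endo A ^ k /\<^sub>R fact k) = (1 / fact k) *\<^sub>R mat_power A k" for k
    by (simp add: linear_scale[OF bounded_linear.linear[OF bounded_linear_endo_mat]] inverse_eq_divide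
        flip: mat_endo_power)
  ultimately show ?thesis unfolding mat_exp_def by (simp add: sums_iff)
qed

lemma mat_exp_apply: "mat_exp (t *\<^sub>R A) *v x = endo_apply (exp (t *\<^sub>R mat_endo A)) x"
  by (simp add: mat_exp_eq mat_endo_simps)

lemma mat_exp_zero_apply [simp]: "mat_exp (0 *\<^sub>R A) *v x = x"
  by (simp add: mat_exp_apply del: scaleR_zero_left, simp)

lemma mat_exp_add_apply:
  "mat_exp ((t + u) *\<^sub>R A) *v x = mat_exp (t *\<^sub>R A) *v (mat_exp (u *\<^sub>R A) *v x)"
proof -
  have "exp (t *\<^sub>R mat_endo A + u *\<^sub>R mat_endo A) = exp (t *\<^sub>R mat_endo A) * exp (u *\<^sub>R mat_endo A)"
    by (rule exp_add_commuting) simp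
  then show ?thesis unfolding mat_exp_apply by (simp add: scaleR_add_left)
qed

lemma norm_mat_exp_apply: "norm (mat_exp (t *\<^sub>R A) *v x) \<le> exp (\<bar>t\<bar> * norm (mat_endo A)) * norm x"
  unfolding mat_exp_apply
  by (rule order_trans[OF norm_endo_apply])
     (intro mult_right_mono order_trans[OF norm_exp] norm_ge_zero, simp)

lemma continuous_exp_scaleR:
  "continuous_on UNIV (\<lambda>t::real. exp (t *\<^sub>R (A :: 'a :: {banach, real_normed_algebra_1})))"
proof (intro continuous_at_imp_continuous_on ballI)
  fix t :: real
  show "isCont (\<lambda>t::real. exp (t *\<^sub>R A)) t"
    using exp_scaleR_has_vector_derivative_right[of A t UNIV] by (rule has_vector_derivative_continuous)
qed

lemma continuous_mat_exp_apply [continuous_intros]: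
  fixes f :: "'a::topological_space \<Rightarrow> real"
  assumes "continuous_on S f" "continuous_on S g"
  shows "continuous_on S (\<lambda>p. mat_exp (f p *\<^sub>R A) *v g p)"
proof -
  have "continuous_on S (\<lambda>p. exp (f p *\<^sub>R mat_endo A))"
    by (rule continuous_on_compose2[OF continuous_exp_scaleR assms(1)]) simp
  from bounded_bilinear.continuous_on[OF bounded_bilinear_endo_apply this assms(2)]
  show ?thesis by (simp add: mat_exp_apply)
qed

lemma transpose_mat_power: "transpose (mat_power A k) = mat_power (transpose A) k"
proof -
  \<comment> \<open>Transposition reverses products while \<open>mat_power\<close> multiplies on the
    left, so the induction needs the new factor on the other side.\<close>
  have comm: "mat_power A k ** A = A ** mat_power A k" for k
    by (induction k) (simp_all add: mat_power_def matrix_mul_assoc[symmetric])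
  show ?thesis
  proof (induction k)
    case (Suc k)
    have "transpose (mat_power A (Suc k)) = transpose (mat_power A k ** A)"
      using comm[of k] by (simp add: mat_power_def)
    also have "\<dots> = mat_power (transpose A) (Suc k)"
      by (simp add: matrix_transpose_mul Suc) (simp add: mat_power_def)
    finally show ?case .
  qed (simp add: mat_power_def)
qed

lemma mat_exp_transpose: "mat_exp (transpose A) = transpose (mat_exp A)"
proof -
  have lin: "linear (transpose :: real^'n^'n \<Rightarrow> real^'n^'n)"
    by (rule linearI) (simp_all add: transpose_def vec_eq_iff)
  have "(\<lambda>k. mat_endo A ^ k /\<^sub>R fact k) sums exp (mat_endo A)" by (rule exp_converges)
  then have "(\<lambda>k. endo_mat (mat_endo A ^ k /\<^sub>R fact k)) sums endo_mat (exp (mat_endo A))"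
    by (rule bounded_linear.sums[OF bounded_linear_endo_mat])
  then have "(\<lambda>k. transpose (endo_mat (mat_endo A ^ k /\<^sub>R fact k))) sums transpose (endo_mat (exp (mat_endo A)))"
    using bounded_linear.sums[OF linear_conv_bounded_linear[THEN iffD1, OF lin]] by blast
  moreover have "transpose (endo_mat (mat_endo A ^ k /\<^sub>R fact k)) = (1 / fact k) *\<^sub>R mat_power (transpose A) k" for k
    by (simp add: linear_scale[OF bounded_linear.linear[OF bounded_linear_endo_mat]] inverse_eq_divide
        linear_scale[OF lin] transpose_mat_power flip: mat_endo_power)
  ultimately have "mat_exp (transpose A) = transpose (endo_mat (exp (mat_endo A)))"
    unfolding mat_exp_def by (simp add: sums_iff)
  then show ?thesis by (simp add: mat_exp_eq)
qed

text \<open>The duality that moves the flow between points and frequencies: a Fourier character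
  composed with the flow generated by \<open>B\<close> is a character at the frequency moved by the
  transpose.\<close>

lemma inner_mat_exp_transpose:
  "(mat_exp (t *\<^sub>R transpose B) *v x) \<bullet> y = x \<bullet> (mat_exp (t *\<^sub>R B) *v y)"
proof -
  have "t *\<^sub>R transpose B = transpose (t *\<^sub>R B)" by (simp add: transpose_def vec_eq_iff)
  then show ?thesis
    by (simp add: mat_exp_transpose dot_lmul_matrix[symmetric] transpose_matrix_vector)
qed

section \<open>Positive definite square roots\<close>

lemma inner_symmetric_mat: "symmetric_mat A \<Longrightarrow> (A *v x) \<bullet> y = x \<bullet> (A *v y)"
  by (metis dot_lmul_matrix symmetric_mat_def transpose_matrix_vector)

lemma pos_def_mat_lower:
  fixes Q :: "real^'n^'n"
  assumes "pos_def_mat Q"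
  obtains c where "c > 0" "\<And>x. c * (norm x)^2 \<le> (Q *v x) \<bullet> x"
proof -
  have "compact (sphere (0::real^'n) 1)" "sphere (0::real^'n) 1 \<noteq> {}"
    by auto
  moreover have "continuous_on (sphere 0 1) (\<lambda>x. (Q *v x) \<bullet> x)"
    by (intro continuous_intros matrix_vector_mult_linear_continuous_on)
  ultimately obtain z where z: "z \<in> sphere 0 1" "\<And>x. x \<in> sphere 0 1 \<Longrightarrow> (Q *v z) \<bullet> z \<le> (Q *v x) \<bullet> x"
    using continuous_attains_inf[of "sphere 0 1" "\<lambda>x. (Q *v x) \<bullet> x"] by blast
  show thesis
  proof
    have "z \<noteq> 0" using z(1) by auto
    then show "(Q *v z) \<bullet> z > 0" using assms by (simp add: pos_def_mat_def)
    fix x :: "real^'n"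
    show "(Q *v z) \<bullet> z * (norm x)^2 \<le> (Q *v x) \<bullet> x"
    proof (cases "x = 0")
      case False
      have "(Q *v z) \<bullet> z \<le> (Q *v (x /\<^sub>R norm x)) \<bullet> (x /\<^sub>R norm x)"
        by (rule z(2)) (simp add: False)
      also have "\<dots> = (Q *v x) \<bullet> x / (norm x)^2"
        by (simp add: matrix_vector_mult_scaleR power2_eq_square divide_inverse)
      finally show ?thesis using False by (simp add: field_simps)
    qed simp
  qed
qed

text \<open>With \<open>D = R - S\<close> one has \<open>R D + D S = R R - S S = 0\<close>.
  Multiplying by \<open>D\<close> and taking traces gives
  \<open>tr (D R D) + tr (D S D) = 0\<close>, where both terms are sums of values of positive forms;
  hence \<open>D\<close> kills every basis vector.\<close>

lemma mat_sqrt_unique: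
  fixes R S :: "real^'n^'n"
  assumes R: "symmetric_mat R" "pos_def_mat R" and S: "symmetric_mat S" "pos_def_mat S"
    and eq: "R ** R = S ** S"
  shows "R = S"
proof -
  define D where "D = R - S"
  have symD: "symmetric_mat D"
    using R(1) S(1) by (simp add: symmetric_mat_def D_def transpose_def vec_eq_iff)
  have "R ** D + D ** S = 0"
    using eq by (simp add: D_def matrix_eq matrix_vector_mult_add_rdistrib
        matrix_vector_mult_diff_rdistrib matrix_vector_mult_diff_distrib flip: matrix_vector_mul_assoc)
  moreover have "D ** (R ** D) + D ** (D ** S) = D ** (R ** D + D ** S)"
    by (simp add: matrix_add_ldistrib)
  moreover have "trace (D ** 0) = 0"
    by (simp add: matrix_matrix_mult_def trace_def)
  ultimately have "trace (D ** (R ** D)) + trace (D ** (D ** S)) = 0"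
    by (metis trace_add)
  moreover have "trace (D ** (D ** S)) = trace (D ** (S ** D))"
    by (metis trace_mul_sym matrix_mul_assoc)
  moreover have tr: "trace (D ** (M ** D)) = (\<Sum>i\<in>UNIV. (M *v (D *v axis i 1)) \<bullet> (D *v axis i 1))" for M
  proof -
    have "(D ** (M ** D)) $ i $ i = (M *v (D *v axis i 1)) \<bullet> (D *v axis i 1)" for i
    proof -
      have "(D ** (M ** D)) $ i $ i = ((D ** (M ** D)) *v axis i 1) \<bullet> axis i 1"
        by (simp add: matrix_vector_mult_basis inner_axis column_def)
      also have "\<dots> = (D *v (M *v (D *v axis i 1))) \<bullet> axis i 1"
        by (simp add: matrix_vector_mul_assoc)
      also have "\<dots> = (M *v (D *v axis i 1)) \<bullet> (D *v axis i 1)"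
        by (rule inner_symmetric_mat[OF symD])
      finally show ?thesis .
    qed
    then show ?thesis by (simp add: trace_def)
  qed
  moreover have nn: "0 \<le> (M *v y) \<bullet> y" if "pos_def_mat M" for M :: "real^'n^'n" and y
    using that by (cases "y = 0") (auto simp: pos_def_mat_def intro: less_imp_le)
  moreover have "0 \<le> (\<Sum>i\<in>UNIV. (R *v (D *v axis i 1)) \<bullet> (D *v axis i 1))"
    "0 \<le> (\<Sum>i\<in>UNIV. (S *v (D *v axis i 1)) \<bullet> (D *v axis i 1))"
    by (intro sum_nonneg nn R(2) S(2))+
  ultimately have "(\<Sum>i\<in>UNIV. (R *v (D *v axis i 1)) \<bullet> (D *v axis i 1)) = 0"
    using tr[of R] tr[of S] by linarith
  then have "(R *v (D *v axis i 1)) \<bullet> (D *v axis i 1) = 0" for i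
    using nn[OF R(2)] by (simp add: sum_nonneg_eq_0_iff)
  then have "D *v axis i 1 = 0" for i
    using R(2) unfolding pos_def_mat_def by (metis less_irrefl)
  then have "D = 0"
    by (simp add: matrix_vector_mult_basis column_def vec_eq_iff)
  then show ?thesis by (simp add: D_def)
qed

text \<open>With \<open>Q = c (1 - A)\<close> and \<open>c\<close> large, \<open>A\<close> is a contraction, and a root \<open>1 - X\<close> of
  \<open>1 - A\<close> is a fixed point of \<open>X \<mapsto> (A + X\<^sup>2) / 2\<close>, which contracts the symmetric ball of
  radius \<open>norm A\<close>.\<close>

lemma mat_sqrt_exists:
  fixes Q :: "real^'n^'n"
  assumes sym: "symmetric_mat Q" and pos: "pos_def_mat Q"
  shows "\<exists>R. symmetric_mat R \<and> pos_def_mat R \<and> R ** R = Q"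
proof -
  obtain q where q: "q > 0" "\<And>x. q * (norm x)^2 \<le> (Q *v x) \<bullet> x"
    using pos_def_mat_lower[OF pos] by blast
  define M where "M = norm (mat_endo Q)"
  \<comment> \<open>In \<open>|x - Q x / c|^2\<close> the quadratic term contributes at most
    \<open>M^2 |x|^2 / c^2\<close>, and \<open>c >= M^2 / q\<close> makes this at most
    \<open>q |x|^2 / c\<close>, half of what the linear term gains. The summand \<open>q\<close>
    keeps the radicand \<open>1 - q / c\<close> nonnegative.\<close>
  define c where "c = M^2 / q + q + 1"
  have c: "c > 0" "c > M^2 / q" "c \<ge> q"
    using q(1) by (auto simp: c_def add_nonneg_pos intro: add_nonneg_nonneg)
  define A where "A = 1 - (1/c) *\<^sub>R mat_endo Q"
  have nQ: "norm (Q *v x) \<le> M * norm x" for x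
    using norm_endo_apply[of "mat_endo Q" x] by (simp add: M_def)
  define r where "r = sqrt (1 - q / c)"
  have r01: "0 \<le> r" "r < 1" using c q(1) by (auto simp: r_def)
  have nA: "norm A \<le> r"
  proof (rule norm_endo_le)
    fix x
    have "(norm (endo_apply A x))^2 = (norm x)^2 - 2 / c * ((Q *v x) \<bullet> x) + (norm (Q *v x))^2 / c^2"
      unfolding A_def power2_norm_eq_inner
      by (simp add: inner_diff_left inner_diff_right inner_commute field_simps power2_eq_square)
    also have "\<dots> \<le> (norm x)^2 - 2 / c * (q * (norm x)^2) + (M * norm x)^2 / c^2"
      using q(2)[of x] c nQ[of x]
      by (intro add_mono diff_mono mult_left_mono divide_right_mono power_mono) auto
    also have "\<dots> = (1 - 2 * q / c + (M^2 / q) * q / c / c) * (norm x)^2"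
      using q(1) by (simp add: field_simps power2_eq_square)
    also have "\<dots> \<le> (1 - 2 * q / c + c * q / c / c) * (norm x)^2"
      using c q(1) by (intro mult_right_mono add_left_mono divide_right_mono) auto
    also have "\<dots> = (r * norm x)^2"
      using c q(1) by (simp add: r_def power_mult_distrib field_simps)
    finally show "norm (endo_apply A x) \<le> r * norm x"
      using r01 by (simp add: power2_le_iff_abs_le)
  qed (use r01 in auto)
  define sy where "sy a \<longleftrightarrow> (\<forall>x y. endo_apply a x \<bullet> y = x \<bullet> endo_apply a y)" for a :: "(real^'n) endo"
  define F where "F = {X. norm X \<le> r \<and> sy X}"
  define f where "f X = (1/2) *\<^sub>R (A + X * X)" for X
  have syA: "sy A"
    unfolding sy_def A_def by (simp add: inner_diff_left inner_diff_right inner_symmetric_mat[OF sym])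
  have "closed F"
  proof -
    have ia: "isCont (\<lambda>a. endo_apply a x) a" for x and a :: "(real^'n) endo"
      by (rule bounded_linear.isCont[OF bounded_bilinear.bounded_linear_left[OF bounded_bilinear_endo_apply] continuous_ident])
    have "closed {X. norm X \<le> r}" by (intro closed_Collect_le continuous_intros)
    moreover have "closed {X. endo_apply X x \<bullet> y = x \<bullet> endo_apply X y}" for x y :: "real^'n"
      by (intro closed_Collect_eq continuous_at_imp_continuous_on ballI isCont_inner continuous_const ia)
    then have "closed {X. sy X}"
      unfolding sy_def by (intro closed_Collect_all)
    ultimately show ?thesis unfolding F_def by (intro closed_Collect_conj)
  qed
  have "\<exists>!X. X \<in> F \<and> f X = X"
  proof (rule Banach_fix[OF complete_eq_closed[THEN iffD2, OF \<open>closed F\<close>]])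
    show "F \<noteq> {}" using nA syA by (auto simp: F_def)
    show "0 \<le> r" "r < 1" by fact+
    show "f ` F \<subseteq> F"
    proof (rule image_subsetI)
      fix X assume X: "X \<in> F"
      have "norm (X * X) \<le> r * 1"
        by (rule order_trans[OF norm_mult_ineq], rule mult_mono) (use X r01 in \<open>auto simp: F_def\<close>)
      then have "norm (f X) \<le> r"
        using norm_triangle_ineq[of A "X * X"] nA by (simp add: f_def)
      moreover have "sy (f X)"
        using X syA unfolding F_def sy_def f_def by (simp add: inner_add_left inner_add_right)
      ultimately show "f X \<in> F" by (simp add: F_def)
    qed
    fix X Y assume XY: "X \<in> F" "Y \<in> F"
    have "f X - f Y = (1/2) *\<^sub>R (X * (X - Y) + (X - Y) * Y)"
      by (simp add: f_def algebra_simps)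
    then have "norm (f X - f Y) \<le> (norm X * norm (X - Y) + norm (X - Y) * norm Y) / 2"
      using norm_triangle_ineq[of "X * (X - Y)" "(X - Y) * Y"] norm_mult_ineq[of X "X - Y"]
        norm_mult_ineq[of "X - Y" Y] by simp
    also have "\<dots> \<le> (r * norm (X - Y) + norm (X - Y) * r) / 2"
      using XY by (intro divide_right_mono add_mono mult_mono) (auto simp: F_def r01)
    finally show "dist (f X) (f Y) \<le> r * dist X Y" by (simp add: dist_norm)
  qed
  then obtain X where X: "norm X \<le> r" "sy X" "f X = X" by (auto simp: F_def)
  have "X + X = (2::real) *\<^sub>R f X" by (simp add: X(3) flip: scaleR_2)
  then have sq: "(1 - X) * (1 - X) = 1 - A" by (simp add: f_def algebra_simps)
  define R where "R = sqrt c *\<^sub>R endo_mat (1 - X)"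
  have Rv: "R *v x = sqrt c *\<^sub>R (x - endo_apply X x)" for x
    by (simp add: R_def flip: scaleR_matrix_vector_assoc)
  have "R ** R = Q"
  proof -
    have "mat_endo (R ** R) = c *\<^sub>R ((1 - X) * (1 - X))"
      using c by (simp add: R_def mat_endo_simps)
    also have "\<dots> = mat_endo Q" using c by (simp add: sq A_def)
    finally show ?thesis by (metis endo_mat_endo)
  qed
  moreover have "symmetric_mat R"
  proof -
    have eq: "(R *v x) \<bullet> y = x \<bullet> (R *v y)" for x y
      using X(2) by (simp add: Rv sy_def inner_diff_left inner_diff_right)
    have "(transpose R *v y) \<bullet> x = (R *v y) \<bullet> x" for x y
      unfolding transpose_matrix_vector dot_lmul_matrix eq ..
    then have "transpose R *v y = R *v y" for y by (metis vector_eq_rdot)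
    then show ?thesis by (simp add: symmetric_mat_def matrix_eq)
  qed
  moreover have "pos_def_mat R"
    unfolding pos_def_mat_def
  proof (intro allI impI)
    fix x :: "real^'n" assume "x \<noteq> 0"
    have "endo_apply X x \<bullet> x \<le> norm (endo_apply X x) * norm x" by (rule norm_cauchy_schwarz)
    also have "\<dots> \<le> (r * norm x) * norm x"
      by (intro mult_right_mono order_trans[OF norm_endo_apply] X(1)) auto
    also have "\<dots> < 1 * norm x * norm x" using r01 \<open>x \<noteq> 0\<close> by (intro mult_strict_right_mono) auto
    finally show "0 < (R *v x) \<bullet> x"
      using c by (simp add: Rv inner_diff_left flip: power2_norm_eq_inner) (simp add: power2_eq_square)
  qed
  ultimately show ?thesis by blast
qed

lemma mat_sqrt_props:
  assumes "symmetric_mat Q" "pos_def_mat Q"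
  shows "symmetric_mat (mat_sqrt Q)" "pos_def_mat (mat_sqrt Q)" "mat_sqrt Q ** mat_sqrt Q = Q"
proof -
  have "\<exists>!R. symmetric_mat R \<and> pos_def_mat R \<and> R ** R = Q"
    using mat_sqrt_exists[OF assms] mat_sqrt_unique by blast
  from theI'[OF this]
  show "symmetric_mat (mat_sqrt Q)" "pos_def_mat (mat_sqrt Q)" "mat_sqrt Q ** mat_sqrt Q = Q"
    by (simp_all add: mat_sqrt_def)
qed

section \<open>Gaussian kernels\<close>

lemma measurable_cis [measurable]: "cis \<in> borel_measurable borel"
  by (intro borel_measurable_continuous_onI continuous_intros)

lemma lborel_integral_affine:
  fixes f :: "'a::euclidean_space \<Rightarrow> 'b::{banach, second_countable_topology}"
  assumes c: "c \<noteq> 0" and f: "integrable lborel f"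
  shows "integrable lborel (\<lambda>x. f (t + c *\<^sub>R x))"
    and "(\<integral>x. f x \<partial>lborel) = \<bar>c\<bar>^DIM('a) *\<^sub>R (\<integral>x. f (t + c *\<^sub>R x) \<partial>lborel)"
proof -
  have [measurable]: "f \<in> borel_measurable borel" using f by auto
  have "integrable (density (distr lborel borel (\<lambda>x. t + c *\<^sub>R x)) (\<lambda>_. ennreal (\<bar>c\<bar>^DIM('a)))) f"
    using f lborel_affine[OF c, of t] by (simp add: ennreal_power)
  then have "integrable (distr lborel borel (\<lambda>x. t + c *\<^sub>R x)) (\<lambda>x. \<bar>c\<bar>^DIM('a) *\<^sub>R f x)"
    by (subst (asm) integrable_density) auto
  then have "integrable lborel (\<lambda>x. (1 / \<bar>c\<bar>^DIM('a)) *\<^sub>R (\<bar>c\<bar>^DIM('a) *\<^sub>R f (t + c *\<^sub>R x)))"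
    by (subst (asm) integrable_distr_eq) (measurable, rule integrable_scaleR_right)
  moreover have "(1 / \<bar>c\<bar>^DIM('a)) *\<^sub>R (\<bar>c\<bar>^DIM('a) *\<^sub>R v) = v" for v :: 'b
    using c by simp
  ultimately show "integrable lborel (\<lambda>x. f (t + c *\<^sub>R x))"
    by (simp only:)
  have "(\<integral>x. f x \<partial>lborel) = (\<integral>x. f x \<partial>density (distr lborel borel (\<lambda>x. t + c *\<^sub>R x)) (\<lambda>_. ennreal (\<bar>c\<bar>^DIM('a))))"
    using lborel_affine[OF c, of t] by (simp add: ennreal_power)
  also have "\<dots> = (\<integral>x. \<bar>c\<bar>^DIM('a) *\<^sub>R f (t + c *\<^sub>R x) \<partial>lborel)"
    by (subst integral_density) (auto simp: integral_distr)
  finally show "(\<integral>x. f x \<partial>lborel) = \<bar>c\<bar>^DIM('a) *\<^sub>R (\<integral>x. f (t + c *\<^sub>R x) \<partial>lborel)"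
    by simp
qed

lemma lborel_integral_translate:
  fixes f :: "'a::euclidean_space \<Rightarrow> 'b::{banach, second_countable_topology}"
  assumes f: "integrable lborel f"
  shows "integrable lborel (\<lambda>x. f (x + t))" "(\<integral>x. f (x + t) \<partial>lborel) = (\<integral>x. f x \<partial>lborel)"
  using lborel_integral_affine[of 1 f t, OF _ f] by (simp_all add: add.commute)

lemma lborel_integral_prod:
  fixes f :: "'a::euclidean_space \<Rightarrow> real \<Rightarrow> complex"
  assumes f: "\<And>b. b \<in> Basis \<Longrightarrow> integrable lborel (f b)"
  shows "integrable lborel (\<lambda>x::'a. \<Prod>b\<in>Basis. f b (x \<bullet> b))"
    and "(\<integral>(x::'a). (\<Prod>b\<in>Basis. f b (x \<bullet> b)) \<partial>lborel) = (\<Prod>b\<in>Basis. (\<integral>x. f b x \<partial>lborel))"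
proof -
  interpret product_sigma_finite "\<lambda>b::'a. lborel :: real measure" ..
  have [measurable]: "f b \<in> borel_measurable borel" if "b \<in> Basis" for b using f[OF that] by auto
  have eq: "(\<Prod>b\<in>Basis. f b ((\<Sum>b\<in>Basis. x b *\<^sub>R b) \<bullet> b)) = (\<Prod>b\<in>Basis. f b (x b))" for x :: "'a \<Rightarrow> real"
    by (intro prod.cong) auto
  have m: "(\<lambda>x::'a. \<Prod>b\<in>Basis. f b (x \<bullet> b)) \<in> borel_measurable borel"
    by measurable
  have mT: "(\<lambda>x. \<Sum>b\<in>Basis. x b *\<^sub>R b) \<in> (\<Pi>\<^sub>M b\<in>(Basis::'a set). lborel) \<rightarrow>\<^sub>M borel"
    by measurable
  show "integrable lborel (\<lambda>x::'a. \<Prod>b\<in>Basis. f b (x \<bullet> b))"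
    by (subst lborel_eq, subst integrable_distr_eq[OF mT m], unfold eq)
       (intro product_integrable_prod finite_Basis f)
  show "(\<integral>(x::'a). (\<Prod>b\<in>Basis. f b (x \<bullet> b)) \<partial>lborel) = (\<Prod>b\<in>Basis. (\<integral>x. f b x \<partial>lborel))"
    by (subst lborel_eq, subst integral_distr[OF mT m], unfold eq)
       (intro product_integral_prod finite_Basis f)
qed

text \<open>Rescaling by \<open>sqrt e\<close> reduces this to the characteristic function of the
  standard normal law.\<close>

lemma gaussian_cis_real:
  fixes e t :: real
  assumes e: "e > 0"
  shows "integrable lborel (\<lambda>x. of_real (exp (- e * x\<^sup>2 / 2)) * cis (t * x))" (is ?int)
    and "(\<integral>x. of_real (exp (- e * x\<^sup>2 / 2)) * cis (t * x) \<partial>lborel)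
      = of_real (sqrt (2 * pi / e) * exp (- t\<^sup>2 / (2 * e)))" (is ?eq)
proof -
  define g where "g u x = of_real (exp (- x\<^sup>2 / 2)) * cis (u * x)" for u x :: real
  have gn: "g u x = of_real (sqrt (2 * pi)) * (std_normal_density x *\<^sub>R cis (u * x))" for u x
    by (simp add: g_def std_normal_density_def scaleR_conv_of_real)
  interpret prob_space "density lborel std_normal_density" by (rule prob_space_normal_density) simp
  have "integrable (density lborel std_normal_density) (\<lambda>x. cis (u * x))" for u
    by (rule integrable_const_bound[where B=1]) auto
  then have "integrable lborel (\<lambda>x. std_normal_density x *\<^sub>R cis (u * x))" for u
    by (subst (asm) integrable_density) auto
  then have gi: "integrable lborel (g u)" for u
    unfolding gn by (rule integrable_mult_right)
  have "char std_normal_distribution u = (\<integral>x. std_normal_density x *\<^sub>R cis (u * x) \<partial>lborel)" for u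
    unfolding char_def by (subst integral_density) (auto simp: cis_conv_exp)
  then have gv: "(\<integral>x. g u x \<partial>lborel) = of_real (sqrt (2 * pi) * exp (- u\<^sup>2 / 2))" for u
    unfolding gn by (subst integral_mult_right_zero) (simp add: char_std_normal_distribution)
  have eq: "g (t / sqrt e) (0 + sqrt e *\<^sub>R x) = of_real (exp (- e * x\<^sup>2 / 2)) * cis (t * x)" for x
    using e by (simp add: g_def power_mult_distrib)
  show ?int
    using lborel_integral_affine(1)[OF _ gi, of "sqrt e" "t / sqrt e" 0] e unfolding eq by simp
  have "(\<integral>x. g (t / sqrt e) x \<partial>lborel) = sqrt e *\<^sub>R (\<integral>x. of_real (exp (- e * x\<^sup>2 / 2)) * cis (t * x) \<partial>lborel)"
    using lborel_integral_affine(2)[OF _ gi, of "sqrt e" "t / sqrt e" 0] e unfolding eq by simp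
  then show ?eq
    using e unfolding gv by (simp add: scaleR_conv_of_real power_divide real_sqrt_divide field_simps)
qed

text \<open>The parameter is a variance in both definitions: \<open>gauss e\<close> is the
  characteristic function of the centred normal law with covariance \<open>e\<close> times the
  identity, and \<open>gauss_kernel e\<close> is its density.\<close>

definition gauss :: "real \<Rightarrow> 'a::euclidean_space \<Rightarrow> real" where
  "gauss e z = exp (- e * (norm z)\<^sup>2 / 2)"

definition gauss_kernel :: "real \<Rightarrow> 'a::euclidean_space \<Rightarrow> real" where
  "gauss_kernel e z = (1 / sqrt (2 * pi * e)) ^ DIM('a) * gauss (1 / e) z"

lemma gauss_bounds: "0 < gauss e z" "e \<ge> 0 \<Longrightarrow> gauss e z \<le> 1"
  by (auto simp: gauss_def)

lemma gauss_kernel_nonneg: "e > 0 \<Longrightarrow> 0 \<le> gauss_kernel e z"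
  by (auto simp: gauss_kernel_def gauss_def)

lemma continuous_gauss: "continuous_on S (gauss e)" "continuous_on S (gauss_kernel e)"
  unfolding gauss_kernel_def gauss_def divide_inverse by (intro continuous_intros)+

lemma measurable_gauss [measurable]:
  "gauss e \<in> borel_measurable borel" "gauss_kernel e \<in> borel_measurable borel"
  by (intro borel_measurable_continuous_onI continuous_gauss)+

lemma gauss_cis:
  fixes \<xi> :: "'a::euclidean_space"
  assumes e: "e > 0"
  shows "integrable lborel (\<lambda>z. of_real (gauss e z) * cis (\<xi> \<bullet> z))" (is ?int)
    and "(\<integral>z. of_real (gauss e z) * cis (\<xi> \<bullet> z) \<partial>lborel)
      = of_real ((sqrt (2 * pi / e)) ^ DIM('a) * gauss (1 / e) \<xi>)" (is ?eq)
proof -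
  define f where "f b x = complex_of_real (exp (- e * x\<^sup>2 / 2)) * cis ((\<xi> \<bullet> b) * x)" for b :: 'a and x
  have cis_sum: "cis (\<Sum>b\<in>A. h b) = (\<Prod>b\<in>A. cis (h b))" if "finite A" for A and h :: "'a \<Rightarrow> real"
    using that by (induction A rule: finite_induct) (auto simp: cis_mult[symmetric])
  have pr: "of_real (gauss d z) = (\<Prod>b\<in>Basis. complex_of_real (exp (- d * (z \<bullet> b)\<^sup>2 / 2)))" for d and z :: 'a
  proof -
    have "(norm z)\<^sup>2 = (\<Sum>b\<in>Basis. (z \<bullet> b)\<^sup>2)"
      unfolding power2_norm_eq_inner by (subst euclidean_inner) (simp add: power2_eq_square)
    then have "- d * (norm z)\<^sup>2 / 2 = (\<Sum>b\<in>Basis. - d * (z \<bullet> b)\<^sup>2 / 2)"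
      by (simp add: sum_distrib_left sum_divide_distrib sum_negf)
    then show ?thesis by (simp add: gauss_def exp_sum)
  qed
  have F: "of_real (gauss e z) * cis (\<xi> \<bullet> z) = (\<Prod>b\<in>Basis. f b (z \<bullet> b))" for z
    unfolding f_def prod.distrib pr[symmetric] by (subst euclidean_inner) (simp add: cis_sum)
  have fi: "integrable lborel (f b)" for b
    unfolding f_def by (rule gaussian_cis_real(1)[OF e])
  show ?int unfolding F by (rule lborel_integral_prod(1)[OF fi])
  have "(\<integral>z. of_real (gauss e z) * cis (\<xi> \<bullet> z) \<partial>lborel) = (\<Prod>b\<in>Basis. (\<integral>x. f b x \<partial>lborel))"
    unfolding F by (rule lborel_integral_prod(2)[OF fi])
  also have "\<dots> = (\<Prod>b\<in>Basis. of_real (sqrt (2 * pi / e)) * of_real (exp (- (1 / e) * (\<xi> \<bullet> b)\<^sup>2 / 2)))"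
    unfolding f_def gaussian_cis_real(2)[OF e] by (intro prod.cong) auto
  finally show ?eq
    unfolding prod.distrib pr[symmetric] by simp
qed

lemma gauss_kernel_cis:
  fixes x \<xi> :: "'a::euclidean_space"
  assumes e: "e > 0"
  shows "integrable lborel (\<lambda>z. of_real (gauss_kernel e z) * cis (\<xi> \<bullet> z))"
    and "(\<integral>z. of_real (gauss_kernel e z) * cis (\<xi> \<bullet> z) \<partial>lborel) = of_real (gauss e \<xi>)"
    and "(\<integral>\<xi>. of_real (gauss e \<xi>) * cis (x \<bullet> \<xi>) \<partial>lborel) = of_real ((2 * pi) ^ DIM('a) * gauss_kernel e x)"
proof -
  have e': "1 / e > 0" using e by simp
  have eq: "of_real (gauss_kernel e z) * cis (\<xi> \<bullet> z)
      = of_real ((1 / sqrt (2 * pi * e)) ^ DIM('a)) * (of_real (gauss (1 / e) z) * cis (\<xi> \<bullet> z))" for z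
    by (simp add: gauss_kernel_def)
  show "integrable lborel (\<lambda>z. of_real (gauss_kernel e z) * cis (\<xi> \<bullet> z))"
    unfolding eq by (intro integrable_mult_right gauss_cis(1)[OF e'])
  have "(1 / sqrt (2 * pi * e)) ^ DIM('a) * sqrt (2 * pi * e) ^ DIM('a) = 1"
    using e by (simp flip: power_mult_distrib)
  then show "(\<integral>z. of_real (gauss_kernel e z) * cis (\<xi> \<bullet> z) \<partial>lborel) = of_real (gauss e \<xi>)"
    unfolding eq integral_mult_right_zero gauss_cis(2)[OF e'] of_real_mult[symmetric]
    by (simp add: mult.assoc[symmetric])
  have "sqrt (2 * pi / e) = 2 * pi * (1 / sqrt (2 * pi * e))"
    using e by (simp add: real_sqrt_mult real_sqrt_divide field_simps)
  then have "sqrt (2 * pi / e) ^ DIM('a) = (2 * pi) ^ DIM('a) * (1 / sqrt (2 * pi * e)) ^ DIM('a)"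
    by (simp only: power_mult_distrib)
  then show "(\<integral>\<xi>. of_real (gauss e \<xi>) * cis (x \<bullet> \<xi>) \<partial>lborel) = of_real ((2 * pi) ^ DIM('a) * gauss_kernel e x)"
    unfolding gauss_cis(2)[OF e] by (simp add: gauss_kernel_def mult.assoc)
qed

lemma integral_gauss_kernel:
  assumes e: "e > 0"
  shows "integrable lborel (gauss_kernel e :: 'a::euclidean_space \<Rightarrow> real)"
    "(\<integral>(z::'a). gauss_kernel e z \<partial>lborel) = 1"
proof -
  have i: "integrable lborel (\<lambda>z::'a. complex_of_real (gauss_kernel e z))"
    using gauss_kernel_cis(1)[OF e, of 0] by simp
  show "integrable lborel (gauss_kernel e :: 'a \<Rightarrow> real)"
    using integrable_Re[OF i] by simp
  have "(\<integral>(z::'a). complex_of_real (gauss_kernel e z) \<partial>lborel) = 1"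
    using gauss_kernel_cis(2)[OF e, of 0] by (simp add: gauss_def)
  then show "(\<integral>(z::'a). gauss_kernel e z \<partial>lborel) = 1"
    by simp
qed

lemma integrable_gauss:
  assumes e: "e > 0"
  shows "integrable lborel (gauss e :: 'a::euclidean_space \<Rightarrow> real)"
  using integrable_Re[OF gauss_cis(1)[OF e, of 0]] by simp

lemma gauss_kernel_scale:
  fixes F :: "'a::euclidean_space \<Rightarrow> complex"
  assumes e: "e > 0" and [measurable]: "F \<in> borel_measurable borel" and b: "\<And>x. cmod (F x) \<le> b"
  shows "integrable lborel (\<lambda>z. of_real (gauss_kernel e (z - a)) * F z)" (is ?int)
    and "(\<integral>z. of_real (gauss_kernel e (z - a)) * F z \<partial>lborel)
      = (\<integral>y. of_real (gauss_kernel 1 y) * F (a + sqrt e *\<^sub>R y) \<partial>lborel)" (is ?eq)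
proof -
  have gi: "integrable lborel (\<lambda>z::'a. gauss_kernel e (z - a))"
    using lborel_integral_translate(1)[OF integral_gauss_kernel(1)[OF e], of "-a"] by simp
  show ?int
  proof (rule Bochner_Integration.integrable_bound)
    show "integrable lborel (\<lambda>z::'a. b * gauss_kernel e (z - a))" using gi by simp
    show "AE z in lborel. norm (of_real (gauss_kernel e (z - a)) * F z) \<le> norm (b * gauss_kernel e (z - a))"
    proof (rule AE_I2)
      fix z
      have "norm (of_real (gauss_kernel e (z - a)) * F z) = gauss_kernel e (z - a) * cmod (F z)"
        using gauss_kernel_nonneg[OF e, of "z - a"] by (simp add: norm_mult)
      also have "\<dots> \<le> gauss_kernel e (z - a) * \<bar>b\<bar>"
        using gauss_kernel_nonneg[OF e, of "z-a"] b[of z] by (intro mult_left_mono) auto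
      finally show "norm (of_real (gauss_kernel e (z - a)) * F z) \<le> norm (b * gauss_kernel e (z - a))"
        using gauss_kernel_nonneg[OF e, of "z-a"] by (simp add: abs_mult mult.commute)
    qed
  qed measurable
  have "sqrt e ^ DIM('a) * gauss_kernel e (sqrt e *\<^sub>R y) = gauss_kernel 1 y" for y :: 'a
  proof -
    have "sqrt e ^ DIM('a) * (1 / sqrt (2 * pi * e)) ^ DIM('a) = (1 / sqrt (2 * pi)) ^ DIM('a)"
      using e by (simp add: real_sqrt_mult flip: power_mult_distrib)
    moreover have "gauss (1 / e) (sqrt e *\<^sub>R y) = gauss 1 y"
      using e by (simp add: gauss_def power_mult_distrib)
    ultimately show ?thesis by (simp add: gauss_kernel_def mult.assoc[symmetric])
  qed
  then have "sqrt e ^ DIM('a) *\<^sub>R (of_real (gauss_kernel e (a + sqrt e *\<^sub>R y - a)) * F (a + sqrt e *\<^sub>R y))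
      = of_real (gauss_kernel 1 y) * F (a + sqrt e *\<^sub>R y)" for y
    by (simp add: scaleR_conv_of_real mult.assoc[symmetric] flip: of_real_mult of_real_power)
  then show ?eq
    using lborel_integral_affine(2)[OF _ \<open>?int\<close>, of "sqrt e" a] e
    by (simp flip: integral_scaleR_right)
qed

text \<open>Rescaling turns the shrinking kernels into one fixed kernel evaluated against
  \<open>F\<close> near \<open>a\<close>, so continuity at the single point \<open>a\<close> and
  dominated convergence suffice.\<close>

lemma gauss_kernel_approx:
  fixes F :: "'a::euclidean_space \<Rightarrow> complex"
  assumes e: "\<And>n. e n > 0" "e \<longlonglongrightarrow> 0" and [measurable]: "F \<in> borel_measurable borel"
    and b: "\<And>x. cmod (F x) \<le> b" and cont: "isCont F a"
  shows "(\<lambda>n. \<integral>z. of_real (gauss_kernel (e n) (z - a)) * F z \<partial>lborel) \<longlonglongrightarrow> F a"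
proof -
  have "(\<lambda>n. \<integral>y. of_real (gauss_kernel 1 y) * F (a + sqrt (e n) *\<^sub>R y) \<partial>lborel)
      \<longlonglongrightarrow> (\<integral>(y::'a). of_real (gauss_kernel 1 y) * F a \<partial>lborel)"
  proof (rule integral_dominated_convergence[where w="\<lambda>y. b * gauss_kernel 1 y"])
    show "AE y in lborel. (\<lambda>n. complex_of_real (gauss_kernel 1 y) * F (a + sqrt (e n) *\<^sub>R y)) \<longlonglongrightarrow> gauss_kernel 1 y * F a"
    proof (rule AE_I2)
      fix y :: 'a
      have "(\<lambda>n. a + sqrt (e n) *\<^sub>R y) \<longlonglongrightarrow> a + sqrt 0 *\<^sub>R y" by (intro tendsto_intros e(2))
      then have "(\<lambda>n. a + sqrt (e n) *\<^sub>R y) \<longlonglongrightarrow> a" by simp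
      then have "(\<lambda>n. F (a + sqrt (e n) *\<^sub>R y)) \<longlonglongrightarrow> F a"
        by (rule isCont_tendsto_compose[OF cont])
      then show "(\<lambda>n. complex_of_real (gauss_kernel 1 y) * F (a + sqrt (e n) *\<^sub>R y)) \<longlonglongrightarrow> gauss_kernel 1 y * F a"
        by (rule tendsto_mult_left)
    qed
    show "AE y in lborel. norm (complex_of_real (gauss_kernel 1 y) * F (a + sqrt (e n) *\<^sub>R y)) \<le> b * gauss_kernel 1 y" for n
    proof (rule AE_I2)
      fix y :: 'a
      show "norm (complex_of_real (gauss_kernel 1 y) * F (a + sqrt (e n) *\<^sub>R y)) \<le> b * gauss_kernel 1 y"
        using mult_right_mono[OF b[of "a + sqrt (e n) *\<^sub>R y"] gauss_kernel_nonneg[of 1 y]]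
          gauss_kernel_nonneg[of 1 y] by (simp add: norm_mult mult.commute)
    qed
  qed (auto intro!: integral_gauss_kernel)
  moreover have "(\<integral>(y::'a). of_real (gauss_kernel 1 y) * F a \<partial>lborel) = F a"
    using integral_gauss_kernel[of 1, where 'a='a] by simp
  ultimately show ?thesis
    by (simp only: gauss_kernel_scale(2)[OF e(1) assms(3) b])
qed

text \<open>The square roots of the two kernels have the explicit overlap
  \<open>gauss_kernel 1 (y - b/2) * exp (- |b|\<^sup>2 / 8)\<close>, and \<open>|r\<^sup>2 - q\<^sup>2|\<close> is bounded by AM-GM with
  weight \<open>1 / |b|\<close>.\<close>

lemma gauss_kernel_translate:
  fixes b :: "'a::euclidean_space"
  shows "(\<integral>y. \<bar>gauss_kernel 1 (y - b) - gauss_kernel 1 y\<bar> \<partial>lborel) \<le> 3 * norm b"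
proof (cases "b = 0")
  case False
  define W where "W = (gauss_kernel 1 :: 'a \<Rightarrow> real)"
  define k where "k = 1 / norm b"
  define q where "q = exp (- (norm b)\<^sup>2 / 8)"
  have k: "k > 0" using False by (simp add: k_def)
  have Wn: "W y \<ge> 0" for y by (simp add: W_def gauss_kernel_nonneg)
  have ov: "sqrt (W y) * sqrt (W (y - b)) = q * W (y - b /\<^sub>R 2)" for y
  proof -
    define m where "m = y - b /\<^sub>R 2"
    have y: "y = m + b /\<^sub>R 2" "y - b = m - b /\<^sub>R 2"
      by (simp_all add: m_def algebra_simps flip: scaleR_2)
    have 1: "(norm y)\<^sup>2 + (norm (y - b))\<^sup>2 = 2 * (norm m)\<^sup>2 + (norm b)\<^sup>2 / 2"
      unfolding y power2_norm_eq_inner by (simp add: inner_add inner_diff algebra_simps)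
    have "sqrt (W y) * sqrt (W (y - b)) = sqrt ((1 / sqrt (2 * pi)) ^ DIM('a) * (1 / sqrt (2 * pi)) ^ DIM('a)
        * (exp (- (norm y)\<^sup>2 / 2) * exp (- (norm (y - b))\<^sup>2 / 2)))"
      by (simp add: W_def gauss_kernel_def gauss_def mult_ac flip: real_sqrt_mult)
    also have "exp (- (norm y)\<^sup>2 / 2) * exp (- (norm (y - b))\<^sup>2 / 2) = (exp (- (norm m)\<^sup>2 / 2) * q)\<^sup>2"
    proof -
      have "- (norm y)\<^sup>2 / 2 + - (norm (y - b))\<^sup>2 / 2 = (- (norm m)\<^sup>2 / 2 + - (norm b)\<^sup>2 / 8) * 2"
        using 1 by simp
      then show ?thesis
        by (simp add: q_def power2_eq_square flip: exp_add)
    qed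
    also have "sqrt ((1 / sqrt (2 * pi)) ^ DIM('a) * (1 / sqrt (2 * pi)) ^ DIM('a) * (exp (- (norm m)\<^sup>2 / 2) * q)\<^sup>2)
        = (1 / sqrt (2 * pi)) ^ DIM('a) * (exp (- (norm m)\<^sup>2 / 2) * q)"
      by (simp add: real_sqrt_mult q_def)
    finally show ?thesis
      unfolding m_def[symmetric] by (simp add: W_def gauss_kernel_def gauss_def mult_ac)
  qed
  have Wi: "integrable lborel (\<lambda>y. W (y + c))" "(\<integral>y. W (y + c) \<partial>lborel) = 1" for c
    using lborel_integral_translate[OF integral_gauss_kernel(1)[of 1], of c] integral_gauss_kernel(2)[of 1, where 'a='a]
    by (simp_all add: W_def)
  have Wi': "integrable lborel (\<lambda>y. W (y - c))" "(\<integral>y. W (y - c) \<partial>lborel) = 1" for c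
    using Wi[of "-c"] by simp_all
  have Wi0: "integrable lborel W" "integral\<^sup>L lborel W = 1" using Wi[of 0] by simp_all
  have am: "\<bar>r\<^sup>2 - p\<^sup>2\<bar> \<le> (k * (r\<^sup>2 + p\<^sup>2 - 2 * (p * r)) + 2 * (r\<^sup>2 + p\<^sup>2) / k) / 2" for r p :: real
  proof -
    have "2 * ((\<bar>r - p\<bar> * sqrt k) * (\<bar>r + p\<bar> / sqrt k)) \<le> (\<bar>r - p\<bar> * sqrt k)\<^sup>2 + (\<bar>r + p\<bar> / sqrt k)\<^sup>2"
      using sum_squares_bound[of "\<bar>r - p\<bar> * sqrt k" "\<bar>r + p\<bar> / sqrt k"] by (simp only: mult.assoc)
    moreover have "(\<bar>r - p\<bar> * sqrt k) * (\<bar>r + p\<bar> / sqrt k) = \<bar>r\<^sup>2 - p\<^sup>2\<bar>"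
      using k by (simp add: power2_eq_square flip: abs_mult) (simp add: algebra_simps)
    moreover have "(\<bar>r - p\<bar> * sqrt k)\<^sup>2 = k * (r\<^sup>2 + p\<^sup>2 - 2 * (p * r))"
      using k by (simp add: power_mult_distrib) (simp add: power2_eq_square algebra_simps)
    moreover have "(\<bar>r + p\<bar> / sqrt k)\<^sup>2 = (r + p)\<^sup>2 / k"
      using k by (simp add: power_divide)
    moreover have "(r + p)\<^sup>2 / k \<le> 2 * (r\<^sup>2 + p\<^sup>2) / k"
      using k sum_squares_bound[of r p] by (intro divide_right_mono) (auto simp: power2_sum)
    moreover have "X \<le> (Y + W) / 2" if "2 * P \<le> Y' + Z" "P = X" "Y' = Y" "Z = V" "V \<le> W" for P X Y Y' Z V W :: real
      using that by simp
    ultimately show ?thesis by blast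
  qed
  have pt: "\<bar>W (y - b) - W y\<bar> \<le> (k * (W (y - b) + W y - 2 * (q * W (y - b /\<^sub>R 2))) + 2 * (W (y - b) + W y) / k) / 2" for y
    using am[of "sqrt (W (y - b))" "sqrt (W y)"] Wn ov[of y] by simp
  have "(\<integral>y. \<bar>W (y - b) - W y\<bar> \<partial>lborel)
      \<le> (\<integral>y. (k * (W (y - b) + W y - 2 * (q * W (y - b /\<^sub>R 2))) + 2 * (W (y - b) + W y) / k) / 2 \<partial>lborel)"
    by (intro integral_mono pt integrable_abs Bochner_Integration.integrable_diff Bochner_Integration.integrable_add
        integrable_mult_right integrable_divide Wi' Wi0)
  also have "\<dots> = (k * (1 + 1 - 2 * (q * 1)) + 2 * (1 + 1) / k) / 2"
    by (simp add: Wi' Wi0)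
  \<comment> \<open>The overlap defect \<open>2 - 2 q\<close> is quadratic in \<open>b\<close>; with
    the weight \<open>k = 1 / norm b\<close> both terms are then linear, namely
    \<open>norm b / 8\<close> and \<open>2 * norm b\<close>.\<close>
  also have "\<dots> \<le> (k * ((norm b)\<^sup>2 / 4) + 4 / k) / 2"
  proof -
    have "1 - (norm b)\<^sup>2 / 8 \<le> q" using exp_ge_add_one_self[of "- (norm b)\<^sup>2 / 8"] by (simp add: q_def)
    then have "1 + 1 - 2 * (q * 1) \<le> (norm b)\<^sup>2 / 4" by simp
    then show ?thesis using k by (intro divide_right_mono add_mono mult_left_mono) auto
  qed
  also have "\<dots> \<le> 3 * norm b" using False by (simp add: k_def power2_eq_square field_simps)
  finally show ?thesis by (simp add: W_def)
qed simp

section \<open>Domination and exchange of integrals\<close>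

lemma norm_integral_le:
  fixes f :: "'a \<Rightarrow> 'b::{banach, second_countable_topology}"
  assumes g: "integrable M g" and le: "\<And>x. x \<in> space M \<Longrightarrow> norm (f x) \<le> g x"
  shows "norm (\<integral>x. f x \<partial>M) \<le> (\<integral>x. g x \<partial>M)"
proof (cases "integrable M f")
  case True
  have "norm (\<integral>x. f x \<partial>M) \<le> (\<integral>x. norm (f x) \<partial>M)" by (rule integral_norm_bound)
  also have "\<dots> \<le> (\<integral>x. g x \<partial>M)" using True g le by (intro integral_mono) auto
  finally show ?thesis .
next
  \<comment> \<open>A function that is not integrable has integral 0 by default, so only the sign of
    the right-hand side matters.\<close>
  case False
  have "0 \<le> (\<integral>x. g x \<partial>M)"
    by (intro integral_nonneg_AE AE_I2) (use le norm_ge_zero order_trans in blast)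
  then show ?thesis using False by (simp add: not_integrable_integral_eq)
qed

text \<open>The exchanges of integrals below have integrands dominated by a product of one-variable
  functions; that single estimate yields joint integrability as well as Fubini.\<close>

lemma fubini_product_bound:
  fixes f :: "'a \<Rightarrow> 'b \<Rightarrow> 'c::{banach, second_countable_topology}"
  assumes MN: "sigma_finite_measure M" "sigma_finite_measure N"
    and meas: "(\<lambda>(x, y). f x y) \<in> borel_measurable (M \<Otimes>\<^sub>M N)"
    and gh: "integrable M g" "integrable N h"
    and le: "\<And>x y. x \<in> space M \<Longrightarrow> y \<in> space N \<Longrightarrow> norm (f x y) \<le> g x * h y"
  shows "integrable (M \<Otimes>\<^sub>M N) (\<lambda>(x, y). f x y)"
    and "(\<integral>y. (\<integral>x. f x y \<partial>M) \<partial>N) = (\<integral>x. (\<integral>y. f x y \<partial>N) \<partial>M)"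
proof -
  interpret M: sigma_finite_measure M by fact
  interpret N: sigma_finite_measure N by fact
  interpret P: pair_sigma_finite M N ..
  have [measurable]: "g \<in> borel_measurable M" "h \<in> borel_measurable N" using gh by auto
  have gh_int: "integrable (M \<Otimes>\<^sub>M N) (\<lambda>(x, y). g x * h y)"
  proof (rule P.Fubini_integrable)
    have "(\<integral>y. norm (case (x, y) of (x, y) \<Rightarrow> g x * h y) \<partial>N) = \<bar>g x\<bar> * (\<integral>y. \<bar>h y\<bar> \<partial>N)" for x
      by (simp add: abs_mult)
    then show "integrable M (\<lambda>x. \<integral>y. norm (case (x, y) of (x, y) \<Rightarrow> g x * h y) \<partial>N)"
      using gh by simp
    show "AE x in M. integrable N (\<lambda>y. case (x, y) of (x, y) \<Rightarrow> g x * h y)"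
      using gh by simp
  qed measurable
  show int: "integrable (M \<Otimes>\<^sub>M N) (\<lambda>(x, y). f x y)"
  proof (rule Bochner_Integration.integrable_bound[OF gh_int meas AE_I2])
    fix p assume "p \<in> space (M \<Otimes>\<^sub>M N)"
    then have "norm (f (fst p) (snd p)) \<le> g (fst p) * h (snd p)"
      by (intro le) (auto simp: space_pair_measure)
    then show "norm (case p of (x, y) \<Rightarrow> f x y) \<le> norm (case p of (x, y) \<Rightarrow> g x * h y)"
      by (auto simp: split_beta)
  qed
  show "(\<integral>y. (\<integral>x. f x y \<partial>M) \<partial>N) = (\<integral>x. (\<integral>y. f x y \<partial>N) \<partial>M)"
    by (rule P.Fubini_integral[OF int])
qed

section \<open>Fourier multipliers\<close>

text \<open>\<open>multiplier K \<phi>\<close> says that the Fourier multiplier with symbol \<open>\<phi>\<close> has norm at most \<open>K\<close>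
  for the sup norm on Fourier transforms of integrable functions; it is enough to test the value at
  the origin, because the class of test functions is closed under modulation.\<close>

definition multiplier :: "real \<Rightarrow> ('a::euclidean_space \<Rightarrow> complex) \<Rightarrow> bool" where
  "multiplier K \<phi> \<longleftrightarrow> 0 \<le> K \<and> \<phi> \<in> borel_measurable borel \<and> bounded (range \<phi>) \<and>
     (\<forall>w S. integrable lborel w \<longrightarrow> (\<forall>x. cmod (\<integral>\<xi>. w \<xi> * cis (\<xi> \<bullet> x) \<partial>lborel) \<le> S) \<longrightarrow>
        cmod (\<integral>\<xi>. \<phi> \<xi> * w \<xi> \<partial>lborel) \<le> K * S)"

lemma multiplierI:
  assumes "0 \<le> K" "\<phi> \<in> borel_measurable borel" "\<And>\<xi>. cmod (\<phi> \<xi>) \<le> b"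
    "\<And>w S. integrable lborel w \<Longrightarrow> (\<And>x. cmod (\<integral>\<xi>. w \<xi> * cis (\<xi> \<bullet> x) \<partial>lborel) \<le> S) \<Longrightarrow>
        cmod (\<integral>\<xi>. \<phi> \<xi> * w \<xi> \<partial>lborel) \<le> K * S"
  shows "multiplier K \<phi>"
  unfolding multiplier_def
proof (intro conjI allI impI assms(1,2))
  show "bounded (range \<phi>)" using assms(3) by (auto simp: bounded_iff)
qed (use assms(4) in blast)

lemma multiplierD:
  assumes "multiplier K \<phi>"
  shows "0 \<le> K" "\<phi> \<in> borel_measurable borel" "bounded (range \<phi>)"
    "integrable lborel w \<Longrightarrow> (\<And>x. cmod (\<integral>\<xi>. w \<xi> * cis (\<xi> \<bullet> x) \<partial>lborel) \<le> S) \<Longrightarrow>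
        cmod (\<integral>\<xi>. \<phi> \<xi> * w \<xi> \<partial>lborel) \<le> K * S"
  using assms by (auto simp: multiplier_def)

lemma integrable_bounded_mult:
  fixes \<phi> w :: "'a::euclidean_space \<Rightarrow> complex"
  assumes "integrable lborel w" and [measurable]: "\<phi> \<in> borel_measurable borel" and b: "\<And>x. cmod (\<phi> x) \<le> b"
  shows "integrable lborel (\<lambda>\<xi>. \<phi> \<xi> * w \<xi>)"
proof (rule Bochner_Integration.integrable_bound)
  show "integrable lborel (\<lambda>\<xi>. of_real b * w \<xi>)" using assms(1) by simp
  show "(\<lambda>\<xi>. \<phi> \<xi> * w \<xi>) \<in> borel_measurable lborel" using assms(1) by measurable
  have "cmod (\<phi> \<xi>) \<le> \<bar>b\<bar>" for \<xi> using b[of \<xi>] by simp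
  then show "AE \<xi> in lborel. norm (\<phi> \<xi> * w \<xi>) \<le> norm (of_real b * w \<xi>)"
    by (intro AE_I2) (simp add: norm_mult mult_right_mono)
qed

lemma integrable_multiplier:
  assumes "multiplier K \<phi>" "integrable lborel w"
  shows "integrable lborel (\<lambda>\<xi>. \<phi> \<xi> * w \<xi>)"
proof -
  obtain b where "\<And>x. cmod (\<phi> x) \<le> b"
    using multiplierD(3)[OF assms(1)] by (auto simp: bounded_iff)
  then show ?thesis
    by (rule integrable_bounded_mult[OF assms(2) multiplierD(2)[OF assms(1)]])
qed

lemma integrable_mult_cis:
  fixes w :: "'a::euclidean_space \<Rightarrow> complex"
  assumes "integrable lborel w"
  shows "integrable lborel (\<lambda>\<xi>. w \<xi> * cis (\<xi> \<bullet> x))"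
  using integrable_bounded_mult[of w "\<lambda>\<xi>. cis (\<xi> \<bullet> x)" 1] assms by (simp add: mult.commute)

lemma multiplier_transform:
  assumes "multiplier K \<phi>" "integrable lborel w"
    and S: "\<And>x. cmod (\<integral>\<xi>. w \<xi> * cis (\<xi> \<bullet> x) \<partial>lborel) \<le> S"
  shows "cmod (\<integral>\<xi>. \<phi> \<xi> * w \<xi> * cis (\<xi> \<bullet> x) \<partial>lborel) \<le> K * S"
proof -
  have "cmod (\<integral>\<xi>. \<phi> \<xi> * (w \<xi> * cis (\<xi> \<bullet> x)) \<partial>lborel) \<le> K * S"
  proof (rule multiplierD(4)[OF assms(1) integrable_mult_cis[OF assms(2)]])
    fix y
    have "w \<xi> * cis (\<xi> \<bullet> x) * cis (\<xi> \<bullet> y) = w \<xi> * cis (\<xi> \<bullet> (x + y))" for \<xi>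
      by (simp add: inner_add_right cis_mult[symmetric])
    then show "cmod (\<integral>\<xi>. w \<xi> * cis (\<xi> \<bullet> x) * cis (\<xi> \<bullet> y) \<partial>lborel) \<le> S"
      using S[of "x + y"] by (simp only:)
  qed
  then show ?thesis by (simp add: mult.assoc)
qed

text \<open>Composition: \<open>\<psi> w\<close> is again a test function, and its transform is
  bounded by \<open>L * S\<close> at every point, so \<open>\<phi>\<close> can be applied to
  it.\<close>

lemma multiplier_mult:
  fixes \<phi> :: "'a::euclidean_space \<Rightarrow> complex"
  assumes "multiplier K \<phi>" "multiplier L \<psi>"
  shows "multiplier (K * L) (\<lambda>\<xi>. \<phi> \<xi> * \<psi> \<xi>)"
proof -
  note [measurable] = multiplierD(2)[OF assms(1)] multiplierD(2)[OF assms(2)]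
  obtain b c where b: "\<And>x. cmod (\<phi> x) \<le> b" and c: "\<And>x. cmod (\<psi> x) \<le> c"
    using multiplierD(3)[OF assms(1)] multiplierD(3)[OF assms(2)] by (auto simp: bounded_iff)
  show ?thesis
  proof (rule multiplierI[where b="b * c"])
    show "0 \<le> K * L" using multiplierD(1)[OF assms(1)] multiplierD(1)[OF assms(2)] by simp
    show "cmod (\<phi> \<xi> * \<psi> \<xi>) \<le> b * c" for \<xi>
      using b[of \<xi>] c[of \<xi>] order_trans[OF norm_ge_zero b[of \<xi>]] by (simp add: norm_mult mult_mono)
    fix w :: "'a \<Rightarrow> complex" and S assume w: "integrable lborel w" and S: "\<And>x. cmod (\<integral>\<xi>. w \<xi> * cis (\<xi> \<bullet> x) \<partial>lborel) \<le> S"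
    have "cmod (\<integral>\<xi>. \<phi> \<xi> * (\<psi> \<xi> * w \<xi>) \<partial>lborel) \<le> K * (L * S)"
      by (intro multiplierD(4)[OF assms(1)] integrable_multiplier[OF assms(2) w]
          multiplier_transform[OF assms(2) w S])
    then show "cmod (\<integral>\<xi>. \<phi> \<xi> * \<psi> \<xi> * w \<xi> \<partial>lborel) \<le> K * L * S" by (simp add: mult.assoc)
  qed measurable
qed

lemma multiplier_add:
  fixes \<phi> :: "'a::euclidean_space \<Rightarrow> complex"
  assumes "multiplier K \<phi>" "multiplier L \<psi>"
  shows "multiplier (K + L) (\<lambda>\<xi>. \<phi> \<xi> + \<psi> \<xi>)"
proof -
  note [measurable] = multiplierD(2)[OF assms(1)] multiplierD(2)[OF assms(2)]
  obtain b c where b: "\<And>x. cmod (\<phi> x) \<le> b" and c: "\<And>x. cmod (\<psi> x) \<le> c"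
    using multiplierD(3)[OF assms(1)] multiplierD(3)[OF assms(2)] by (auto simp: bounded_iff)
  show ?thesis
  proof (rule multiplierI[where b="b + c"])
    show "0 \<le> K + L" using multiplierD(1)[OF assms(1)] multiplierD(1)[OF assms(2)] by simp
    show "cmod (\<phi> \<xi> + \<psi> \<xi>) \<le> b + c" for \<xi>
      by (intro norm_triangle_le add_mono b c)
    fix w :: "'a \<Rightarrow> complex" and S assume w: "integrable lborel w" and S: "\<And>x. cmod (\<integral>\<xi>. w \<xi> * cis (\<xi> \<bullet> x) \<partial>lborel) \<le> S"
    have "(\<integral>\<xi>. (\<phi> \<xi> + \<psi> \<xi>) * w \<xi> \<partial>lborel) = (\<integral>\<xi>. \<phi> \<xi> * w \<xi> \<partial>lborel) + (\<integral>\<xi>. \<psi> \<xi> * w \<xi> \<partial>lborel)"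
      unfolding distrib_right
      by (intro Bochner_Integration.integral_add integrable_multiplier[OF assms(1) w] integrable_multiplier[OF assms(2) w])
    then show "cmod (\<integral>\<xi>. (\<phi> \<xi> + \<psi> \<xi>) * w \<xi> \<partial>lborel) \<le> (K + L) * S"
      using norm_triangle_le[OF add_mono[OF multiplierD(4)[OF assms(1) w S] multiplierD(4)[OF assms(2) w S]]]
      by (simp add: distrib_right)
  qed measurable
qed

lemma multiplier_const: "multiplier (cmod c) (\<lambda>_. c)"
proof (rule multiplierI[where b="cmod c"])
  fix w :: "'a::euclidean_space \<Rightarrow> complex" and S
  assume "\<And>x. cmod (\<integral>\<xi>. w \<xi> * cis (\<xi> \<bullet> x) \<partial>lborel) \<le> S"
  from this[of 0] show "cmod (\<integral>\<xi>. c * w \<xi> \<partial>lborel) \<le> cmod c * S"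
    by (simp add: norm_mult mult_left_mono)
qed auto

lemma multiplier_mono:
  assumes "multiplier K \<phi>" "K \<le> L"
  shows "multiplier L \<phi>"
proof -
  have "cmod (\<integral>\<xi>. \<phi> \<xi> * w \<xi> \<partial>lborel) \<le> L * S"
    if w: "integrable lborel w" and S: "\<And>x. cmod (\<integral>\<xi>. w \<xi> * cis (\<xi> \<bullet> x) \<partial>lborel) \<le> S" for w S
    using multiplierD(4)[OF assms(1) w S] order_trans[OF norm_ge_zero S] assms(2)
    by (meson mult_right_mono order_trans)
  then show ?thesis using assms by (auto simp: multiplier_def)
qed

lemma multiplier_cmult: "multiplier K \<phi> \<Longrightarrow> multiplier (cmod c * K) (\<lambda>\<xi>. c * \<phi> \<xi>)"
  by (rule multiplier_mult[OF multiplier_const])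

lemma multiplier_power: "multiplier 1 \<phi> \<Longrightarrow> multiplier 1 (\<lambda>\<xi>. \<phi> \<xi> ^ n)"
proof (induction n)
  case 0
  then show ?case using multiplier_const[of 1] by simp
next
  case (Suc n)
  then show ?case using multiplier_mult[of 1 \<phi> 1 "\<lambda>\<xi>. \<phi> \<xi> ^ n"] by simp
qed

lemma multiplier_sum:
  assumes "finite A" "\<And>i. i \<in> A \<Longrightarrow> multiplier (K i) (\<phi> i)"
  shows "multiplier (\<Sum>i\<in>A. K i) (\<lambda>\<xi>. \<Sum>i\<in>A. \<phi> i \<xi>)"
  using assms
proof (induction A rule: finite_induct)
  case empty
  then show ?case using multiplier_const[of 0] by simp
next
  case (insert i A)
  then show ?case using multiplier_add[of "K i" "\<phi> i" "\<Sum>i\<in>A. K i"] by simp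
qed

lemma multiplier_cis: "multiplier 1 (\<lambda>\<xi>. cis (\<xi> \<bullet> h))"
proof (rule multiplierI[where b=1])
  fix w :: "'a \<Rightarrow> complex" and S
  assume "\<And>x. cmod (\<integral>\<xi>. w \<xi> * cis (\<xi> \<bullet> x) \<partial>lborel) \<le> S"
  from this[of h] show "cmod (\<integral>\<xi>. cis (\<xi> \<bullet> h) * w \<xi> \<partial>lborel) \<le> 1 * S" by (simp add: mult.commute)
qed auto

text \<open>The uniform bound \<open>b\<close> gives dominated convergence for each fixed test
  function. The norms may vary with \<open>n\<close>, which allows bounds obtained by iteration to
  be improved in the limit.\<close>

lemma multiplier_lim:
  fixes \<psi> :: "'a::euclidean_space \<Rightarrow> complex"
  assumes m: "\<And>n. multiplier (K n) (\<phi> n)" and lim: "\<And>\<xi>. (\<lambda>n. \<phi> n \<xi>) \<longlonglongrightarrow> \<psi> \<xi>"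
    and b: "\<And>n \<xi>. cmod (\<phi> n \<xi>) \<le> b" and K: "K \<longlonglongrightarrow> L"
  shows "multiplier L \<psi>"
proof (rule multiplierI[where b=b])
  note [measurable] = multiplierD(2)[OF m]
  show "0 \<le> L" by (rule LIMSEQ_le_const[OF K]) (use multiplierD(1)[OF m] in auto)
  show [measurable]: "\<psi> \<in> borel_measurable borel"
    by (rule borel_measurable_LIMSEQ_metric[OF _ lim]) measurable
  show "cmod (\<psi> \<xi>) \<le> b" for \<xi>
    by (rule LIMSEQ_le_const2[OF tendsto_norm[OF lim]]) (use b in auto)
  fix w :: "'a \<Rightarrow> complex" and S assume w: "integrable lborel w" and S: "\<And>x. cmod (\<integral>\<xi>. w \<xi> * cis (\<xi> \<bullet> x) \<partial>lborel) \<le> S"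
  have [measurable]: "w \<in> borel_measurable borel" using w by auto
  have "(\<lambda>n. \<integral>\<xi>. \<phi> n \<xi> * w \<xi> \<partial>lborel) \<longlonglongrightarrow> (\<integral>\<xi>. \<psi> \<xi> * w \<xi> \<partial>lborel)"
  proof (rule integral_dominated_convergence[where w="\<lambda>\<xi>. b * cmod (w \<xi>)"])
    show "integrable lborel (\<lambda>\<xi>. b * cmod (w \<xi>))" using w by simp
    show "AE \<xi> in lborel. (\<lambda>n. \<phi> n \<xi> * w \<xi>) \<longlonglongrightarrow> \<psi> \<xi> * w \<xi>"
      by (intro AE_I2 tendsto_mult lim tendsto_const)
    show "AE \<xi> in lborel. norm (\<phi> n \<xi> * w \<xi>) \<le> b * cmod (w \<xi>)" for n
      by (intro AE_I2) (simp add: norm_mult mult_right_mono b)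
  qed measurable
  from LIMSEQ_le[OF tendsto_norm[OF this] tendsto_mult[OF K tendsto_const]]
  show "cmod (\<integral>\<xi>. \<psi> \<xi> * w \<xi> \<partial>lborel) \<le> L * S"
    using multiplierD(4)[OF m w S] by blast
qed

text \<open>Minkowski's inequality for multipliers; the mixtures of Gaussians below are estimated
  through it.\<close>

lemma multiplier_integral:
  fixes \<psi> :: "'b \<Rightarrow> 'a::euclidean_space \<Rightarrow> complex"
  assumes M: "sigma_finite_measure M"
    and meas: "(\<lambda>(\<xi>, y). \<psi> y \<xi>) \<in> borel_measurable (borel \<Otimes>\<^sub>M M)"
    and b: "integrable M b" "\<And>y \<xi>. y \<in> space M \<Longrightarrow> cmod (\<psi> y \<xi>) \<le> b y"
    and G: "integrable M G" "\<And>y. y \<in> space M \<Longrightarrow> multiplier (G y) (\<psi> y)"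
  shows "multiplier (\<integral>y. G y \<partial>M) (\<lambda>\<xi>. \<integral>y. \<psi> y \<xi> \<partial>M)"
proof (rule multiplierI[where b="\<integral>y. b y \<partial>M"])
  interpret M: sigma_finite_measure M by fact
  note [measurable] = meas
  show "0 \<le> (\<integral>y. G y \<partial>M)" by (intro integral_nonneg_AE AE_I2 multiplierD(1)[OF G(2)])
  have [simp]: "sets (borel \<Otimes>\<^sub>M M) = sets (lborel \<Otimes>\<^sub>M M)" by (intro sets_pair_measure_cong) auto
  show "(\<lambda>\<xi>. \<integral>y. \<psi> y \<xi> \<partial>M) \<in> borel_measurable borel"
    using meas by (intro M.borel_measurable_lebesgue_integral) (simp add: split_beta')
  show "cmod (\<integral>y. \<psi> y \<xi> \<partial>M) \<le> (\<integral>y. b y \<partial>M)" for \<xi>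
    by (rule norm_integral_le[OF b(1)]) (use b(2) in auto)
  fix w :: "'a \<Rightarrow> complex" and S assume w: "integrable lborel w" and S: "\<And>x. cmod (\<integral>\<xi>. w \<xi> * cis (\<xi> \<bullet> x) \<partial>lborel) \<le> S"
  have [measurable]: "w \<in> borel_measurable borel" using w by auto
  have mp: "(\<lambda>(\<xi>, y). \<psi> y \<xi> * w \<xi>) \<in> borel_measurable (lborel \<Otimes>\<^sub>M M)"
    using meas by (subst measurable_cong_sets[OF sets_pair_measure_cong[of lborel borel M M] refl]) (auto simp: split_beta')
  have "(\<integral>\<xi>. (\<integral>y. \<psi> y \<xi> \<partial>M) * w \<xi> \<partial>lborel) = (\<integral>\<xi>. (\<integral>y. \<psi> y \<xi> * w \<xi> \<partial>M) \<partial>lborel)"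
    by simp
  also have "\<dots> = (\<integral>y. (\<integral>\<xi>. \<psi> y \<xi> * w \<xi> \<partial>lborel) \<partial>M)"
    by (rule fubini_product_bound(2)[OF lborel.sigma_finite_measure_axioms M mp integrable_norm[OF w] b(1), symmetric])
       (subst norm_mult, subst mult.commute, intro mult_left_mono b(2), auto)
  also have "cmod \<dots> \<le> (\<integral>y. G y * S \<partial>M)"
    by (rule norm_integral_le[OF integrable_mult_left[OF G(1)]])
       (intro multiplierD(4)[OF G(2) w S])
  finally show "cmod (\<integral>\<xi>. (\<integral>y. \<psi> y \<xi> \<partial>M) * w \<xi> \<partial>lborel) \<le> (\<integral>y. G y \<partial>M) * S"
    by simp
qed

text \<open>The exponential series, all powers having norm at most 1. After multiplication by
  \<open>exp (- a)\<close> this is the symbol of a compound Poisson law with rate \<open>a\<close>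
  and jump symbol \<open>\<phi>\<close>.\<close>

lemma multiplier_exp:
  assumes m: "multiplier 1 \<phi>" and le: "\<And>\<xi>. cmod (\<phi> \<xi>) \<le> 1" and a: "0 \<le> a"
  shows "multiplier (exp a) (\<lambda>\<xi>. exp (of_real a * \<phi> \<xi>))"
proof (rule multiplier_lim)
  let ?t = "\<lambda>k \<xi>. of_real (a ^ k / fact k) * \<phi> \<xi> ^ k"
  show "multiplier (\<Sum>k<n. a ^ k / fact k) (\<lambda>\<xi>. \<Sum>k<n. ?t k \<xi>)" for n
  proof (rule multiplier_sum)
    fix k
    have "cmod (of_real (a ^ k / fact k)) = a ^ k / fact k" using a by (simp add: norm_power norm_divide)
    then show "multiplier (a ^ k / fact k) (?t k)"
      using multiplier_cmult[OF multiplier_power[OF m], of "of_real (a ^ k / fact k)" k] by simp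
  qed simp
  show "(\<lambda>n. \<Sum>k<n. a ^ k / fact k) \<longlonglongrightarrow> exp a"
    using exp_converges[of a] by (simp add: sums_def divide_inverse mult.commute)
  show "(\<lambda>n. \<Sum>k<n. ?t k \<xi>) \<longlonglongrightarrow> exp (of_real a * \<phi> \<xi>)" for \<xi>
    using exp_converges[of "of_real a * \<phi> \<xi>"]
    by (simp add: sums_def scaleR_conv_of_real power_mult_distrib divide_inverse mult_ac)
  show "cmod (\<Sum>k<n. ?t k \<xi>) \<le> exp a" for n \<xi>
  proof -
    have "cmod (\<Sum>k<n. ?t k \<xi>) \<le> (\<Sum>k<n. a ^ k / fact k)"
      using a by (intro sum_norm_le)
        (simp add: norm_mult norm_power norm_divide mult_left_le power_le_one le divide_right_mono)
    also have "\<dots> \<le> exp a"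
      unfolding exp_def using a summable_exp[of a]
      by (intro order_trans[OF _ sum_le_suminf[of "\<lambda>k. a ^ k /\<^sub>R fact k" "{..<n}"]])
         (auto simp: divide_inverse mult.commute)
    finally show ?thesis .
  qed
qed

text \<open>The factor \<open>D\<close> may be absorbed into one of the factors \<open>\<phi>\<close> of every term of the
  exponential series except the constant one.\<close>

lemma multiplier_exp_minus_one:
  assumes m: "multiplier 1 \<phi>" and le: "\<And>\<xi>. cmod (\<phi> \<xi>) \<le> 1" and a: "0 \<le> a"
    and D: "multiplier L (\<lambda>\<xi>. D \<xi> * \<phi> \<xi>)" "\<And>\<xi>. cmod (D \<xi>) \<le> d"
  shows "multiplier (L * exp a) (\<lambda>\<xi>. D \<xi> * (exp (of_real a * \<phi> \<xi>) - 1))"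
proof -
  let ?c = "\<lambda>k. a ^ Suc k / fact (Suc k)"
  let ?t = "\<lambda>k \<xi>. of_real (?c k) * \<phi> \<xi> ^ Suc k"
  have L: "L \<ge> 0" by (rule multiplierD(1)[OF D(1)])
  have c: "?c k \<ge> 0" "cmod (of_real (?c k)) = ?c k" for k
    using a by (simp_all add: norm_power norm_divide norm_mult del: fact_Suc of_real_mult power_Suc)
  have es: "(\<lambda>k. z ^ Suc k /\<^sub>R fact (Suc k)) sums (exp z - 1)" for z :: "'z::{banach,real_normed_algebra_1}"
    using exp_converges[of z] by (subst sums_Suc_iff) simp
  have s1: "?c sums (exp a - 1)"
    using es[of a] by (simp only: real_scaleR_def divide_inverse mult.commute)
  \<comment> \<open>Without the constant term the coefficients sum to \<open>exp a - 1\<close>. The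
    final weakening to \<open>exp a\<close> makes the constant exactly \<open>L\<close> once the
    symbol is multiplied by \<open>exp (- a)\<close>.\<close>
  have "multiplier (L * (exp a - 1)) (\<lambda>\<xi>. D \<xi> * (exp (of_real a * \<phi> \<xi>) - 1))"
  proof (rule multiplier_lim)
    show "multiplier (\<Sum>k<n. L * ?c k) (\<lambda>\<xi>. \<Sum>k<n. D \<xi> * ?t k \<xi>)" for n
    proof (rule multiplier_sum)
      fix k
      have "multiplier (?c k * (L * 1)) (\<lambda>\<xi>. of_real (?c k) * (D \<xi> * \<phi> \<xi> * \<phi> \<xi> ^ k))"
        using multiplier_cmult[OF multiplier_mult[OF D(1) multiplier_power[OF m]], of "of_real (?c k)" k]
        unfolding c(2) .
      then show "multiplier (L * ?c k) (\<lambda>\<xi>. D \<xi> * ?t k \<xi>)"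
        by (simp only: power_Suc mult_1_left mult_1_right mult.assoc mult.commute mult.left_commute)
    qed simp
    show "(\<lambda>n. \<Sum>k<n. L * ?c k) \<longlonglongrightarrow> L * (exp a - 1)"
      using sums_mult[OF s1, of L] by (simp only: sums_def)
    show "(\<lambda>n. \<Sum>k<n. D \<xi> * ?t k \<xi>) \<longlonglongrightarrow> D \<xi> * (exp (of_real a * \<phi> \<xi>) - 1)" for \<xi>
    proof -
      have "(of_real a * \<phi> \<xi>) ^ Suc k /\<^sub>R fact (Suc k) = ?t k \<xi>" for k
        by (simp add: scaleR_conv_of_real power_mult_distrib divide_inverse mult_ac del: fact_Suc power_Suc)
      then show ?thesis
        using sums_mult[OF es[of "of_real a * \<phi> \<xi>"], of "D \<xi>"] by (simp only: sums_def)
    qed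
    show "cmod (\<Sum>k<n. D \<xi> * ?t k \<xi>) \<le> d * (exp a - 1)" for n \<xi>
    proof -
      have "cmod (D \<xi> * ?t k \<xi>) \<le> d * ?c k" for k
      proof -
        have "cmod (?t k \<xi>) \<le> ?c k * 1"
          unfolding norm_mult c(2) norm_power by (intro mult_left_mono power_le_one c le norm_ge_zero)
        then show ?thesis
          unfolding norm_mult[of "D \<xi>"] using D(2)[of \<xi>] order_trans[OF norm_ge_zero D(2)[of \<xi>]]
          by (intro mult_mono) auto
      qed
      then have "cmod (\<Sum>k<n. D \<xi> * ?t k \<xi>) \<le> (\<Sum>k<n. d * ?c k)" by (rule sum_norm_le)
      also have "\<dots> = d * (\<Sum>k<n. ?c k)" by (simp only: sum_distrib_left)
      also have "\<dots> \<le> d * (exp a - 1)"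
        using sum_le_suminf[OF sums_summable[OF s1], of "{..<n}"] c(1) order_trans[OF norm_ge_zero D(2)[of \<xi>]]
        unfolding sums_unique[OF s1, symmetric] by (intro mult_left_mono) auto
      finally show ?thesis .
    qed
  qed
  then show ?thesis
    by (rule multiplier_mono) (use L in \<open>intro mult_left_mono, auto\<close>)
qed

text \<open>The Gaussian is an average of the characters \<open>cis (\<xi> \<bullet> A' y)\<close>,
  that is, of translations, with total weight 1. Translating by \<open>A' b\<close> shifts the
  weight by \<open>b\<close>, so the difference costs the L1 distance between a normal density and
  its shift.\<close>

lemma multiplier_gauss:
  fixes A A' :: "'a::euclidean_space \<Rightarrow> 'a"
  assumes adj: "\<And>\<xi> y. A \<xi> \<bullet> y = \<xi> \<bullet> A' y" and [measurable]: "A \<in> borel_measurable borel"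
  shows "multiplier 1 (\<lambda>\<xi>. of_real (exp (- (norm (A \<xi>))\<^sup>2 / 2)))"
    and "multiplier (3 * norm b) (\<lambda>\<xi>. (cis (\<xi> \<bullet> A' b) - 1) * of_real (exp (- (norm (A \<xi>))\<^sup>2 / 2)))"
proof -
  let ?W = "gauss_kernel 1 :: 'a \<Rightarrow> real"
  have Wi: "integrable lborel ?W" "integral\<^sup>L lborel ?W = 1" by (rule integral_gauss_kernel, simp)+
  have Wib: "integrable lborel (\<lambda>y. ?W (y - b))"
    using lborel_integral_translate(1)[OF Wi(1), of "-b"] by simp
  have rep: "complex_of_real (exp (- (norm (A \<xi>))\<^sup>2 / 2)) = (\<integral>y. of_real (?W y) * cis (A \<xi> \<bullet> y) \<partial>lborel)" for \<xi>
    using gauss_kernel_cis(2)[of 1 "A \<xi>"] by (simp add: gauss_def)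
  have mult: "multiplier \<bar>r\<bar> (\<lambda>\<xi>. of_real r * cis (A \<xi> \<bullet> y))" for r y
    using multiplier_cmult[OF multiplier_cis[of "A' y"], of "of_real r"] by (simp add: adj)
  have "multiplier (\<integral>y. \<bar>?W y\<bar> \<partial>lborel) (\<lambda>\<xi>. \<integral>y. of_real (?W y) * cis (A \<xi> \<bullet> y) \<partial>lborel)"
    by (rule multiplier_integral[where b="\<lambda>y. \<bar>?W y\<bar>"])
       (auto intro: mult integrable_abs Wi sigma_finite_lborel simp: norm_mult)
  moreover have "\<bar>?W y\<bar> = ?W y" for y using gauss_kernel_nonneg[of 1 y] by simp
  ultimately show "multiplier 1 (\<lambda>\<xi>. of_real (exp (- (norm (A \<xi>))\<^sup>2 / 2)))"
    using Wi(2) unfolding rep by simp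
  have "(cis (\<xi> \<bullet> A' b) - 1) * of_real (exp (- (norm (A \<xi>))\<^sup>2 / 2))
      = (\<integral>y. of_real (?W (y - b) - ?W y) * cis (A \<xi> \<bullet> y) \<partial>lborel)" for \<xi>
  proof -
    have i: "integrable lborel (\<lambda>y. of_real (?W y) * cis (A \<xi> \<bullet> y))" by (rule gauss_kernel_cis(1)) simp
    have ib: "integrable lborel (\<lambda>y. of_real (?W y) * cis (A \<xi> \<bullet> (y + b)))"
      using integrable_mult_right[OF i, of "cis (A \<xi> \<bullet> b)"]
      by (simp add: inner_add_right cis_mult[symmetric] mult_ac)
    have ib': "integrable lborel (\<lambda>y. of_real (?W (y - b)) * cis (A \<xi> \<bullet> y))"
      "(\<integral>y. of_real (?W (y - b)) * cis (A \<xi> \<bullet> y) \<partial>lborel) = (\<integral>y. of_real (?W y) * cis (A \<xi> \<bullet> (y + b)) \<partial>lborel)"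
      using lborel_integral_translate[OF ib, of "-b"] by simp_all
    have "cis (\<xi> \<bullet> A' b) * (\<integral>y. of_real (?W y) * cis (A \<xi> \<bullet> y) \<partial>lborel)
        = (\<integral>y. of_real (?W y) * cis (A \<xi> \<bullet> (y + b)) \<partial>lborel)"
      by (simp add: inner_add_right cis_mult[symmetric] mult_ac adj flip: integral_mult_right_zero)
    then show ?thesis
      unfolding rep left_diff_distrib of_real_diff
      by (simp add: Bochner_Integration.integral_diff[OF ib'(1) i] ib'(2))
  qed
  moreover have "multiplier (\<integral>y. \<bar>?W (y - b) - ?W y\<bar> \<partial>lborel) (\<lambda>\<xi>. \<integral>y. of_real (?W (y - b) - ?W y) * cis (A \<xi> \<bullet> y) \<partial>lborel)"
    by (rule multiplier_integral[where b="\<lambda>y. \<bar>?W (y - b) - ?W y\<bar>"])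
       (auto intro!: mult integrable_abs Bochner_Integration.integrable_diff Wi Wib sigma_finite_lborel
         simp: norm_mult simp flip: of_real_diff simp del: of_real_diff)
  ultimately show "multiplier (3 * norm b) (\<lambda>\<xi>. (cis (\<xi> \<bullet> A' b) - 1) * of_real (exp (- (norm (A \<xi>))\<^sup>2 / 2)))"
    using multiplier_mono[OF _ gauss_kernel_translate[of b]] by simp
qed

section \<open>The fractional power as a mixture of exponentials\<close>

text \<open>Explicit antiderivative formulas speak of the gauge integral; for nonnegative functions
  the value carries over to the Lebesgue integral.\<close>

lemma nonneg_has_integral_lborel:
  fixes f :: "'a::euclidean_space \<Rightarrow> real"
  assumes [measurable]: "f \<in> borel_measurable borel" "S \<in> sets borel" and nn: "\<And>x. x \<in> S \<Longrightarrow> 0 \<le> f x"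
    and I: "(f has_integral I) S"
  shows "set_integrable lborel S f" "(LINT x:S|lborel. f x) = I"
proof -
  define g where "g x = indicator S x * f x" for x
  have [measurable]: "g \<in> borel_measurable borel" unfolding g_def by measurable
  have gn: "0 \<le> g x" for x using nn by (simp add: g_def indicator_def)
  have "((\<lambda>x. if x \<in> S then f x else 0) has_integral I) UNIV" using I by (simp add: has_integral_restrict_UNIV)
  moreover have "(\<lambda>x. if x \<in> S then f x else 0) = g" by (auto simp: g_def indicator_def)
  ultimately have gI: "(g has_integral I) UNIV" by simp
  have nI: "integral\<^sup>N lborel g = I"
    by (rule nn_integral_has_integral_lborel[OF _ gn gI]) measurable
  have I0: "0 \<le> I" by (rule has_integral_nonneg[OF gI]) (simp add: gn)
  have hb: "has_bochner_integral lborel g I"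
    by (rule has_bochner_integral_nn_integral[OF _ _ I0 nI]) (simp_all add: gn)
  then show "set_integrable lborel S f" "(LINT x:S|lborel. f x) = I"
    unfolding set_integrable_def set_lebesgue_integral_def
    by (simp_all add: has_bochner_integral_iff g_def[abs_def])
qed

text \<open>The Laplace exponent at \<open>x\<close> of a subordinator with jump measure
  \<open>\<tau> powr (- 1 - s) d\<tau>\<close> restricted to \<open>W\<close>. For
  \<open>W = {0<..}\<close> it belongs to the s-stable subordinator, up to normalization.\<close>

definition levy :: "real \<Rightarrow> real set \<Rightarrow> real \<Rightarrow> real" where
  "levy s W x = (LINT \<tau>:W|lborel. (1 - exp (- \<tau> * x)) * \<tau> powr (- 1 - s))"

text \<open>The jump rate on \<open>W\<close>. The full half-line has infinite rate, so the
  statements that use it assume integrability over \<open>W\<close> or take a half-line away from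
  0.\<close>

definition levy_mass :: "real \<Rightarrow> real set \<Rightarrow> real" where
  "levy_mass s W = (LINT \<tau>:W|lborel. \<tau> powr (- 1 - s))"

lemma levy_mass_atLeast:
  assumes "0 < s" "0 < \<rho>"
  shows "set_integrable lborel {\<rho>..} (\<lambda>\<tau>. \<tau> powr (- 1 - s))" "levy_mass s {\<rho>..} = \<rho> powr (- s) / s"
proof -
  have "((\<lambda>\<tau>. \<tau> powr (- 1 - s)) has_integral - (\<rho> powr (- 1 - s + 1)) / (- 1 - s + 1)) {\<rho>..}"
    by (rule has_integral_powr_to_inf) (use assms in auto)
  then have I: "((\<lambda>\<tau>. \<tau> powr (- 1 - s)) has_integral \<rho> powr (- s) / s) {\<rho>..}" by simp
  show "set_integrable lborel {\<rho>..} (\<lambda>\<tau>. \<tau> powr (- 1 - s))" "levy_mass s {\<rho>..} = \<rho> powr (- s) / s"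
    unfolding levy_mass_def by (rule nonneg_has_integral_lborel[OF _ _ _ I]; simp)+
qed

text \<open>Near 0 the inequality \<open>1 - exp (- y) <= y\<close> leaves
  \<open>\<tau> powr (- s)\<close>, integrable because \<open>s < 1\<close>; beyond 1 the integrand
  is at most \<open>\<tau> powr (- 1 - s)\<close>, integrable because \<open>s > 0\<close>.\<close>

lemma levy_integrable:
  fixes s x :: real
  assumes s: "0 < s" "s < 1" and x: "0 \<le> x" and W: "W \<in> sets borel" "W \<subseteq> {0<..}"
  shows "set_integrable lborel W (\<lambda>\<tau>. (1 - exp (- \<tau> * x)) * \<tau> powr (- 1 - s))"
proof -
  let ?f = "\<lambda>\<tau>::real. (1 - exp (- \<tau> * x)) * \<tau> powr (- 1 - s)"
  have "((\<lambda>\<tau>. \<tau> powr (- s)) has_integral 1 powr (- s + 1) / (- s + 1)) {0..1}"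
    by (rule has_integral_powr_from_0) (use s in auto)
  then have "set_integrable lborel {0..1::real} (\<lambda>\<tau>. \<tau> powr (- s))"
    by (intro nonneg_has_integral_lborel(1)) auto
  then have i1: "set_integrable lborel {0<..<1::real} (\<lambda>\<tau>. x * \<tau> powr (- s))"
    by (intro set_integrable_mult_right) (rule set_integrable_subset, auto)
  have "set_integrable lborel {0<..<1} ?f"
  proof (rule set_integrable_bound[OF i1])
    show "set_borel_measurable lborel {0<..<1} ?f" unfolding set_borel_measurable_def by measurable
    show "AE \<tau> in lborel. \<tau> \<in> {0<..<1} \<longrightarrow> norm (?f \<tau>) \<le> norm (x * \<tau> powr (- s))"
    proof (intro AE_I2 impI)
      fix \<tau> :: real assume \<tau>: "\<tau> \<in> {0<..<1}"
      have "\<bar>1 - exp (- \<tau> * x)\<bar> \<le> \<tau> * x"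
        using exp_ge_add_one_self[of "- \<tau> * x"] \<tau> x by (simp add: abs_le_iff)
      then have "\<bar>?f \<tau>\<bar> \<le> (\<tau> * x) * \<tau> powr (- 1 - s)"
        unfolding abs_mult by (intro mult_mono) auto
      also have "\<tau> * \<tau> powr (- 1 - s) = \<tau> powr (- s)"
        using \<tau> powr_add[of \<tau> 1 "- 1 - s"] by simp
      then have "(\<tau> * x) * \<tau> powr (- 1 - s) = x * \<tau> powr (- s)" by (simp add: mult_ac)
      finally show "norm (?f \<tau>) \<le> norm (x * \<tau> powr (- s))" using x by (simp add: abs_mult)
    qed
  qed
  moreover have "set_integrable lborel {1..} ?f"
  proof (rule set_integrable_bound[OF levy_mass_atLeast(1)[OF s(1), of 1]])
    show "set_borel_measurable lborel {1..} ?f" unfolding set_borel_measurable_def by measurable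
    show "AE \<tau> in lborel. \<tau> \<in> {1..} \<longrightarrow> norm (?f \<tau>) \<le> norm (\<tau> powr (- 1 - s))"
    proof (intro AE_I2 impI)
      fix \<tau> :: real assume \<tau>: "\<tau> \<in> {1..}"
      have "0 \<le> 1 - exp (- \<tau> * x)" "1 - exp (- \<tau> * x) \<le> 1" using \<tau> x by auto
      then show "norm (?f \<tau>) \<le> norm (\<tau> powr (- 1 - s))"
        by (simp add: abs_mult mult_left_le_one_le)
    qed
  qed simp
  ultimately have "set_integrable lborel ({0<..<1} \<union> {1..}) ?f"
    by (rule set_integrable_Un) auto
  then show ?thesis
  proof (rule set_integrable_subset)
    show "W \<in> sets lborel" using W(1) by simp
    show "W \<subseteq> {0<..<1} \<union> {1..}" using W(2) by force
  qed
qed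

lemma levy_integrand_nonneg:
  fixes x \<tau> s :: real
  shows "0 \<le> x \<Longrightarrow> 0 < \<tau> \<Longrightarrow> 0 \<le> (1 - exp (- \<tau> * x)) * \<tau> powr (- 1 - s)"
  by (intro mult_nonneg_nonneg) auto

lemma levy_mono:
  assumes s: "0 < s" "s < 1" and x: "0 \<le> x" and W: "W \<in> sets borel" "V \<in> sets borel" "V \<subseteq> W" "W \<subseteq> {0<..}"
  shows "0 \<le> levy s V x" "levy s V x \<le> levy s W x"
proof -
  have VW: "V \<subseteq> {0<..}" using W by auto
  show "0 \<le> levy s V x"
    unfolding levy_def set_lebesgue_integral_def
    by (intro integral_nonneg_AE AE_I2) (use levy_integrand_nonneg[OF x] VW in \<open>auto simp: indicator_def\<close>)
  show "levy s V x \<le> levy s W x"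
    unfolding levy_def set_lebesgue_integral_def
  proof (rule integral_mono)
    fix \<tau> :: real
    show "indicator V \<tau> *\<^sub>R ((1 - exp (- \<tau> * x)) * \<tau> powr (- 1 - s)) \<le> indicator W \<tau> *\<^sub>R ((1 - exp (- \<tau> * x)) * \<tau> powr (- 1 - s))"
      using levy_integrand_nonneg[OF x, of \<tau> s] W by (auto simp: indicator_def)
  qed (use levy_integrable[OF s x W(2) VW] levy_integrable[OF s x W(1,4)] in \<open>simp_all add: set_integrable_def\<close>)
qed

lemma levy_pos:
  assumes s: "0 < s" "s < 1"
  shows "0 < levy s {0<..} 1"
proof -
  have "0 < (1 - exp (- 1)) * (1 / s)" using s by simp
  also have "\<dots> = (LINT \<tau>:{1..}|lborel. (1 - exp (- 1)) * \<tau> powr (- 1 - s))"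
    using levy_mass_atLeast(2)[OF s(1), of 1] by (simp add: levy_mass_def)
  also have "\<dots> \<le> levy s {1..} 1"
    unfolding levy_def
  proof (rule set_integral_mono)
    show "set_integrable lborel {1..} (\<lambda>\<tau>. (1 - exp (- 1)) * \<tau> powr (- 1 - s))"
      by (intro set_integrable_mult_right levy_mass_atLeast s) simp
    show "set_integrable lborel {1..} (\<lambda>\<tau>. (1 - exp (- \<tau> * 1)) * \<tau> powr (- 1 - s))"
      by (rule levy_integrable[OF s]) auto
  qed (auto intro!: mult_right_mono)
  also have "\<dots> \<le> levy s {0<..} 1"
    by (rule levy_mono[OF s]) auto
  finally show ?thesis .
qed

text \<open>Substitution \<open>u = x \<tau>\<close>. The constant is left as an integral; of its
  value, only positivity is used later.\<close>

lemma levy_scale: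
  assumes s: "0 < s" "s < 1" and x: "0 \<le> x"
  shows "levy s {0<..} x = x powr s * levy s {0<..} 1"
proof (cases "x = 0")
  case True
  then show ?thesis by (simp add: levy_def)
next
  case False
  with x have x: "x > 0" by simp
  let ?f = "\<lambda>\<tau>. indicator {0<..} \<tau> * ((1 - exp (- \<tau> * x)) * \<tau> powr (- 1 - s))"
  have "levy s {0<..} x = (\<integral>\<tau>. ?f \<tau> \<partial>lborel)"
    unfolding levy_def set_lebesgue_integral_def real_scaleR_def ..
  also have "\<dots> = \<bar>1 / x\<bar> *\<^sub>R (\<integral>u. ?f (0 + 1 / x * u) \<partial>lborel)"
    by (rule lborel_integral_real_affine) (use x in simp)
  also have "(\<lambda>u. ?f (0 + 1 / x * u)) = (\<lambda>u. x powr (1 + s) * (indicator {0<..} u * ((1 - exp (- u * 1)) * u powr (- 1 - s))))"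
  proof
    fix u :: real
    have "(1 / x * u) powr (- 1 - s) = x powr (1 + s) * u powr (- 1 - s)" if "u > 0"
    proof -
      have "(1 / x * u) powr (- 1 - s) = u powr (- 1 - s) / x powr (- 1 - s)"
        using x that by (simp add: powr_divide)
      moreover have "x powr (- 1 - s) = inverse (x powr (1 + s))"
        using powr_minus[of x "1 + s"] by simp
      ultimately show ?thesis by (simp add: divide_inverse)
    qed
    then show "?f (0 + 1 / x * u) = x powr (1 + s) * (indicator {0<..} u * ((1 - exp (- u * 1)) * u powr (- 1 - s)))"
      using x by (auto simp: indicator_def zero_less_mult_iff zero_less_divide_iff)
  qed
  also have "\<bar>1 / x\<bar> *\<^sub>R (\<integral>u. x powr (1 + s) * (indicator {0<..} u * ((1 - exp (- u * 1)) * u powr (- 1 - s))) \<partial>lborel)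
      = (1 / x * x powr (1 + s)) * levy s {0<..} 1"
    unfolding levy_def set_lebesgue_integral_def real_scaleR_def using x by simp
  also have "1 / x * x powr (1 + s) = x powr s"
    using x by (simp add: powr_add)
  finally show ?thesis .
qed

text \<open>Cutting off the jumps below \<open>1 / Suc n\<close> makes the rate finite, so each
  approximant belongs to a compound Poisson process.\<close>

lemma levy_tendsto:
  assumes s: "0 < s" "s < 1" and x: "0 \<le> x"
  shows "(\<lambda>n. levy s {1 / real (Suc n)..} x) \<longlonglongrightarrow> levy s {0<..} x"
  unfolding levy_def set_lebesgue_integral_def
proof (rule integral_dominated_convergence)
  let ?f = "\<lambda>\<tau>::real. (1 - exp (- \<tau> * x)) * \<tau> powr (- 1 - s)"
  show "integrable lborel (\<lambda>\<tau>. indicator {0<..} \<tau> *\<^sub>R ?f \<tau>)"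
    using levy_integrable[OF s x, of "{0<..}"] by (simp add: set_integrable_def)
  show "AE \<tau> in lborel. (\<lambda>n. indicator {1 / real (Suc n)..} \<tau> *\<^sub>R ?f \<tau>) \<longlonglongrightarrow> indicator {0<..} \<tau> *\<^sub>R ?f \<tau>"
  proof (rule AE_I2)
    fix \<tau> :: real
    have "(\<lambda>n. indicator {1 / real (Suc n)..} \<tau> :: real) \<longlonglongrightarrow> indicator {0<..} \<tau>"
    proof (cases "\<tau> > 0")
      case True
      then have "\<forall>\<^sub>F n in sequentially. 1 / real (Suc n) < \<tau>"
        using order_tendstoD(2)[OF LIMSEQ_Suc[OF lim_1_over_n]] by simp
      then have "\<forall>\<^sub>F n in sequentially. indicator {1 / real (Suc n)..} \<tau> = (indicator {0<..} \<tau> :: real)"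
        by eventually_elim (use True in auto)
      then show ?thesis by (rule tendsto_eventually)
    next
      case False
      have "indicator {1 / real (Suc n)..} \<tau> = (indicator {0<..} \<tau> :: real)" for n
      proof -
        have "0 < 1 / real (Suc n)" by (rule divide_pos_pos) auto
        then have "\<tau> \<notin> {1 / real (Suc n)..}" "\<tau> \<notin> {0<..}"
          using False by (meson atLeast_iff less_le_trans, meson greaterThan_iff)
        then show ?thesis by (metis indicator_simps(2))
      qed
      then show ?thesis by (simp only: tendsto_const)
    qed
    then show "(\<lambda>n. indicator {1 / real (Suc n)..} \<tau> *\<^sub>R ?f \<tau>) \<longlonglongrightarrow> indicator {0<..} \<tau> *\<^sub>R ?f \<tau>"
      by (rule tendsto_scaleR) (rule tendsto_const)
  qed
  show "AE \<tau> in lborel. norm (indicator {1 / real (Suc n)..} \<tau> *\<^sub>R ?f \<tau>) \<le> indicator {0<..} \<tau> *\<^sub>R ?f \<tau>" for n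
  proof (rule AE_I2)
    fix \<tau> :: real
    have "0 < 1 / real (Suc n)" by (rule divide_pos_pos) auto
    then have sub: "\<tau> \<in> {1 / real (Suc n)..} \<Longrightarrow> \<tau> \<in> {0<..}"
      unfolding atLeast_iff greaterThan_iff by (rule less_le_trans)
    have nn: "\<tau> \<in> {0<..} \<Longrightarrow> 0 \<le> ?f \<tau>" using levy_integrand_nonneg[OF x, of \<tau> s] by (simp only: greaterThan_iff)
    have gen: "norm (indicator A \<tau> *\<^sub>R ?f \<tau>) \<le> indicator {0<..} \<tau> *\<^sub>R ?f \<tau>" if "\<tau> \<in> A \<Longrightarrow> \<tau> \<in> {0<..}" for A
      using that nn by (cases "\<tau> \<in> A"; cases "\<tau> \<in> {0<..}") (simp_all only: indicator_simps scaleR_one scaleR_zero_left norm_zero real_norm_def abs_of_nonneg, simp_all)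
    show "norm (indicator {1 / real (Suc n)..} \<tau> *\<^sub>R ?f \<tau>) \<le> indicator {0<..} \<tau> *\<^sub>R ?f \<tau>"
      by (rule gen[OF sub])
  qed
qed measurable

lemma levy_split:
  assumes s: "0 < s" "s < 1" and x: "0 \<le> x" and "V \<in> sets borel" "W \<in> sets borel" "V \<inter> W = {}"
    "V \<subseteq> {0<..}" "W \<subseteq> {0<..}"
  shows "levy s (V \<union> W) x = levy s V x + levy s W x"
  unfolding levy_def by (intro set_integral_Un levy_integrable s x assms)

lemma levy_eq_mass:
  fixes s x :: real
  assumes s: "0 < s" "s < 1" and x: "0 \<le> x" and W: "W \<in> sets borel" "W \<subseteq> {0<..}"
    and fin: "set_integrable lborel W (\<lambda>\<tau>. \<tau> powr (- 1 - s))"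
  shows "set_integrable lborel W (\<lambda>\<tau>. exp (- \<tau> * x) * \<tau> powr (- 1 - s))"
    and "levy s W x = levy_mass s W - (LINT \<tau>:W|lborel. exp (- \<tau> * x) * \<tau> powr (- 1 - s))"
proof -
  have eq: "exp (- \<tau> * x) * \<tau> powr (- 1 - s) = \<tau> powr (- 1 - s) - (1 - exp (- \<tau> * x)) * \<tau> powr (- 1 - s)" for \<tau>
    by (simp add: algebra_simps)
  show *: "set_integrable lborel W (\<lambda>\<tau>. exp (- \<tau> * x) * \<tau> powr (- 1 - s))"
    unfolding eq by (intro set_integral_diff fin levy_integrable s x W)
  have "levy s W x = (LINT \<tau>:W|lborel. \<tau> powr (- 1 - s) - exp (- \<tau> * x) * \<tau> powr (- 1 - s))"
    unfolding levy_def left_diff_distrib mult_1_left ..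
  then show "levy s W x = levy_mass s W - (LINT \<tau>:W|lborel. exp (- \<tau> * x) * \<tau> powr (- 1 - s))"
    by (simp only: set_integral_diff(2)[OF fin *] levy_mass_def)
qed

section \<open>The characteristic exponent\<close>

lemma continuous_matrix_vector:
  fixes A :: "real^'m^'n"
  shows "continuous_on S g \<Longrightarrow> continuous_on S (\<lambda>p. A *v g p)"
  by (rule continuous_on_compose2[OF matrix_vector_mult_linear_continuous_on[of UNIV A]]) auto

lemma atLeast_inverse_Suc_subset: "{1 / real (Suc n)..} \<subseteq> {0<..}"
proof -
  have "0 < 1 / real (Suc n)" by (rule divide_pos_pos) auto
  then show ?thesis by (meson subsetI atLeast_iff greaterThan_iff less_le_trans)
qed

locale ou =
  fixes Q B :: "real^'n^'n" and s :: real
  assumes sym: "symmetric_mat Q" and pos: "pos_def_mat Q" and s: "0 < s" "s < 1"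
begin

definition flow :: "real \<Rightarrow> real^'n \<Rightarrow> real^'n" where
  "flow t x = mat_exp ((- t) *\<^sub>R B) *v x"

definition coflow :: "real \<Rightarrow> real^'n \<Rightarrow> real^'n" where
  "coflow t \<xi> = mat_exp ((- t) *\<^sub>R transpose B) *v \<xi>"

definition q :: "real \<Rightarrow> real^'n \<Rightarrow> real" where
  "q t \<xi> = norm (mat_sqrt Q *v coflow t \<xi>)"

definition expo :: "real \<Rightarrow> real \<Rightarrow> real^'n \<Rightarrow> real" where
  "expo a b \<xi> = (1/2) * (LINT \<sigma>:{a..b}|lborel. q \<sigma> \<xi> powr (2 * s))"

lemma flow_0 [simp]: "flow 0 x = x"
  using mat_exp_zero_apply[of B x] by (simp add: flow_def)

lemma coflow_0 [simp]: "coflow 0 x = x"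
  using mat_exp_zero_apply[of "transpose B" x] by (simp add: coflow_def)

lemma flow_add: "flow (t + u) x = flow t (flow u x)"
  using mat_exp_add_apply[of "-t" "-u" B x] by (simp add: flow_def)

lemma coflow_add: "coflow (t + u) x = coflow t (coflow u x)"
  using mat_exp_add_apply[of "-t" "-u" "transpose B" x] by (simp add: coflow_def)

lemma flow_lin: "flow t (x + y) = flow t x + flow t y" "flow t (r *\<^sub>R x) = r *\<^sub>R flow t x"
  "flow t (x - y) = flow t x - flow t y"
  by (simp_all add: flow_def matrix_vector_right_distrib matrix_vector_mult_scaleR matrix_vector_mult_diff_distrib)

lemma coflow_scaleR: "coflow t (r *\<^sub>R x) = r *\<^sub>R coflow t x"
  by (simp add: coflow_def matrix_vector_mult_scaleR)

lemma inner_coflow: "coflow t \<xi> \<bullet> x = \<xi> \<bullet> flow t x"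
  by (simp only: flow_def coflow_def inner_mat_exp_transpose)

definition \<beta> :: real where "\<beta> = norm (mat_endo B) + norm (mat_endo (transpose B))"

lemma \<beta>_nonneg: "0 \<le> \<beta>" by (simp add: \<beta>_def)

lemma norm_flow: "norm (flow t x) \<le> exp (\<bar>t\<bar> * \<beta>) * norm x"
  unfolding flow_def
  by (rule order_trans[OF norm_mat_exp_apply]) (auto simp: \<beta>_def intro!: mult_right_mono mult_left_mono)

lemma norm_coflow: "norm (coflow t x) \<le> exp (\<bar>t\<bar> * \<beta>) * norm x"
  unfolding coflow_def
  by (rule order_trans[OF norm_mat_exp_apply]) (auto simp: \<beta>_def intro!: mult_right_mono mult_left_mono)

lemma continuous_flow [continuous_intros]:
  assumes "continuous_on S f" "continuous_on S g"
  shows "continuous_on S (\<lambda>p. flow (f p) (g p))" "continuous_on S (\<lambda>p. coflow (f p) (g p))"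
  unfolding flow_def coflow_def by (intro continuous_intros assms)+

lemma continuous_q [continuous_intros]:
  assumes "continuous_on S f" "continuous_on S g"
  shows "continuous_on S (\<lambda>p. q (f p) (g p))"
  unfolding q_def
  by (intro continuous_on_norm continuous_matrix_vector continuous_flow assms)

lemma measurable_q [measurable (raw)]:
  assumes "f \<in> borel_measurable M" "g \<in> borel_measurable M"
  shows "(\<lambda>x. q (f x) (g x)) \<in> borel_measurable M"
  by (rule borel_measurable_continuous_Pair[OF assms]) (intro continuous_intros)

lemma measurable_flow [measurable (raw)]:
  assumes "f \<in> borel_measurable M" "g \<in> borel_measurable M"
  shows "(\<lambda>x. flow (f x) (g x)) \<in> borel_measurable M" "(\<lambda>x. coflow (f x) (g x)) \<in> borel_measurable M"
  by (rule borel_measurable_continuous_Pair[OF assms], intro continuous_intros)+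

lemma q_nonneg: "0 \<le> q t \<xi>"
  by (simp add: q_def)

lemma q_add: "q (t + u) \<xi> = q t (coflow u \<xi>)"
  by (simp add: q_def coflow_add)

section \<open>Ellipticity and the effect of a single Gaussian jump\<close>

lemma sqrt_lower:
  obtains c where "c > 0" "\<And>x. c * norm x \<le> norm (mat_sqrt Q *v x)"
proof -
  obtain c where c: "c > 0" "\<And>x. c * (norm x)\<^sup>2 \<le> (mat_sqrt Q *v x) \<bullet> x"
    using pos_def_mat_lower[OF mat_sqrt_props(2)[OF sym pos]] by blast
  have "c * norm x \<le> norm (mat_sqrt Q *v x)" for x
  proof (cases "x = 0")
    case False
    have "c * norm x * norm x \<le> norm (mat_sqrt Q *v x) * norm x"
      using order_trans[OF c(2) norm_cauchy_schwarz, of x] by (simp add: power2_eq_square)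
    then show ?thesis using False by simp
  qed simp
  with c(1) that show thesis by blast
qed

text \<open>Running the flow backwards from time \<sigma> loses at most the factor
  \<open>exp \<beta>\<close> while \<sigma> stays in the unit interval. The restriction to times up
  to 1 in the smoothing estimates has the same origin.\<close>

lemma q_lower:
  obtains c where "c > 0" "\<And>\<sigma> \<xi>. 0 \<le> \<sigma> \<Longrightarrow> \<sigma> \<le> 1 \<Longrightarrow> c * norm \<xi> \<le> q \<sigma> \<xi>"
proof -
  obtain c where c: "c > 0" "\<And>x. c * norm x \<le> norm (mat_sqrt Q *v x)"
    using sqrt_lower by blast
  have "c * exp (- \<beta>) * norm \<xi> \<le> q \<sigma> \<xi>" if "0 \<le> \<sigma>" "\<sigma> \<le> 1" for \<sigma> \<xi>
  proof -
    have "norm \<xi> = norm (coflow (- \<sigma>) (coflow \<sigma> \<xi>))" by (simp flip: coflow_add)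
    also have "\<dots> \<le> exp (\<bar>- \<sigma>\<bar> * \<beta>) * norm (coflow \<sigma> \<xi>)" by (rule norm_coflow)
    also have "\<dots> \<le> exp (1 * \<beta>) * norm (coflow \<sigma> \<xi>)"
      using that \<beta>_nonneg by (intro mult_right_mono iffD2[OF exp_le_cancel_iff] mult_right_mono) auto
    finally have "exp (- \<beta>) * norm \<xi> \<le> norm (coflow \<sigma> \<xi>)"
      by (simp add: exp_minus field_simps)
    then have "c * (exp (- \<beta>) * norm \<xi>) \<le> c * norm (coflow \<sigma> \<xi>)" using c(1) by simp
    also have "\<dots> \<le> q \<sigma> \<xi>" unfolding q_def by (rule c(2))
    finally show ?thesis by (simp add: mult.assoc)
  qed
  then show thesis using that[of "c * exp (- \<beta>)"] c(1) by simp
qed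

text \<open>The Gaussian \<open>exp (- \<tau> q^2)\<close> is that of
  \<open>A = sqrt (2 \<tau>) Q^(1/2) coflow \<sigma>\<close>. A shift by \<open>h\<close> is a shift
  by \<open>A' b\<close> because \<open>mat_sqrt Q\<close> is onto: take
  \<open>b = y / sqrt (2 \<tau>)\<close> with \<open>mat_sqrt Q\<close> sending \<open>y\<close> to
  \<open>h\<close> flowed back by \<sigma>. The size of \<open>y\<close> is estimated separately,
  uniformly in \<sigma>.\<close>

lemma multiplier_gauss_q:
  assumes "0 < \<tau>"
  shows "multiplier 1 (\<lambda>\<xi>. of_real (exp (- \<tau> * (q \<sigma> \<xi>)\<^sup>2)))"
    and "\<exists>y. mat_sqrt Q *v y = flow (- \<sigma>) h \<and> multiplier (3 * norm y / sqrt (2 * \<tau>))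
       (\<lambda>\<xi>. (cis (\<xi> \<bullet> h) - 1) * of_real (exp (- \<tau> * (q \<sigma> \<xi>)\<^sup>2)))"
proof -
  let ?R = "\<lambda>x. mat_sqrt Q *v x"
  define A where "A \<xi> = sqrt (2 * \<tau>) *\<^sub>R ?R (coflow \<sigma> \<xi>)" for \<xi>
  define A' where "A' y = flow \<sigma> (?R (sqrt (2 * \<tau>) *\<^sub>R y))" for y
  have adj: "A \<xi> \<bullet> y = \<xi> \<bullet> A' y" for \<xi> y
    by (simp add: A_def A'_def inner_symmetric_mat[OF mat_sqrt_props(1)[OF sym pos]]
        matrix_vector_mult_scaleR flip: inner_coflow)
  have "continuous_on UNIV A"
    unfolding A_def[abs_def]
    by (intro continuous_on_scaleR continuous_matrix_vector continuous_intros)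
  then have mA: "A \<in> borel_measurable borel" by (rule borel_measurable_continuous_onI)
  have nA: "exp (- (norm (A \<xi>))\<^sup>2 / 2) = exp (- \<tau> * (q \<sigma> \<xi>)\<^sup>2)" for \<xi>
    using assms by (simp add: A_def q_def power_mult_distrib)
  show "multiplier 1 (\<lambda>\<xi>. of_real (exp (- \<tau> * (q \<sigma> \<xi>)\<^sup>2)))"
    using multiplier_gauss(1)[OF adj mA] unfolding nA .
  obtain c where c: "c > 0" "\<And>x. c * norm x \<le> norm (?R x)" using sqrt_lower by blast
  have "inj ?R"
  proof (rule injI)
    fix x y assume "?R x = ?R y"
    then have "c * norm (x - y) \<le> 0" using c(2)[of "x - y"] by (simp add: matrix_vector_mult_diff_distrib)
    then show "x = y" using c(1) by (simp add: mult_le_0_iff)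
  qed
  then have "surj ?R" by (rule linear_inj_imp_surj[OF matrix_vector_mul_linear])
  then obtain y where y: "?R y = flow (- \<sigma>) h" by (metis surjD)
  define b where "b = (1 / sqrt (2 * \<tau>)) *\<^sub>R y"
  have "A' b = h"
    using assms by (simp add: A'_def b_def y flip: flow_add)
  then have "multiplier (3 * norm b) (\<lambda>\<xi>. (cis (\<xi> \<bullet> h) - 1) * of_real (exp (- \<tau> * (q \<sigma> \<xi>)\<^sup>2)))"
    using multiplier_gauss(2)[OF adj mA, of b] unfolding nA by simp
  moreover have "3 * norm b = 3 * norm y / sqrt (2 * \<tau>)" using assms by (simp add: b_def)
  ultimately show "\<exists>y. ?R y = flow (- \<sigma>) h \<and> multiplier (3 * norm y / sqrt (2 * \<tau>))
       (\<lambda>\<xi>. (cis (\<xi> \<bullet> h) - 1) * of_real (exp (- \<tau> * (q \<sigma> \<xi>)\<^sup>2)))"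
    using y by auto
qed

lemma multiplier_gauss_difference:
  obtains K where "K > 0" "\<And>\<sigma> \<tau> h. 0 \<le> \<sigma> \<Longrightarrow> \<sigma> \<le> 1 \<Longrightarrow> 0 < \<tau> \<Longrightarrow>
    multiplier (K * norm h / sqrt \<tau>) (\<lambda>\<xi>. (cis (\<xi> \<bullet> h) - 1) * of_real (exp (- \<tau> * (q \<sigma> \<xi>)\<^sup>2)))"
proof -
  obtain c where c: "c > 0" "\<And>x. c * norm x \<le> norm (mat_sqrt Q *v x)" using sqrt_lower by blast
  have "multiplier (3 * exp \<beta> / c * norm h / sqrt \<tau>) (\<lambda>\<xi>. (cis (\<xi> \<bullet> h) - 1) * of_real (exp (- \<tau> * (q \<sigma> \<xi>)\<^sup>2)))"
    if \<sigma>: "0 \<le> \<sigma>" "\<sigma> \<le> 1" and \<tau>: "0 < \<tau>" for \<sigma> \<tau> h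
  proof -
    obtain y where y: "mat_sqrt Q *v y = flow (- \<sigma>) h"
      and m: "multiplier (3 * norm y / sqrt (2 * \<tau>)) (\<lambda>\<xi>. (cis (\<xi> \<bullet> h) - 1) * of_real (exp (- \<tau> * (q \<sigma> \<xi>)\<^sup>2)))"
      using multiplier_gauss_q(2)[OF \<tau>] by blast
    have "c * norm y \<le> norm (flow (- \<sigma>) h)" using c(2)[of y] y by simp
    also have "\<dots> \<le> exp (\<bar>- \<sigma>\<bar> * \<beta>) * norm h" by (rule norm_flow)
    also have "\<dots> \<le> exp (1 * \<beta>) * norm h"
      using \<sigma> \<beta>_nonneg by (intro mult_right_mono iffD2[OF exp_le_cancel_iff] mult_right_mono) auto
    finally have "norm y \<le> exp \<beta> * norm h / c" using c(1) by (simp add: field_simps)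
    then have "3 * norm y / sqrt (2 * \<tau>) \<le> 3 * (exp \<beta> * norm h / c) / sqrt \<tau>"
      using \<tau> c(1) by (intro frac_le mult_left_mono) auto
    then show ?thesis
      by (intro multiplier_mono[OF m]) simp
  qed
  then show thesis using that[of "3 * exp \<beta> / c"] c(1) by simp
qed

section \<open>Jump exponents over a time interval and their compound Poisson form\<close>

definition level :: "real set \<Rightarrow> real \<Rightarrow> real \<Rightarrow> real^'n \<Rightarrow> real" where
  "level W a b \<xi> = (LINT \<sigma>:{a..b}|lborel. levy s W ((q \<sigma> \<xi>)\<^sup>2))"

text \<open>Up to the constant \<open>\<kappa>\<close> below, \<open>level W a b\<close> is the
  characteristic exponent due to jumps whose Gaussian parameter \<tau> lies in \<open>W\<close>; at
  finite positive rate, \<open>mixture W a b\<close> divided by its value at the origin is the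
  characteristic function of one such jump.\<close>

definition mixture :: "real set \<Rightarrow> real \<Rightarrow> real \<Rightarrow> real^'n \<Rightarrow> real" where
  "mixture W a b \<xi> = (LINT \<sigma>:{a..b}|lborel. LINT \<tau>:W|lborel. exp (- \<tau> * (q \<sigma> \<xi>)\<^sup>2) * \<tau> powr (- 1 - s))"

lemma measurable_levy_q [measurable (raw)]:
  assumes [measurable]: "W \<in> sets borel" "f \<in> borel_measurable M" "g \<in> borel_measurable M"
  shows "(\<lambda>x. levy s W ((q (f x) (g x))\<^sup>2)) \<in> borel_measurable M"
  unfolding levy_def set_lebesgue_integral_def by measurable

lemma levy_q: "levy s {0<..} ((q \<sigma> \<xi>)\<^sup>2) = q \<sigma> \<xi> powr (2 * s) * levy s {0<..} 1"
proof -
  have "(q \<sigma> \<xi>)\<^sup>2 = q \<sigma> \<xi> powr 2" using q_nonneg[of \<sigma> \<xi>] by (simp add: powr_numeral)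
  then show ?thesis by (subst levy_scale[OF s]) (simp_all add: powr_powr)
qed

lemma integrable_q_powr: "set_integrable lborel {a..b} (\<lambda>\<sigma>. q \<sigma> \<xi> powr (2 * s))"
  by (rule borel_integrable_atLeastAtMost')
     (intro continuous_on_powr' continuous_intros; use s q_nonneg in auto)

lemma integrable_level:
  assumes W: "W \<in> sets borel" "W \<subseteq> {0<..}"
  shows "set_integrable lborel {a..b} (\<lambda>\<sigma>. levy s W ((q \<sigma> \<xi>)\<^sup>2))"
proof (rule set_integrable_bound)
  show "set_integrable lborel {a..b} (\<lambda>\<sigma>. q \<sigma> \<xi> powr (2 * s) * levy s {0<..} 1)"
    by (intro set_integrable_mult_left integrable_q_powr)
  show "set_borel_measurable lborel {a..b} (\<lambda>\<sigma>. levy s W ((q \<sigma> \<xi>)\<^sup>2))"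
    unfolding set_borel_measurable_def using W by measurable
  have "norm (levy s W ((q \<sigma> \<xi>)\<^sup>2)) \<le> norm (q \<sigma> \<xi> powr (2 * s) * levy s {0<..} 1)" for \<sigma>
    using levy_mono[OF s, of "(q \<sigma> \<xi>)\<^sup>2" "{0<..}" W] W by (simp add: levy_q)
  then show "AE \<sigma> in lborel. \<sigma> \<in> {a..b} \<longrightarrow> norm (levy s W ((q \<sigma> \<xi>)\<^sup>2)) \<le> norm (q \<sigma> \<xi> powr (2 * s) * levy s {0<..} 1)"
    by simp
qed

lemma level_nonneg:
  assumes W: "W \<in> sets borel" "W \<subseteq> {0<..}"
  shows "0 \<le> level W a b \<xi>"
  unfolding level_def set_lebesgue_integral_def
  by (intro integral_nonneg_AE AE_I2) (use levy_mono(1)[OF s, of _ W W] W in simp)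

lemma expo_level: "expo a b \<xi> = level {0<..} a b \<xi> / (2 * levy s {0<..} 1)"
  using levy_pos[OF s] by (simp add: expo_def level_def levy_q)

lemma level_split:
  assumes "V \<in> sets borel" "W \<in> sets borel" "V \<inter> W = {}" "V \<subseteq> {0<..}" "W \<subseteq> {0<..}"
  shows "level (V \<union> W) a b \<xi> = level V a b \<xi> + level W a b \<xi>"
  unfolding level_def
  by (subst levy_split[OF s _ assms]) (simp_all add: set_integral_add integrable_level assms)

lemma expo_nonneg: "0 \<le> expo a b \<xi>"
  unfolding expo_def set_lebesgue_integral_def by (intro mult_nonneg_nonneg integral_nonneg_AE AE_I2) auto

lemma expo_join:
  assumes "a \<le> b" "b \<le> c"
  shows "expo a c \<xi> = expo a b \<xi> + expo b c \<xi>"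
proof -
  have "(LINT \<sigma>:{a..c}|lborel. q \<sigma> \<xi> powr (2 * s)) = (LINT \<sigma>:{a..b} \<union> {b<..c}|lborel. q \<sigma> \<xi> powr (2 * s))"
    using assms by (simp add: ivl_disj_un)
  also have "\<dots> = (LINT \<sigma>:{a..b}|lborel. q \<sigma> \<xi> powr (2 * s)) + (LINT \<sigma>:{b<..c}|lborel. q \<sigma> \<xi> powr (2 * s))"
    by (rule set_integral_Un) (auto intro: integrable_q_powr set_integrable_subset[OF integrable_q_powr[of b c]])
  also have "(LINT \<sigma>:{b<..c}|lborel. q \<sigma> \<xi> powr (2 * s)) = (LINT \<sigma>:{b..c}|lborel. q \<sigma> \<xi> powr (2 * s))"
    unfolding set_lebesgue_integral_def
  proof (rule integral_cong_AE)
    show "AE \<sigma> in lborel. indicat_real {b<..c} \<sigma> *\<^sub>R (q \<sigma> \<xi> powr (2 * s)) = indicat_real {b..c} \<sigma> *\<^sub>R (q \<sigma> \<xi> powr (2 * s))"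
      using AE_lborel_singleton[of b] by eventually_elim (auto simp: indicator_def)
  qed measurable
  finally show ?thesis by (simp add: expo_def distrib_left)
qed

lemma level_tendsto:
  "(\<lambda>n. level {1 / real (Suc n)..} a b \<xi>) \<longlonglongrightarrow> level {0<..} a b \<xi>"
  unfolding level_def set_lebesgue_integral_def
proof (rule integral_dominated_convergence)
  show "integrable lborel (\<lambda>\<sigma>. indicator {a..b} \<sigma> *\<^sub>R levy s {0<..} ((q \<sigma> \<xi>)\<^sup>2))"
    using integrable_level[of "{0<..}" a b \<xi>] by (simp add: set_integrable_def)
  show "AE \<sigma> in lborel. (\<lambda>n. indicator {a..b} \<sigma> *\<^sub>R levy s {1 / real (Suc n)..} ((q \<sigma> \<xi>)\<^sup>2))
      \<longlonglongrightarrow> indicator {a..b} \<sigma> *\<^sub>R levy s {0<..} ((q \<sigma> \<xi>)\<^sup>2)"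
    by (intro AE_I2 tendsto_scaleR tendsto_const levy_tendsto s) simp
  note sub = atLeast_inverse_Suc_subset
  show "AE \<sigma> in lborel. norm (indicator {a..b} \<sigma> *\<^sub>R levy s {1 / real (Suc n)..} ((q \<sigma> \<xi>)\<^sup>2))
      \<le> indicator {a..b} \<sigma> *\<^sub>R levy s {0<..} ((q \<sigma> \<xi>)\<^sup>2)" for n
  proof (rule AE_I2)
    fix \<sigma>
    show "norm (indicator {a..b} \<sigma> *\<^sub>R levy s {1 / real (Suc n)..} ((q \<sigma> \<xi>)\<^sup>2))
      \<le> indicator {a..b} \<sigma> *\<^sub>R levy s {0<..} ((q \<sigma> \<xi>)\<^sup>2)"
      using levy_mono[OF s, of "(q \<sigma> \<xi>)\<^sup>2" "{0<..}" "{1 / real (Suc n)..}"] sub[of n] by (simp add: indicator_def)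
  qed
qed measurable

text \<open>The difference on the right is the exponent of the jumps below \<open>\<rho>\<close>; as
  a limit of finite-rate exponents it comes within reach of
  \<open>multiplier_level_finite\<close>.\<close>

lemma level_tendsto_below:
  assumes "0 < \<rho>"
  shows "(\<lambda>n. level ({1 / real (Suc n)..} - {\<rho>..}) a b \<xi>) \<longlonglongrightarrow> level {0<..} a b \<xi> - level {\<rho>..} a b \<xi>"
proof -
  have "\<forall>\<^sub>F n in sequentially. 1 / real (Suc n) < \<rho>"
    using order_tendstoD(2)[OF LIMSEQ_Suc[OF lim_1_over_n]] assms by simp
  then have "\<forall>\<^sub>F n in sequentially. level {1 / real (Suc n)..} a b \<xi> - level {\<rho>..} a b \<xi>
      = level ({1 / real (Suc n)..} - {\<rho>..}) a b \<xi>"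
  proof eventually_elim
    case (elim n)
    have eq: "{1 / real (Suc n)..} = ({1 / real (Suc n)..} - {\<rho>..}) \<union> {\<rho>..}"
      using elim by force
    have "level (({1 / real (Suc n)..} - {\<rho>..}) \<union> {\<rho>..}) a b \<xi>
        = level ({1 / real (Suc n)..} - {\<rho>..}) a b \<xi> + level {\<rho>..} a b \<xi>"
      using assms atLeast_inverse_Suc_subset[of n] by (intro level_split) auto
    then show ?case using eq by simp
  qed
  moreover have "(\<lambda>n. level {1 / real (Suc n)..} a b \<xi> - level {\<rho>..} a b \<xi>) \<longlonglongrightarrow> level {0<..} a b \<xi> - level {\<rho>..} a b \<xi>"
    by (intro tendsto_diff level_tendsto tendsto_const)
  ultimately show ?thesis by (rule Lim_transform_eventually[rotated])
qed

text \<open>The factor \<open>D\<close> serves two purposes: with \<open>D = 1\<close> the jump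
  symbol has norm at most its mass, and with \<open>D\<close> the symbol of a difference every jump
  contributes its own smoothing bound \<open>L\<close>.\<close>

lemma multiplier_mixture:
  fixes D :: "real^'n \<Rightarrow> complex"
  assumes W [measurable]: "W \<in> sets borel" and W0: "W \<subseteq> {0<..}"
    and fin: "set_integrable lborel W (\<lambda>\<tau>. \<tau> powr (- 1 - s))" and ab: "a \<le> b"
    and D [measurable]: "D \<in> borel_measurable borel" and d: "\<And>\<xi>. cmod (D \<xi>) \<le> d"
    and L: "0 \<le> L" "\<And>\<sigma> \<tau>. \<sigma> \<in> {a..b} \<Longrightarrow> \<tau> \<in> W \<Longrightarrow> multiplier L (\<lambda>\<xi>. D \<xi> * of_real (exp (- \<tau> * (q \<sigma> \<xi>)\<^sup>2)))"
  shows "multiplier (L * ((b - a) * levy_mass s W)) (\<lambda>\<xi>. D \<xi> * of_real (mixture W a b \<xi>))"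
proof -
  let ?p = "\<lambda>\<tau>. indicator W \<tau> * \<tau> powr (- 1 - s) :: real"
  have pi: "integrable lborel ?p" using fin by (simp add: set_integrable_def)
  have pm: "(\<integral>\<tau>. ?p \<tau> \<partial>lborel) = levy_mass s W"
    by (simp add: levy_mass_def set_lebesgue_integral_def)
  have d0: "0 \<le> d" using d[of 0] norm_ge_zero order_trans by blast
  define \<psi> where "\<psi> \<sigma> \<tau> \<xi> = of_real (?p \<tau>) * (D \<xi> * of_real (exp (- \<tau> * (q \<sigma> \<xi>)\<^sup>2)))" for \<sigma> \<tau> \<xi>
  have p0: "0 \<le> ?p \<tau>" for \<tau> by simp
  have psi_le: "cmod (\<psi> \<sigma> \<tau> \<xi>) \<le> ?p \<tau> * d" for \<sigma> \<tau> \<xi>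
  proof (cases "\<tau> \<in> W")
    case True
    then have "exp (- \<tau> * (q \<sigma> \<xi>)\<^sup>2) \<le> 1" using W0 by auto
    then have "cmod (D \<xi>) * exp (- \<tau> * (q \<sigma> \<xi>)\<^sup>2) \<le> d * 1" using d d0 by (intro mult_mono) auto
    then show ?thesis using True by (simp add: \<psi>_def norm_mult mult_left_mono)
  qed (simp add: \<psi>_def)
  have "multiplier (\<integral>\<tau>. ?p \<tau> * L \<partial>lborel) (\<lambda>\<xi>. \<integral>\<tau>. \<psi> \<sigma> \<tau> \<xi> \<partial>lborel)" if "\<sigma> \<in> {a..b}" for \<sigma>
  proof (rule multiplier_integral[OF lborel.sigma_finite_measure_axioms, where b="\<lambda>\<tau>. ?p \<tau> * d"])
    show "(\<lambda>(\<xi>, \<tau>). \<psi> \<sigma> \<tau> \<xi>) \<in> borel_measurable (borel \<Otimes>\<^sub>M lborel)"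
      unfolding \<psi>_def by measurable
    show "multiplier (?p \<tau> * L) (\<psi> \<sigma> \<tau>)" for \<tau>
    proof (cases "\<tau> \<in> W")
      case True
      show ?thesis
        using multiplier_cmult[OF L(2)[OF that True], of "of_real (?p \<tau>)"] True
        unfolding \<psi>_def[abs_def] by simp
    next
      case False
      then show ?thesis using multiplier_const[of 0] by (simp add: \<psi>_def[abs_def])
    qed
  qed (use psi_le pi in auto)
  then have inner: "multiplier (levy_mass s W * L) (\<lambda>\<xi>. \<integral>\<tau>. \<psi> \<sigma> \<tau> \<xi> \<partial>lborel)" if "\<sigma> \<in> {a..b}" for \<sigma>
    using that by (simp add: pm)
  let ?i = "\<lambda>\<sigma>. indicator {a..b} \<sigma> :: real"
  have ii: "integrable lborel ?i" "(\<integral>\<sigma>. ?i \<sigma> \<partial>lborel) = b - a" using ab by simp_all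
  have "multiplier (\<integral>\<sigma>. ?i \<sigma> * (levy_mass s W * L) \<partial>lborel) (\<lambda>\<xi>. \<integral>\<sigma>. of_real (?i \<sigma>) * (\<integral>\<tau>. \<psi> \<sigma> \<tau> \<xi> \<partial>lborel) \<partial>lborel)"
  proof (rule multiplier_integral[OF lborel.sigma_finite_measure_axioms, where b="\<lambda>\<sigma>. ?i \<sigma> * (levy_mass s W * d)"])
    show "(\<lambda>(\<xi>, \<sigma>). complex_of_real (?i \<sigma>) * (\<integral>\<tau>. \<psi> \<sigma> \<tau> \<xi> \<partial>lborel)) \<in> borel_measurable (borel \<Otimes>\<^sub>M lborel)"
      unfolding \<psi>_def by measurable
    show "cmod (of_real (?i \<sigma>) * (\<integral>\<tau>. \<psi> \<sigma> \<tau> \<xi> \<partial>lborel)) \<le> ?i \<sigma> * (levy_mass s W * d)" for \<sigma> \<xi>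
    proof -
      have "cmod (\<integral>\<tau>. \<psi> \<sigma> \<tau> \<xi> \<partial>lborel) \<le> (\<integral>\<tau>. ?p \<tau> * d \<partial>lborel)"
        by (rule norm_integral_le) (use pi psi_le in auto)
      then show ?thesis by (simp add: norm_mult pm mult_left_mono)
    qed
    show "multiplier (?i \<sigma> * (levy_mass s W * L)) (\<lambda>\<xi>. of_real (?i \<sigma>) * (\<integral>\<tau>. \<psi> \<sigma> \<tau> \<xi> \<partial>lborel))" for \<sigma>
    proof (cases "\<sigma> \<in> {a..b}")
      case True
      then show ?thesis using inner[OF True] by simp
    next
      case False
      then show ?thesis using multiplier_const[of 0] by simp
    qed
  qed (use ii in auto)
  moreover have "(\<integral>\<sigma>. of_real (?i \<sigma>) * (\<integral>\<tau>. \<psi> \<sigma> \<tau> \<xi> \<partial>lborel) \<partial>lborel) = D \<xi> * of_real (mixture W a b \<xi>)" for \<xi>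
  proof -
    have "\<psi> \<sigma> \<tau> \<xi> = D \<xi> * of_real (indicator W \<tau> * (exp (- \<tau> * (q \<sigma> \<xi>)\<^sup>2) * \<tau> powr (- 1 - s)))" for \<sigma> \<tau>
      by (simp add: \<psi>_def)
    then have "(\<integral>\<tau>. \<psi> \<sigma> \<tau> \<xi> \<partial>lborel) = D \<xi> * of_real (LINT \<tau>:W|lborel. exp (- \<tau> * (q \<sigma> \<xi>)\<^sup>2) * \<tau> powr (- 1 - s))" for \<sigma>
      unfolding set_lebesgue_integral_def real_scaleR_def
      by (simp only: integral_mult_right_zero integral_complex_of_real)
    then have "of_real (?i \<sigma>) * (\<integral>\<tau>. \<psi> \<sigma> \<tau> \<xi> \<partial>lborel)
        = D \<xi> * of_real (?i \<sigma> * (LINT \<tau>:W|lborel. exp (- \<tau> * (q \<sigma> \<xi>)\<^sup>2) * \<tau> powr (- 1 - s)))" for \<sigma>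
      by (simp only: of_real_mult mult_ac)
    then show ?thesis
      unfolding mixture_def set_lebesgue_integral_def[of _ "{a..b}"] real_scaleR_def
      by (simp only: integral_mult_right_zero integral_complex_of_real)
  qed
  moreover have "(\<integral>\<sigma>. ?i \<sigma> * (levy_mass s W * L) \<partial>lborel) = L * ((b - a) * levy_mass s W)"
    using ii by simp
  ultimately show ?thesis by (simp only:)
qed

lemma level_mixture:
  assumes W [measurable]: "W \<in> sets borel" and W0: "W \<subseteq> {0<..}"
    and fin: "set_integrable lborel W (\<lambda>\<tau>. \<tau> powr (- 1 - s))" and ab: "a \<le> b"
  shows "level W a b \<xi> = (b - a) * levy_mass s W - mixture W a b \<xi>"
    and "0 \<le> mixture W a b \<xi>" "mixture W a b \<xi> \<le> (b - a) * levy_mass s W" "0 \<le> levy_mass s W"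
proof -
  let ?J = "\<lambda>\<sigma>. LINT \<tau>:W|lborel. exp (- \<tau> * (q \<sigma> \<xi>)\<^sup>2) * \<tau> powr (- 1 - s)"
  have J: "levy s W ((q \<sigma> \<xi>)\<^sup>2) = levy_mass s W - ?J \<sigma>" for \<sigma>
    by (rule levy_eq_mass(2)[OF s _ W W0 fin]) simp
  have cI: "set_integrable lborel {a..b} (\<lambda>\<sigma>. levy_mass s W)"
    unfolding set_integrable_def real_scaleR_def by (rule integrable_mult_left) (use ab in simp)
  have lI: "set_integrable lborel {a..b} (\<lambda>\<sigma>. levy s W ((q \<sigma> \<xi>)\<^sup>2))"
    by (rule integrable_level[OF W W0])
  have "mixture W a b \<xi> = (LINT \<sigma>:{a..b}|lborel. levy_mass s W - levy s W ((q \<sigma> \<xi>)\<^sup>2))"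
    unfolding mixture_def J by simp
  also have "\<dots> = (LINT \<sigma>:{a..b}|lborel. levy_mass s W) - level W a b \<xi>"
    unfolding level_def by (rule set_integral_diff(2)[OF cI lI])
  also have "(LINT \<sigma>:{a..b}|lborel. levy_mass s W) = (b - a) * levy_mass s W"
    using ab by (simp add: set_lebesgue_integral_def)
  finally show eq: "level W a b \<xi> = (b - a) * levy_mass s W - mixture W a b \<xi>" by simp
  show "mixture W a b \<xi> \<le> (b - a) * levy_mass s W"
    using eq level_nonneg[OF W W0, of a b \<xi>] by simp
  show "0 \<le> mixture W a b \<xi>"
    unfolding mixture_def set_lebesgue_integral_def by (intro integral_nonneg_AE AE_I2) simp
  show "0 \<le> levy_mass s W"
    unfolding levy_mass_def set_lebesgue_integral_def by (intro integral_nonneg_AE AE_I2) simp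
qed

lemma multiplier_mixture_normalized:
  assumes W: "W \<in> sets borel" "W \<subseteq> {0<..}" "set_integrable lborel W (\<lambda>\<tau>. \<tau> powr (- 1 - s))" and ab: "a \<le> b"
    and c: "c = (b - a) * levy_mass s W"
  shows "multiplier 1 (\<lambda>\<xi>. of_real (mixture W a b \<xi> / c))" "cmod (of_real (mixture W a b \<xi> / c)) \<le> 1"
proof -
  note m = level_mixture[OF W ab]
  have c0: "0 \<le> c" using ab m(4) by (simp add: c)
  have "\<bar>mixture W a b \<xi> / c\<bar> \<le> 1"
    using m(2,3)[of \<xi>] c0 by (cases "c = 0") (auto simp: c[symmetric] divide_le_eq_1)
  then show "cmod (of_real (mixture W a b \<xi> / c)) \<le> 1"
    by (simp only: norm_of_real)
  have "multiplier (1 * c) (\<lambda>\<xi>. 1 * of_real (mixture W a b \<xi>))"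
    unfolding c
  proof (rule multiplier_mixture[OF W ab, where d=1])
    fix \<sigma> \<tau> :: real assume "\<tau> \<in> W"
    then show "multiplier 1 (\<lambda>\<xi>. 1 * of_real (exp (- \<tau> * (q \<sigma> \<xi>)\<^sup>2)))"
      using multiplier_gauss_q(1)[of \<tau> \<sigma>] W(2) by auto
  qed auto
  then have "multiplier (cmod (of_real (1 / c)) * (1 * c)) (\<lambda>\<xi>. of_real (1 / c) * (1 * of_real (mixture W a b \<xi>)))"
    by (rule multiplier_cmult)
  then have "multiplier (cmod (of_real (1 / c)) * (1 * c)) (\<lambda>\<xi>. of_real (mixture W a b \<xi> / c))"
    by simp
  then show "multiplier 1 (\<lambda>\<xi>. of_real (mixture W a b \<xi> / c))"
    by (rule multiplier_mono) (use c0 in \<open>simp add: norm_divide\<close>)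
qed

text \<open>At finite rate the symbol is \<open>exp (- k c)\<close> times the exponential of
  \<open>k c\<close> times a normalized jump symbol; the factor \<open>exp (k c)\<close> from the
  series cancels.\<close>

lemma multiplier_level_finite:
  assumes W: "W \<in> sets borel" "W \<subseteq> {0<..}" "set_integrable lborel W (\<lambda>\<tau>. \<tau> powr (- 1 - s))"
    and ab: "a \<le> b" and k: "0 \<le> k"
  shows "multiplier 1 (\<lambda>\<xi>. of_real (exp (- k * level W a b \<xi>)))"
proof -
  define c where "c = (b - a) * levy_mass s W"
  define \<phi> where "\<phi> \<xi> = complex_of_real (mixture W a b \<xi> / c)" for \<xi>
  note m = level_mixture[OF W ab]
  have c0: "0 \<le> c" using ab m(4) by (simp add: c_def)
  have "multiplier (exp (k * c)) (\<lambda>\<xi>. exp (of_real (k * c) * \<phi> \<xi>))"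
    unfolding \<phi>_def by (intro multiplier_exp multiplier_mixture_normalized[OF W ab c_def] mult_nonneg_nonneg k c0)
  then have "multiplier (cmod (of_real (exp (- k * c))) * exp (k * c)) (\<lambda>\<xi>. of_real (exp (- k * c)) * exp (of_real (k * c) * \<phi> \<xi>))"
    by (rule multiplier_cmult)
  moreover have "cmod (of_real (exp (- k * c))) * exp (k * c) = 1"
    by (simp flip: exp_add)
  moreover have "of_real (exp (- k * c)) * exp (of_real (k * c) * \<phi> \<xi>) = of_real (exp (- k * level W a b \<xi>))" for \<xi>
  proof -
    \<comment> \<open>If \<open>c = 0\<close> the quotient is 0 by convention, but then
      \<open>mixture\<close> lies between 0 and \<open>c\<close> and vanishes too.\<close>
    have "c * (mixture W a b \<xi> / c) = mixture W a b \<xi>"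
      using m(2,3)[of \<xi>] by (cases "c = 0") (auto simp: c_def)
    then have "k * c * (mixture W a b \<xi> / c) = k * mixture W a b \<xi>"
      by (simp only: mult.assoc)
    then have "- k * c + k * c * (mixture W a b \<xi> / c) = - k * level W a b \<xi>"
      unfolding m(1) c_def[symmetric] by (simp only:) (simp add: algebra_simps)
    then have "exp (- k * c) * exp (k * c * (mixture W a b \<xi> / c)) = exp (- k * level W a b \<xi>)"
      by (simp only: exp_add[symmetric])
    then show ?thesis
      unfolding \<phi>_def by (simp only: of_real_mult[symmetric] exp_of_real)
  qed
  ultimately show ?thesis by (simp only:)
qed

text \<open>The normalization for which \<open>\<kappa> * levy s {0<..} (r^2)\<close> equals half of
  \<open>r powr (2 * s)\<close> for nonnegative \<open>r\<close>.\<close>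

definition \<kappa> :: real where "\<kappa> = 1 / (2 * levy s {0<..} 1)"

lemma \<kappa>_pos: "0 < \<kappa>" using levy_pos[OF s] by (simp add: \<kappa>_def)

lemma expo_eq: "expo a b \<xi> = \<kappa> * level {0<..} a b \<xi>"
  by (simp add: expo_level \<kappa>_def)

lemma multiplier_expo:
  assumes ab: "a \<le> b"
  shows "multiplier 1 (\<lambda>\<xi>. of_real (exp (- expo a b \<xi>)))"
proof (rule multiplier_lim[where b=1 and K="\<lambda>_. 1"])
  show "multiplier 1 (\<lambda>\<xi>. of_real (exp (- \<kappa> * level {1 / real (Suc n)..} a b \<xi>)))" for n
    by (rule multiplier_level_finite[OF _ atLeast_inverse_Suc_subset levy_mass_atLeast(1) ab])
       (use s \<kappa>_pos in auto)
  show "(\<lambda>n. complex_of_real (exp (- \<kappa> * level {1 / real (Suc n)..} a b \<xi>))) \<longlonglongrightarrow> of_real (exp (- expo a b \<xi>))" for \<xi>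
    unfolding expo_eq mult_minus_left[symmetric] by (intro tendsto_intros level_tendsto)
  show "cmod (of_real (exp (- \<kappa> * level {1 / real (Suc n)..} a b \<xi>))) \<le> 1" for n \<xi>
    using level_nonneg[OF _ atLeast_inverse_Suc_subset[of n], of a b \<xi>] \<kappa>_pos by simp
qed simp

text \<open>What remains when the jumps with \<tau> at least \<rho> are removed is again a symbol of
  norm 1. It can stand by as an inert factor while the removed jumps do the smoothing.\<close>

lemma multiplier_expo_below:
  assumes ab: "a \<le> b" and \<rho>: "0 < \<rho>"
  shows "multiplier 1 (\<lambda>\<xi>. of_real (exp (- (expo a b \<xi> - \<kappa> * level {\<rho>..} a b \<xi>))))"
proof (rule multiplier_lim[where b=1 and K="\<lambda>_. 1"])
  let ?W = "\<lambda>n. {1 / real (Suc n)..} - {\<rho>..}"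
  have W: "?W n \<in> sets borel" "?W n \<subseteq> {0<..}" for n
    using atLeast_inverse_Suc_subset[of n] by auto
  have fin: "set_integrable lborel (?W n) (\<lambda>\<tau>. \<tau> powr (- 1 - s))" for n
    by (rule set_integrable_subset[OF levy_mass_atLeast(1)[of s "1 / real (Suc n)"]]) (use s in auto)
  show "multiplier 1 (\<lambda>\<xi>. of_real (exp (- \<kappa> * level (?W n) a b \<xi>)))" for n
    by (rule multiplier_level_finite[OF W fin ab]) (use \<kappa>_pos in simp)
  show "(\<lambda>n. complex_of_real (exp (- \<kappa> * level (?W n) a b \<xi>))) \<longlonglongrightarrow> of_real (exp (- (expo a b \<xi> - \<kappa> * level {\<rho>..} a b \<xi>)))" for \<xi>
  proof -
    have "- (expo a b \<xi> - \<kappa> * level {\<rho>..} a b \<xi>) = - \<kappa> * (level {0<..} a b \<xi> - level {\<rho>..} a b \<xi>)"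
      by (simp add: expo_eq algebra_simps)
    then show ?thesis
      by (simp only:) (intro tendsto_intros level_tendsto_below \<rho>)
  qed
  show "cmod (of_real (exp (- \<kappa> * level (?W n) a b \<xi>))) \<le> 1" for n \<xi>
    using level_nonneg[OF W[of n], of a b \<xi>] \<kappa>_pos by simp
qed simp

end

section \<open>Inversion of multipliers into probability densities\<close>

text \<open>A multiplier of norm 1 with value 1 at the origin is a positive functional: a test function
  \<open>w\<close> with transform in \<open>[0, 1]\<close> is compared with a Gaussian whose transform also lies
  in \<open>[0, 1]\<close> and on which the functional is nearly 1.\<close>

lemma multiplier_positive:
  fixes \<phi> :: "'a::euclidean_space \<Rightarrow> complex"
  assumes m: "multiplier 1 \<phi>" and c: "isCont \<phi> 0" and one: "\<phi> 0 = 1"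
    and w: "integrable lborel w"
    and T: "\<And>x. (\<integral>\<xi>. w \<xi> * cis (\<xi> \<bullet> x) \<partial>lborel) = of_real (T x)" "\<And>x. 0 \<le> T x" "\<And>x. T x \<le> M"
  shows "0 \<le> Re (\<integral>\<xi>. \<phi> \<xi> * w \<xi> \<partial>lborel)"
proof -
  note [measurable] = multiplierD(2)[OF m]
  obtain b where b: "\<And>x. cmod (\<phi> x) \<le> b"
    using multiplierD(3)[OF m] by (auto simp: bounded_iff)
  \<comment> \<open>\<open>M\<close> may be 0, and the division needs a positive bound.\<close>
  define M' where "M' = M + 1"
  have M': "M' > 0" "\<And>x. T x \<le> M'" using order_trans[OF T(2)[of 0] T(3)[of 0]] T(3) by (auto simp: M'_def add_increasing2)
  define e where "e n = 1 / real (Suc n)" for n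
  have e: "e n > 0" "e \<longlonglongrightarrow> 0" for n
    unfolding e_def using LIMSEQ_Suc[OF lim_1_over_n] by simp_all
  let ?W = "\<lambda>n \<xi>. complex_of_real (gauss_kernel (e n) \<xi>)"
  let ?I = "\<integral>\<xi>. \<phi> \<xi> * w \<xi> \<partial>lborel"
  have Wi: "integrable lborel (?W n)" for n
    by (intro integrable_of_real integral_gauss_kernel(1) e(1))
  have main: "cmod ((\<integral>\<xi>. \<phi> \<xi> * ?W n \<xi> \<partial>lborel) - of_real (1 / M') * ?I) \<le> 1" for n
  proof -
    have "cmod (\<integral>\<xi>. \<phi> \<xi> * (?W n \<xi> - of_real (1 / M') * w \<xi>) \<partial>lborel) \<le> 1 * 1"
    proof (rule multiplierD(4)[OF m])
      show "integrable lborel (\<lambda>\<xi>. ?W n \<xi> - of_real (1 / M') * w \<xi>)"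
        by (intro Bochner_Integration.integrable_diff Wi integrable_mult_right w)
      fix x :: 'a
      have Wt: "(\<integral>\<xi>. ?W n \<xi> * cis (\<xi> \<bullet> x) \<partial>lborel) = of_real (gauss (e n) x)"
        using gauss_kernel_cis(2)[OF e(1), of n x] by (simp add: inner_commute)
      have "(\<integral>\<xi>. (?W n \<xi> - of_real (1 / M') * w \<xi>) * cis (\<xi> \<bullet> x) \<partial>lborel)
          = (\<integral>\<xi>. ?W n \<xi> * cis (\<xi> \<bullet> x) \<partial>lborel) - (\<integral>\<xi>. of_real (1 / M') * (w \<xi> * cis (\<xi> \<bullet> x)) \<partial>lborel)"
        unfolding left_diff_distrib mult.assoc
        by (intro Bochner_Integration.integral_diff integrable_mult_right integrable_mult_cis Wi w)
      also have "\<dots> = of_real (gauss (e n) x - 1 / M' * T x)"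
        by (simp add: Wt T(1))
      finally have "cmod (\<integral>\<xi>. (?W n \<xi> - of_real (1 / M') * w \<xi>) * cis (\<xi> \<bullet> x) \<partial>lborel)
          = \<bar>gauss (e n) x - 1 / M' * T x\<bar>" by (simp only: norm_of_real)
      moreover have "0 \<le> gauss (e n) x" "gauss (e n) x \<le> 1"
        using gauss_bounds[of "e n" x] e(1)[of n] by auto
      moreover have "0 \<le> 1 / M' * T x" "1 / M' * T x \<le> 1"
        using M' T(2) by (auto simp: divide_le_eq_1)
      ultimately show "cmod (\<integral>\<xi>. (?W n \<xi> - of_real (1 / M') * w \<xi>) * cis (\<xi> \<bullet> x) \<partial>lborel) \<le> 1"
        by linarith
    qed
    moreover have "(\<integral>\<xi>. \<phi> \<xi> * (?W n \<xi> - of_real (1 / M') * w \<xi>) \<partial>lborel)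
        = (\<integral>\<xi>. \<phi> \<xi> * ?W n \<xi> \<partial>lborel) - (\<integral>\<xi>. of_real (1 / M') * (\<phi> \<xi> * w \<xi>) \<partial>lborel)"
      unfolding right_diff_distrib mult.left_commute[of "\<phi> _"]
      by (intro Bochner_Integration.integral_diff integrable_mult_right integrable_multiplier[OF m] Wi w)
    ultimately show ?thesis by simp
  qed
  have "(\<lambda>n. \<integral>\<xi>. ?W n (\<xi> - 0) * \<phi> \<xi> \<partial>lborel) \<longlonglongrightarrow> \<phi> 0"
    by (rule gauss_kernel_approx[OF e _ b c]) measurable
  then have "(\<lambda>n. \<integral>\<xi>. \<phi> \<xi> * ?W n \<xi> \<partial>lborel) \<longlonglongrightarrow> 1"
    by (simp add: one mult.commute)
  then have "(\<lambda>n. cmod ((\<integral>\<xi>. \<phi> \<xi> * ?W n \<xi> \<partial>lborel) - of_real (1 / M') * ?I)) \<longlonglongrightarrow> cmod (1 - of_real (1 / M') * ?I)"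
    by (intro tendsto_intros)
  then have "cmod (1 - of_real (1 / M') * ?I) \<le> 1"
    by (rule LIMSEQ_le_const2) (use main in auto)
  then have "Re (1 - of_real (1 / M') * ?I) \<le> 1"
    using complex_Re_le_cmod order_trans by blast
  then show ?thesis using M'(1) by (simp add: zero_le_divide_iff)
qed

text \<open>Gaussian regularization on both sides. Multiplying \<open>\<phi>\<close> by a modulated
  Gaussian gives test functions with nonnegative transform, so the inverse transform is nonnegative
  in the limit. Multiplying \<open>g\<close> by a Gaussian makes Fubini available and turns the
  forward transform into a Gaussian average of \<open>\<phi>\<close> around \<open>\<eta>\<close>,
  which tends to \<open>\<phi> \<eta>\<close>.\<close>

theorem multiplier_density:
  fixes \<phi> :: "'a::euclidean_space \<Rightarrow> real"
  assumes m: "multiplier 1 (\<lambda>\<xi>. of_real (\<phi> \<xi>))" and i: "integrable lborel \<phi>"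
    and c: "\<And>\<xi>. isCont \<phi> \<xi>" and one: "\<phi> 0 = 1" and even: "\<And>\<xi>. \<phi> (- \<xi>) = \<phi> \<xi>"
  defines "g z \<equiv> Re (1 / (2 * of_real pi) ^ DIM('a) * (\<integral>\<xi>. of_real (\<phi> \<xi>) * cis (- (\<xi> \<bullet> z)) \<partial>lborel))"
  shows "0 \<le> g z" "integrable lborel g" "(\<integral>z. of_real (g z) * cis (\<eta> \<bullet> z) \<partial>lborel) = of_real (\<phi> \<eta>)"
proof -
  let ?\<phi> = "\<lambda>\<xi>. complex_of_real (\<phi> \<xi>)"
  let ?P = "(2 * pi) ^ DIM('a)"
  define G where "G z = (\<integral>\<xi>. ?\<phi> \<xi> * cis (- (\<xi> \<bullet> z)) \<partial>lborel)" for z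
  have P: "?P > 0" by simp
  have [measurable]: "\<phi> \<in> borel_measurable borel" using i by auto
  have ic: "integrable lborel ?\<phi>" using i by simp
  obtain b where b: "\<And>x. cmod (?\<phi> x) \<le> b"
    using multiplierD(3)[OF m] by (auto simp: bounded_iff)
  have cc: "isCont ?\<phi> \<xi>" for \<xi> using c by (intro isCont_of_real)
  have iz: "integrable lborel (\<lambda>\<xi>. ?\<phi> \<xi> * cis (- (\<xi> \<bullet> z)))" for z
    using integrable_mult_cis[OF ic, of "- z"] by simp
  \<comment> \<open>Evenness of \<open>\<phi>\<close> makes the inverse transform real, so taking
    \<open>Re\<close> in \<open>g\<close> discards nothing.\<close>
  have "cnj (G z) = G z" for z
  proof -
    have "cnj (G z) = (\<integral>\<xi>. cnj (?\<phi> \<xi> * cis (- (\<xi> \<bullet> z))) \<partial>lborel)"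
      unfolding G_def by (rule Bochner_Integration.integral_cnj[symmetric])
    also have "\<dots> = (\<integral>\<xi>. ?\<phi> \<xi> * cis (- (\<xi> \<bullet> (- z))) \<partial>lborel)" by (simp add: cis_cnj)
    also have "\<dots> = \<bar>- 1\<bar> ^ DIM('a) *\<^sub>R (\<integral>\<xi>. ?\<phi> (0 + (- 1) *\<^sub>R \<xi>) * cis (- ((0 + (- 1) *\<^sub>R \<xi>) \<bullet> (- z))) \<partial>lborel)"
      by (rule lborel_integral_affine(2)[OF _ iz]) simp
    also have "\<dots> = G z" by (simp add: G_def even)
    finally show ?thesis .
  qed
  then have Gr: "G z = of_real (Re (G z))" for z by (metis Reals_cnj_iff of_real_Re)
  have gG: "of_real (g z) = of_real (1 / ?P) * G z" for z
  proof -
    have "1 / (2 * of_real pi) ^ DIM('a) = complex_of_real (1 / ?P)" by simp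
    then have "g z = Re (of_real (1 / ?P) * G z)" unfolding g_def G_def by (simp only:)
    also have "\<dots> = 1 / ?P * Re (G z)" by (subst Gr) (simp only: of_real_mult[symmetric] Re_complex_of_real)
    finally show ?thesis by (subst Gr) (simp only: of_real_mult)
  qed
  have Gm [measurable]: "G \<in> borel_measurable borel"
    unfolding G_def[abs_def] by measurable
  have [measurable]: "g \<in> borel_measurable borel"
    unfolding g_def G_def[symmetric] by measurable
  define e where "e n = 1 / real (Suc n)" for n
  have e: "e n > 0" "e \<longlonglongrightarrow> 0" for n
    unfolding e_def using LIMSEQ_Suc[OF lim_1_over_n] by simp_all
  have gl: "(\<lambda>n. gauss (e n) z) \<longlonglongrightarrow> 1" for z :: 'a
  proof -
    have "(\<lambda>n. exp (- e n * (norm z)\<^sup>2 / 2)) \<longlonglongrightarrow> exp (- 0 * (norm z)\<^sup>2 / 2)"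
      by (intro tendsto_intros e(2)) simp
    then show ?thesis by (simp add: gauss_def)
  qed
  have gb: "0 \<le> gauss (e n) z" "gauss (e n) z \<le> 1" for n and z :: 'a
    using gauss_bounds[of "e n" z] e(1)[of n] by auto
  have pos: "0 \<le> Re (\<integral>\<xi>. ?\<phi> \<xi> * (of_real (gauss (e n) \<xi>) * cis (- (\<xi> \<bullet> z))) \<partial>lborel)" for n z
  proof (rule multiplier_positive[OF m])
    show "isCont ?\<phi> 0" by (rule cc)
    show "?\<phi> 0 = 1" by (simp add: one)
    have wi: "integrable lborel (\<lambda>\<xi>. complex_of_real (gauss (e n) \<xi>))"
      by (intro integrable_of_real integrable_gauss e(1))
    show "integrable lborel (\<lambda>\<xi>. of_real (gauss (e n) \<xi>) * cis (- (\<xi> \<bullet> z)))"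
      using integrable_mult_cis[OF wi, of "- z"] by simp
    show "(\<integral>\<xi>. of_real (gauss (e n) \<xi>) * cis (- (\<xi> \<bullet> z)) * cis (\<xi> \<bullet> x) \<partial>lborel) = of_real (?P * gauss_kernel (e n) (x - z))" for x
    proof -
      have "of_real (gauss (e n) \<xi>) * cis (- (\<xi> \<bullet> z)) * cis (\<xi> \<bullet> x) = of_real (gauss (e n) \<xi>) * cis ((x - z) \<bullet> \<xi>)" for \<xi>
        by (simp add: mult.assoc cis_mult inner_diff_left inner_diff_right inner_commute)
      then show ?thesis using gauss_kernel_cis(3)[OF e(1), of n "x - z"] by (simp only:)
    qed
    show "0 \<le> ?P * gauss_kernel (e n) (x - z)" for x
      using gauss_kernel_nonneg[OF e(1)] P by (intro mult_nonneg_nonneg) auto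
    have "gauss (1 / e n) (x - z) \<le> 1" for x
      using gauss_bounds(2)[of "1 / e n" "x - z"] e(1)[of n] by simp
    then show "?P * gauss_kernel (e n) (x - z) \<le> ?P * ((1 / sqrt (2 * pi * e n)) ^ DIM('a))" for x
      unfolding gauss_kernel_def using e(1)[of n] P by (intro mult_left_mono) (auto intro!: mult_left_le)
  qed
  have "(\<lambda>n. \<integral>\<xi>. ?\<phi> \<xi> * (of_real (gauss (e n) \<xi>) * cis (- (\<xi> \<bullet> z))) \<partial>lborel) \<longlonglongrightarrow> G z" for z
    unfolding G_def
  proof (rule integral_dominated_convergence[where w="\<lambda>\<xi>. \<bar>\<phi> \<xi>\<bar>"])
    show "AE \<xi> in lborel. (\<lambda>n. ?\<phi> \<xi> * (of_real (gauss (e n) \<xi>) * cis (- (\<xi> \<bullet> z)))) \<longlonglongrightarrow> ?\<phi> \<xi> * cis (- (\<xi> \<bullet> z))"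
    proof (rule AE_I2)
      fix \<xi>
      have "(\<lambda>n. ?\<phi> \<xi> * (of_real (gauss (e n) \<xi>) * cis (- (\<xi> \<bullet> z)))) \<longlonglongrightarrow> ?\<phi> \<xi> * (of_real 1 * cis (- (\<xi> \<bullet> z)))"
        by (intro tendsto_intros gl)
      then show "(\<lambda>n. ?\<phi> \<xi> * (of_real (gauss (e n) \<xi>) * cis (- (\<xi> \<bullet> z)))) \<longlonglongrightarrow> ?\<phi> \<xi> * cis (- (\<xi> \<bullet> z))" by simp
    qed
    show "AE \<xi> in lborel. norm (?\<phi> \<xi> * (of_real (gauss (e n) \<xi>) * cis (- (\<xi> \<bullet> z)))) \<le> \<bar>\<phi> \<xi>\<bar>" for n
      using gb by (intro AE_I2) (simp add: norm_mult mult_left_le)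
    show "integrable lborel (\<lambda>\<xi>. \<bar>\<phi> \<xi>\<bar>)" using i by simp
  qed measurable
  then have "0 \<le> Re (G z)" for z
    by (rule LIMSEQ_le_const[OF tendsto_Re]) (use pos in auto)
  moreover have "g z = 1 / ?P * Re (G z)" for z
    using gG[of z] by (subst (asm) Gr) (metis of_real_eq_iff of_real_mult)
  ultimately show g0: "0 \<le> g z" for z using P by simp
  have gle: "\<bar>g z\<bar> \<le> 1 / ?P * (\<integral>\<xi>. \<bar>\<phi> \<xi>\<bar> \<partial>lborel)" for z
  proof -
    have "cmod (G z) \<le> (\<integral>\<xi>. \<bar>\<phi> \<xi>\<bar> \<partial>lborel)"
      unfolding G_def by (rule norm_integral_le) (use i in \<open>auto simp: norm_mult\<close>)
    then have "1 / ?P * cmod (G z) \<le> 1 / ?P * (\<integral>\<xi>. \<bar>\<phi> \<xi>\<bar> \<partial>lborel)"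
      using P by (intro mult_left_mono) auto
    moreover have "\<bar>g z\<bar> = 1 / ?P * cmod (G z)"
      using arg_cong[OF gG[of z], of cmod] P by (simp add: norm_mult norm_divide norm_power)
    ultimately show ?thesis by simp
  qed
  have gi: "integrable lborel (\<lambda>z. of_real (g z) * (of_real (gauss (e n) z) * cis (\<eta> \<bullet> z)))" for n \<eta>
    by (rule integrable_bounded_mult[OF gauss_cis(1)[OF e(1)], where b="1 / ?P * (\<integral>\<xi>. \<bar>\<phi> \<xi>\<bar> \<partial>lborel)"])
       (use gle in auto)
  have J: "(\<lambda>n. \<integral>z. of_real (g z) * (of_real (gauss (e n) z) * cis (\<eta> \<bullet> z)) \<partial>lborel) \<longlonglongrightarrow> ?\<phi> \<eta>" for \<eta>
  proof -
    have eq: "(\<integral>z. of_real (g z) * (of_real (gauss (e n) z) * cis (\<eta> \<bullet> z)) \<partial>lborel)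
        = (\<integral>\<xi>. of_real (gauss_kernel (e n) (\<xi> - \<eta>)) * ?\<phi> \<xi> \<partial>lborel)" for n
    proof -
      let ?f = "\<lambda>\<xi> z. ?\<phi> \<xi> * (of_real (gauss (e n) z) * cis ((\<eta> - \<xi>) \<bullet> z))"
      have inner: "(\<integral>z. ?f \<xi> z \<partial>lborel) = of_real ?P * (of_real (gauss_kernel (e n) (\<xi> - \<eta>)) * ?\<phi> \<xi>)" for \<xi>
      proof -
        have "gauss_kernel (e n) (\<eta> - \<xi>) = gauss_kernel (e n) (\<xi> - \<eta>)"
          by (simp add: gauss_kernel_def gauss_def norm_minus_commute)
        then show ?thesis
          using gauss_kernel_cis(3)[OF e(1), of n "\<eta> - \<xi>"] by (simp add: mult_ac)
      qed
      have "of_real (g z) * (of_real (gauss (e n) z) * cis (\<eta> \<bullet> z)) = of_real (1 / ?P) * (\<integral>\<xi>. ?f \<xi> z \<partial>lborel)" for z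
      proof -
        have "cis ((\<eta> - \<xi>) \<bullet> z) = cis (\<eta> \<bullet> z) * cis (- (\<xi> \<bullet> z))" for \<xi>
          by (simp add: cis_mult inner_diff_left)
        then have "?f \<xi> z = (of_real (gauss (e n) z) * cis (\<eta> \<bullet> z)) * (?\<phi> \<xi> * cis (- (\<xi> \<bullet> z)))" for \<xi>
          by (simp only: mult_ac)
        then have "(\<integral>\<xi>. ?f \<xi> z \<partial>lborel) = (of_real (gauss (e n) z) * cis (\<eta> \<bullet> z)) * G z"
          unfolding G_def by (simp only: integral_mult_right_zero)
        then show ?thesis unfolding gG by (simp only: mult_ac)
      qed
      then have "(\<integral>z. of_real (g z) * (of_real (gauss (e n) z) * cis (\<eta> \<bullet> z)) \<partial>lborel)
          = of_real (1 / ?P) * (\<integral>z. (\<integral>\<xi>. ?f \<xi> z \<partial>lborel) \<partial>lborel)"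
        by (simp only: integral_mult_right_zero)
      also have "(\<integral>z. (\<integral>\<xi>. ?f \<xi> z \<partial>lborel) \<partial>lborel) = (\<integral>\<xi>. (\<integral>z. ?f \<xi> z \<partial>lborel) \<partial>lborel)"
      proof (rule fubini_product_bound(2)[where g="\<lambda>\<xi>. \<bar>\<phi> \<xi>\<bar>" and h="gauss (e n)"])
        show "(\<lambda>(\<xi>, z). ?f \<xi> z) \<in> borel_measurable (lborel \<Otimes>\<^sub>M lborel)" by measurable
        show "norm (?f \<xi> z) \<le> \<bar>\<phi> \<xi>\<bar> * gauss (e n) z" for \<xi> z using gb(1)[of n z] by (simp add: norm_mult)
      qed (use i integrable_gauss[OF e(1)] in \<open>auto intro: lborel.sigma_finite_measure_axioms\<close>)
      also have "\<dots> = of_real ?P * (\<integral>\<xi>. of_real (gauss_kernel (e n) (\<xi> - \<eta>)) * ?\<phi> \<xi> \<partial>lborel)"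
        unfolding inner by (rule integral_mult_right_zero)
      finally show ?thesis using P by (simp add: mult.assoc[symmetric])
    qed
    show ?thesis unfolding eq by (rule gauss_kernel_approx[OF e(1,2) _ b cc]) measurable
  qed
  \<comment> \<open>Since \<open>g\<close> is nonnegative, monotone convergence extracts its
    integrability from the regularized identity at \<open>\<eta> = 0\<close>, whose limit is
    \<open>\<phi> 0 = 1\<close>.\<close>
  show gint: "integrable lborel g"
  proof (rule integrable_monotone_convergence[where f="\<lambda>n z. g z * gauss (e n) z" and x=1])
    show "integrable lborel (\<lambda>z. g z * gauss (e n) z)" for n
      using integrable_Re[OF gi[of n 0]] by simp
    show "AE z in lborel. mono (\<lambda>n. g z * gauss (e n) z)"
    proof (intro AE_I2 monoI)
      fix z n k assume "n \<le> (k::nat)"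
      then have "e k \<le> e n" by (auto simp: e_def intro!: frac_le)
      then show "g z * gauss (e n) z \<le> g z * gauss (e k) z"
        using g0[of z] unfolding gauss_def
        by (intro mult_left_mono iffD2[OF exp_le_cancel_iff] divide_right_mono mult_right_mono) auto
    qed
    show "AE z in lborel. (\<lambda>n. g z * gauss (e n) z) \<longlonglongrightarrow> g z"
      using tendsto_mult[OF tendsto_const gl] by (intro AE_I2) simp
    have "(\<lambda>n. Re (\<integral>z. complex_of_real (g z * gauss (e n) z) \<partial>lborel)) \<longlonglongrightarrow> Re (?\<phi> 0)"
      using tendsto_Re[OF J[of 0]] by simp
    then show "(\<lambda>n. \<integral>z. g z * gauss (e n) z \<partial>lborel) \<longlonglongrightarrow> 1"
      by (simp add: one del: of_real_mult)
  qed measurable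
  have "(\<lambda>n. \<integral>z. of_real (g z) * (of_real (gauss (e n) z) * cis (\<eta> \<bullet> z)) \<partial>lborel) \<longlonglongrightarrow> (\<integral>z. of_real (g z) * cis (\<eta> \<bullet> z) \<partial>lborel)"
  proof (rule integral_dominated_convergence[where w=g])
    show "AE z in lborel. (\<lambda>n. complex_of_real (g z) * (of_real (gauss (e n) z) * cis (\<eta> \<bullet> z))) \<longlonglongrightarrow> of_real (g z) * cis (\<eta> \<bullet> z)"
    proof (rule AE_I2)
      fix z
      have "(\<lambda>n. complex_of_real (g z) * (of_real (gauss (e n) z) * cis (\<eta> \<bullet> z))) \<longlonglongrightarrow> of_real (g z) * (of_real 1 * cis (\<eta> \<bullet> z))"
        by (intro tendsto_intros gl)
      then show "(\<lambda>n. complex_of_real (g z) * (of_real (gauss (e n) z) * cis (\<eta> \<bullet> z))) \<longlonglongrightarrow> of_real (g z) * cis (\<eta> \<bullet> z)" by simp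
    qed
    show "AE z in lborel. norm (complex_of_real (g z) * (of_real (gauss (e n) z) * cis (\<eta> \<bullet> z))) \<le> g z" for n
      using gb g0 by (intro AE_I2) (simp add: norm_mult mult_left_le)
  qed (use gint in auto)
  from LIMSEQ_unique[OF this J]
  show "(\<integral>z. of_real (g z) * cis (\<eta> \<bullet> z) \<partial>lborel) = of_real (\<phi> \<eta>)" .
qed

section \<open>Approximation by Fourier transforms\<close>

text \<open>Multiplier bounds concern transforms of integrable functions only. The data are cut off
  by a Gaussian and averaged against a Gaussian kernel: the average is the transform of an
  integrable \<open>w n\<close>, and neither operation increases the bound \<open>S\<close>.\<close>

lemma approx_by_transforms:
  fixes f :: "'a::euclidean_space \<Rightarrow> real"
  assumes f: "continuous_on UNIV f" "\<And>x. \<bar>f x\<bar> \<le> S"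
  obtains w :: "nat \<Rightarrow> 'a \<Rightarrow> complex" where "\<And>n. integrable lborel (w n)"
    "\<And>n x. cmod (\<integral>\<xi>. w n \<xi> * cis (\<xi> \<bullet> x) \<partial>lborel) \<le> S"
    "\<And>x. (\<lambda>n. \<integral>\<xi>. w n \<xi> * cis (\<xi> \<bullet> x) \<partial>lborel) \<longlonglongrightarrow> of_real (f x)"
proof -
  let ?P = "(2 * pi) ^ DIM('a)"
  have P: "?P > 0" by simp
  have [measurable]: "f \<in> borel_measurable borel" by (rule borel_measurable_continuous_onI[OF f(1)])
  have S0: "0 \<le> S" using f(2)[of 0] by simp
  define e where "e n = 1 / real (Suc n)" for n
  have e: "e n > 0" "e \<longlonglongrightarrow> 0" for n
    unfolding e_def using LIMSEQ_Suc[OF lim_1_over_n] by simp_all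
  have gb: "0 \<le> gauss (e n) z" "gauss (e n) z \<le> 1" for n and z :: 'a
    using gauss_bounds[of "e n" z] e(1)[of n] by auto
  define F where "F n y = complex_of_real (f y * gauss (e n) y)" for n y
  have Fm [measurable]: "F n \<in> borel_measurable borel" for n unfolding F_def by measurable
  have Fle: "cmod (F n y) \<le> S * gauss (e n) y" for n y
    using f(2)[of y] gb(1)[of n y] by (simp add: F_def abs_mult mult_right_mono del: of_real_mult)
  have FS: "cmod (F n y) \<le> S" for n y
    by (rule order_trans[OF Fle]) (simp add: mult_left_le gb S0)
  define H where "H n \<xi> = (\<integral>y. F n y * cis (- (\<xi> \<bullet> y)) \<partial>lborel)" for n \<xi>
  have Hm [measurable]: "H n \<in> borel_measurable borel" for n
    unfolding H_def[abs_def] by measurable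
  define w where "w n \<xi> = of_real (1 / ?P) * (H n \<xi> * of_real (gauss (e n) \<xi>))" for n \<xi>
  have Hle: "cmod (H n \<xi>) \<le> (\<integral>(y::'a). S * gauss (e n) y \<partial>lborel)" for n \<xi>
    unfolding H_def
    by (rule norm_integral_le) (use Fle integrable_gauss[OF e(1)] in \<open>auto simp: norm_mult\<close>)
  have wi: "integrable lborel (w n)" for n
    unfolding w_def
    by (intro integrable_mult_right integrable_bounded_mult[OF _ Hm Hle] integrable_of_real integrable_gauss e(1))
  have wt: "(\<integral>\<xi>. w n \<xi> * cis (\<xi> \<bullet> x) \<partial>lborel) = (\<integral>y. of_real (gauss_kernel 1 y) * F n (x + sqrt (e n) *\<^sub>R y) \<partial>lborel)" for n x
  proof -
    let ?f = "\<lambda>\<xi> y. F n y * (of_real (gauss (e n) \<xi>) * cis ((x - y) \<bullet> \<xi>))"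
    have "w n \<xi> * cis (\<xi> \<bullet> x) = of_real (1 / ?P) * (\<integral>y. ?f \<xi> y \<partial>lborel)" for \<xi>
    proof -
      have "cis ((x - y) \<bullet> \<xi>) = cis (- (\<xi> \<bullet> y)) * cis (\<xi> \<bullet> x)" for y
        by (simp add: cis_mult inner_diff_left inner_diff_right inner_commute)
      then have "?f \<xi> y = (of_real (gauss (e n) \<xi>) * cis (\<xi> \<bullet> x)) * (F n y * cis (- (\<xi> \<bullet> y)))" for y
        by (simp only: mult_ac)
      then have "(\<integral>y. ?f \<xi> y \<partial>lborel) = (of_real (gauss (e n) \<xi>) * cis (\<xi> \<bullet> x)) * H n \<xi>"
        unfolding H_def by (simp only: integral_mult_right_zero)
      then show ?thesis unfolding w_def by (simp only: mult_ac)
    qed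
    then have "(\<integral>\<xi>. w n \<xi> * cis (\<xi> \<bullet> x) \<partial>lborel) = of_real (1 / ?P) * (\<integral>\<xi>. (\<integral>y. ?f \<xi> y \<partial>lborel) \<partial>lborel)"
      by (simp only: integral_mult_right_zero)
    also have "(\<integral>\<xi>. (\<integral>y. ?f \<xi> y \<partial>lborel) \<partial>lborel) = (\<integral>y. (\<integral>\<xi>. ?f \<xi> y \<partial>lborel) \<partial>lborel)"
    proof (rule fubini_product_bound(2)[where h="gauss (e n)" and g="\<lambda>y. S * gauss (e n) y"])
      show "(\<lambda>(y, \<xi>). ?f \<xi> y) \<in> borel_measurable (lborel \<Otimes>\<^sub>M lborel)" by measurable
      show "norm (?f \<xi> y) \<le> S * gauss (e n) y * gauss (e n) \<xi>" for \<xi> y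
        using Fle[of n y] gb(1)[of n \<xi>] by (simp add: norm_mult mult_right_mono)
    qed (use integrable_gauss[OF e(1)] in \<open>auto intro: lborel.sigma_finite_measure_axioms\<close>)
    also have "\<dots> = (\<integral>y. of_real ?P * (of_real (gauss_kernel (e n) (y - x)) * F n y) \<partial>lborel)"
    proof (rule Bochner_Integration.integral_cong[OF refl])
      fix y
      have "gauss_kernel (e n) (x - y) = gauss_kernel (e n) (y - x)"
        by (simp add: gauss_kernel_def gauss_def norm_minus_commute)
      then show "(\<integral>\<xi>. ?f \<xi> y \<partial>lborel) = of_real ?P * (of_real (gauss_kernel (e n) (y - x)) * F n y)"
        using gauss_kernel_cis(3)[OF e(1), of n "x - y"] by (simp add: mult_ac)
    qed
    also have "\<dots> = of_real ?P * (\<integral>y. of_real (gauss_kernel (e n) (y - x)) * F n y \<partial>lborel)"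
      by (rule integral_mult_right_zero)
    also have "(\<integral>y. of_real (gauss_kernel (e n) (y - x)) * F n y \<partial>lborel)
        = (\<integral>y. of_real (gauss_kernel 1 y) * F n (x + sqrt (e n) *\<^sub>R y) \<partial>lborel)"
      by (rule gauss_kernel_scale(2)[OF e(1) Fm FS])
    finally show ?thesis using P by (simp add: mult.assoc[symmetric])
  qed
  have dom: "norm (complex_of_real (gauss_kernel 1 y) * F n (x + sqrt (e n) *\<^sub>R y)) \<le> S * gauss_kernel 1 y" for n x y
    using mult_right_mono[OF FS[of n "x + sqrt (e n) *\<^sub>R y"] gauss_kernel_nonneg[of 1 y]] gauss_kernel_nonneg[of 1 y]
    by (simp add: norm_mult mult.commute)
  have Si: "integrable lborel (\<lambda>y::'a. S * gauss_kernel 1 y)"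
    by (intro integrable_mult_right integral_gauss_kernel(1)) simp
  have wS: "cmod (\<integral>\<xi>. w n \<xi> * cis (\<xi> \<bullet> x) \<partial>lborel) \<le> S" for n x
  proof -
    have "cmod (\<integral>\<xi>. w n \<xi> * cis (\<xi> \<bullet> x) \<partial>lborel) \<le> (\<integral>(y::'a). S * gauss_kernel 1 y \<partial>lborel)"
      unfolding wt by (rule norm_integral_le[OF Si dom])
    also have "\<dots> = S" using integral_gauss_kernel(2)[of 1, where 'a='a] by simp
    finally show ?thesis .
  qed
  have wl: "(\<lambda>n. \<integral>\<xi>. w n \<xi> * cis (\<xi> \<bullet> x) \<partial>lborel) \<longlonglongrightarrow> of_real (f x)" for x
  proof -
    have "(\<lambda>n. \<integral>y. of_real (gauss_kernel 1 y) * F n (x + sqrt (e n) *\<^sub>R y) \<partial>lborel)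
        \<longlonglongrightarrow> (\<integral>(y::'a). of_real (gauss_kernel 1 y) * of_real (f x) \<partial>lborel)"
    proof (rule integral_dominated_convergence[OF _ _ Si])
      show "AE y in lborel. (\<lambda>n. complex_of_real (gauss_kernel 1 y) * F n (x + sqrt (e n) *\<^sub>R y)) \<longlonglongrightarrow> of_real (gauss_kernel 1 y) * of_real (f x)"
      proof (rule AE_I2)
        fix y :: 'a
        have l: "(\<lambda>n. x + sqrt (e n) *\<^sub>R y) \<longlonglongrightarrow> x + sqrt 0 *\<^sub>R y" by (intro tendsto_intros e(2))
        then have l: "(\<lambda>n. x + sqrt (e n) *\<^sub>R y) \<longlonglongrightarrow> x" by simp
        have "isCont f x" using f(1) by (simp add: continuous_on_eq_continuous_at)
        then have "(\<lambda>n. f (x + sqrt (e n) *\<^sub>R y)) \<longlonglongrightarrow> f x"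
          by (rule isCont_tendsto_compose[OF _ l])
        moreover have "(\<lambda>n. gauss (e n) (x + sqrt (e n) *\<^sub>R y)) \<longlonglongrightarrow> exp (- 0 * (norm x)\<^sup>2 / 2)"
          unfolding gauss_def by (intro tendsto_intros e(2) l) simp
        ultimately have "(\<lambda>n. F n (x + sqrt (e n) *\<^sub>R y)) \<longlonglongrightarrow> of_real (f x * exp (- 0 * (norm x)\<^sup>2 / 2))"
          unfolding F_def by (intro tendsto_of_real tendsto_mult)
        then show "(\<lambda>n. complex_of_real (gauss_kernel 1 y) * F n (x + sqrt (e n) *\<^sub>R y)) \<longlonglongrightarrow> of_real (gauss_kernel 1 y) * of_real (f x)"
          by (intro tendsto_mult tendsto_const) simp
      qed
      show "AE y in lborel. norm (complex_of_real (gauss_kernel 1 y) * F n (x + sqrt (e n) *\<^sub>R y)) \<le> S * gauss_kernel 1 y" for n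
        by (intro AE_I2 dom)
    qed measurable
    moreover have "(\<integral>(y::'a). of_real (gauss_kernel 1 y) * of_real (f x) \<partial>lborel) = complex_of_real (f x)"
      using integral_gauss_kernel(2)[of 1, where 'a='a] by (simp only: integral_mult_left_zero integral_complex_of_real of_real_1 mult_1_left zero_less_one)
    ultimately show ?thesis by (simp only: wt)
  qed
  show thesis by (rule that[OF wi wS wl])
qed

section \<open>Smoothing of the symbol\<close>

context ou
begin

lemma multiplier_difference_cis: "multiplier 2 (\<lambda>\<xi>. cis (\<xi> \<bullet> h) - 1)"
  using multiplier_add[OF multiplier_cis multiplier_const[of "-1"], of h] by simp

lemma norm_cis_minus_one_le: "cmod (cis x - 1) \<le> 2"
  by (rule order_trans[OF norm_triangle_ineq4]) simp

text \<open>The first half of the time interval is used once: with probability \<open>1 - exp (- a)\<close> it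
  contributes a Gaussian of variance at least \<open>\<rho>\<close>, \<open>\<rho>\<close> being such that \<open>a\<close> does not
  depend on the length of the interval; otherwise only the second half is used, and the bound is
  iterated.\<close>

lemma multiplier_difference_step:
  assumes K: "0 < K" "\<And>\<sigma> \<tau> h. 0 \<le> \<sigma> \<Longrightarrow> \<sigma> \<le> 1 \<Longrightarrow> 0 < \<tau> \<Longrightarrow>
      multiplier (K * norm h / sqrt \<tau>) (\<lambda>\<xi>. (cis (\<xi> \<bullet> h) - 1) * of_real (exp (- \<tau> * (q \<sigma> \<xi>)\<^sup>2)))"
    and t: "0 \<le> a" "a < m" "m \<le> b" "b \<le> 1" and \<rho>: "0 < \<rho>"
    and c: "c = (m - a) * (\<rho> powr (- s) / s)"
    and X: "multiplier X (\<lambda>\<xi>. (cis (\<xi> \<bullet> h) - 1) * of_real (exp (- expo m b \<xi>)))"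
  shows "multiplier (K * norm h / sqrt \<rho> + exp (- (\<kappa> * c)) * X) (\<lambda>\<xi>. (cis (\<xi> \<bullet> h) - 1) * of_real (exp (- expo a b \<xi>)))"
proof -
  let ?D = "\<lambda>\<xi>. cis (\<xi> \<bullet> h) - 1"
  let ?E = "\<lambda>\<xi>. complex_of_real (exp (- expo m b \<xi>))"
  let ?R = "\<lambda>\<xi>. complex_of_real (exp (- (expo a m \<xi> - \<kappa> * level {\<rho>..} a m \<xi>)))"
  let ?L = "K * norm h / sqrt \<rho>"
  have W: "{\<rho>..} \<in> sets borel" "{\<rho>..} \<subseteq> {0<..}" "set_integrable lborel {\<rho>..} (\<lambda>\<tau>. \<tau> powr (- 1 - s))"
    using \<rho> levy_mass_atLeast(1)[OF s(1) \<rho>] by auto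
  have am: "a \<le> m" using t by simp
  have cm: "c = (m - a) * levy_mass s {\<rho>..}"
    using levy_mass_atLeast(2)[OF s(1) \<rho>] c by simp
  have c0: "c > 0" using t \<rho> s by (simp add: c)
  define \<phi> where "\<phi> \<xi> = complex_of_real (mixture {\<rho>..} a m \<xi> / c)" for \<xi>
  have L0: "0 \<le> ?L" using K \<rho> by simp
  have "multiplier (?L * ((m - a) * levy_mass s {\<rho>..})) (\<lambda>\<xi>. ?D \<xi> * of_real (mixture {\<rho>..} a m \<xi>))"
  proof (rule multiplier_mixture[OF W am _ norm_cis_minus_one_le L0])
    fix \<sigma> \<tau> assume \<sigma>: "\<sigma> \<in> {a..m}" and \<tau>: "\<tau> \<in> {\<rho>..}"
    have "multiplier (K * norm h / sqrt \<tau>) (\<lambda>\<xi>. ?D \<xi> * of_real (exp (- \<tau> * (q \<sigma> \<xi>)\<^sup>2)))"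
      by (rule K(2)) (use \<sigma> \<tau> t \<rho> in auto)
    then show "multiplier ?L (\<lambda>\<xi>. ?D \<xi> * of_real (exp (- \<tau> * (q \<sigma> \<xi>)\<^sup>2)))"
      by (rule multiplier_mono) (use \<tau> \<rho> K in \<open>auto intro!: divide_left_mono\<close>)
  qed measurable
  then have "multiplier (cmod (of_real (1 / c)) * (?L * c)) (\<lambda>\<xi>. of_real (1 / c) * (?D \<xi> * of_real (mixture {\<rho>..} a m \<xi>)))"
    unfolding cm[symmetric] by (rule multiplier_cmult)
  moreover have "cmod (of_real (1 / c)) * (?L * c) = ?L"
    using c0 by (simp add: norm_divide)
  moreover have "of_real (1 / c) * (?D \<xi> * of_real (mixture {\<rho>..} a m \<xi>)) = ?D \<xi> * \<phi> \<xi>" for \<xi>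
    by (simp add: \<phi>_def)
  ultimately have D\<phi>: "multiplier ?L (\<lambda>\<xi>. ?D \<xi> * \<phi> \<xi>)" by (simp only:)
  have M1: "multiplier (?L * exp (\<kappa> * c)) (\<lambda>\<xi>. ?D \<xi> * (exp (of_real (\<kappa> * c) * \<phi> \<xi>) - 1))"
  proof (rule multiplier_exp_minus_one[OF _ _ _ D\<phi> norm_cis_minus_one_le])
    show "multiplier 1 \<phi>" "cmod (\<phi> \<xi>) \<le> 1" for \<xi>
      unfolding \<phi>_def[abs_def] by (rule multiplier_mixture_normalized[OF W am cm])+
    show "0 \<le> \<kappa> * c" using \<kappa>_pos c0 by simp
  qed
  have "multiplier (cmod (of_real (exp (- (\<kappa> * c)))) * (?L * exp (\<kappa> * c)) * 1)
      (\<lambda>\<xi>. of_real (exp (- (\<kappa> * c))) * (?D \<xi> * (exp (of_real (\<kappa> * c) * \<phi> \<xi>) - 1)) * ?E \<xi>)"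
    by (rule multiplier_mult[OF multiplier_cmult[OF M1] multiplier_expo[OF t(3)]])
  moreover have "cmod (of_real (exp (- (\<kappa> * c)))) * (?L * exp (\<kappa> * c)) * 1 = ?L"
    by (simp only: norm_of_real abs_exp_cancel) (simp add: exp_minus)
  ultimately have 1: "multiplier ?L (\<lambda>\<xi>. of_real (exp (- (\<kappa> * c))) * (?D \<xi> * (exp (of_real (\<kappa> * c) * \<phi> \<xi>) - 1)) * ?E \<xi>)"
    by (simp only:)
  have 2: "multiplier (exp (- (\<kappa> * c)) * X) (\<lambda>\<xi>. of_real (exp (- (\<kappa> * c))) * (?D \<xi> * ?E \<xi>))"
    using multiplier_cmult[OF X, of "of_real (exp (- (\<kappa> * c)))"] by simp
  \<comment> \<open>The two summands correspond to at least one and to no jump with \<tau> at least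
    \<rho> before time \<open>m\<close>; the smaller jumps before \<open>m\<close> act as the common
    factor \<open>?R\<close> of norm 1.\<close>
  have "multiplier (1 * (?L + exp (- (\<kappa> * c)) * X)) (\<lambda>\<xi>. ?R \<xi> *
      (of_real (exp (- (\<kappa> * c))) * (?D \<xi> * (exp (of_real (\<kappa> * c) * \<phi> \<xi>) - 1)) * ?E \<xi> + of_real (exp (- (\<kappa> * c))) * (?D \<xi> * ?E \<xi>)))"
    by (rule multiplier_mult[OF multiplier_expo_below[OF am \<rho>] multiplier_add[OF 1 2]])
  moreover have "?R \<xi> * (of_real (exp (- (\<kappa> * c))) * (?D \<xi> * (exp (of_real (\<kappa> * c) * \<phi> \<xi>) - 1)) * ?E \<xi>
      + of_real (exp (- (\<kappa> * c))) * (?D \<xi> * ?E \<xi>)) = ?D \<xi> * of_real (exp (- expo a b \<xi>))" for \<xi>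
  proof -
    have "- expo a b \<xi> = - (expo a m \<xi> - \<kappa> * level {\<rho>..} a m \<xi>) + (- (\<kappa> * c) + \<kappa> * c * (mixture {\<rho>..} a m \<xi> / c)) + - expo m b \<xi>"
      using c0 level_mixture(1)[OF W am, of \<xi>] expo_join[of a m b \<xi>] t
      by (simp add: cm[symmetric]) (simp add: algebra_simps)
    then have "complex_of_real (exp (- expo a b \<xi>)) = ?R \<xi> * (of_real (exp (- (\<kappa> * c))) * exp (of_real (\<kappa> * c) * \<phi> \<xi>)) * ?E \<xi>"
      unfolding \<phi>_def by (simp only: exp_add of_real_mult[symmetric] exp_of_real)
    then show ?thesis by (simp add: algebra_simps)
  qed
  ultimately show ?thesis by (simp only: mult_1_left)
qed

lemma multiplier_difference:
  obtains K where "K > 0" "\<And>t h. 0 < t \<Longrightarrow> t \<le> 1 \<Longrightarrow>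
    multiplier (K * norm h * t powr (- 1 / (2 * s))) (\<lambda>\<xi>. (cis (\<xi> \<bullet> h) - 1) * of_real (exp (- expo 0 t \<xi>)))"
proof -
  obtain K0 where K0: "K0 > 0" "\<And>\<sigma> \<tau> h. 0 \<le> \<sigma> \<Longrightarrow> \<sigma> \<le> 1 \<Longrightarrow> 0 < \<tau> \<Longrightarrow>
      multiplier (K0 * norm h / sqrt \<tau>) (\<lambda>\<xi>. (cis (\<xi> \<bullet> h) - 1) * of_real (exp (- \<tau> * (q \<sigma> \<xi>)\<^sup>2)))"
    using multiplier_gauss_difference by blast
  define p where "p = - 1 / (2 * s)"
  \<comment> \<open>Halving \<open>t\<close> multiplies \<open>t powr p\<close> by
    \<open>2 powr (- p)\<close>. This \<open>a0\<close> makes the probability factor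
    \<open>exp (- a0)\<close> outweigh it, leaving exactly \<open>1 / 2\<close>.\<close>
  define a0 where "a0 = ln 2 * (1 - p)"
  have p: "p < 0" using s by (simp add: p_def)
  have a0: "a0 > 0" using p by (simp add: a0_def)
  have ea: "exp (- a0) * 2 powr (- p) = 1 / 2"
    by (simp add: a0_def powr_def algebra_simps flip: exp_add) (simp add: exp_minus)
  \<comment> \<open>With \<open>\<rho> = (k t) powr (1 / s)\<close> over half of the interval, the
    product \<open>\<kappa> * c\<close> equals \<open>a0\<close> for every \<open>t\<close>.\<close>
  define k where "k = \<kappa> / (2 * s * a0)"
  have k: "k > 0" using \<kappa>_pos s a0 by (simp add: k_def)
  define K1 where "K1 = K0 * k powr p"
  have K1: "K1 > 0" using K0 k by (simp add: K1_def)
  \<comment> \<open>The start \<open>a\<close> is arbitrary because each step passes to the second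
    half of the interval. The iteration begins with the trivial constant 2; the coefficient
    \<open>2 * K1\<close> reproduces itself, being \<open>K1\<close> plus half of
    \<open>2 * K1\<close>, and only the remainder shrinks.\<close>
  have claim: "multiplier (2 * K1 * norm h * t powr p + 2 * exp (- a0) ^ n) (\<lambda>\<xi>. (cis (\<xi> \<bullet> h) - 1) * of_real (exp (- expo a (a + t) \<xi>)))"
    if "0 \<le> a" "0 < t" "a + t \<le> 1" for a t h n
    using that
  proof (induction n arbitrary: a t)
    case 0
    have "multiplier (2 * 1) (\<lambda>\<xi>. (cis (\<xi> \<bullet> h) - 1) * of_real (exp (- expo a (a + t) \<xi>)))"
      by (rule multiplier_mult[OF multiplier_difference_cis multiplier_expo]) (use 0 in simp)
    then show ?case by (rule multiplier_mono) (use K1 in simp)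
  next
    case (Suc n)
    define \<rho> where "\<rho> = (k * t) powr (1 / s)"
    have \<rho>: "\<rho> > 0" using k Suc by (simp add: \<rho>_def)
    define c where "c = (a + t / 2 - a) * (\<rho> powr (- s) / s)"
    have "\<rho> powr (- s) = 1 / (k * t)"
      using k Suc s by (simp add: \<rho>_def powr_powr powr_minus_divide)
    then have kc: "\<kappa> * c = a0"
      using \<kappa>_pos s a0 Suc by (simp add: c_def k_def)
    have "1 / sqrt \<rho> = (k * t) powr p"
      using k Suc s by (simp add: \<rho>_def p_def powr_half_sqrt[symmetric] powr_powr powr_minus_divide mult.commute[of s 2])
    moreover have "(k * t) powr p = k powr p * t powr p"
      using k Suc.prems by (simp add: powr_mult)
    moreover have "K0 * norm h / sqrt \<rho> = K0 * norm h * (1 / sqrt \<rho>)" by simp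
    ultimately have L: "K0 * norm h / sqrt \<rho> = K1 * norm h * t powr p"
      by (simp only: K1_def mult_ac)
    have "multiplier (K0 * norm h / sqrt \<rho> + exp (- (\<kappa> * c)) * (2 * K1 * norm h * (t / 2) powr p + 2 * exp (- a0) ^ n))
       (\<lambda>\<xi>. (cis (\<xi> \<bullet> h) - 1) * of_real (exp (- expo a (a + t) \<xi>)))"
    proof (rule multiplier_difference_step[OF K0, where m="a + t / 2"])
      have half: "a + t / 2 + t / 2 = a + t" by simp
      show "multiplier (2 * K1 * norm h * (t / 2) powr p + 2 * exp (- a0) ^ n)
         (\<lambda>\<xi>. (cis (\<xi> \<bullet> h) - 1) * of_real (exp (- expo (a + t / 2) (a + t) \<xi>)))"
        by (rule Suc.IH[of "a + t / 2" "t / 2", unfolded half]) (use Suc.prems in auto)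
    qed (use Suc.prems \<rho> c_def in auto)
    moreover have "K0 * norm h / sqrt \<rho> + exp (- (\<kappa> * c)) * (2 * K1 * norm h * (t / 2) powr p + 2 * exp (- a0) ^ n)
        = 2 * K1 * norm h * t powr p + 2 * exp (- a0) ^ Suc n"
    proof -
      have "(t / 2) powr p = t powr p * 2 powr (- p)"
        using Suc.prems by (simp add: powr_divide powr_minus_divide)
      then have "exp (- (\<kappa> * c)) * (2 * K1 * norm h * (t / 2) powr p) = 2 * K1 * norm h * t powr p * (exp (- a0) * 2 powr (- p))"
        by (simp add: kc)
      then show ?thesis unfolding L ea kc by (simp add: distrib_left)
    qed
    ultimately show ?case by (simp only:)
  qed
  have "multiplier (2 * K1 * norm h * t powr p) (\<lambda>\<xi>. (cis (\<xi> \<bullet> h) - 1) * of_real (exp (- expo 0 t \<xi>)))"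
    if "0 < t" "t \<le> 1" for t h
  proof (rule multiplier_lim[where K="\<lambda>n. 2 * K1 * norm h * t powr p + 2 * exp (- a0) ^ n"])
    show "multiplier (2 * K1 * norm h * t powr p + 2 * exp (- a0) ^ n) (\<lambda>\<xi>. (cis (\<xi> \<bullet> h) - 1) * of_real (exp (- expo 0 t \<xi>)))" for n
      using claim[of 0 t h n] that by simp
    have "(\<lambda>n. exp (- a0) ^ n) \<longlonglongrightarrow> 0" by (rule LIMSEQ_realpow_zero) (use a0 in auto)
    from tendsto_add[OF tendsto_const[of "2 * K1 * norm h * t powr p"] tendsto_mult[OF tendsto_const[of 2] this]]
    show "(\<lambda>n. 2 * K1 * norm h * t powr p + 2 * exp (- a0) ^ n) \<longlonglongrightarrow> 2 * K1 * norm h * t powr p" by simp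
    show "cmod ((cis (\<xi> \<bullet> h) - 1) * of_real (exp (- expo 0 t \<xi>))) \<le> 2 * 1" for \<xi>
      unfolding norm_mult using expo_nonneg[of 0 t \<xi>] by (intro mult_mono norm_cis_minus_one_le) auto
  qed simp
  with K1 show thesis using that[of "2 * K1"] unfolding p_def by simp
qed

end

section \<open>The density of the semigroup\<close>

lemma integrable_exp_powr_real:
  fixes c p :: real
  assumes c: "c > 0" and p: "p > 0"
  shows "integrable lborel (\<lambda>x. exp (- c * \<bar>x\<bar> powr p))"
proof -
  \<comment> \<open>Chosen so that \<open>(x powr p) ^ n\<close> dominates \<open>x powr 2\<close>
    for \<open>x >= 1\<close>. The constant \<open>M\<close> comes from raising
    \<open>u <= exp u\<close> with \<open>u = c y / n\<close> to the n-th power.\<close>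
  define n where "n = nat \<lceil>2 / p\<rceil>"
  have n: "2 / p \<le> real n" "n > 0"
    using p by (auto simp: n_def of_nat_ceiling)
  define M where "M = (real n / c) ^ n"
  have M: "M \<ge> 0" using c by (simp add: M_def)
  have le: "exp (- c * x powr p) \<le> M * x powr (- 1 - 1)" if "x \<ge> 1" for x :: real
  proof -
    define y where "y = x powr p"
    have y: "y \<ge> 1" using that p by (simp add: y_def ge_one_powr_ge_zero)
    have "c * y / real n \<le> exp (c * y / real n)"
      using exp_ge_add_one_self[of "c * y / real n"] by linarith
    then have "(c * y / real n) ^ n \<le> exp (c * y / real n) ^ n"
      using c y by (intro power_mono) auto
    also have "\<dots> = exp (c * y)"
      using n by (simp flip: exp_of_nat_mult)
    finally have "y ^ n \<le> M * exp (c * y)"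
      using c n by (simp add: M_def power_divide power_mult_distrib field_simps)
    moreover have "x powr 2 \<le> y ^ n"
    proof -
      have "x powr 2 = y powr (2 / p)" using p that by (simp add: y_def powr_powr)
      also have "\<dots> \<le> y powr (real n)" using y n by (intro powr_mono) auto
      finally show ?thesis using y by (simp add: powr_realpow)
    qed
    ultimately have "x powr 2 \<le> M * exp (c * y)" by linarith
    then have "exp (- c * y) \<le> M / x powr 2"
      using that by (simp add: exp_minus field_simps)
    then show ?thesis by (simp add: y_def powr_minus_divide)
  qed
  let ?h = "\<lambda>x. indicator {1..} x * x powr (- 1 - 1) :: real"
  have h: "integrable lborel ?h"
    using levy_mass_atLeast(1)[of 1 1] by (simp add: set_integrable_def)
  have h': "integrable lborel (\<lambda>x. ?h (0 + (- 1) * x))"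
    by (rule lborel_integrable_real_affine[OF h]) simp
  have g: "integrable lborel (\<lambda>x. indicator {-1..1} x + M * ?h x + M * ?h (0 + (- 1) * x))"
    by (intro Bochner_Integration.integrable_add integrable_mult_right h h') simp
  show ?thesis
  proof (rule Bochner_Integration.integrable_bound[OF g])
    show "AE x in lborel. norm (exp (- c * \<bar>x\<bar> powr p)) \<le> norm (indicator {-1..1} x + M * ?h x + M * ?h (0 + (- 1) * x))"
    proof (rule AE_I2)
      fix x :: real
      have nn: "0 \<le> M * ?h x" "0 \<le> M * ?h (0 + (- 1) * x)" using M by auto
      have "exp (- c * \<bar>x\<bar> powr p) \<le> indicator {-1..1} x + M * ?h x + M * ?h (0 + (- 1) * x)"
      proof (cases "x \<in> {-1..1}")
        case True
        have "exp (- c * \<bar>x\<bar> powr p) \<le> 1" using c by simp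
        moreover have "indicator {-1..1} x = (1::real)" using True by simp
        ultimately show ?thesis using nn by linarith
      next
        case False
        then consider "x > 1" | "x < -1" by fastforce
        then show ?thesis
        proof cases
          case 1
          then show ?thesis using le[of x] nn by simp
        next
          case 2
          then show ?thesis using le[of "- x"] nn by simp
        qed
      qed
      then show "norm (exp (- c * \<bar>x\<bar> powr p)) \<le> norm (indicator {-1..1} x + M * ?h x + M * ?h (0 + (- 1) * x))"
        by simp
    qed
  qed measurable
qed

lemma integrable_indicator_Icc: "integrable lborel (indicator {a..b::real} :: real \<Rightarrow> real)"
  by (rule integrable_real_indicator) (auto simp: emeasure_lborel_Icc_eq)

text \<open>Each coordinate is at most the norm, so an equal share \<open>c / DIM('a)\<close> of the
  exponent per coordinate yields a product of integrable one-dimensional functions as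
  majorant.\<close>

lemma integrable_exp_norm_powr:
  fixes c p :: real
  assumes c: "c > 0" and p: "p > 0"
  shows "integrable lborel (\<lambda>\<xi>::'a::euclidean_space. exp (- c * norm \<xi> powr p))"
proof -
  define d where "d = c / real DIM('a)"
  have d: "d > 0" using c by (simp add: d_def)
  let ?f = "\<lambda>\<xi>::'a. \<Prod>b\<in>Basis. complex_of_real (exp (- d * \<bar>\<xi> \<bullet> b\<bar> powr p))"
  have f: "integrable lborel ?f"
    by (rule lborel_integral_prod(1)) (intro integrable_of_real integrable_exp_powr_real d p)
  show ?thesis
  proof (rule Bochner_Integration.integrable_bound[OF f])
    show "AE \<xi>::'a in lborel. norm (exp (- c * norm \<xi> powr p)) \<le> norm (?f \<xi>)"
    proof (rule AE_I2)
      fix \<xi> :: 'a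
      have "(\<Sum>b\<in>Basis. \<bar>\<xi> \<bullet> b\<bar> powr p) \<le> (\<Sum>b\<in>(Basis::'a set). norm \<xi> powr p)"
        using p by (intro sum_mono powr_mono2) (auto simp: Basis_le_norm)
      then have "d * (\<Sum>b\<in>Basis. \<bar>\<xi> \<bullet> b\<bar> powr p) \<le> d * (real DIM('a) * norm \<xi> powr p)"
        using d by simp
      also have "\<dots> = c * norm \<xi> powr p" by (simp add: d_def)
      finally have "exp (- c * norm \<xi> powr p) \<le> exp (\<Sum>b\<in>Basis. - d * \<bar>\<xi> \<bullet> b\<bar> powr p)"
        by (simp add: sum_distrib_left sum_negf)
      also have "\<dots> = norm (?f \<xi>)"
        by (simp add: exp_sum prod_norm[symmetric] norm_of_real[of "exp _"] del: of_real_exp)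
      finally show "norm (exp (- c * norm \<xi> powr p)) \<le> norm (?f \<xi>)" by simp
    qed
  qed measurable
qed

context ou
begin

section \<open>Analytic properties of the symbol and of the density\<close>

definition symbol :: "real \<Rightarrow> real^'n \<Rightarrow> real" where
  "symbol t \<xi> = exp (- expo 0 t \<xi>)"

lemma symbol_bounds: "0 < symbol t \<xi>" "symbol t \<xi> \<le> 1"
  using expo_nonneg[of 0 t \<xi>] by (auto simp: symbol_def)

lemma symbol_0: "symbol t 0 = 1"
  using s by (simp add: symbol_def expo_def q_def coflow_def)

lemma symbol_minus: "symbol t (- \<xi>) = symbol t \<xi>"
proof -
  have "mat_sqrt Q *v (- y) = - (mat_sqrt Q *v y)" for y
    using matrix_vector_mult_scaleR[of "mat_sqrt Q" "-1" y] by simp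
  then have "q \<sigma> (- \<xi>) = q \<sigma> \<xi>" for \<sigma>
    using coflow_scaleR[of \<sigma> "-1" \<xi>] by (simp add: q_def)
  then show ?thesis by (simp add: symbol_def expo_def)
qed

lemma expo_mono: "0 \<le> u \<Longrightarrow> u \<le> t \<Longrightarrow> expo 0 u \<xi> \<le> expo 0 t \<xi>"
  using expo_join[of 0 u t \<xi>] expo_nonneg[of u t \<xi>] by simp

lemma expo_lower:
  assumes t: "0 < t"
  obtains c where "c > 0" "\<And>\<xi>. c * norm \<xi> powr (2 * s) \<le> expo 0 t \<xi>"
proof -
  obtain c where c: "c > 0" "\<And>\<sigma> \<xi>. 0 \<le> \<sigma> \<Longrightarrow> \<sigma> \<le> 1 \<Longrightarrow> c * norm \<xi> \<le> q \<sigma> \<xi>"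
    using q_lower by blast
  define u where "u = min t 1"
  have u: "0 < u" "u \<le> 1" "u \<le> t" using t by (auto simp: u_def)
  have "u / 2 * c powr (2 * s) * norm \<xi> powr (2 * s) \<le> expo 0 t \<xi>" for \<xi>
  proof -
    have "(LINT \<sigma>:{0..u}|lborel. (c * norm \<xi>) powr (2 * s)) \<le> (LINT \<sigma>:{0..u}|lborel. q \<sigma> \<xi> powr (2 * s))"
    proof (rule set_integral_mono)
      show "set_integrable lborel {0..u} (\<lambda>\<sigma>. (c * norm \<xi>) powr (2 * s))"
        unfolding set_integrable_def real_scaleR_def by (rule integrable_mult_left) (simp add: integrable_indicator_Icc)
      show "set_integrable lborel {0..u} (\<lambda>\<sigma>. q \<sigma> \<xi> powr (2 * s))" by (rule integrable_q_powr)
      show "(c * norm \<xi>) powr (2 * s) \<le> q \<sigma> \<xi> powr (2 * s)" if "\<sigma> \<in> {0..u}" for \<sigma>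
        using that c s u by (intro powr_mono2) auto
    qed
    moreover have "(LINT \<sigma>:{0..u}|lborel. (c * norm \<xi>) powr (2 * s)) = u * (c powr (2 * s) * norm \<xi> powr (2 * s))"
      using u c by (simp add: set_lebesgue_integral_def powr_mult)
    ultimately have "u / 2 * c powr (2 * s) * norm \<xi> powr (2 * s) \<le> expo 0 u \<xi>"
      by (simp add: expo_def)
    also have "\<dots> \<le> expo 0 t \<xi>" using u by (intro expo_mono) auto
    finally show ?thesis .
  qed
  with that[of "u / 2 * c powr (2 * s)"] show thesis using u c by simp
qed

lemma measurable_expo_pair [measurable (raw)]:
  assumes [measurable]: "f \<in> borel_measurable M" "g \<in> borel_measurable M"
  shows "(\<lambda>x. expo 0 (f x) (g x)) \<in> borel_measurable M"
proof -
  have eq: "expo 0 t \<xi> = (1/2) * (\<integral>\<sigma>. (if 0 \<le> \<sigma> \<and> \<sigma> \<le> t then 1 else 0) * q \<sigma> \<xi> powr (2 * s) \<partial>lborel)" for t \<xi>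
    unfolding expo_def set_lebesgue_integral_def by (simp add: indicator_def of_bool_def)
  show ?thesis unfolding eq by measurable
qed

lemma measurable_symbol [measurable (raw)]:
  assumes [measurable]: "f \<in> borel_measurable M" "g \<in> borel_measurable M"
  shows "(\<lambda>x. symbol (f x) (g x)) \<in> borel_measurable M"
  unfolding symbol_def by measurable

lemma integrable_symbol:
  assumes t: "0 < t"
  shows "integrable lborel (symbol t)"
proof -
  obtain c where c: "c > 0" "\<And>\<xi>. c * norm \<xi> powr (2 * s) \<le> expo 0 t \<xi>"
    using expo_lower[OF t] by blast
  show ?thesis
  proof (rule Bochner_Integration.integrable_bound[OF integrable_exp_norm_powr[OF c(1), of "2 * s"]])
    show "AE \<xi> in lborel. norm (symbol t \<xi>) \<le> norm (exp (- c * norm \<xi> powr (2 * s)))"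
      using c(2) by (intro AE_I2) (simp add: symbol_def)
  qed (use s in auto)
qed

lemma isCont_expo: "isCont (expo a b) \<xi>"
  unfolding continuous_at_sequentially o_def
proof (intro allI impI)
  fix X assume X: "X \<longlonglongrightarrow> \<xi>"
  define m where "m = norm (mat_endo (mat_sqrt Q))"
  obtain R where R: "\<And>n. norm (X n) \<le> R"
    using Bseq_def convergent_imp_Bseq[OF convergentI[OF X]] by blast
  have qle: "q \<sigma> (X n) \<le> m * (exp ((\<bar>a\<bar> + \<bar>b\<bar>) * \<beta>) * R)" if "\<sigma> \<in> {a..b}" for \<sigma> n
  proof -
    have "q \<sigma> (X n) \<le> m * norm (coflow \<sigma> (X n))"
      using norm_endo_apply[of "mat_endo (mat_sqrt Q)"] by (simp add: q_def m_def)
    also have "norm (coflow \<sigma> (X n)) \<le> exp (\<bar>\<sigma>\<bar> * \<beta>) * norm (X n)" by (rule norm_coflow)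
    also have "\<dots> \<le> exp ((\<bar>a\<bar> + \<bar>b\<bar>) * \<beta>) * R"
      using that \<beta>_nonneg R by (intro mult_mono iffD2[OF exp_le_cancel_iff] mult_right_mono) auto
    finally show ?thesis by (simp add: m_def mult_left_mono)
  qed
  show "(\<lambda>n. expo a b (X n)) \<longlonglongrightarrow> expo a b \<xi>"
    unfolding expo_def set_lebesgue_integral_def
  proof (intro tendsto_mult tendsto_const integral_dominated_convergence)
    let ?w = "\<lambda>\<sigma>. indicator {a..b} \<sigma> * ((m * (exp ((\<bar>a\<bar> + \<bar>b\<bar>) * \<beta>) * R)) powr (2 * s))"
    show "integrable lborel ?w" by (rule integrable_mult_left) (simp add: integrable_indicator_Icc)
    show "AE \<sigma> in lborel. (\<lambda>n. indicat_real {a..b} \<sigma> *\<^sub>R (q \<sigma> (X n) powr (2 * s))) \<longlonglongrightarrow> indicat_real {a..b} \<sigma> *\<^sub>R (q \<sigma> \<xi> powr (2 * s))"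
    proof (rule AE_I2)
      fix \<sigma>
      have "continuous_on UNIV (q \<sigma>)" by (intro continuous_intros)
      then have "(\<lambda>n. q \<sigma> (X n)) \<longlonglongrightarrow> q \<sigma> \<xi>"
        using X isCont_tendsto_compose[of \<xi> "q \<sigma>" X] by (simp add: continuous_on_eq_continuous_at)
      then have "(\<lambda>n. q \<sigma> (X n) powr (2 * s)) \<longlonglongrightarrow> q \<sigma> \<xi> powr (2 * s)"
        by (rule tendsto_powr') (use s q_nonneg in auto)
      then show "(\<lambda>n. indicat_real {a..b} \<sigma> *\<^sub>R (q \<sigma> (X n) powr (2 * s))) \<longlonglongrightarrow> indicat_real {a..b} \<sigma> *\<^sub>R (q \<sigma> \<xi> powr (2 * s))"
        by (rule tendsto_scaleR[OF tendsto_const])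
    qed
    show "AE \<sigma> in lborel. norm (indicat_real {a..b} \<sigma> *\<^sub>R (q \<sigma> (X n) powr (2 * s))) \<le> ?w \<sigma>" for n
    proof (rule AE_I2)
      fix \<sigma>
      show "norm (indicat_real {a..b} \<sigma> *\<^sub>R (q \<sigma> (X n) powr (2 * s))) \<le> ?w \<sigma>"
      proof (cases "\<sigma> \<in> {a..b}")
        case True
        then show ?thesis using qle[OF True, of n] s q_nonneg by (simp add: powr_mono2)
      qed simp
    qed
  qed measurable
qed

lemma isCont_symbol: "isCont (symbol t) \<xi>"
  unfolding symbol_def[abs_def] by (intro continuous_intros isCont_expo)

lemma multiplier_symbol: "0 \<le> t \<Longrightarrow> multiplier 1 (\<lambda>\<xi>. of_real (symbol t \<xi>))"
  using multiplier_expo[of 0 t] by (simp add: symbol_def)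

text \<open>The cocycle identity behind the semigroup law: a shift of the time variable moves
  \<open>coflow u\<close> from the frequency into the interval of integration.\<close>

lemma symbol_add:
  assumes "0 \<le> t" "0 \<le> u"
  shows "symbol (t + u) \<xi> = symbol u \<xi> * symbol t (coflow u \<xi>)"
proof -
  have "(LINT \<sigma>:{0..t}|lborel. q \<sigma> (coflow u \<xi>) powr (2 * s)) = (LINT \<sigma>:{u..u + t}|lborel. q \<sigma> \<xi> powr (2 * s))"
  proof -
    have "(LINT \<sigma>:{u..u + t}|lborel. q \<sigma> \<xi> powr (2 * s))
        = \<bar>1\<bar> *\<^sub>R (\<integral>\<sigma>. indicator {u..u + t} (u + 1 * \<sigma>) *\<^sub>R (q (u + 1 * \<sigma>) \<xi> powr (2 * s)) \<partial>lborel)"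
      unfolding set_lebesgue_integral_def by (rule lborel_integral_real_affine) simp
    also have "\<dots> = (\<integral>\<sigma>. indicator {0..t} \<sigma> *\<^sub>R (q \<sigma> (coflow u \<xi>) powr (2 * s)) \<partial>lborel)"
      by (simp add: q_add[symmetric] indicator_def add.commute)
    finally show ?thesis by (simp only: set_lebesgue_integral_def)
  qed
  then have "expo 0 t (coflow u \<xi>) = expo u (u + t) \<xi>" by (simp add: expo_def)
  then have "expo 0 (t + u) \<xi> = expo 0 u \<xi> + expo 0 t (coflow u \<xi>)"
    using expo_join[of 0 u "u + t" \<xi>] assms by (simp add: add.commute)
  then show ?thesis by (simp add: symbol_def exp_diff exp_minus exp_add divide_inverse)
qed

definition dens :: "real \<Rightarrow> real^'n \<Rightarrow> real" where
  "dens t z = ou_density Q B s t z"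

lemma dens_eq:
  "dens t z = Re (1 / (2 * of_real pi) ^ DIM(real^'n) * (\<integral>\<xi>. of_real (symbol t \<xi>) * cis (- (\<xi> \<bullet> z)) \<partial>lborel))"
proof -
  have "exp (- \<i> * complex_of_real (\<xi> \<bullet> z)) = cis (- (\<xi> \<bullet> z))" for \<xi>
    by (simp add: cis_conv_exp)
  then show ?thesis
    by (simp add: dens_def ou_density_def symbol_def expo_def q_def coflow_def)
qed

lemma dens_props:
  assumes t: "0 < t"
  shows "0 \<le> dens t z" "integrable lborel (dens t)"
    "(\<integral>z. of_real (dens t z) * cis (\<eta> \<bullet> z) \<partial>lborel) = of_real (symbol t \<eta>)"
    "(\<integral>z. dens t z \<partial>lborel) = 1"
proof -
  have t0: "0 \<le> t" using t by simp
  note m = multiplier_density[OF multiplier_symbol[OF t0] integrable_symbol[OF t] isCont_symbol symbol_0 symbol_minus,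
      folded dens_eq]
  show "0 \<le> dens t z" "integrable lborel (dens t)"
    "(\<integral>z. of_real (dens t z) * cis (\<eta> \<bullet> z) \<partial>lborel) = of_real (symbol t \<eta>)"
    using m(1,2) m(3)[of \<eta>] by simp_all
  show "(\<integral>z. dens t z \<partial>lborel) = 1"
    using m(3)[of 0] by (simp add: symbol_0)
qed

lemma measurable_dens [measurable (raw)]:
  assumes [measurable]: "f \<in> borel_measurable M" "g \<in> borel_measurable M"
  shows "(\<lambda>x. dens (f x) (g x)) \<in> borel_measurable M"
  unfolding dens_eq by measurable

end

section \<open>The semigroup\<close>

context ou
begin

definition P :: "real \<Rightarrow> (real^'n \<Rightarrow> real) \<Rightarrow> real^'n \<Rightarrow> real" where
  "P t f x = ou_semigroup Q B s t f x"

text \<open>The complex version acts on Fourier transforms; it carries no case distinction at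
  \<open>t = 0\<close> and is used for positive times.\<close>

definition PC :: "real \<Rightarrow> (real^'n \<Rightarrow> complex) \<Rightarrow> real^'n \<Rightarrow> complex" where
  "PC t F x = (\<integral>z. F (flow t x + z) * of_real (dens t z) \<partial>lborel)"

lemma P_0 [simp]: "P 0 f x = f x"
  by (simp add: P_def ou_semigroup_def)

lemma P_pos: "t \<noteq> 0 \<Longrightarrow> P t f x = (\<integral>z. f (flow t x + z) * dens t z \<partial>lborel)"
  by (simp add: P_def ou_semigroup_def flow_def dens_def)

lemma PC_of_real: "t \<noteq> 0 \<Longrightarrow> PC t (\<lambda>y. of_real (f y)) x = of_real (P t f x)"
  unfolding PC_def P_pos of_real_mult[symmetric] by (rule integral_complex_of_real)

lemma PC_integrable:
  assumes t: "0 < t" and [measurable]: "F \<in> borel_measurable borel" and S: "\<And>y. cmod (F y) \<le> S"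
  shows "integrable lborel (\<lambda>z. F (flow t x + z) * of_real (dens t z))"
  by (rule integrable_bounded_mult[where b=S]) (use S dens_props(2)[OF t] in auto)

lemma P_integrable:
  assumes t: "0 < t" and [measurable]: "f \<in> borel_measurable borel" and S: "\<And>y. \<bar>f y\<bar> \<le> S"
  shows "integrable lborel (\<lambda>z. f (flow t x + z) * dens t z)"
  using integrable_Re[OF PC_integrable[OF t, of "\<lambda>y. of_real (f y)" S x]] S by simp

lemma PC_bound:
  assumes t: "0 < t" and S: "\<And>y. cmod (F y) \<le> S"
  shows "cmod (PC t F x) \<le> S"
proof -
  have "cmod (PC t F x) \<le> (\<integral>z. S * dens t z \<partial>lborel)"
    unfolding PC_def
    by (rule norm_integral_le)
       (use S dens_props(1,2)[OF t] in \<open>auto simp: norm_mult abs_of_nonneg intro!: mult_right_mono\<close>)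
  then show ?thesis using dens_props(4)[OF t] by simp
qed

lemma P_bound:
  assumes t: "0 \<le> t" and S: "\<And>y. \<bar>f y\<bar> \<le> S"
  shows "\<bar>P t f x\<bar> \<le> S"
proof (cases "t = 0")
  case False
  then have "cmod (of_real (P t f x)) \<le> S"
    unfolding PC_of_real[OF False, symmetric] using t S by (intro PC_bound) auto
  then show ?thesis by simp
qed (use S in simp)

lemma P_diff:
  assumes t: "0 \<le> t" and f: "f \<in> borel_measurable borel" "\<And>y. \<bar>f y\<bar> \<le> S" and g: "g \<in> borel_measurable borel" "\<And>y. \<bar>g y\<bar> \<le> T"
  shows "P t (\<lambda>y. f y - g y) x = P t f x - P t g x"
proof (cases "t = 0")
  case False
  then have t: "0 < t" using t by simp
  show ?thesis
    unfolding P_pos[OF False] left_diff_distrib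
    by (rule Bochner_Integration.integral_diff[OF P_integrable[OF t f] P_integrable[OF t g]])
qed simp

lemma P_translate:
  assumes t: "0 \<le> t" and f [measurable]: "f \<in> borel_measurable borel" and S: "\<And>y. \<bar>f y\<bar> \<le> S"
  shows "P t f (x + h) - P t f x = P t (\<lambda>y. f (y + flow t h) - f y) x"
proof -
  have "P t (\<lambda>y. f (y + flow t h) - f y) x = P t (\<lambda>y. f (y + flow t h)) x - P t f x"
    by (rule P_diff[OF t _ _ f S]) (use S in auto)
  moreover have "P t (\<lambda>y. f (y + flow t h)) x = P t f (x + h)"
    by (cases "t = 0") (simp_all add: P_pos flow_lin add_ac)
  ultimately show ?thesis by simp
qed

text \<open>The frequency map \<open>L\<close> makes two steps composable: after time
  \<open>u\<close> the characters sit at \<open>coflow u \<xi>\<close> instead of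
  \<open>\<xi>\<close>.\<close>

lemma PC_transform:
  assumes t: "0 < t" and w: "integrable lborel w" and [measurable]: "L \<in> borel_measurable borel"
  shows "PC t (\<lambda>y. \<integral>\<xi>. w \<xi> * cis (L \<xi> \<bullet> y) \<partial>lborel) x
    = (\<integral>\<xi>. w \<xi> * of_real (symbol t (L \<xi>)) * cis (L \<xi> \<bullet> flow t x) \<partial>lborel)"
proof -
  have [measurable]: "w \<in> borel_measurable borel" using w by auto
  let ?f = "\<lambda>\<xi> z. w \<xi> * cis (L \<xi> \<bullet> (flow t x + z)) * of_real (dens t z)"
  have "PC t (\<lambda>y. \<integral>\<xi>. w \<xi> * cis (L \<xi> \<bullet> y) \<partial>lborel) x = (\<integral>z. (\<integral>\<xi>. ?f \<xi> z \<partial>lborel) \<partial>lborel)"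
    unfolding PC_def by simp
  also have "\<dots> = (\<integral>\<xi>. (\<integral>z. ?f \<xi> z \<partial>lborel) \<partial>lborel)"
  proof (rule fubini_product_bound(2)[where g="\<lambda>\<xi>. cmod (w \<xi>)" and h="dens t"])
    show "(\<lambda>(\<xi>, z). ?f \<xi> z) \<in> borel_measurable (lborel \<Otimes>\<^sub>M lborel)" by measurable
    show "norm (?f \<xi> z) \<le> cmod (w \<xi>) * dens t z" for \<xi> z
      using dens_props(1)[OF t] by (simp add: norm_mult)
  qed (use w dens_props(2)[OF t] in \<open>auto intro: lborel.sigma_finite_measure_axioms\<close>)
  also have "\<dots> = (\<integral>\<xi>. w \<xi> * of_real (symbol t (L \<xi>)) * cis (L \<xi> \<bullet> flow t x) \<partial>lborel)"
  proof (rule Bochner_Integration.integral_cong[OF refl])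
    fix \<xi>
    have "?f \<xi> z = w \<xi> * cis (L \<xi> \<bullet> flow t x) * (of_real (dens t z) * cis (L \<xi> \<bullet> z))" for z
      by (simp add: inner_add_right cis_mult[symmetric])
    then have "(\<integral>z. ?f \<xi> z \<partial>lborel) = w \<xi> * cis (L \<xi> \<bullet> flow t x) * of_real (symbol t (L \<xi>))"
      by (simp only: integral_mult_right_zero dens_props(3)[OF t])
    then show "(\<integral>z. ?f \<xi> z \<partial>lborel) = w \<xi> * of_real (symbol t (L \<xi>)) * cis (L \<xi> \<bullet> flow t x)"
      by (simp only: mult_ac)
  qed
  finally show ?thesis .
qed

lemma PC_tendsto:
  assumes t: "0 < t" and [measurable]: "\<And>n. F n \<in> borel_measurable borel" and S: "\<And>n y. cmod (F n y) \<le> S"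
    and lim: "\<And>y. (\<lambda>n. F n y) \<longlonglongrightarrow> G y"
  shows "(\<lambda>n. PC t (F n) x) \<longlonglongrightarrow> PC t G x"
  unfolding PC_def
proof (rule integral_dominated_convergence[where w="\<lambda>z. S * dens t z"])
  have [measurable]: "G \<in> borel_measurable borel"
    by (rule borel_measurable_LIMSEQ_metric[OF _ lim]) measurable
  show "(\<lambda>z. G (flow t x + z) * of_real (dens t z)) \<in> borel_measurable lborel" by measurable
  show "integrable lborel (\<lambda>z. S * dens t z)" using dens_props(2)[OF t] by simp
  show "AE z in lborel. (\<lambda>n. F n (flow t x + z) * of_real (dens t z)) \<longlonglongrightarrow> G (flow t x + z) * of_real (dens t z)"
    by (intro AE_I2 tendsto_mult tendsto_const lim)
  show "AE z in lborel. norm (F n (flow t x + z) * of_real (dens t z)) \<le> S * dens t z" for n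
    using S dens_props(1)[OF t] by (intro AE_I2) (simp add: norm_mult mult_right_mono)
qed measurable

lemma measurable_transform:
  assumes "integrable lborel w" and [measurable]: "L \<in> borel_measurable borel"
  shows "(\<lambda>y. \<integral>\<xi>. w \<xi> * cis (L \<xi> \<bullet> (y::real^'n)) \<partial>lborel) \<in> borel_measurable borel"
proof -
  have [measurable]: "w \<in> borel_measurable borel" using assms(1) by auto
  show ?thesis by measurable
qed

lemma measurable_PC:
  assumes [measurable]: "F \<in> borel_measurable borel"
  shows "PC t F \<in> borel_measurable borel"
  unfolding PC_def[abs_def] by measurable

lemma measurable_P [measurable (raw)]:
  assumes [measurable]: "f \<in> borel_measurable borel" "g \<in> borel_measurable M" "h \<in> borel_measurable M"
  shows "(\<lambda>x. P (g x) f (h x)) \<in> borel_measurable M"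
proof -
  have "P t f x = (if t = 0 then f x else (\<integral>z. f (flow t x + z) * dens t z \<partial>lborel))" for t x
    by (simp add: P_pos)
  then show ?thesis by simp
qed

text \<open>On Fourier transforms this is \<open>symbol_add\<close>; bounded pointwise convergence
  extends it to bounded continuous functions.\<close>

lemma semigroup:
  assumes t: "0 \<le> t" "0 \<le> u" and f: "continuous_on UNIV f" "\<And>x. \<bar>f x\<bar> \<le> S"
  shows "P t (P u f) x = P (t + u) f x"
proof (cases "t = 0 \<or> u = 0")
  case True
  have "P 0 f = f" by (rule ext) simp
  then show ?thesis using True by auto
next
  case False
  then have t: "0 < t" "0 < u" "t \<noteq> 0" "u \<noteq> 0" "t + u \<noteq> 0" "0 < t + u" using t by auto
  have [measurable]: "f \<in> borel_measurable borel" by (rule borel_measurable_continuous_onI[OF f(1)])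
  obtain w where w: "\<And>n. integrable lborel (w n)"
    "\<And>n x. cmod (\<integral>\<xi>. w n \<xi> * cis (\<xi> \<bullet> x) \<partial>lborel) \<le> S"
    "\<And>x. (\<lambda>n. \<integral>\<xi>. w n \<xi> * cis (\<xi> \<bullet> x) \<partial>lborel) \<longlonglongrightarrow> of_real (f x)"
    using approx_by_transforms[OF f] by blast
  define F where "F n x = (\<integral>\<xi>. w n \<xi> * cis (\<xi> \<bullet> x) \<partial>lborel)" for n x
  have Fm: "F n \<in> borel_measurable borel" for n
    unfolding F_def[abs_def] by (rule measurable_transform[OF w(1)]) measurable
  have Fb: "cmod (F n y) \<le> S" for n y unfolding F_def by (rule w(2))
  have Fl: "(\<lambda>n. F n y) \<longlonglongrightarrow> of_real (f y)" for y unfolding F_def by (rule w(3))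
  have wsym: "integrable lborel (\<lambda>\<xi>. w n \<xi> * of_real (symbol r \<xi>))" if "0 < r" for n r
    using integrable_multiplier[OF multiplier_symbol w(1), of r n] that by (simp add: mult.commute)
  have Pu: "PC u (F n) y = (\<integral>\<xi>. w n \<xi> * of_real (symbol u \<xi>) * cis (coflow u \<xi> \<bullet> y) \<partial>lborel)" for n y
    unfolding F_def using PC_transform[OF t(2) w(1), of "\<lambda>\<xi>. \<xi>" n y] by (simp add: inner_coflow)
  have "PC t (PC u (F n)) x = (\<integral>\<xi>. w n \<xi> * of_real (symbol u \<xi>) * of_real (symbol t (coflow u \<xi>)) * cis (coflow u \<xi> \<bullet> flow t x) \<partial>lborel)" for n
    unfolding Pu by (rule PC_transform[OF t(1) wsym[OF t(2)]]) measurable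
  also have "\<dots> n = (\<integral>\<xi>. w n \<xi> * of_real (symbol (t + u) \<xi>) * cis (\<xi> \<bullet> flow (t + u) x) \<partial>lborel)" for n
    using t by (simp add: symbol_add inner_coflow mult_ac flip: flow_add) (simp add: add.commute)
  also have "\<dots> n = PC (t + u) (F n) x" for n
    unfolding F_def by (rule PC_transform[OF t(6) w(1), symmetric]) measurable
  finally have eq: "PC t (PC u (F n)) x = PC (t + u) (F n) x" for n .
  have "(\<lambda>n. PC t (PC u (F n)) x) \<longlonglongrightarrow> PC t (PC u (\<lambda>y. of_real (f y))) x"
    by (intro PC_tendsto[OF t(1) _ PC_bound[OF t(2) Fb]] measurable_PC Fm PC_tendsto[OF t(2) _ Fb] Fl)
  moreover have "(\<lambda>n. PC t (PC u (F n)) x) \<longlonglongrightarrow> PC (t + u) (\<lambda>y. of_real (f y)) x"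
    unfolding eq by (intro PC_tendsto[OF t(6) _ Fb] Fm Fl)
  ultimately have "PC t (PC u (\<lambda>y. of_real (f y))) x = PC (t + u) (\<lambda>y. of_real (f y)) x"
    by (rule LIMSEQ_unique)
  moreover have "PC u (\<lambda>y. of_real (f y)) = (\<lambda>y. of_real (P u f y))"
    by (rule ext, rule PC_of_real[OF t(4)])
  ultimately have "complex_of_real (P t (P u f) x) = of_real (P (t + u) f x)"
    by (simp only: PC_of_real[OF t(3)] PC_of_real[OF t(5)])
  then show ?thesis by (simp only: of_real_eq_iff)
qed

text \<open>On transforms the difference between \<open>x + h\<close> and \<open>x\<close> is the
  multiplier \<open>cis (\<xi> \<bullet> flow t h) - 1\<close> times the symbol, so the symbol
  estimate applies with \<open>flow t h\<close> in place of \<open>h\<close>; for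
  \<open>t <= 1\<close> the flow costs the factor \<open>exp \<beta>\<close>.\<close>

lemma smoothing:
  obtains K where "K > 0" "\<And>t h f S x. 0 < t \<Longrightarrow> t \<le> 1 \<Longrightarrow> continuous_on UNIV f \<Longrightarrow> (\<And>y. \<bar>f y\<bar> \<le> S) \<Longrightarrow>
    \<bar>P t f (x + h) - P t f x\<bar> \<le> K * norm h * t powr (- 1 / (2 * s)) * S"
proof -
  obtain K where K: "K > 0" "\<And>t h. 0 < t \<Longrightarrow> t \<le> 1 \<Longrightarrow>
    multiplier (K * norm h * t powr (- 1 / (2 * s))) (\<lambda>\<xi>. (cis (\<xi> \<bullet> h) - 1) * of_real (exp (- expo 0 t \<xi>)))"
    using multiplier_difference by blast
  have "\<bar>P t f (x + h) - P t f x\<bar> \<le> K * exp \<beta> * norm h * t powr (- 1 / (2 * s)) * S"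
    if t: "0 < t" "t \<le> 1" and f: "continuous_on UNIV f" "\<And>y. \<bar>f y\<bar> \<le> S" for t h f S x
  proof -
    let ?k = "K * norm (flow t h) * t powr (- 1 / (2 * s))"
    let ?D = "\<lambda>\<xi>. (cis (\<xi> \<bullet> flow t h) - 1) * of_real (symbol t \<xi>)"
    have D: "multiplier ?k ?D" using K(2)[OF t] by (simp add: symbol_def)
    have S0: "0 \<le> S" using f(2)[of 0] by simp
    obtain w where w: "\<And>n. integrable lborel (w n)"
      "\<And>n x. cmod (\<integral>\<xi>. w n \<xi> * cis (\<xi> \<bullet> x) \<partial>lborel) \<le> S"
      "\<And>x. (\<lambda>n. \<integral>\<xi>. w n \<xi> * cis (\<xi> \<bullet> x) \<partial>lborel) \<longlonglongrightarrow> of_real (f x)"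
      using approx_by_transforms[OF f] by blast
    define F where "F n x = (\<integral>\<xi>. w n \<xi> * cis (\<xi> \<bullet> x) \<partial>lborel)" for n x
    have Fm: "F n \<in> borel_measurable borel" for n
      unfolding F_def[abs_def] by (rule measurable_transform[OF w(1)]) measurable
    have Fb: "cmod (F n y) \<le> S" for n y unfolding F_def by (rule w(2))
    have Fl: "(\<lambda>n. F n y) \<longlonglongrightarrow> of_real (f y)" for y unfolding F_def by (rule w(3))
    have PF: "PC t (F n) y = (\<integral>\<xi>. w n \<xi> * of_real (symbol t \<xi>) * cis (\<xi> \<bullet> flow t y) \<partial>lborel)" for n y
      unfolding F_def by (rule PC_transform[OF t(1) w(1)]) measurable
    have wi: "integrable lborel (\<lambda>\<xi>. w n \<xi> * of_real (symbol t \<xi>) * cis (\<xi> \<bullet> y))" for n y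
      using integrable_mult_cis[OF integrable_multiplier[OF multiplier_symbol w(1)], of t n y] t
      by (simp add: mult.commute mult.left_commute)
    have "PC t (F n) (x + h) - PC t (F n) x = (\<integral>\<xi>. ?D \<xi> * w n \<xi> * cis (\<xi> \<bullet> flow t x) \<partial>lborel)" for n
      unfolding PF Bochner_Integration.integral_diff[OF wi wi, symmetric]
      by (intro Bochner_Integration.integral_cong refl)
         (simp add: flow_lin inner_add_right cis_mult[symmetric] algebra_simps)
    then have le: "cmod (PC t (F n) (x + h) - PC t (F n) x) \<le> ?k * S" for n
      using multiplier_transform[OF D w(1) w(2), of n "flow t x"] by simp
    have "(\<lambda>n. cmod (PC t (F n) (x + h) - PC t (F n) x)) \<longlonglongrightarrow> cmod (PC t (\<lambda>y. of_real (f y)) (x + h) - PC t (\<lambda>y. of_real (f y)) x)"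
      by (intro tendsto_norm tendsto_diff PC_tendsto[OF t(1) _ Fb] Fm Fl)
    then have "cmod (PC t (\<lambda>y. of_real (f y)) (x + h) - PC t (\<lambda>y. of_real (f y)) x) \<le> ?k * S"
      by (rule LIMSEQ_le_const2) (use le in auto)
    then have "\<bar>P t f (x + h) - P t f x\<bar> \<le> ?k * S"
      using t(1) by (simp add: PC_of_real flip: of_real_diff)
    also have "\<dots> \<le> K * (exp \<beta> * norm h) * t powr (- 1 / (2 * s)) * S"
    proof -
      have "norm (flow t h) \<le> exp (\<bar>t\<bar> * \<beta>) * norm h" by (rule norm_flow)
      also have "\<dots> \<le> exp (1 * \<beta>) * norm h"
        using t \<beta>_nonneg by (intro mult_right_mono iffD2[OF exp_le_cancel_iff] mult_right_mono) auto
      finally show ?thesis using K(1) S0 by (intro mult_right_mono mult_left_mono) auto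
    qed
    finally show ?thesis by (simp add: mult.assoc)
  qed
  with that[of "K * exp \<beta>"] K(1) show thesis by simp
qed

lemma continuous_P:
  assumes t: "0 \<le> t" and f: "continuous_on UNIV f" "\<And>x. \<bar>f x\<bar> \<le> S"
  shows "continuous_on UNIV (P t f)"
proof (cases "t = 0")
  case True
  have "P 0 f = f" by (rule ext) simp
  then show ?thesis using True f by simp
next
  case False
  then have t: "0 < t" using t by simp
  have [measurable]: "f \<in> borel_measurable borel" by (rule borel_measurable_continuous_onI[OF f(1)])
  have fl: "continuous_on UNIV (flow t)" by (intro continuous_intros)
  have "isCont (P t f) x" for x
    unfolding continuous_at_sequentially o_def
  proof (intro allI impI)
    fix X assume X: "X \<longlonglongrightarrow> x"
    show "(\<lambda>n. P t f (X n)) \<longlonglongrightarrow> P t f x"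
      unfolding P_pos[OF False]
    proof (rule integral_dominated_convergence[where w="\<lambda>z. S * dens t z"])
      show "integrable lborel (\<lambda>z. S * dens t z)" using dens_props(2)[OF t] by simp
      show "AE z in lborel. (\<lambda>n. f (flow t (X n) + z) * dens t z) \<longlonglongrightarrow> f (flow t x + z) * dens t z"
      proof (rule AE_I2)
        fix z
        have "(\<lambda>n. flow t (X n)) \<longlonglongrightarrow> flow t x"
          using fl X isCont_tendsto_compose[of x "flow t" X] by (simp add: continuous_on_eq_continuous_at)
        then have "(\<lambda>n. flow t (X n) + z) \<longlonglongrightarrow> flow t x + z" by (intro tendsto_intros)
        then have "(\<lambda>n. f (flow t (X n) + z)) \<longlonglongrightarrow> f (flow t x + z)"
          using f(1) isCont_tendsto_compose[of "flow t x + z" f] by (simp add: continuous_on_eq_continuous_at)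
        then show "(\<lambda>n. f (flow t (X n) + z) * dens t z) \<longlonglongrightarrow> f (flow t x + z) * dens t z"
          by (intro tendsto_intros)
      qed
      show "AE z in lborel. norm (f (flow t (X n) + z) * dens t z) \<le> S * dens t z" for n
        using f(2) dens_props(1)[OF t] by (intro AE_I2) (simp add: abs_mult mult_right_mono)
    qed measurable
  qed
  then show ?thesis by (simp add: continuous_on_eq_continuous_at)
qed

end

section \<open>Laplace transforms\<close>

lemma exp_integral:
  fixes a :: real
  assumes "0 < a"
  shows "set_integrable lborel {0..} (\<lambda>t. exp (- a * t))" "(LINT t:{0..}|lborel. exp (- a * t)) = 1 / a"
  using nonneg_has_integral_lborel[OF _ _ _ has_integral_exp_minus_to_infinity[OF assms, of 0]] by simp_all

lemma laplace_integrable: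
  fixes a :: real
  assumes a: "0 < a" and [measurable]: "\<phi> \<in> borel_measurable borel" and S: "\<And>t. \<bar>\<phi> t\<bar> \<le> S"
  shows "set_integrable lborel {0..} (\<lambda>t. exp (- a * t) * \<phi> t)"
proof (rule set_integrable_bound)
  show "set_integrable lborel {0..} (\<lambda>t. S * exp (- a * t))"
    by (intro set_integrable_mult_right exp_integral a)
  show "set_borel_measurable lborel {0..} (\<lambda>t. exp (- a * t) * \<phi> t)"
    unfolding set_borel_measurable_def by measurable
  have "norm (exp (- a * t) * \<phi> t) \<le> norm (S * exp (- a * t))" for t
    using S[of t] by (simp add: abs_mult)
  then show "AE t in lborel. t \<in> {0..} \<longrightarrow> norm (exp (- a * t) * \<phi> t) \<le> norm (S * exp (- a * t))"
    by simp
qed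

lemma laplace_bound:
  fixes a :: real
  assumes a: "0 < a" and S: "\<And>t. 0 \<le> t \<Longrightarrow> \<bar>\<phi> t\<bar> \<le> S"
  shows "\<bar>LINT t:{0..}|lborel. exp (- a * t) * \<phi> t\<bar> \<le> S / a"
proof -
  have "norm (LINT t:{0..}|lborel. exp (- a * t) * \<phi> t) \<le> (\<integral>t. indicator {0..} t *\<^sub>R (S * exp (- a * t)) \<partial>lborel)"
    unfolding set_lebesgue_integral_def
  proof (rule norm_integral_le)
    show "integrable lborel (\<lambda>t. indicator {0..} t *\<^sub>R (S * exp (- a * t)))"
      using set_integrable_mult_right[of S lborel "{0..}" "\<lambda>t. exp (- a * t)"] exp_integral(1)[OF a]
      unfolding set_integrable_def by simp
    show "norm (indicator {0..} t *\<^sub>R (exp (- a * t) * \<phi> t)) \<le> indicator {0..} t *\<^sub>R (S * exp (- a * t))" for t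
      using S[of t] by (simp add: indicator_def abs_mult)
  qed
  also have "\<dots> = (LINT t:{0..}|lborel. S * exp (- a * t))"
    by (simp only: set_lebesgue_integral_def)
  also have "\<dots> = S / a" using exp_integral(2)[OF a] by simp
  finally show ?thesis by simp
qed

text \<open>With \<open>v = t + u\<close> the double integral runs over \<open>0 <= t <= v\<close>,
  and the inner integral of \<open>(m - l) exp ((m - l) t)\<close> is explicit. Keeping the factor
  \<open>m - l\<close> on the left covers \<open>m = l\<close> as well.\<close>

lemma laplace_convolution:
  fixes l m :: real
  assumes l: "0 < l" and m: "0 < m" and [measurable]: "\<phi> \<in> borel_measurable borel" and S: "\<And>t. \<bar>\<phi> t\<bar> \<le> S"
  shows "(m - l) * (LINT t:{0..}|lborel. exp (- l * t) * (LINT u:{0..}|lborel. exp (- m * u) * \<phi> (t + u)))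
    = (LINT t:{0..}|lborel. exp (- l * t) * \<phi> t) - (LINT t:{0..}|lborel. exp (- m * t) * \<phi> t)"
proof -
  have S0: "0 \<le> S" using S[of 0] by simp
  \<comment> \<open>The decay is shared out so that a product in \<open>t\<close> and
    \<open>v\<close> dominates the kernel: on \<open>0 <= t <= v\<close> the exponent
    \<open>l t + m (v - t)\<close> is at least \<open>2 c v\<close>, hence at least
    \<open>c v + c t\<close>.\<close>
  define c where "c = min l m / 2"
  have c: "c > 0" "2 * c \<le> l" "2 * c \<le> m" using l m by (auto simp: c_def)
  define K where "K t v = indicator {0..} t * exp (- l * t) * (indicator {0..} (v - t) * (exp (- m * (v - t)) * \<phi> v))" for t v :: real
  let ?e = "\<lambda>t::real. indicator {0..} t * exp (- c * t)"
  have ei: "integrable lborel ?e" using exp_integral(1)[OF c(1)] by (simp add: set_integrable_def)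
  have inner: "(LINT u:{0..}|lborel. exp (- m * u) * \<phi> (t + u))
      = (\<integral>v. indicator {0..} (v - t) * (exp (- m * (v - t)) * \<phi> v) \<partial>lborel)" for t
  proof -
    have "(LINT u:{0..}|lborel. exp (- m * u) * \<phi> (t + u)) = (\<integral>u. indicator {0..} u * (exp (- m * u) * \<phi> (t + u)) \<partial>lborel)"
      by (simp only: set_lebesgue_integral_def real_scaleR_def)
    also have "\<dots> = \<bar>1\<bar> *\<^sub>R (\<integral>v. indicator {0..} (- t + 1 * v) * (exp (- m * (- t + 1 * v)) * \<phi> (t + (- t + 1 * v))) \<partial>lborel)"
      by (rule lborel_integral_real_affine) simp
    finally show ?thesis by simp
  qed
  have "(LINT t:{0..}|lborel. exp (- l * t) * (LINT u:{0..}|lborel. exp (- m * u) * \<phi> (t + u)))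
      = (\<integral>t. (\<integral>v. K t v \<partial>lborel) \<partial>lborel)"
    unfolding inner unfolding set_lebesgue_integral_def K_def by (simp add: mult.assoc)
  also have "\<dots> = (\<integral>v. (\<integral>t. K t v \<partial>lborel) \<partial>lborel)"
  proof (rule fubini_product_bound(2)[where g="\<lambda>v. S * ?e v" and h="?e"])
    show "(\<lambda>(v, t). K t v) \<in> borel_measurable (lborel \<Otimes>\<^sub>M lborel)" unfolding K_def by measurable
    show "norm (K t v) \<le> S * ?e v * ?e t" for v t
    proof (cases "0 \<le> t \<and> t \<le> v")
      case True
      have "2 * c * t \<le> l * t" "2 * c * (v - t) \<le> m * (v - t)"
        using c True by (auto intro!: mult_right_mono)
      moreover have "0 \<le> c * (v - t)" using c True by simp
      ultimately have "- l * t + - m * (v - t) \<le> - c * v + - c * t" by (simp add: algebra_simps)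
      then have E: "exp (- l * t) * exp (- m * (v - t)) \<le> exp (- c * v) * exp (- c * t)"
        by (simp only: exp_add[symmetric] exp_le_cancel_iff)
      have "(exp (- l * t) * exp (- m * (v - t))) * \<bar>\<phi> v\<bar> \<le> (exp (- c * v) * exp (- c * t)) * S"
        by (rule mult_mono[OF E S[of v]]) simp_all
      then show ?thesis using True by (simp add: K_def abs_mult mult_ac)
    next
      case False
      then show ?thesis using S0 by (auto simp: K_def)
    qed
    show "integrable lborel (\<lambda>v. S * ?e v)" using ei by simp
  qed (use ei in \<open>auto intro: lborel.sigma_finite_measure_axioms\<close>)
  finally have "(m - l) * (LINT t:{0..}|lborel. exp (- l * t) * (LINT u:{0..}|lborel. exp (- m * u) * \<phi> (t + u)))
      = (\<integral>v. (m - l) * (\<integral>t. K t v \<partial>lborel) \<partial>lborel)" by simp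
  also have "(\<lambda>v. (m - l) * (\<integral>t. K t v \<partial>lborel))
      = (\<lambda>v. indicator {0..} v *\<^sub>R (exp (- l * v) * \<phi> v - exp (- m * v) * \<phi> v))"
  proof
    fix v
    show "(m - l) * (\<integral>t. K t v \<partial>lborel) = indicator {0..} v *\<^sub>R (exp (- l * v) * \<phi> v - exp (- m * v) * \<phi> v)"
    proof (cases "0 \<le> v")
      case True
      have "has_bochner_integral lborel (\<lambda>t. ((m - l) * exp ((m - l) * t)) * indicator {0..v} t) (exp ((m - l) * v) - exp ((m - l) * 0))"
        by (rule has_bochner_integral_FTC_Icc_real[OF True]) (auto intro!: derivative_eq_intros)
      then have F: "(\<integral>t. ((m - l) * exp ((m - l) * t)) * indicator {0..v} t \<partial>lborel) = exp ((m - l) * v) - 1"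
        by (simp add: has_bochner_integral_iff)
      have "(m - l) * K t v = (exp (- m * v) * \<phi> v) * (((m - l) * exp ((m - l) * t)) * indicator {0..v} t)" for t
      proof -
        have "exp (- l * t) * exp (- m * (v - t)) = exp (- m * v) * exp ((m - l) * t)"
          by (simp add: algebra_simps flip: exp_add)
        then show ?thesis by (auto simp: K_def indicator_def)
      qed
      then have "(m - l) * (\<integral>t. K t v \<partial>lborel) = (exp (- m * v) * \<phi> v) * (exp ((m - l) * v) - 1)"
        unfolding integral_mult_right_zero[symmetric, of "m - l"] by (simp only: integral_mult_right_zero F)
      also have "\<dots> = (exp (- m * v) * exp ((m - l) * v)) * \<phi> v - exp (- m * v) * \<phi> v"
        by (simp add: algebra_simps)
      also have "exp (- m * v) * exp ((m - l) * v) = exp (- l * v)"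
        by (simp add: algebra_simps flip: exp_add)
      finally show ?thesis using True by simp
    next
      case False
      then have "K t v = 0" for t by (simp add: K_def indicator_def)
      then show ?thesis using False by simp
    qed
  qed
  also have "(\<integral>v. indicator {0..} v *\<^sub>R (exp (- l * v) * \<phi> v - exp (- m * v) * \<phi> v) \<partial>lborel)
      = (LINT t:{0..}|lborel. exp (- l * t) * \<phi> t - exp (- m * t) * \<phi> t)"
    by (simp only: set_lebesgue_integral_def)
  also have "\<dots> = (LINT t:{0..}|lborel. exp (- l * t) * \<phi> t) - (LINT t:{0..}|lborel. exp (- m * t) * \<phi> t)"
    by (intro set_integral_diff laplace_integrable[OF _ _ S] l m) measurable
  finally show ?thesis .
qed

section \<open>The resolvent and the generator\<close>

context ou
begin

lemma symbol_tendsto: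
  assumes t: "\<And>n. 0 < t n" "t \<longlonglongrightarrow> 0"
  shows "(\<lambda>n. symbol (t n) \<xi>) \<longlonglongrightarrow> 1"
proof -
  have ev: "\<forall>\<^sub>F n in sequentially. t n < 1" using order_tendstoD(2)[OF t(2), of 1] by simp
  define m where "m = norm (mat_endo (mat_sqrt Q)) * (exp \<beta> * norm \<xi>)"
  have qle: "q \<sigma> \<xi> \<le> m" if "0 \<le> \<sigma>" "\<sigma> \<le> 1" for \<sigma>
  proof -
    have "q \<sigma> \<xi> \<le> norm (mat_endo (mat_sqrt Q)) * norm (coflow \<sigma> \<xi>)"
      using norm_endo_apply[of "mat_endo (mat_sqrt Q)"] by (simp add: q_def)
    also have "norm (coflow \<sigma> \<xi>) \<le> exp (\<bar>\<sigma>\<bar> * \<beta>) * norm \<xi>" by (rule norm_coflow)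
    also have "\<dots> \<le> exp (1 * \<beta>) * norm \<xi>"
      using that \<beta>_nonneg by (intro mult_right_mono iffD2[OF exp_le_cancel_iff] mult_right_mono) auto
    finally show ?thesis by (simp add: m_def mult_left_mono)
  qed
  have le: "expo 0 u \<xi> \<le> (1/2) * (u * m powr (2 * s))" if u: "0 < u" "u < 1" for u
  proof -
    have "(LINT \<sigma>:{0..u}|lborel. q \<sigma> \<xi> powr (2 * s)) \<le> (LINT \<sigma>:{0..u}|lborel. m powr (2 * s))"
    proof (rule set_integral_mono)
      show "set_integrable lborel {0..u} (\<lambda>\<sigma>. m powr (2 * s))"
        unfolding set_integrable_def real_scaleR_def by (rule integrable_mult_left) (simp add: integrable_indicator_Icc)
      show "q \<sigma> \<xi> powr (2 * s) \<le> m powr (2 * s)" if "\<sigma> \<in> {0..u}" for \<sigma>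
        using that u s qle[of \<sigma>] q_nonneg by (intro powr_mono2) auto
    qed (rule integrable_q_powr)
    also have "\<dots> = u * m powr (2 * s)" using u by (simp add: set_lebesgue_integral_def)
    finally show ?thesis by (simp add: expo_def)
  qed
  have "(\<lambda>n. expo 0 (t n) \<xi>) \<longlonglongrightarrow> 0"
  proof (rule tendsto_sandwich[OF _ _ tendsto_const])
    show "\<forall>\<^sub>F n in sequentially. 0 \<le> expo 0 (t n) \<xi>" by (simp add: expo_nonneg)
    show "\<forall>\<^sub>F n in sequentially. expo 0 (t n) \<xi> \<le> (1/2) * (t n * m powr (2 * s))"
      using ev by eventually_elim (use le t in auto)
    have "(\<lambda>n. (1/2) * (t n * m powr (2 * s))) \<longlonglongrightarrow> (1/2) * (0 * m powr (2 * s))"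
      by (intro tendsto_intros t)
    then show "(\<lambda>n. (1/2) * (t n * m powr (2 * s))) \<longlonglongrightarrow> 0" by simp
  qed
  then have "(\<lambda>n. symbol (t n) \<xi>) \<longlonglongrightarrow> exp (- 0)"
    unfolding symbol_def by (intro tendsto_intros)
  then show ?thesis by simp
qed

text \<open>The oscillation of \<open>f\<close> near \<open>x\<close> is dominated by \<open>1 - k\<close> with a Gaussian \<open>k\<close> centred
  at \<open>x\<close>, for which the limit follows from the convergence of the symbols.\<close>

lemma P_tendsto:
  assumes t: "\<And>n. 0 < t n" "t \<longlonglongrightarrow> 0" and f: "continuous_on UNIV f" "\<And>x. \<bar>f x\<bar> \<le> S"
  shows "(\<lambda>n. P (t n) f x) \<longlonglongrightarrow> f x"
proof -
  have [measurable]: "f \<in> borel_measurable borel" by (rule borel_measurable_continuous_onI[OF f(1)])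
  have S0: "0 \<le> S" using f(2)[of 0] by simp
  define k where "k y = gauss 1 (y - x)" for y
  have [measurable]: "k \<in> borel_measurable borel" unfolding k_def[abs_def] by measurable
  have kb: "0 \<le> k y" "k y \<le> 1" for y using gauss_bounds[of 1 "y - x"] by (auto simp: k_def)
  define w where "w \<xi> = of_real (gauss_kernel 1 \<xi>) * cis (- (\<xi> \<bullet> x))" for \<xi>
  have wi: "integrable lborel w"
    using integrable_mult_cis[of "\<lambda>\<xi>. of_real (gauss_kernel 1 \<xi>)" "- x"] integral_gauss_kernel(1)[of 1, where 'a="real^'n"]
    by (simp add: w_def[abs_def])
  have [measurable]: "w \<in> borel_measurable borel" using wi by auto
  have kw: "of_real (k y) = (\<integral>\<xi>. w \<xi> * cis (\<xi> \<bullet> y) \<partial>lborel)" for y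
  proof -
    have "w \<xi> * cis (\<xi> \<bullet> y) = of_real (gauss_kernel 1 \<xi>) * cis ((y - x) \<bullet> \<xi>)" for \<xi>
      by (simp add: w_def mult.assoc cis_mult inner_diff_left inner_diff_right inner_commute)
    then show ?thesis using gauss_kernel_cis(2)[of 1 "y - x"] by (simp add: k_def)
  qed
  have Pk: "complex_of_real (P (t n) k x) = (\<integral>\<xi>. w \<xi> * of_real (symbol (t n) \<xi>) * cis (\<xi> \<bullet> flow (t n) x) \<partial>lborel)" for n
    using PC_transform[OF t(1) wi, of "\<lambda>\<xi>. \<xi>" n x] PC_of_real[of "t n" k x] t(1)[of n] by (simp add: kw)
  have fl: "(\<lambda>n. flow (t n) x) \<longlonglongrightarrow> x"
  proof -
    have "continuous_on UNIV (\<lambda>t. flow t x)" by (intro continuous_intros)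
    then have "isCont (\<lambda>t. flow t x) 0" by (simp add: continuous_on_eq_continuous_at)
    from isCont_tendsto_compose[OF this t(2)] show ?thesis by simp
  qed
  have "(\<lambda>n. complex_of_real (P (t n) k x)) \<longlonglongrightarrow> (\<integral>\<xi>. w \<xi> * of_real 1 * cis (\<xi> \<bullet> x) \<partial>lborel)"
    unfolding Pk
  proof (rule integral_dominated_convergence[where w="\<lambda>\<xi>. cmod (w \<xi>)"])
    show "AE \<xi> in lborel. (\<lambda>n. w \<xi> * of_real (symbol (t n) \<xi>) * cis (\<xi> \<bullet> flow (t n) x)) \<longlonglongrightarrow> w \<xi> * of_real 1 * cis (\<xi> \<bullet> x)"
      by (intro AE_I2 tendsto_intros symbol_tendsto t fl)
    show "AE \<xi> in lborel. norm (w \<xi> * of_real (symbol (t n) \<xi>) * cis (\<xi> \<bullet> flow (t n) x)) \<le> cmod (w \<xi>)" for n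
      using symbol_bounds by (intro AE_I2) (simp add: norm_mult mult_left_le less_imp_le)
  qed (use wi in auto)
  then have "(\<lambda>n. complex_of_real (P (t n) k x)) \<longlonglongrightarrow> of_real 1"
    using kw[of x] by (simp add: k_def gauss_def)
  then have Pk1: "(\<lambda>n. P (t n) k x) \<longlonglongrightarrow> 1"
    by (simp only: tendsto_of_real_iff)
  show ?thesis
  proof (rule LIMSEQ_I)
    fix r :: real assume r: "0 < r"
    have "isCont f x" using f(1) by (simp add: continuous_on_eq_continuous_at)
    then obtain d where d: "d > 0" "\<And>y. dist y x < d \<Longrightarrow> dist (f y) (f x) < r / 2"
      using r unfolding continuous_at_eps_delta by (meson half_gt_zero)
    \<comment> \<open>Outside the ball of radius \<open>d\<close> the Gaussian \<open>k\<close> is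
      at most \<open>exp (- d^2 / 2)\<close>, so \<open>C (1 - k)\<close> is at least
      \<open>2 S\<close> there, which covers any oscillation of \<open>f\<close>.\<close>
    define C where "C = 2 * S / (1 - exp (- d\<^sup>2 / 2))"
    have e1: "exp (- d\<^sup>2 / 2) < 1" using d by simp
    have C0: "0 \<le> C" using S0 e1 by (simp add: C_def)
    have osc: "\<bar>f y - f x\<bar> \<le> r / 2 + C * (1 - k y)" for y
    proof (cases "dist y x < d")
      case True
      have "0 \<le> C * (1 - k y)" using C0 kb[of y] by simp
      then show ?thesis using d(2)[OF True] by (simp add: dist_real_def)
    next
      case False
      then have "d\<^sup>2 \<le> (norm (y - x))\<^sup>2" using d by (intro power_mono) (auto simp: dist_norm)
      then have "k y \<le> exp (- d\<^sup>2 / 2)" by (simp add: k_def gauss_def)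
      then have "C * (1 - exp (- d\<^sup>2 / 2)) \<le> C * (1 - k y)" using C0 by (intro mult_left_mono) auto
      moreover have "C * (1 - exp (- d\<^sup>2 / 2)) = 2 * S" using e1 by (simp add: C_def)
      ultimately show ?thesis using f(2)[of y] f(2)[of x] r by linarith
    qed
    have main: "\<bar>P (t n) f x - f x\<bar> \<le> r / 2 + C * (1 - P (t n) k x)" for n
    proof -
      note D = dens_props[OF t(1)[of n]]
      have nz: "t n \<noteq> 0" using t(1)[of n] by simp
      have fi: "integrable lborel (\<lambda>z. f (flow (t n) x + z) * dens (t n) z)"
        by (rule P_integrable[OF t(1) _ f(2)]) measurable
      have ki: "integrable lborel (\<lambda>z. k (flow (t n) x + z) * dens (t n) z)"
        by (rule P_integrable[OF t(1), where S=1]) (use kb in \<open>auto simp: abs_of_nonneg\<close>)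
      have "P (t n) f x - f x = (\<integral>z. f (flow (t n) x + z) * dens (t n) z - f x * dens (t n) z \<partial>lborel)"
        unfolding P_pos[OF nz] using fi D(2,4) by simp
      also have "\<bar>\<dots>\<bar> \<le> (\<integral>z. (r / 2 + C) * dens (t n) z - C * (k (flow (t n) x + z) * dens (t n) z) \<partial>lborel)"
        unfolding real_norm_def[symmetric]
      proof (rule norm_integral_le)
        show "integrable lborel (\<lambda>z. (r / 2 + C) * dens (t n) z - C * (k (flow (t n) x + z) * dens (t n) z))"
          using D(2) ki by simp
        fix z
        have "norm (f (flow (t n) x + z) * dens (t n) z - f x * dens (t n) z) = \<bar>f (flow (t n) x + z) - f x\<bar> * dens (t n) z"
          using D(1)[of z] by (simp add: abs_mult flip: left_diff_distrib)
        also have "\<dots> \<le> (r / 2 + C * (1 - k (flow (t n) x + z))) * dens (t n) z"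
          by (intro mult_right_mono osc D(1))
        finally show "norm (f (flow (t n) x + z) * dens (t n) z - f x * dens (t n) z)
            \<le> (r / 2 + C) * dens (t n) z - C * (k (flow (t n) x + z) * dens (t n) z)"
          by (simp add: algebra_simps)
      qed
      also have "\<dots> = r / 2 + C * (1 - P (t n) k x)"
        unfolding P_pos[OF nz] using D(2,4) ki by (simp add: algebra_simps)
      finally show ?thesis .
    qed
    have "(\<lambda>n. r / 2 + C * (1 - P (t n) k x)) \<longlonglongrightarrow> r / 2 + C * (1 - 1)"
      by (intro tendsto_intros Pk1)
    then have "\<forall>\<^sub>F n in sequentially. r / 2 + C * (1 - P (t n) k x) < r"
      by (rule order_tendstoD(2)) (use r in simp)
    then show "\<exists>no. \<forall>n\<ge>no. norm (P (t n) f x - f x) < r"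
      using main unfolding eventually_sequentially real_norm_def by (meson le_less_trans)
  qed
qed

definition Rs :: "real \<Rightarrow> (real^'n \<Rightarrow> real) \<Rightarrow> real^'n \<Rightarrow> real" where
  "Rs l f x = (LINT t:{0..}|lborel. exp (- l * t) * P t f x)"

text \<open>Negative times carry no bounds on \<open>P\<close>; replacing \<open>t\<close> by
  \<open>max 0 t\<close> gives a function that is bounded and measurable on the whole line, the form
  in which \<open>laplace_integrable\<close> and \<open>laplace_convolution\<close> take it.\<close>

lemma Rs_max: "Rs l f x = (LINT t:{0..}|lborel. exp (- l * t) * P (max 0 t) f x)"
  unfolding Rs_def by (rule set_lebesgue_integral_cong) auto

lemma Rs_integrable:
  assumes l: "0 < l" and f: "continuous_on UNIV f" "\<And>x. \<bar>f x\<bar> \<le> S"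
  shows "set_integrable lborel {0..} (\<lambda>t. exp (- l * t) * P (max 0 t) f x)"
proof (rule laplace_integrable[OF l])
  have [measurable]: "f \<in> borel_measurable borel" by (rule borel_measurable_continuous_onI[OF f(1)])
  show "(\<lambda>t. P (max 0 t) f x) \<in> borel_measurable borel" by measurable
  show "\<bar>P (max 0 t) f x\<bar> \<le> S" for t by (rule P_bound[OF _ f(2)]) simp
qed

lemma Rs_bound:
  assumes l: "0 < l" and S: "\<And>x. \<bar>f x\<bar> \<le> S"
  shows "\<bar>Rs l f x\<bar> \<le> S / l"
  unfolding Rs_def by (rule laplace_bound[OF l P_bound[OF _ S]])

lemma continuous_Rs:
  assumes l: "0 < l" and f: "continuous_on UNIV f" "\<And>x. \<bar>f x\<bar> \<le> S"
  shows "continuous_on UNIV (Rs l f)"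
proof -
  have [measurable]: "f \<in> borel_measurable borel" by (rule borel_measurable_continuous_onI[OF f(1)])
  have "isCont (Rs l f) x" for x
    unfolding continuous_at_sequentially o_def
  proof (intro allI impI)
    fix X assume X: "X \<longlonglongrightarrow> x"
    show "(\<lambda>n. Rs l f (X n)) \<longlonglongrightarrow> Rs l f x"
      unfolding Rs_max set_lebesgue_integral_def
    proof (rule integral_dominated_convergence[where w="\<lambda>t. S * (indicator {0..} t *\<^sub>R exp (- l * t))"])
      show "integrable lborel (\<lambda>t. S * (indicator {0..} t *\<^sub>R exp (- l * t)))"
        using exp_integral(1)[OF l] unfolding set_integrable_def by (rule integrable_mult_right)
      show "AE t in lborel. (\<lambda>n. indicat_real {0..} t *\<^sub>R (exp (- l * t) * P (max 0 t) f (X n)))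
          \<longlonglongrightarrow> indicat_real {0..} t *\<^sub>R (exp (- l * t) * P (max 0 t) f x)"
      proof (rule AE_I2)
        fix t :: real
        have "continuous_on UNIV (P (max 0 t) f)" by (rule continuous_P[OF _ f]) simp
        then have "(\<lambda>n. P (max 0 t) f (X n)) \<longlonglongrightarrow> P (max 0 t) f x"
          using X isCont_tendsto_compose[of x "P (max 0 t) f" X] by (simp add: continuous_on_eq_continuous_at)
        then show "(\<lambda>n. indicat_real {0..} t *\<^sub>R (exp (- l * t) * P (max 0 t) f (X n)))
            \<longlonglongrightarrow> indicat_real {0..} t *\<^sub>R (exp (- l * t) * P (max 0 t) f x)"
          by (intro tendsto_scaleR tendsto_mult tendsto_const)
      qed
      show "AE t in lborel. norm (indicat_real {0..} t *\<^sub>R (exp (- l * t) * P (max 0 t) f (X n)))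
          \<le> S * (indicator {0..} t *\<^sub>R exp (- l * t))" for n
      proof (rule AE_I2)
        fix t :: real
        have "\<bar>P (max 0 t) f (X n)\<bar> \<le> S" by (rule P_bound[OF _ f(2)]) simp
        then show "norm (indicat_real {0..} t *\<^sub>R (exp (- l * t) * P (max 0 t) f (X n)))
          \<le> S * (indicator {0..} t *\<^sub>R exp (- l * t))"
          by (cases "0 \<le> t") (simp_all add: abs_mult)
      qed
    qed measurable
  qed
  then show ?thesis by (simp add: continuous_on_eq_continuous_at)
qed

text \<open>The time integral and the density are interchanged, and the semigroup law shifts the
  orbit by \<open>t\<close>.\<close>

lemma P_Rs:
  assumes l: "0 < l" and f: "continuous_on UNIV f" "\<And>x. \<bar>f x\<bar> \<le> S" and t: "0 \<le> t"
  shows "P t (Rs l f) x = (LINT u:{0..}|lborel. exp (- l * u) * P (max 0 (t + u)) f x)"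
proof (cases "t = 0")
  case True
  then show ?thesis by (simp add: Rs_max)
next
  case False
  then have t: "0 < t" using t by simp
  have [measurable]: "f \<in> borel_measurable borel" by (rule borel_measurable_continuous_onI[OF f(1)])
  have S0: "0 \<le> S" using f(2)[of 0] by simp
  let ?f = "\<lambda>u z. indicator {0..} u * (exp (- l * u) * P (max 0 u) f (flow t x + z)) * dens t z"
  have "P t (Rs l f) x = (\<integral>z. (\<integral>u. ?f u z \<partial>lborel) \<partial>lborel)"
    unfolding P_pos[OF False] Rs_max set_lebesgue_integral_def by simp
  also have "\<dots> = (\<integral>u. (\<integral>z. ?f u z \<partial>lborel) \<partial>lborel)"
  proof (rule fubini_product_bound(2)[where g="\<lambda>u. S * (indicator {0..} u *\<^sub>R exp (- l * u))" and h="dens t"])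
    show "(\<lambda>(u, z). ?f u z) \<in> borel_measurable (lborel \<Otimes>\<^sub>M lborel)" by measurable
    show "integrable lborel (\<lambda>u. S * (indicator {0..} u *\<^sub>R exp (- l * u)))"
      using exp_integral(1)[OF l] unfolding set_integrable_def by (rule integrable_mult_right)
    show "norm (?f u z) \<le> S * (indicator {0..} u *\<^sub>R exp (- l * u)) * dens t z" for u z
    proof -
      have "\<bar>P (max 0 u) f (flow t x + z)\<bar> \<le> S" by (rule P_bound[OF _ f(2)]) simp
      then show ?thesis
        using dens_props(1)[OF t, of z] by (auto simp: indicator_def abs_mult intro!: mult_right_mono)
    qed
  qed (use dens_props(2)[OF t] in \<open>auto intro: lborel.sigma_finite_measure_axioms\<close>)
  also have "\<dots> = (\<integral>u. indicator {0..} u *\<^sub>R (exp (- l * u) * P (max 0 (t + u)) f x) \<partial>lborel)"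
  proof (rule Bochner_Integration.integral_cong[OF refl])
    fix u :: real
    show "(\<integral>z. ?f u z \<partial>lborel) = indicator {0..} u *\<^sub>R (exp (- l * u) * P (max 0 (t + u)) f x)"
    proof (cases "0 \<le> u")
      case True
      have "(\<integral>z. ?f u z \<partial>lborel) = (\<integral>z. exp (- l * u) * (P u f (flow t x + z) * dens t z) \<partial>lborel)"
        using True by (intro Bochner_Integration.integral_cong) auto
      also have "\<dots> = exp (- l * u) * P t (P u f) x"
        by (simp add: P_pos[OF False])
      also have "P t (P u f) x = P (t + u) f x"
        using t True by (intro semigroup[OF _ _ f]) auto
      finally show ?thesis using True t by simp
    qed simp
  qed
  finally show ?thesis by (simp only: set_lebesgue_integral_def)
qed

lemma resolvent_identity:
  assumes l: "0 < l" and m: "0 < m" and f: "continuous_on UNIV f" "\<And>x. \<bar>f x\<bar> \<le> S"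
  shows "(m - l) * Rs l (Rs m f) x = Rs l f x - Rs m f x"
proof -
  have [measurable]: "f \<in> borel_measurable borel" by (rule borel_measurable_continuous_onI[OF f(1)])
  have "Rs l (Rs m f) x = (LINT t:{0..}|lborel. exp (- l * t) * (LINT u:{0..}|lborel. exp (- m * u) * P (max 0 (t + u)) f x))"
    unfolding Rs_def[of l] by (rule set_lebesgue_integral_cong) (use P_Rs[OF m f] in auto)
  moreover have "\<bar>P (max 0 t) f x\<bar> \<le> S" for t by (rule P_bound[OF _ f(2)]) simp
  then have "(m - l) * (LINT t:{0..}|lborel. exp (- l * t) * (LINT u:{0..}|lborel. exp (- m * u) * P (max 0 (t + u)) f x))
    = Rs l f x - Rs m f x"
    unfolding Rs_max by (intro laplace_convolution[OF l m]) measurable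
  ultimately show ?thesis by simp
qed

text \<open>After the substitution \<open>v = l t\<close> this is dominated convergence from
  pointwise continuity of the orbit at time 0. It supplies injectivity of the resolvent.\<close>

lemma Rs_limit:
  assumes f: "continuous_on UNIV f" "\<And>x. \<bar>f x\<bar> \<le> S"
  shows "(\<lambda>n. real (Suc n) * Rs (real (Suc n)) f x) \<longlonglongrightarrow> f x"
proof -
  have [measurable]: "f \<in> borel_measurable borel" by (rule borel_measurable_continuous_onI[OF f(1)])
  have eq: "l * Rs l f x = (\<integral>v. indicator {0..} v *\<^sub>R (exp (- 1 * v) * P (max 0 (v / l)) f x) \<partial>lborel)" if l: "0 < l" for l
  proof -
    have "Rs l f x = \<bar>1 / l\<bar> *\<^sub>R (\<integral>v. indicator {0..} (0 + 1 / l * v) *\<^sub>R (exp (- l * (0 + 1 / l * v)) * P (max 0 (0 + 1 / l * v)) f x) \<partial>lborel)"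
      unfolding Rs_max set_lebesgue_integral_def by (rule lborel_integral_real_affine) (use l in simp)
    moreover have "indicator {0..} (0 + 1 / l * v) = (indicator {0..} v :: real)" for v
      using l by (simp add: indicator_def zero_le_divide_iff)
    ultimately show ?thesis using l by simp
  qed
  have "(\<lambda>n. \<integral>v. indicator {0..} v *\<^sub>R (exp (- 1 * v) * P (max 0 (v / real (Suc n))) f x) \<partial>lborel)
      \<longlonglongrightarrow> (\<integral>v. indicator {0..} v *\<^sub>R (exp (- 1 * v) * f x) \<partial>lborel)"
  proof (rule integral_dominated_convergence[where w="\<lambda>t. S * (indicator {0..} t *\<^sub>R exp (- 1 * t))"])
    show "integrable lborel (\<lambda>t. S * (indicator {0..} t *\<^sub>R exp (- 1 * t)))"
      using exp_integral(1)[of 1] unfolding set_integrable_def by (intro integrable_mult_right) simp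
    show "AE v in lborel. (\<lambda>n. indicator {0..} v *\<^sub>R (exp (- 1 * v) * P (max 0 (v / real (Suc n))) f x))
       \<longlonglongrightarrow> indicator {0..} v *\<^sub>R (exp (- 1 * v) * f x)"
    proof (rule AE_I2)
      fix v :: real
      show "(\<lambda>n. indicator {0..} v *\<^sub>R (exp (- 1 * v) * P (max 0 (v / real (Suc n))) f x))
         \<longlonglongrightarrow> indicator {0..} v *\<^sub>R (exp (- 1 * v) * f x)"
      proof (cases "0 < v")
        case True
        have "(\<lambda>n. v * (1 / real (Suc n))) \<longlonglongrightarrow> v * 0"
          by (intro tendsto_mult tendsto_const LIMSEQ_Suc[OF lim_1_over_n])
        then have "(\<lambda>n. v / real (Suc n)) \<longlonglongrightarrow> 0" by simp
        then have "(\<lambda>n. P (v / real (Suc n)) f x) \<longlonglongrightarrow> f x"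
          using True by (intro P_tendsto[OF _ _ f]) auto
        moreover have "max 0 (v / real (Suc n)) = v / real (Suc n)" for n using True by simp
        ultimately show ?thesis by (intro tendsto_scaleR tendsto_mult tendsto_const) simp
      next
        case False
        then have "max 0 (v / real (Suc n)) = 0" for n by (simp add: max_def zero_le_divide_iff divide_le_0_iff)
        then show ?thesis by simp
      qed
    qed
    show "AE v in lborel. norm (indicator {0..} v *\<^sub>R (exp (- 1 * v) * P (max 0 (v / real (Suc n))) f x))
       \<le> S * (indicator {0..} v *\<^sub>R exp (- 1 * v))" for n
    proof (rule AE_I2)
      fix v :: real
      have "\<bar>P (max 0 (v / real (Suc n))) f x\<bar> \<le> S" by (rule P_bound[OF _ f(2)]) simp
      then show "norm (indicator {0..} v *\<^sub>R (exp (- 1 * v) * P (max 0 (v / real (Suc n))) f x))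
         \<le> S * (indicator {0..} v *\<^sub>R exp (- 1 * v))"
        by (cases "0 \<le> v") (simp_all add: abs_mult)
    qed
  qed measurable
  moreover have "(\<integral>v. indicator {0..} v *\<^sub>R (exp (- 1 * v) * f x) \<partial>lborel) = f x"
  proof -
    have "(LINT v:{0..}|lborel. exp (- 1 * v) * f x) = f x"
      using exp_integral(2)[of 1] by simp
    then show ?thesis by (simp only: set_lebesgue_integral_def)
  qed
  moreover have "real (Suc n) * Rs (real (Suc n)) f x = (\<integral>v. indicator {0..} v *\<^sub>R (exp (- 1 * v) * P (max 0 (v / real (Suc n))) f x) \<partial>lborel)" for n
    by (rule eq) simp
  ultimately show ?thesis by (simp only:)
qed

lemma P_cmult: "P t (\<lambda>y. r * f y) x = r * P t f x"
  by (cases "t = 0") (simp_all add: P_pos mult.assoc)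

lemma P_add:
  assumes t: "0 \<le> t" and f: "f \<in> borel_measurable borel" "\<And>y. \<bar>f y\<bar> \<le> S" and g: "g \<in> borel_measurable borel" "\<And>y. \<bar>g y\<bar> \<le> T"
  shows "P t (\<lambda>y. f y + g y) x = P t f x + P t g x"
proof (cases "t = 0")
  case False
  then have t: "0 < t" using t by simp
  show ?thesis
    unfolding P_pos[OF False] distrib_right
    by (rule Bochner_Integration.integral_add[OF P_integrable[OF t f] P_integrable[OF t g]])
qed simp

section \<open>Resolvent operators on the space of bounded continuous functions\<close>

definition Rc :: "real \<Rightarrow> ((real^'n) \<Rightarrow>\<^sub>C real) \<Rightarrow> (real^'n) \<Rightarrow>\<^sub>C real" where
  "Rc l f = Bcontfun (Rs l (apply_bcontfun f))"

lemma abs_bcontfun_le: "\<bar>apply_bcontfun f x\<bar> \<le> norm f"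
  using norm_bounded[of f x] by simp

lemma continuous_bcontfun: "continuous_on UNIV (apply_bcontfun f)"
  by simp

lemma Rc_apply: "0 < l \<Longrightarrow> apply_bcontfun (Rc l f) x = Rs l (apply_bcontfun f) x"
proof -
  assume l: "0 < l"
  have "Rs l (apply_bcontfun f) \<in> bcontfun"
    by (rule bcontfun_normI[OF continuous_Rs[OF l continuous_bcontfun abs_bcontfun_le], of _ "norm f / l"])
       (use Rs_bound[OF l abs_bcontfun_le] in simp)
  then show ?thesis by (simp add: Rc_def Bcontfun_inverse)
qed

lemma bounded_linear_Rc:
  assumes l: "0 < l"
  shows "bounded_linear (Rc l)"
proof (rule bounded_linear_intro[where K="1 / l"])
  fix f g :: "(real^'n) \<Rightarrow>\<^sub>C real" and r :: real
  have m: "apply_bcontfun h \<in> borel_measurable borel" for h :: "(real^'n) \<Rightarrow>\<^sub>C real"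
    by (rule borel_measurable_continuous_onI[OF continuous_bcontfun])
  show "Rc l (f + g) = Rc l f + Rc l g"
  proof (rule bcontfun_eqI)
    fix x
    have "Rs l (apply_bcontfun (f + g)) x
        = (LINT t:{0..}|lborel. exp (- l * t) * P (max 0 t) f x + exp (- l * t) * P (max 0 t) g x)"
      unfolding Rs_max plus_bcontfun.rep_eq
      by (rule set_lebesgue_integral_cong) (auto simp: P_add[OF _ m abs_bcontfun_le m abs_bcontfun_le] distrib_left)
    also have "\<dots> = Rs l f x + Rs l g x"
      unfolding Rs_max
      by (rule set_integral_add(2)[OF Rs_integrable[OF l continuous_bcontfun abs_bcontfun_le] Rs_integrable[OF l continuous_bcontfun abs_bcontfun_le]])
    finally show "apply_bcontfun (Rc l (f + g)) x = apply_bcontfun (Rc l f + Rc l g) x"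
      by (simp add: Rc_apply[OF l] plus_bcontfun.rep_eq)
  qed
  show "Rc l (r *\<^sub>R f) = r *\<^sub>R Rc l f"
  proof (rule bcontfun_eqI)
    fix x
    have "Rs l (apply_bcontfun (r *\<^sub>R f)) x = r * Rs l f x"
      by (simp add: Rs_def scaleR_bcontfun.rep_eq P_cmult mult.left_commute)
    then show "apply_bcontfun (Rc l (r *\<^sub>R f)) x = apply_bcontfun (r *\<^sub>R Rc l f) x"
      by (simp add: Rc_apply[OF l] scaleR_bcontfun.rep_eq)
  qed
  show "norm (Rc l f) \<le> norm f * (1 / l)"
    by (rule norm_bound) (use Rs_bound[OF l abs_bcontfun_le] in \<open>simp add: Rc_apply[OF l]\<close>)
qed

lemma Rc_identity:
  assumes l: "0 < l" and m: "0 < m"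
  shows "(m - l) *\<^sub>R Rc l (Rc m f) = Rc l f - Rc m f"
proof (rule bcontfun_eqI)
  fix x
  have "apply_bcontfun (Rc m f) = Rs m f" by (rule ext) (rule Rc_apply[OF m])
  then show "apply_bcontfun ((m - l) *\<^sub>R Rc l (Rc m f)) x = apply_bcontfun (Rc l f - Rc m f) x"
    using resolvent_identity[OF l m continuous_bcontfun abs_bcontfun_le, of f x]
    by (simp add: scaleR_bcontfun.rep_eq minus_bcontfun.rep_eq Rc_apply l m)
qed

text \<open>By the resolvent identity the kernel of \<open>Rc 1\<close> lies in that of every
  \<open>Rc l\<close>; then \<open>l Rc l f\<close>, which is 0, tends pointwise to \<open>f\<close>
  as \<open>l\<close> runs through the positive integers.\<close>

lemma Rc_injective:
  assumes "Rc 1 f = 0"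
  shows "f = 0"
proof (rule bcontfun_eqI)
  fix x
  have "Rc l f = 0" if l: "0 < l" for l
  proof -
    have "Rc l 0 = 0" by (rule linear_0[OF bounded_linear.linear[OF bounded_linear_Rc[OF l]]])
    then show ?thesis using Rc_identity[OF l, of 1 f] assms by simp
  qed
  then have "Rs (real (Suc n)) f x = 0" for n
    using Rc_apply[of "real (Suc n)" f x] by simp
  then have "(\<lambda>n. 0) \<longlonglongrightarrow> apply_bcontfun f x"
    using Rs_limit[OF continuous_bcontfun abs_bcontfun_le, of f x] by simp
  then show "apply_bcontfun f x = apply_bcontfun 0 x"
    by (simp add: LIMSEQ_const_iff)
qed

text \<open>The graph of the identity minus the inverse of \<open>Rc 1\<close>, written without an
  inverse: \<open>u\<close> is the resolvent of \<open>u - w\<close>. Closedness then follows from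
  continuity of \<open>Rc 1\<close>.\<close>

definition gen :: "(((real^'n) \<Rightarrow>\<^sub>C real) \<times> ((real^'n) \<Rightarrow>\<^sub>C real)) set" where
  "gen = {(u, w). u = Rc 1 (u - w)}"

text \<open>The equation at \<open>l\<close> is the fixed point equation
  \<open>u = Rc 1 (f + (1 - l) u)\<close>. The resolvent identity shows that \<open>Rc l f\<close>
  solves it. If \<open>v\<close> is the difference of a solution and \<open>Rc l f\<close>, applying
  \<open>Rc l\<close> to \<open>v = (1 - l) Rc 1 v\<close> and comparing with the resolvent identity
  leaves \<open>Rc 1 v = 0\<close>.\<close>

lemma gen_solves:
  assumes l: "0 < l"
  shows "solves_resolvent_eq gen l f u \<longleftrightarrow> u = Rc l f"
proof -
  note lin = bounded_linear.linear[OF bounded_linear_Rc]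
  note lin1 = lin[OF zero_less_one]
  have sol: "solves_resolvent_eq gen l f u \<longleftrightarrow> u = Rc 1 (f + (1 - l) *\<^sub>R u)" for u
  proof -
    have "solves_resolvent_eq gen l f u \<longleftrightarrow> (u, l *\<^sub>R u - f) \<in> gen"
      unfolding solves_resolvent_eq_def by (metis (no_types, opaque_lifting) diff_diff_eq2 diff_add_cancel add_diff_cancel_left')
    moreover have "u - (l *\<^sub>R u - f) = f + (1 - l) *\<^sub>R u" by (simp add: algebra_simps)
    ultimately show ?thesis by (simp add: gen_def)
  qed
  have ex: "Rc l f = Rc 1 (f + (1 - l) *\<^sub>R Rc l f)"
  proof -
    have "(1 - l) *\<^sub>R Rc 1 (Rc l f) = Rc l f - Rc 1 f"
      using Rc_identity[of 1 l f] l by (simp add: algebra_simps)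
    then show ?thesis by (simp add: linear_add[OF lin1] linear_scale[OF lin1])
  qed
  show ?thesis
  proof
    assume "solves_resolvent_eq gen l f u"
    then have u: "u = Rc 1 (f + (1 - l) *\<^sub>R u)" by (simp only: sol)
    define v where "v = u - Rc l f"
    have "v = Rc 1 (f + (1 - l) *\<^sub>R u) - Rc 1 (f + (1 - l) *\<^sub>R Rc l f)"
      unfolding v_def using u ex by simp
    also have "\<dots> = (1 - l) *\<^sub>R Rc 1 v"
      by (simp add: v_def linear_add[OF lin1] linear_diff[OF lin1] linear_scale[OF lin1] scaleR_diff_right)
    finally have v: "v = (1 - l) *\<^sub>R Rc 1 v" .
    then have "Rc l v = (1 - l) *\<^sub>R Rc l (Rc 1 v)"
      using linear_scale[OF lin[OF l], of "1 - l" "Rc 1 v"] by simp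
    then have "Rc 1 v = 0" using Rc_identity[OF l, of 1 v] by simp
    then have "v = 0" by (rule Rc_injective)
    then show "u = Rc l f" by (simp add: v_def)
  next
    assume "u = Rc l f"
    then show "solves_resolvent_eq gen l f u" using ex sol by simp
  qed
qed

lemma gen_closed: "closed_operator gen"
  unfolding closed_operator_def
proof (intro conjI)
  note lin = bounded_linear.linear[OF bounded_linear_Rc[of 1]]
  show "subspace gen"
    unfolding subspace_def
  proof (intro conjI ballI allI)
    show "0 \<in> gen" by (simp add: gen_def zero_prod_def linear_0[OF lin])
    fix p p' assume p: "p \<in> gen" "p' \<in> gen"
    have "Rc 1 (fst p + fst p' - (snd p + snd p')) = Rc 1 (fst p - snd p) + Rc 1 (fst p' - snd p')"
      by (simp add: add_diff_add linear_add[OF lin])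
    then show "p + p' \<in> gen" using p by (auto simp: gen_def split_beta)
  next
    fix c p assume p: "p \<in> gen"
    have "Rc 1 (c *\<^sub>R fst p - c *\<^sub>R snd p) = c *\<^sub>R Rc 1 (fst p - snd p)"
      by (simp add: linear_scale[OF lin] flip: scaleR_diff_right)
    then show "c *\<^sub>R p \<in> gen" using p by (auto simp: gen_def split_beta)
  qed
  show "single_valued gen"
  proof (rule single_valuedI)
    fix u w w' assume "(u, w) \<in> gen" "(u, w') \<in> gen"
    then have "Rc 1 (u - w) - Rc 1 (u - w') = 0" by (simp add: gen_def)
    then have "Rc 1 (w' - w) = 0" by (simp flip: linear_diff[OF lin])
    from Rc_injective[OF this] show "w = w'" by simp
  qed
  have "closed {p. fst p = Rc 1 (fst p - snd p)}"
    by (intro closed_Collect_eq continuous_intros bounded_linear.continuous_on[OF bounded_linear_Rc]) simp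
  moreover have "gen = {p. fst p = Rc 1 (fst p - snd p)}" by (auto simp: gen_def)
  ultimately show "closed gen" by simp
qed

text \<open>The resolvent at 1 alone determines the graph, since \<open>(u, w)\<close> belongs to it
  exactly when \<open>u\<close> solves the equation at 1 with right-hand side \<open>u - w\<close>.
  This gives uniqueness in the definite description.\<close>

lemma ou_generator_gen: "ou_generator Q B s = gen"
  unfolding ou_generator_def
proof (rule the_equality)
  show "is_ou_generator Q B s gen"
    unfolding is_ou_generator_def
  proof (intro conjI allI impI gen_closed)
    fix l :: real assume l: "0 < l"
    show "\<exists>R. is_resolvent gen l R \<and> (\<forall>f x. apply_bcontfun (R f) x =
        (LINT t:{0..}|lborel. exp (- l * t) * ou_semigroup Q B s t (apply_bcontfun f) x))"
      by (rule exI[of _ "Rc l"])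
         (auto simp: is_resolvent_def bounded_linear_Rc[OF l] gen_solves[OF l] Rc_apply[OF l] Rs_def P_def)
  qed
  fix L assume L: "is_ou_generator Q B s L"
  then obtain R where R: "is_resolvent L 1 R" "\<And>f x. apply_bcontfun (R f) x =
        (LINT t:{0..}|lborel. exp (- 1 * t) * ou_semigroup Q B s t (apply_bcontfun f) x)"
    unfolding is_ou_generator_def using zero_less_one by blast
  have "R f = Rc 1 f" for f
    by (rule bcontfun_eqI) (simp add: R(2) Rc_apply Rs_def P_def)
  then have "solves_resolvent_eq L 1 f u \<longleftrightarrow> u = Rc 1 f" for f u
    using R(1) by (simp add: is_resolvent_def)
  moreover have "(u, w) \<in> L \<longleftrightarrow> solves_resolvent_eq L 1 (u - w) u" for u w
    by (auto simp: solves_resolvent_eq_def)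
  ultimately show "L = gen" by (auto simp: gen_def)
qed

lemma ou_generator_solves: "0 < l \<Longrightarrow> solves_resolvent_eq (ou_generator Q B s) l f u \<longleftrightarrow> u = Rc l f"
  by (simp add: ou_generator_gen gen_solves)

end

section \<open>Regularity from third differences\<close>

definition incr :: "'a::real_vector \<Rightarrow> ('a \<Rightarrow> real) \<Rightarrow> 'a \<Rightarrow> real" where
  "incr h u x = u (x + h) - u x"

lemma norm_scaleR_two: "norm (2 *\<^sub>R h) powr \<theta> = 2 powr \<theta> * norm h powr \<theta>"
  by (simp add: powr_mult)

lemma le_of_geometric:
  fixes x a b c :: real
  assumes "\<And>n. x \<le> a + b * c ^ n" "0 \<le> c" "c < 1"
  shows "x \<le> a"
proof -
  have "(\<lambda>n. a + b * c ^ n) \<longlonglongrightarrow> a + b * 0"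
    by (intro tendsto_intros LIMSEQ_realpow_zero assms)
  then show ?thesis
    using assms(1) LIMSEQ_le_const[of "\<lambda>n. a + b * c ^ n" a x] by simp
qed

text \<open>Marchaud's argument, upwards in scale: the difference with step \<open>2 h\<close> is
  twice the difference with step \<open>h\<close> plus a second difference, so each doubling gains a
  factor 1/2 and boundedness of \<open>u\<close> ends the iteration. The constant solves
  \<open>A 2^\<theta> + K = 2 A\<close> and does not involve \<open>M\<close>.\<close>

lemma marchaud_first:
  fixes u :: "'a::real_normed_vector \<Rightarrow> real"
  assumes \<theta>: "\<theta> < 1" and K0: "0 \<le> K" and M: "\<And>x. \<bar>u x\<bar> \<le> M"
    and K: "\<And>h x. \<bar>incr h (incr h u) x\<bar> \<le> K * norm h powr \<theta>"
  shows "\<bar>incr h u x\<bar> \<le> K / (2 - 2 powr \<theta>) * norm h powr \<theta>"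
proof -
  have "2 powr \<theta> < (2::real) powr 1" using \<theta> by (intro powr_less_mono) auto
  then have p: "2 powr \<theta> < (2::real)" by simp
  define A where "A = K / (2 - 2 powr \<theta>)"
  have A: "A * 2 powr \<theta> + K = 2 * A" using p by (simp add: A_def field_simps)
  have A0: "0 \<le> A" using K0 p by (simp add: A_def)
  have "\<bar>incr h u x\<bar> \<le> A * norm h powr \<theta> + 2 * M * (1/2) ^ n" for n h x
  proof (induction n arbitrary: h x)
    case 0
    have "\<bar>incr h u x\<bar> \<le> 2 * M" using M[of x] M[of "x + h"] by (simp add: incr_def)
    moreover have "0 \<le> A * norm h powr \<theta>" using A0 by simp
    ultimately show ?case by simp
  next
    case (Suc n)
    have id: "incr (2 *\<^sub>R h) u x = 2 * incr h u x + incr h (incr h u) x"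
      by (simp add: incr_def scaleR_2 add.assoc)
    then have "2 * incr h u x = incr (2 *\<^sub>R h) u x - incr h (incr h u) x" by simp
    then have "\<bar>2 * incr h u x\<bar> \<le> \<bar>incr (2 *\<^sub>R h) u x\<bar> + \<bar>incr h (incr h u) x\<bar>"
      by (simp only: abs_triangle_ineq4)
    then have "\<bar>incr h u x\<bar> \<le> (\<bar>incr (2 *\<^sub>R h) u x\<bar> + \<bar>incr h (incr h u) x\<bar>) / 2" by (simp add: abs_mult)
    also have "\<dots> \<le> ((A * norm (2 *\<^sub>R h) powr \<theta> + 2 * M * (1/2) ^ n) + K * norm h powr \<theta>) / 2"
      by (intro divide_right_mono add_mono Suc.IH K) simp
    also have "\<dots> = (A * 2 powr \<theta> + K) * norm h powr \<theta> / 2 + 2 * M * (1/2) ^ Suc n"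
      unfolding norm_scaleR_two by (simp add: field_simps)
    also have "\<dots> = A * norm h powr \<theta> + 2 * M * (1/2) ^ Suc n" by (simp add: A)
    finally show ?case .
  qed
  from le_of_geometric[OF this] show ?thesis by (simp add: A_def)
qed

text \<open>The same doubling argument with \<open>(2 + d)^2 = 4 + 3 d + d (1 + d)\<close>, where
  \<open>d\<close> stands for \<open>incr h\<close> and \<open>1 + d\<close> for translation by
  \<open>h\<close>; the gain per doubling is 1/4, whence \<open>\<theta> < 2\<close>.\<close>

lemma marchaud_second:
  fixes u :: "'a::real_normed_vector \<Rightarrow> real"
  assumes \<theta>: "\<theta> < 2" and K0: "0 \<le> K" and M: "\<And>x. \<bar>u x\<bar> \<le> M"
    and K: "\<And>h x. \<bar>incr h (incr h (incr h u)) x\<bar> \<le> K * norm h powr \<theta>"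
  shows "\<bar>incr h (incr h u) x\<bar> \<le> 4 * K / (4 - 2 powr \<theta>) * norm h powr \<theta>"
proof -
  have "2 powr \<theta> < (2::real) powr 2" using \<theta> by (intro powr_less_mono) auto
  then have p: "2 powr \<theta> < (4::real)" by simp
  define A where "A = 4 * K / (4 - 2 powr \<theta>)"
  have A: "A * 2 powr \<theta> + 4 * K = 4 * A" using p by (simp add: A_def field_simps)
  have A0: "0 \<le> A" using K0 p by (simp add: A_def)
  have "\<bar>incr h (incr h u) x\<bar> \<le> A * norm h powr \<theta> + 4 * M * (1/4) ^ n" for n h x
  proof (induction n arbitrary: h x)
    case 0
    have "\<bar>incr h (incr h u) x\<bar> \<le> 4 * M"
      using M[of x] M[of "x + h"] M[of "x + h + h"] by (simp add: incr_def)
    moreover have "0 \<le> A * norm h powr \<theta>" using A0 by simp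
    ultimately show ?case by simp
  next
    case (Suc n)
    have id: "incr (2 *\<^sub>R h) (incr (2 *\<^sub>R h) u) x = 4 * incr h (incr h u) x
        + (incr h (incr h (incr h u)) (x + h) + 3 * incr h (incr h (incr h u)) x)"
      by (simp add: incr_def scaleR_2 add.assoc)
    have gen: "\<bar>Y\<bar> \<le> (\<bar>X\<bar> + (\<bar>Z\<bar> + 3 * \<bar>W\<bar>)) / 4" if "X = 4 * Y + (Z + 3 * W)" for X Y Z W :: real
      using that by (simp add: abs_if)
    have "\<bar>incr h (incr h u) x\<bar> \<le> (\<bar>incr (2 *\<^sub>R h) (incr (2 *\<^sub>R h) u) x\<bar>
        + (\<bar>incr h (incr h (incr h u)) (x + h)\<bar> + 3 * \<bar>incr h (incr h (incr h u)) x\<bar>)) / 4"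
      by (rule gen[OF id])
    also have "\<dots> \<le> ((A * norm (2 *\<^sub>R h) powr \<theta> + 4 * M * (1/4) ^ n) + (K * norm h powr \<theta> + 3 * (K * norm h powr \<theta>))) / 4"
      by (intro divide_right_mono add_mono Suc.IH K mult_left_mono) simp_all
    also have "\<dots> = (A * 2 powr \<theta> + 4 * K) * norm h powr \<theta> / 4 + 4 * M * (1/4) ^ Suc n"
      unfolding norm_scaleR_two by (simp add: field_simps)
    also have "\<dots> = A * norm h powr \<theta> + 4 * M * (1/4) ^ Suc n" by (simp add: A)
    finally show ?case .
  qed
  from le_of_geometric[OF this] show ?thesis by (simp add: A_def)
qed

text \<open>Polarization: both pure second differences are centred at \<open>x + (a + b)/2\<close>.\<close>

lemma incr_mixed:
  fixes u :: "'a::real_normed_vector \<Rightarrow> real"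
  assumes \<theta>: "0 < \<theta>" and A0: "0 \<le> A"
    and A: "\<And>h x. \<bar>incr h (incr h u) x\<bar> \<le> A * norm h powr \<theta>"
  shows "\<bar>incr a (incr b u) x\<bar> \<le> 2 * A * max (norm a) (norm b) powr \<theta>"
proof -
  define h where "h = (1/2) *\<^sub>R (a + b)"
  define k where "k = (1/2) *\<^sub>R (b - a)"
  let ?m = "max (norm a) (norm b)"
  have [simp]: "x + h + h = x + a + b" "x + a + k = x + h" "x + h + k = x + b"
  proof -
    have "h + h = a + b" unfolding h_def scaleR_add_left[symmetric] by simp
    then show "x + h + h = x + a + b" by (simp add: add.assoc)
    have "a + k = h" unfolding h_def k_def by (simp add: algebra_simps) (simp flip: scaleR_add_left)
    then show 1: "x + a + k = x + h" by (simp add: add.assoc)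
    have "h + k = b" unfolding h_def k_def by (simp add: algebra_simps) (simp flip: scaleR_add_left)
    then show "x + h + k = x + b" by (simp add: add.assoc)
  qed
  have "incr a (incr b u) x = incr h (incr h u) x - incr k (incr k u) (x + a)"
    by (simp add: incr_def)
  then have "\<bar>incr a (incr b u) x\<bar> \<le> A * norm h powr \<theta> + A * norm k powr \<theta>"
    using A[of h x] A[of k "x + a"] by linarith
  also have "\<dots> \<le> A * ?m powr \<theta> + A * ?m powr \<theta>"
  proof (intro add_mono mult_left_mono powr_mono2 A0)
    show "norm h \<le> ?m" using norm_triangle_ineq[of a b] by (simp add: h_def)
    show "norm k \<le> ?m" using norm_triangle_ineq4[of b a] by (simp add: k_def)
  qed (use \<theta> in auto)
  finally show ?thesis by simp
qed

section \<open>Derivatives as limits of dyadic difference quotients\<close>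

lemma geometric_limit:
  fixes a :: "nat \<Rightarrow> real"
  assumes "\<And>n. \<bar>a n - a (Suc n)\<bar> \<le> c * r ^ n" and r: "0 \<le> r" "r < 1"
  shows "convergent a" "\<bar>a 0 - lim a\<bar> \<le> c / (1 - r)"
proof -
  let ?f = "\<lambda>n. a (Suc n) - a n"
  have s: "summable (\<lambda>n. c * r ^ n)" using r by (intro summable_mult summable_geometric) simp
  have le: "norm (?f n) \<le> c * r ^ n" for n using assms(1)[of n] by (simp add: abs_minus_commute)
  have sf: "summable (\<lambda>n. norm (?f n))" by (rule summable_comparison_test'[OF s]) (use le in simp)
  then have "summable ?f" by (rule summable_norm_cancel)
  then have "(\<lambda>n. \<Sum>k<n. ?f k) \<longlonglongrightarrow> suminf ?f" by (rule summable_LIMSEQ)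
  then have "(\<lambda>n. a n - a 0) \<longlonglongrightarrow> suminf ?f" by (simp add: sum_lessThan_telescope)
  from tendsto_add[OF this tendsto_const[of "a 0"]]
  have l: "a \<longlonglongrightarrow> suminf ?f + a 0" by simp
  then show "convergent a" by (rule convergentI)
  have "lim a = suminf ?f + a 0" using l by (rule limI)
  then have "\<bar>a 0 - lim a\<bar> = norm (suminf ?f)" by simp
  also have "\<dots> \<le> (\<Sum>n. norm (?f n))" by (rule summable_norm[OF sf])
  also have "\<dots> \<le> (\<Sum>n. c * r ^ n)" by (rule suminf_le[OF le sf s])
  also have "\<dots> = c / (1 - r)" using r by (simp add: suminf_mult suminf_geometric)
  finally show "\<bar>a 0 - lim a\<bar> \<le> c / (1 - r)" .
qed

text \<open>The deviation from linearity is additive and vanishes on integers, hence is periodic and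
  bounded; a bounded additive function is 0.\<close>

lemma additive_bounded_scale:
  fixes \<phi> :: "real \<Rightarrow> real"
  assumes add: "\<And>a b. \<phi> (a + b) = \<phi> a + \<phi> b" and B: "\<And>c. 0 \<le> c \<Longrightarrow> c \<le> 1 \<Longrightarrow> \<bar>\<phi> c\<bar> \<le> B"
  shows "\<phi> c = c * \<phi> 1"
proof -
  define \<psi> where "\<psi> c = \<phi> c - c * \<phi> 1" for c
  have add': "\<psi> (a + b) = \<psi> a + \<psi> b" for a b by (simp add: \<psi>_def add algebra_simps)
  have one: "\<psi> 1 = 0" by (simp add: \<psi>_def)
  have nat: "\<psi> (real n * c) = real n * \<psi> c" for n c
  proof (induction n)
    case 0
    show ?case using add'[of 0 0] by simp
  next
    case (Suc n)
    then show ?case using add'[of c "real n * c"] by (simp add: algebra_simps)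
  qed
  have neg: "\<psi> (- c) = - \<psi> c" for c using add'[of c "- c"] add'[of 0 0] by simp
  have int: "\<psi> (of_int k) = 0" for k
    using nat[of "nat k" 1] nat[of "nat (- k)" 1] one neg[of "real (nat (- k))"] by (cases "0 \<le> k") auto
  have bd: "\<bar>\<psi> c\<bar> \<le> B + \<bar>\<phi> 1\<bar>" for c
  proof -
    have "\<psi> c = \<psi> (frac c)" using add'[of "of_int \<lfloor>c\<rfloor>" "frac c"] int by (simp add: frac_def)
    moreover have "\<bar>\<phi> (frac c)\<bar> \<le> B" by (rule B) (auto simp: frac_ge_0 less_imp_le[OF frac_lt_1])
    moreover have "\<bar>frac c * \<phi> 1\<bar> \<le> \<bar>\<phi> 1\<bar>"
      using frac_ge_0[of c] frac_lt_1[of c] by (simp add: abs_mult mult_left_le_one_le)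
    ultimately show ?thesis by (simp add: \<psi>_def)
  qed
  have "\<psi> c = 0"
  proof (rule ccontr)
    assume "\<psi> c \<noteq> 0"
    then obtain n where "B + \<bar>\<phi> 1\<bar> < real n * \<bar>\<psi> c\<bar>"
      using reals_Archimedean3[of "\<bar>\<psi> c\<bar>"] by auto
    then show False using bd[of "real n * c"] by (simp add: nat abs_mult)
  qed
  then show ?thesis by (simp add: \<psi>_def)
qed

lemma norm_half_powr:
  "norm ((1/2) ^ n *\<^sub>R h) powr \<theta> * 2 ^ n = norm h powr \<theta> * (2 powr (1 - \<theta>)) ^ n"
proof -
  have "norm ((1/2) ^ n *\<^sub>R h) powr \<theta> = ((1/2) ^ n) powr \<theta> * norm h powr \<theta>"
    by (simp add: powr_mult)
  moreover have "((1/2::real) ^ n) powr \<theta> * 2 ^ n = (2 powr (1 - \<theta>)) ^ n"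
  proof -
    have "((1/2::real) ^ n) powr \<theta> = ((1/2) powr \<theta>) ^ n"
      by (simp add: powr_realpow[symmetric] powr_powr mult.commute)
    moreover have "(1/2::real) powr \<theta> * 2 = 2 powr (1 - \<theta>)"
      by (simp add: powr_divide powr_diff)
    ultimately show ?thesis by (simp flip: power_mult_distrib)
  qed
  ultimately show ?thesis by (simp add: mult_ac)
qed

text \<open>The derivative is the limit of the dyadic difference quotients, whose consecutive
  differences are second differences.\<close>

lemma derivative_from_second_differences:
  fixes u :: "'a::euclidean_space \<Rightarrow> real"
  assumes \<theta>: "1 < \<theta>" and A0: "0 \<le> A" and M: "\<And>x. \<bar>u x\<bar> \<le> M"
    and A: "\<And>a b x. \<bar>incr a (incr b u) x\<bar> \<le> A * max (norm a) (norm b) powr \<theta>"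
  obtains D where "\<And>x. (u has_derivative D x) (at x)"
    "\<And>x h. (\<lambda>n. 2 ^ n * incr ((1/2) ^ n *\<^sub>R h) u x) \<longlonglongrightarrow> D x h"
    "\<And>h. continuous_on UNIV (\<lambda>x. D x h)"
proof -
  define r where "r = 2 powr (1 - \<theta>)"
  have r: "0 < r" "r < 1"
  proof -
    have "2 powr (1 - \<theta>) < (2::real) powr 0" using \<theta> by (intro powr_less_mono) auto
    then show "0 < r" "r < 1" by (auto simp: r_def)
  qed
  note half = norm_half_powr[of _ _ \<theta>, folded r_def]
  define a where "a x h n = 2 ^ n * incr ((1/2) ^ n *\<^sub>R h) u x" for x h n
  define D where "D x h = lim (a x h)" for x h
  define C where "C = A / (1 - r)"
  have C0: "0 \<le> C" using A0 r by (simp add: C_def)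
  have step: "\<bar>a x h n - a x h (Suc n)\<bar> \<le> A * norm h powr \<theta> * r ^ n" for x h n
  proof -
    define k where "k = (1/2) ^ Suc n *\<^sub>R h"
    have k2: "(1/2) ^ n *\<^sub>R h = k + k" by (simp add: k_def flip: scaleR_add_left)
    have "a x h n - a x h (Suc n) = 2 ^ n * incr k (incr k u) x"
      unfolding a_def k2 k_def[symmetric] by (simp add: incr_def algebra_simps)
    then have "\<bar>a x h n - a x h (Suc n)\<bar> = 2 ^ n * \<bar>incr k (incr k u) x\<bar>" by (simp add: abs_mult)
    also have "\<dots> \<le> 2 ^ n * (A * norm k powr \<theta>)" using A[of k k x] by simp
    also have "\<dots> \<le> 2 ^ n * (A * norm ((1/2) ^ n *\<^sub>R h) powr \<theta>)"
      using A0 \<theta> by (intro mult_left_mono powr_mono2) (auto simp: k_def)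
    also have "\<dots> = A * norm h powr \<theta> * r ^ n" using half[of n h] by (simp add: mult_ac)
    finally show ?thesis .
  qed
  have lim: "a x h \<longlonglongrightarrow> D x h" for x h
    using geometric_limit(1)[of "a x h", OF step] r unfolding D_def by (simp add: convergent_LIMSEQ_iff)
  have D1: "\<bar>incr h u x - D x h\<bar> \<le> C * norm h powr \<theta>" for x h
  proof -
    have "a x h 0 = incr h u x" by (simp add: a_def)
    then show ?thesis using geometric_limit(2)[of "a x h", OF step] r by (simp add: D_def C_def)
  qed
  have D_half: "D x ((1/2) ^ n *\<^sub>R h) = (1/2) ^ n * D x h" for x h n
  proof -
    have e: "a x ((1/2) ^ n *\<^sub>R h) = (\<lambda>k. (1/2) ^ n * a x h (k + n))"
      by (rule ext) (simp add: a_def power_add power_one_over)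
    have "a x ((1/2) ^ n *\<^sub>R h) \<longlonglongrightarrow> (1/2) ^ n * D x h"
      unfolding e by (intro tendsto_mult tendsto_const LIMSEQ_ignore_initial_segment lim)
    then show ?thesis by (rule LIMSEQ_unique[OF lim])
  qed
  have D_add: "D x (h + k) = D x h + D x k" for x h k
  proof -
    define m where "m = 2 * max (norm h) (norm k)"
    have m0: "0 \<le> m" by (simp add: m_def le_max_iff_disj)
    have est: "\<bar>D x (h + k) - D x h - D x k\<bar> \<le> (A + 3 * C) * (2 * max (norm h) (norm k)) powr \<theta>" for h k
    proof -
      let ?m = "2 * max (norm h) (norm k)"
      have "incr k (incr h u) x = incr (h + k) u x - incr h u x - incr k u x"
        by (simp add: incr_def algebra_simps)
      then have "\<bar>D x (h + k) - D x h - D x k\<bar> \<le> A * max (norm k) (norm h) powr \<theta>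
          + (C * norm (h + k) powr \<theta> + C * norm h powr \<theta> + C * norm k powr \<theta>)"
        using A[of k h x] D1[of "h + k" x] D1[of h x] D1[of k x] by linarith
      also have "\<dots> \<le> A * ?m powr \<theta> + (C * ?m powr \<theta> + C * ?m powr \<theta> + C * ?m powr \<theta>)"
      proof -
        have mm: "norm h \<le> ?m" "norm k \<le> ?m" "norm (h + k) \<le> ?m" "max (norm k) (norm h) \<le> ?m" "0 \<le> max (norm k) (norm h)"
          using norm_triangle_ineq[of h k] norm_ge_zero[of h] norm_ge_zero[of k] by linarith+
        show ?thesis
          by (intro add_mono mult_left_mono powr_mono2 A0 C0 mm norm_ge_zero) (use \<theta> in simp_all)
      qed
      finally show ?thesis by (simp add: algebra_simps)
    qed
    \<comment> \<open>At scale \<open>m\<close> additivity fails by at most a constant times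
      \<open>m powr \<theta>\<close>. Since \<open>D\<close> is exactly homogeneous under halving,
      rescaling by \<open>(1/2)^n\<close> multiplies the bound on the defect by \<open>r^n\<close>,
      which tends to 0.\<close>
    have "\<bar>D x (h + k) - D x h - D x k\<bar> \<le> 0 + (A + 3 * C) * m powr \<theta> * r ^ n" for n
    proof -
      have "(1/2) ^ n * \<bar>D x (h + k) - D x h - D x k\<bar>
          = \<bar>D x ((1/2) ^ n *\<^sub>R h + (1/2) ^ n *\<^sub>R k) - D x ((1/2) ^ n *\<^sub>R h) - D x ((1/2) ^ n *\<^sub>R k)\<bar>"
        unfolding scaleR_add_right[symmetric] D_half right_diff_distrib[symmetric] by (simp add: abs_mult)
      also have "\<dots> \<le> (A + 3 * C) * (2 * max (norm ((1/2) ^ n *\<^sub>R h)) (norm ((1/2) ^ n *\<^sub>R k))) powr \<theta>"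
        by (rule est)
      also have "2 * max (norm ((1/2) ^ n *\<^sub>R h)) (norm ((1/2) ^ n *\<^sub>R k)) = (1/2) ^ n * m"
        by (simp add: m_def max_mult_distrib_left)
      finally have f1: "2 ^ n * ((1/2) ^ n * \<bar>D x (h + k) - D x h - D x k\<bar>) \<le> 2 ^ n * ((A + 3 * C) * ((1/2) ^ n * m) powr \<theta>)"
        by (intro mult_left_mono) auto
      have one: "(2::real) ^ n * (1/2) ^ n = 1" by (simp flip: power_mult_distrib)
      have f3: "((1/2) ^ n * m) powr \<theta> * 2 ^ n = m powr \<theta> * r ^ n"
      proof -
        \<comment> \<open>A vector of norm \<open>m\<close> turns the scalar identity into an
          instance of \<open>norm_half_powr\<close>.\<close>
        obtain e :: 'a where "norm e = 1" using vector_choose_size[of 1] by auto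
        then have "norm ((1/2) ^ n *\<^sub>R (m *\<^sub>R e)) = (1/2) ^ n * m" "norm (m *\<^sub>R e) = m"
          using m0 by simp_all
        then show ?thesis using half[of n "m *\<^sub>R e"] by simp
      qed
      have "\<bar>D x (h + k) - D x h - D x k\<bar> = 2 ^ n * ((1/2) ^ n * \<bar>D x (h + k) - D x h - D x k\<bar>)"
        unfolding mult.assoc[symmetric] one by simp
      also note f1
      also have "2 ^ n * ((A + 3 * C) * ((1/2) ^ n * m) powr \<theta>) = (A + 3 * C) * (((1/2) ^ n * m) powr \<theta> * 2 ^ n)"
        by (simp only: mult_ac)
      also have "\<dots> = 0 + (A + 3 * C) * m powr \<theta> * r ^ n" unfolding f3 by simp
      finally show ?thesis .
    qed
    from le_of_geometric[OF this] r show ?thesis by simp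
  qed
  have Db: "\<bar>D x h\<bar> \<le> 2 * M + C * norm h powr \<theta>" for x h
    using D1[of h x] M[of x] M[of "x + h"] by (simp add: incr_def)
  have D_scale: "D x (c *\<^sub>R h) = c * D x h" for x c h
  proof -
    have "D x (c *\<^sub>R h) = c * D x (1 *\<^sub>R h)"
    proof (rule additive_bounded_scale)
      show "D x ((a + b) *\<^sub>R h) = D x (a *\<^sub>R h) + D x (b *\<^sub>R h)" for a b
        by (simp add: scaleR_add_left D_add)
      show "\<bar>D x (c *\<^sub>R h)\<bar> \<le> 2 * M + C * norm h powr \<theta>" if "0 \<le> c" "c \<le> 1" for c
      proof -
        have "C * norm (c *\<^sub>R h) powr \<theta> \<le> C * norm h powr \<theta>"
          using that \<theta> C0 by (intro mult_left_mono powr_mono2) (auto simp: mult_left_le_one_le)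
        then show ?thesis using Db[of x "c *\<^sub>R h"] by simp
      qed
    qed
    then show ?thesis by simp
  qed
  have "linear (D x)" for x by (rule linearI) (simp_all add: D_add D_scale)
  then have Dl: "bounded_linear (D x)" for x by (simp add: linear_conv_bounded_linear)
  have deriv: "(u has_derivative D x) (at x)" for x
    unfolding has_derivative_at
  proof (intro conjI Dl)
    have z: "((\<lambda>h::'a. C * norm h powr (\<theta> - 1)) \<longlongrightarrow> 0) (at 0)"
    proof -
      have "((\<lambda>h::'a. C * norm h powr (\<theta> - 1)) \<longlongrightarrow> C * norm (0::'a) powr (\<theta> - 1)) (at 0)"
        by (intro tendsto_mult tendsto_const tendsto_powr' tendsto_norm tendsto_ident_at) (use \<theta> in auto)
      then show ?thesis by simp
    qed
    show "((\<lambda>h. norm (u (x + h) - u x - D x h) / norm h) \<longlongrightarrow> 0) (at 0)"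
    proof (rule tendsto_sandwich[OF _ _ tendsto_const z])
      show "\<forall>\<^sub>F h in at 0. 0 \<le> norm (u (x + h) - u x - D x h) / norm h" by simp
      have "norm (u (x + h) - u x - D x h) / norm h \<le> C * norm h powr (\<theta> - 1)" if "h \<noteq> 0" for h
      proof -
        have "norm h powr (\<theta> - 1) * norm h = norm h powr \<theta>"
          using that by (simp add: powr_diff)
        then show ?thesis using D1[of h x] that by (simp add: incr_def divide_le_eq mult.assoc)
      qed
      then show "\<forall>\<^sub>F h in at 0. norm (u (x + h) - u x - D x h) / norm h \<le> C * norm h powr (\<theta> - 1)"
        by (simp add: eventually_at_filter)
    qed
  qed
  have Dcont: "continuous_on UNIV (\<lambda>x. D x h)" for h
  proof -
    have cu: "continuous_on UNIV u"
      by (intro continuous_at_imp_continuous_on ballI has_derivative_continuous[OF deriv])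
    have "continuous_on UNIV (\<lambda>x. u (x + k))" for k
      by (rule continuous_on_compose2[OF cu]) (auto intro!: continuous_intros)
    then have ac: "continuous_on UNIV (\<lambda>x. a x h n)" for n
      unfolding a_def incr_def by (intro continuous_on_mult continuous_on_const continuous_on_diff cu)
    have ad: "\<bar>a x h n - D x h\<bar> \<le> C * norm h powr \<theta> * r ^ n" for x n
    proof -
      have "a x h n - D x h = 2 ^ n * (incr ((1/2) ^ n *\<^sub>R h) u x - D x ((1/2) ^ n *\<^sub>R h))"
        unfolding a_def right_diff_distrib D_half by (simp add: power_one_over)
      then have "\<bar>a x h n - D x h\<bar> \<le> 2 ^ n * (C * norm ((1/2) ^ n *\<^sub>R h) powr \<theta>)"
        using D1[of "(1/2) ^ n *\<^sub>R h" x] by (simp add: abs_mult)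
      also have "\<dots> = C * norm h powr \<theta> * r ^ n" using half[of n h] by (simp add: mult_ac)
      finally show ?thesis .
    qed
    have "uniform_limit UNIV (\<lambda>n x. a x h n) (\<lambda>x. D x h) sequentially"
    proof (rule uniform_limitI)
      fix e :: real assume e: "0 < e"
      have "(\<lambda>n. C * norm h powr \<theta> * r ^ n) \<longlonglongrightarrow> C * norm h powr \<theta> * 0"
        by (intro tendsto_intros LIMSEQ_realpow_zero) (use r in auto)
      then have "\<forall>\<^sub>F n in sequentially. C * norm h powr \<theta> * r ^ n < e"
        by (rule order_tendstoD(2)) (use e in simp)
      then show "\<forall>\<^sub>F n in sequentially. \<forall>x\<in>UNIV. dist (a x h n) (D x h) < e"
      proof eventually_elim
        case (elim n)
        show ?case
        proof
          fix x
          show "dist (a x h n) (D x h) < e" using le_less_trans[OF ad[of x n] elim] by (simp add: dist_real_def)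
        qed
      qed
    qed
    moreover have "\<forall>\<^sub>F n in sequentially. continuous_on UNIV (\<lambda>x. a x h n)" by (simp add: ac)
    ultimately show ?thesis
      by (intro uniform_limit_theorem[where f="\<lambda>n x. a x h n" and F=sequentially]) auto
  qed
  show thesis by (rule that[OF deriv lim[unfolded a_def] Dcont])
qed

lemma incr_zero [simp]: "incr 0 u x = 0"
  by (simp add: incr_def)

text \<open>One increment is spent on a derivative: third differences of order \<theta> become
  second differences of order \<open>\<theta> - 1\<close> of the partial derivatives. The bounds
  stay linear in \<open>M + K\<close>, so the step can be repeated.\<close>

lemma regularity_step:
  fixes \<theta> :: real
  assumes \<theta>: "1 < \<theta>" "\<theta> < 3"
  obtains C where "C > 0" "\<And>(u :: real^'n \<Rightarrow> real) M K. (\<And>x. \<bar>u x\<bar> \<le> M) \<Longrightarrow> 0 \<le> K \<Longrightarrow>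
      (\<And>a b c x. \<bar>incr a (incr b (incr c u)) x\<bar> \<le> K * max (norm a) (max (norm b) (norm c)) powr \<theta>) \<Longrightarrow>
      (\<forall>x. u differentiable at x) \<and> (\<forall>i. continuous_on UNIV (partial i u) \<and>
         (\<forall>x. \<bar>partial i u x\<bar> \<le> C * (M + K)) \<and>
         (\<forall>a b x. \<bar>incr a (incr b (partial i u)) x\<bar> \<le> C * (M + K) * max (norm a) (norm b) powr (\<theta> - 1)))"
proof -
  define r where "r = 2 powr (1 - \<theta>)"
  have r: "0 < r" "r < 1"
  proof -
    have "2 powr (1 - \<theta>) < (2::real) powr 0" using \<theta> by (intro powr_less_mono) auto
    then show "0 < r" "r < 1" by (auto simp: r_def)
  qed
  define C2 where "C2 = 2 / (1 - r)"
  have C2: "0 < C2" using r by (simp add: C2_def)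
  define C where "C = 4 * C2 + 4"
  have "(\<forall>x. u differentiable at x) \<and> (\<forall>i. continuous_on UNIV (partial i u) \<and>
         (\<forall>x. \<bar>partial i u x\<bar> \<le> C * (M + K)) \<and>
         (\<forall>a b x. \<bar>incr a (incr b (partial i u)) x\<bar> \<le> C * (M + K) * max (norm a) (norm b) powr (\<theta> - 1)))"
    if M: "\<And>x. \<bar>u x\<bar> \<le> M" and K0: "0 \<le> K"
      and K: "\<And>a b c x. \<bar>incr a (incr b (incr c u)) x\<bar> \<le> K * max (norm a) (max (norm b) (norm c)) powr \<theta>"
    for u :: "real^'n \<Rightarrow> real" and M K
  proof -
    have M0: "0 \<le> M" using M[of 0] by simp
    \<comment> \<open>Differentiability needs an exponent above 1, the passage to second differences
      one below 2. Lowering \<theta> is harmless: for \<open>norm h <= 1\<close> powers only grow,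
      and for larger \<open>h\<close> the bound \<open>8 * M\<close> takes over.\<close>
    define \<theta>' where "\<theta>' = min \<theta> (3/2)"
    have \<theta>': "1 < \<theta>'" "\<theta>' < 2" "\<theta>' \<le> \<theta>" using \<theta> by (auto simp: \<theta>'_def)
    have pure: "\<bar>incr h (incr h (incr h u)) x\<bar> \<le> (K + 8 * M) * norm h powr \<theta>'" for h x
    proof (cases "norm h \<le> 1")
      case True
      have "\<bar>incr h (incr h (incr h u)) x\<bar> \<le> K * norm h powr \<theta>" using K[of h h h x] by simp
      also have "\<dots> \<le> (K + 8 * M) * norm h powr \<theta>'"
        using True \<theta>' K0 M0 by (intro mult_mono powr_mono') auto
      finally show ?thesis .
    next
      case False
      have "\<bar>incr h (incr h (incr h u)) x\<bar> \<le> 8 * M"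
        using M[of x] M[of "x + h"] M[of "x + h + h"] M[of "x + h + h + h"] by (simp add: incr_def)
      also have "\<dots> \<le> (K + 8 * M) * norm h powr \<theta>'"
      proof -
        have "1 \<le> norm h powr \<theta>'" using False \<theta>' by (intro ge_one_powr_ge_zero) auto
        then have "(K + 8 * M) * 1 \<le> (K + 8 * M) * norm h powr \<theta>'" using K0 M0 by (intro mult_left_mono) auto
        then show ?thesis using K0 by simp
      qed
      finally show ?thesis .
    qed
    define A1 where "A1 = 4 * (K + 8 * M) / (4 - 2 powr \<theta>')"
    have "2 powr \<theta>' < (2::real) powr 2" using \<theta>' by (intro powr_less_mono) auto
    then have A1: "0 \<le> A1" using K0 M0 by (simp add: A1_def)
    have second: "\<bar>incr h (incr h u) x\<bar> \<le> A1 * norm h powr \<theta>'" for h x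
      unfolding A1_def by (rule marchaud_second[OF \<theta>'(2) _ M pure]) (use K0 M0 in simp)
    have mixed: "\<bar>incr a (incr b u) x\<bar> \<le> 2 * A1 * max (norm a) (norm b) powr \<theta>'" for a b x
      by (rule incr_mixed[OF _ A1 second]) (use \<theta>' in simp)
    have A2: "0 \<le> 2 * A1" using A1 by simp
    obtain D where D: "\<And>x. (u has_derivative D x) (at x)"
      "\<And>x h. (\<lambda>n. 2 ^ n * incr ((1/2) ^ n *\<^sub>R h) u x) \<longlonglongrightarrow> D x h"
      "\<And>h. continuous_on UNIV (\<lambda>x. D x h)"
      using derivative_from_second_differences[OF \<theta>'(1) A2 M mixed] by blast
    \<comment> \<open>Formally the derivative is the logarithm \<open>d - d^2 / 2 + ...\<close> of
      the translation \<open>1 + d\<close>, with \<open>d = incr h\<close>; this is its truncation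
      after two terms. The error is governed by third differences, so the approximation has order
      \<theta> for every \<theta> below 3, whereas \<open>incr h u\<close> alone stops at order
      2.\<close>
    define E where "E h x = incr h u x - incr h (incr h u) x / 2" for h x
    have ED: "\<bar>E h x - D x h\<bar> \<le> C2 * K * norm h powr \<theta>" for h x
    proof -
      define b where "b n = 2 ^ n * E ((1/2) ^ n *\<^sub>R h) x" for n
      define a where "a n = 2 ^ n * incr ((1/2) ^ n *\<^sub>R h) u x" for n
      define k where "k n = (1/2) ^ Suc n *\<^sub>R h" for n
      have k2: "(1/2) ^ n *\<^sub>R h = k n + k n" for n by (simp add: k_def flip: scaleR_add_left)
      have ks: "(1/2) ^ Suc n *\<^sub>R h = k n" for n by (simp only: k_def)
      have aa: "a n - a (Suc n) = 2 ^ n * incr (k n) (incr (k n) u) x" for n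
      proof -
        have "a n = 2 ^ n * incr (k n + k n) u x" by (simp only: a_def k2)
        moreover have "a (Suc n) = 2 ^ Suc n * incr (k n) u x" by (simp only: a_def ks)
        ultimately show ?thesis by (simp add: incr_def algebra_simps)
      qed
      have al: "a \<longlonglongrightarrow> D x h" unfolding a_def by (rule D(2))
      \<comment> \<open>The sequences \<open>a\<close> and \<open>b\<close> have the same limit,
        because \<open>a (Suc n) - b (Suc n)\<close> equals \<open>a n - a (Suc n)\<close>, a
        difference of consecutive terms of a convergent sequence.\<close>
      have "(\<lambda>n. a n - a (Suc n)) \<longlonglongrightarrow> D x h - D x h" by (intro tendsto_diff al LIMSEQ_Suc)
      moreover have "a (Suc n) - b (Suc n) = a n - a (Suc n)" for n
      proof -
        have "a (Suc n) - b (Suc n) = 2 ^ Suc n * (incr (k n) u x - E (k n) x)"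
          by (simp only: a_def b_def ks right_diff_distrib)
        also have "\<dots> = 2 ^ n * incr (k n) (incr (k n) u) x" by (simp add: E_def)
        finally show ?thesis by (simp only: aa)
      qed
      ultimately have "(\<lambda>n. a (Suc n) - b (Suc n)) \<longlonglongrightarrow> 0" by (simp only: diff_self)
      then have "(\<lambda>n. a (Suc n) - (a (Suc n) - b (Suc n))) \<longlonglongrightarrow> D x h - 0"
        by (intro tendsto_diff LIMSEQ_Suc[OF al])
      then have "(\<lambda>n. b (Suc n)) \<longlonglongrightarrow> D x h" by simp
      then have bl: "b \<longlonglongrightarrow> D x h" by (rule LIMSEQ_imp_Suc)
      have "\<bar>b n - b (Suc n)\<bar> \<le> 2 * K * norm h powr \<theta> * r ^ n" for n
      proof -
        let ?k = "k n"
        \<comment> \<open>With \<open>d = incr ?k\<close> the doubled step is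
          \<open>2 d + d^2\<close>; the terms of order 1 and 2 cancel and
          \<open>- (4 d^3 + d^4) / 2\<close> remains.\<close>
        have "b n - b (Suc n) = 2 ^ n * (- (incr ?k (incr ?k (incr ?k u)) (x + ?k) + 3 * incr ?k (incr ?k (incr ?k u)) x) / 2)"
        proof -
          have "b n = 2 ^ n * E (?k + ?k) x" by (simp only: b_def k2)
          moreover have "b (Suc n) = 2 ^ Suc n * E ?k x" by (simp only: b_def ks)
          ultimately have "b n - b (Suc n) = 2 ^ n * (E (?k + ?k) x - 2 * E ?k x)" by (simp add: right_diff_distrib)
          also have "E (?k + ?k) x - 2 * E ?k x
              = - (incr ?k (incr ?k (incr ?k u)) (x + ?k) + 3 * incr ?k (incr ?k (incr ?k u)) x) / 2"
            unfolding E_def incr_def add.assoc by (simp add: field_simps)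
          finally show ?thesis .
        qed
        then have "\<bar>b n - b (Suc n)\<bar> = 2 ^ n * (\<bar>incr ?k (incr ?k (incr ?k u)) (x + ?k) + 3 * incr ?k (incr ?k (incr ?k u)) x\<bar> / 2)"
          by (simp only: abs_mult abs_divide abs_minus_cancel) simp
        also have "\<dots> \<le> 2 ^ n * ((K * norm ?k powr \<theta> + 3 * (K * norm ?k powr \<theta>)) / 2)"
        proof -
          have "\<bar>X + 3 * Y\<bar> \<le> Z + 3 * Z" if "\<bar>X\<bar> \<le> Z" "\<bar>Y\<bar> \<le> Z" for X Y Z :: real using that by linarith
          then show ?thesis using K[of ?k ?k ?k] by (intro mult_left_mono divide_right_mono) auto
        qed
        also have "\<dots> = 2 ^ n * (2 * K * norm ?k powr \<theta>)" by simp
        also have "\<dots> \<le> 2 ^ n * (2 * K * norm ((1/2) ^ n *\<^sub>R h) powr \<theta>)"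
          using K0 \<theta> by (intro mult_left_mono powr_mono2) (auto simp: k_def)
        also have "\<dots> = 2 * K * norm h powr \<theta> * r ^ n"
          using norm_half_powr[of n h \<theta>] by (simp add: r_def mult_ac)
        finally show ?thesis .
      qed
      from geometric_limit(2)[of b, OF this] r
      have "\<bar>b 0 - lim b\<bar> \<le> 2 * K * norm h powr \<theta> / (1 - r)" by simp
      moreover have "lim b = D x h" using bl by (rule limI)
      moreover have "b 0 = E h x" by (simp add: b_def)
      ultimately show ?thesis by (simp add: C2_def)
    qed
    have part: "partial i u x = D x (axis i 1)" for i x
      using frechet_derivative_at[OF D(1), of x] by (simp add: partial_def)
    have "\<bar>partial i u x\<bar> \<le> C * (M + K)" for i x
    proof -
      let ?e = "axis i 1 :: real^'n"
      have gen: "\<bar>(b - a) - ((c - b) - (b - a)) / 2\<bar> \<le> 4 * M" if "\<bar>a\<bar> \<le> M" "\<bar>b\<bar> \<le> M" "\<bar>c\<bar> \<le> M" for a b c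
      proof (rule abs_leI)
        show "(b - a) - ((c - b) - (b - a)) / 2 \<le> 4 * M" using that by (simp add: abs_le_iff add_divide_distrib diff_divide_distrib)
        show "- ((b - a) - ((c - b) - (b - a)) / 2) \<le> 4 * M" using that by (simp add: abs_le_iff add_divide_distrib diff_divide_distrib)
      qed
      have "\<bar>E ?e x\<bar> \<le> 4 * M"
        unfolding E_def incr_def by (rule gen[OF M M M])
      then have "\<bar>D x ?e\<bar> \<le> 4 * M + C2 * K" using ED[of ?e x] by (simp add: norm_axis_1)
      also have "\<dots> \<le> C * (M + K)"
        using mult_nonneg_nonneg[of C2 M] mult_nonneg_nonneg[of C2 K] C2 M0 K0 by (simp add: C_def algebra_simps)
      finally show ?thesis by (simp add: part)
    qed
    moreover have "\<bar>incr a (incr b (partial i u)) x\<bar> \<le> C * (M + K) * max (norm a) (norm b) powr (\<theta> - 1)" for i a b x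
    proof -
      define m where "m = max (norm a) (norm b)"
      have m0: "0 \<le> m" by (simp add: m_def le_max_iff_disj)
      show ?thesis
      proof (cases "m = 0")
        case True
        then have "a = 0" unfolding m_def by (metis max.cobounded1 norm_le_zero_iff)
        then show ?thesis using True C2 M0 K0 by (simp add: C_def)
      next
        case False
        then have m: "0 < m" using m0 by simp
        let ?e = "axis i 1 :: real^'n"
        \<comment> \<open>The coordinate step gets the length \<open>m\<close> of the larger
          increment: the approximation error and the third differences in \<open>a\<close>,
          \<open>b\<close>, \<open>k\<close> are then both of size \<open>m powr \<theta>\<close>,
          and division by \<open>m\<close> leaves \<open>m powr (\<theta> - 1)\<close>.\<close>
        define k where "k = m *\<^sub>R ?e"
        have nk: "norm k = m" using m by (simp add: k_def norm_axis_1)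
        have Dk: "D y k = m * partial i u y" for y
          using linear_scale[OF has_derivative_linear[OF D(1)], of y m ?e] by (simp add: k_def part)
        define G where "G y = D y k - E k y" for y
        have Gb: "\<bar>G y\<bar> \<le> C2 * K * m powr \<theta>" for y
          using ED[of k y] by (simp add: G_def nk abs_minus_commute)
        define X where "X y = incr a (incr b (incr k u)) y" for y
        have Xb: "\<bar>X y\<bar> \<le> K * m powr \<theta>" for y
        proof -
          have "max (norm a) (max (norm b) (norm k)) = m" unfolding nk by (simp add: m_def)
          then show ?thesis using K[of a b k y] by (simp add: X_def)
        qed
        have "m * incr a (incr b (partial i u)) x = incr a (incr b (\<lambda>y. D y k)) x"
          by (simp add: incr_def Dk algebra_simps)
        also have "\<dots> = (G (x + a + b) - G (x + a) - (G (x + b) - G x)) + (X x - (X (x + k) - X x) / 2)"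
          by (simp add: G_def E_def X_def incr_def algebra_simps add_divide_distrib diff_divide_distrib)
        finally have "\<bar>m * incr a (incr b (partial i u)) x\<bar>
            = \<bar>(G (x + a + b) - G (x + a) - (G (x + b) - G x)) + (X x - (X (x + k) - X x) / 2)\<bar>" by simp
        also have "\<dots> \<le> (4 * C2 + 2) * K * m powr \<theta>"
        proof -
          have gen: "\<bar>(g1 - g2 - (g3 - g4)) + (x1 - (x2 - x1) / 2)\<bar> \<le> 4 * g + 2 * z"
            if "\<bar>g1\<bar> \<le> g" "\<bar>g2\<bar> \<le> g" "\<bar>g3\<bar> \<le> g" "\<bar>g4\<bar> \<le> g" "\<bar>x1\<bar> \<le> z" "\<bar>x2\<bar> \<le> z"
            for g g1 g2 g3 g4 x1 x2 z :: real using that by (simp add: abs_le_iff add_divide_distrib diff_divide_distrib)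
          have "4 * (C2 * K * m powr \<theta>) + 2 * (K * m powr \<theta>) = (4 * C2 + 2) * K * m powr \<theta>"
            by (simp add: algebra_simps)
          then show ?thesis using gen[OF Gb Gb Gb Gb Xb Xb] by simp
        qed
        also have "\<dots> \<le> C * (M + K) * m powr \<theta>"
          using C2 M0 K0 by (intro mult_right_mono mult_mono) (auto simp: C_def)
        also have "\<dots> = m * (C * (M + K) * m powr (\<theta> - 1))"
          using m by (simp add: powr_diff)
        finally show ?thesis using m by (simp add: abs_mult m_def[symmetric])
      qed
    qed
    moreover have "u differentiable at x" for x using D(1) by (rule differentiableI)
    moreover have "continuous_on UNIV (partial i u)" for i
      using D(3) by (simp add: part[abs_def])
    ultimately show ?thesis by blast
  qed
  moreover have "0 < C" using C2 by (simp add: C_def)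
  ultimately show thesis using that by blast
qed

section \<open>Derivative tensors and membership criteria\<close>

lemma tensor_norm_bounds:
  fixes T :: "'n::finite list \<Rightarrow> real"
  assumes "\<And>js. length js = k \<Longrightarrow> \<bar>T js\<bar> \<le> b"
  shows "0 \<le> tensor_norm k T" "tensor_norm k T \<le> real (CARD('n) ^ k) * b"
proof -
  show "0 \<le> tensor_norm k T" by (simp add: tensor_norm_def L2_set_nonneg)
  have c: "card {js :: 'n list. length js = k} = CARD('n) ^ k"
    using card_lists_length_eq[of "UNIV :: 'n set" k] by simp
  have "tensor_norm k T \<le> (\<Sum>js | length js = k. \<bar>T js\<bar>)"
    unfolding tensor_norm_def by (rule L2_set_le_sum_abs)
  also have "\<dots> \<le> real (card {js :: 'n list. length js = k}) * b"
    by (rule sum_bounded_above) (use assms in auto)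
  finally show "tensor_norm k T \<le> real (CARD('n) ^ k) * b" by (simp add: c)
qed

lemma Cnb_norm_le:
  fixes f :: "real^'n \<Rightarrow> real"
  assumes "\<And>js x. length js \<le> n \<Longrightarrow> \<bar>partials js f x\<bar> \<le> b"
  shows "Cnb_norm n f \<le> (\<Sum>k\<le>n. real (CARD('n) ^ k)) * b"
  unfolding Cnb_norm_def sum_distrib_right
proof (rule sum_mono)
  fix k assume "k \<in> {..n}"
  then show "(SUP x. tensor_norm k (\<lambda>js. partials js f x)) \<le> real (CARD('n) ^ k) * b"
    by (intro cSUP_least tensor_norm_bounds(2)) (use assms in auto)
qed

lemma hoelder_spaceI:
  fixes f :: "real^'n \<Rightarrow> real"
  assumes n: "n = nat \<lfloor>\<theta>\<rfloor>" and f: "f \<in> Cnb n" and b: "\<And>js x. length js \<le> n \<Longrightarrow> \<bar>partials js f x\<bar> \<le> b"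
    and h: "\<And>js x h. length js = n \<Longrightarrow> \<bar>partials js f (x + h) - partials js f x\<bar> \<le> b * norm h powr frac \<theta>"
  shows "f \<in> hoelder_space \<theta> \<and> hoelder_norm \<theta> f \<le> ((\<Sum>k\<le>n. real (CARD('n) ^ k)) + real (CARD('n) ^ n)) * b"
proof -
  have q: "hoelder_quot n (frac \<theta>) f p \<le> real (CARD('n) ^ n) * b" if p: "p \<in> UNIV \<times> (- {0})" for p
  proof -
    obtain x k where xk: "p = (x, k)" "k \<noteq> 0" using p by (cases p) auto
    have "tensor_norm n (\<lambda>js. partials js f (x + k) - partials js f x) \<le> real (CARD('n) ^ n) * (b * norm k powr frac \<theta>)"
      by (rule tensor_norm_bounds(2)[OF h])
    then show ?thesis using xk by (simp add: hoelder_quot_def divide_le_eq mult.assoc)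
  qed
  then have "bdd_above (hoelder_quot n (frac \<theta>) f ` (UNIV \<times> (- {0})))" by (auto intro!: bdd_aboveI2)
  moreover have "(SUP p\<in>UNIV \<times> (- {0}). hoelder_quot n (frac \<theta>) f p) \<le> real (CARD('n) ^ n) * b"
  proof (rule cSUP_least)
    obtain e :: "real^'n" where "norm e = 1" using vector_choose_size[of 1] by auto
    then have "(0, e) \<in> UNIV \<times> (- {0::real^'n})" by auto
    then show "UNIV \<times> (- {0::real^'n}) \<noteq> ({} :: ((real^'n) \<times> (real^'n)) set)" by blast
  qed (rule q)
  ultimately show ?thesis
    using f Cnb_norm_le[of n f b] b by (simp add: hoelder_space_def hoelder_norm_def n[symmetric] distrib_right add_mono)
qed

lemma zygmund_spaceI:
  fixes f :: "real^'n \<Rightarrow> real"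
  assumes n: "n = k - 1" and f: "f \<in> Cnb n" and b: "\<And>js x. length js \<le> n \<Longrightarrow> \<bar>partials js f x\<bar> \<le> b"
    and h: "\<And>js x h. length js = n \<Longrightarrow> \<bar>incr h (incr h (partials js f)) x\<bar> \<le> b * norm h"
  shows "f \<in> zygmund_space k \<and> zygmund_norm k f \<le> ((\<Sum>j\<le>n. real (CARD('n) ^ j)) + real (CARD('n) ^ n)) * b"
proof -
  have q: "zygmund_quot n f p \<le> real (CARD('n) ^ n) * b" if p: "p \<in> UNIV \<times> (- {0})" for p
  proof -
    obtain x v where xv: "p = (x, v)" "v \<noteq> 0" using p by (cases p) auto
    have "\<bar>partials js f (x + 2 *\<^sub>R v) - 2 * partials js f (x + v) + partials js f x\<bar> \<le> b * norm v" if "length js = n" for js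
      using h[OF that, of v x] by (simp add: incr_def scaleR_2 add.assoc)
    then have "tensor_norm n (\<lambda>js. partials js f (x + 2 *\<^sub>R v) - 2 * partials js f (x + v) + partials js f x) \<le> real (CARD('n) ^ n) * (b * norm v)"
      by (rule tensor_norm_bounds(2))
    then show ?thesis using xv by (simp add: zygmund_quot_def divide_le_eq mult.assoc)
  qed
  then have "bdd_above (zygmund_quot n f ` (UNIV \<times> (- {0})))" by (auto intro!: bdd_aboveI2)
  moreover have "(SUP p\<in>UNIV \<times> (- {0}). zygmund_quot n f p) \<le> real (CARD('n) ^ n) * b"
  proof (rule cSUP_least)
    obtain e :: "real^'n" where "norm e = 1" using vector_choose_size[of 1] by auto
    then have "(0, e) \<in> UNIV \<times> (- {0::real^'n})" by auto
    then show "UNIV \<times> (- {0::real^'n}) \<noteq> ({} :: ((real^'n) \<times> (real^'n)) set)" by blast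
  qed (rule q)
  ultimately show ?thesis
    using f Cnb_norm_le[of n f b] b
    unfolding zygmund_space_def zygmund_norm_def n[symmetric] by (simp add: distrib_right add_mono)
qed

lemma CnbI:
  assumes "\<And>js. length js \<le> n \<Longrightarrow> continuous_on UNIV (partials js f)"
    "\<And>js x. length js \<le> n \<Longrightarrow> \<bar>partials js f x\<bar> \<le> b"
    "\<And>js x. length js < n \<Longrightarrow> partials js f differentiable at x"
  shows "f \<in> Cnb n"
  using assms by (auto simp: Cnb_def bounded_iff)

text \<open>\<open>regularity_step\<close> is applied once for every positive integer strictly below
  \<theta>; below or at 1, second differences come from \<open>marchaud_second\<close> instead. What
  is left is a second difference estimate with an exponent in (0, 1]: exponent 1 is the Zygmund
  condition, and a smaller one becomes a Hoelder condition by \<open>marchaud_first\<close>.\<close>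

theorem third_difference_regularity:
  fixes \<theta> :: real
  assumes \<theta>: "0 < \<theta>" "\<theta> < 3"
  obtains C where "C > 0" "\<And>(u :: real^'n \<Rightarrow> real) M K. continuous_on UNIV u \<Longrightarrow> (\<And>x. \<bar>u x\<bar> \<le> M) \<Longrightarrow> 0 \<le> K \<Longrightarrow>
      (\<And>a b c x. \<bar>incr a (incr b (incr c u)) x\<bar> \<le> K * max (norm a) (max (norm b) (norm c)) powr \<theta>) \<Longrightarrow>
      (\<theta> \<notin> {1, 2} \<longrightarrow> u \<in> hoelder_space \<theta> \<and> hoelder_norm \<theta> u \<le> C * (M + K)) \<and>
      (\<forall>k::nat. \<theta> = real k \<longrightarrow> u \<in> zygmund_space k \<and> zygmund_norm k u \<le> C * (M + K))"
proof -
  consider "\<theta> < 1" | "\<theta> = 1" | "1 < \<theta>" "\<theta> < 2" | "\<theta> = 2" | "2 < \<theta>" by linarith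
  then show thesis
  proof cases
    case 1
    define A where "A = 4 / (4 - 2 powr \<theta>)"
    define B where "B = A / (2 - 2 powr \<theta>)"
    have "2 powr \<theta> < (2::real) powr 1" using 1 by (intro powr_less_mono) auto
    then have AB: "0 < A" "0 < B" by (auto simp: A_def B_def)
    have n: "0 = nat \<lfloor>\<theta>\<rfloor>" using 1 \<theta> by (simp add: floor_eq_iff)
    have fr: "frac \<theta> = \<theta>" using 1 \<theta> by (simp add: frac_eq)
    show thesis
    proof (rule that[of "2 * (1 + B)"])
      show "0 < 2 * (1 + B)" using AB by simp
      fix u :: "real^'n \<Rightarrow> real" and M K
      assume u: "continuous_on UNIV u" and M: "\<And>x. \<bar>u x\<bar> \<le> M" and K0: "0 \<le> K"
        and K: "\<And>a b c x. \<bar>incr a (incr b (incr c u)) x\<bar> \<le> K * max (norm a) (max (norm b) (norm c)) powr \<theta>"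
      have M0: "0 \<le> M" using M[of 0] by simp
      have "\<bar>incr h (incr h u) x\<bar> \<le> A * K * norm h powr \<theta>" for h x
        using marchaud_second[of \<theta> K u M h x] K[of h h h for h] M K0 1 by (simp add: A_def)
      then have inc: "\<bar>incr h u x\<bar> \<le> B * K * norm h powr \<theta>" for h x
        using marchaud_first[of \<theta> "A * K" u M h x] M K0 1 AB by (simp add: B_def)
      let ?b = "(1 + B) * (M + K)"
      have b: "M \<le> ?b" "B * K \<le> ?b" using AB M0 K0 by (simp_all add: algebra_simps add_increasing2 add_increasing)
      have ub: "\<bar>partials js u x\<bar> \<le> ?b" if "length js \<le> 0" for js x
        using that order_trans[OF M b(1)] by simp
      have "u \<in> hoelder_space \<theta> \<and> hoelder_norm \<theta> u \<le> ((\<Sum>k\<le>0. real (CARD('n) ^ k)) + real (CARD('n) ^ 0)) * ?b"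
      proof (rule hoelder_spaceI[OF n _ ub])
        show "u \<in> Cnb 0" by (rule CnbI[OF _ ub]) (use u in auto)
        fix js :: "'n list" and x h :: "real^'n" assume "length js = 0"
        then show "\<bar>partials js u (x + h) - partials js u x\<bar> \<le> ?b * norm h powr frac \<theta>"
          using order_trans[OF inc[of h x] mult_right_mono[OF b(2), of "norm h powr \<theta>"]] by (simp add: incr_def fr)
      qed auto
      moreover have "((\<Sum>k\<le>0. real (CARD('n) ^ k)) + real (CARD('n) ^ 0)) * ?b = 2 * (1 + B) * (M + K)" by simp
      moreover have "\<theta> \<noteq> real k" for k using 1 \<theta> by (cases k) auto
      ultimately show "(\<theta> \<notin> {1, 2} \<longrightarrow> u \<in> hoelder_space \<theta> \<and> hoelder_norm \<theta> u \<le> 2 * (1 + B) * (M + K)) \<and>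
        (\<forall>k::nat. \<theta> = real k \<longrightarrow> u \<in> zygmund_space k \<and> zygmund_norm k u \<le> 2 * (1 + B) * (M + K))"
        by metis
    qed
  next
    case 2
    show thesis
    proof (rule that[of 4])
      fix u :: "real^'n \<Rightarrow> real" and M K
      assume u: "continuous_on UNIV u" and M: "\<And>x. \<bar>u x\<bar> \<le> M" and K0: "0 \<le> K"
        and K: "\<And>a b c x. \<bar>incr a (incr b (incr c u)) x\<bar> \<le> K * max (norm a) (max (norm b) (norm c)) powr \<theta>"
      have M0: "0 \<le> M" using M[of 0] by simp
      have inc: "\<bar>incr h (incr h u) x\<bar> \<le> 2 * K * norm h" for h x
        using marchaud_second[of 1 K u M h x] K[of h h h for h] M K0 2 by simp
      let ?b = "2 * (M + K)"
      have ub: "\<bar>partials js u x\<bar> \<le> ?b" if "length js \<le> 0" for js x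
        using that M[of x] K0 M0 by simp
      have "u \<in> zygmund_space 1 \<and> zygmund_norm 1 u \<le> ((\<Sum>k\<le>0. real (CARD('n) ^ k)) + real (CARD('n) ^ 0)) * ?b"
      proof (rule zygmund_spaceI[OF _ _ ub])
        show "u \<in> Cnb 0" by (rule CnbI[OF _ ub]) (use u in auto)
        fix js :: "'n list" and x h :: "real^'n" assume "length js = 0"
        moreover have "2 * K * norm h \<le> ?b * norm h" using M0 by (intro mult_right_mono) auto
        ultimately show "\<bar>incr h (incr h (partials js u)) x\<bar> \<le> ?b * norm h"
          using inc[of h x] by simp
      qed auto
      moreover have "k = 1" if "\<theta> = real k" for k using that 2 by simp
      ultimately show "(\<theta> \<notin> {1, 2} \<longrightarrow> u \<in> hoelder_space \<theta> \<and> hoelder_norm \<theta> u \<le> 4 * (M + K)) \<and>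
        (\<forall>k::nat. \<theta> = real k \<longrightarrow> u \<in> zygmund_space k \<and> zygmund_norm k u \<le> 4 * (M + K))"
        using 2 by (auto simp: algebra_simps)
    qed simp
  next
    case 3
    obtain C0 where C0: "C0 > 0" "\<And>(u :: real^'n \<Rightarrow> real) M K. (\<And>x. \<bar>u x\<bar> \<le> M) \<Longrightarrow> 0 \<le> K \<Longrightarrow>
      (\<And>a b c x. \<bar>incr a (incr b (incr c u)) x\<bar> \<le> K * max (norm a) (max (norm b) (norm c)) powr \<theta>) \<Longrightarrow>
      (\<forall>x. u differentiable at x) \<and> (\<forall>i. continuous_on UNIV (partial i u) \<and>
         (\<forall>x. \<bar>partial i u x\<bar> \<le> C0 * (M + K)) \<and>
         (\<forall>a b x. \<bar>incr a (incr b (partial i u)) x\<bar> \<le> C0 * (M + K) * max (norm a) (norm b) powr (\<theta> - 1)))"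
      using regularity_step[where 'n='n, OF 3(1) \<theta>(2)] by blast
    define B where "B = C0 / (2 - 2 powr (\<theta> - 1))"
    have "2 powr (\<theta> - 1) < (2::real) powr 1" using 3 by (intro powr_less_mono) auto
    then have B: "0 < B" using C0 by (simp add: B_def)
    have "\<lfloor>\<theta>\<rfloor> = 1" using 3 by (simp add: floor_eq_iff)
    then have n: "1 = nat \<lfloor>\<theta>\<rfloor>" by simp
    have fr: "frac \<theta> = \<theta> - 1" using 3 by (simp add: frac_unique_iff)
    have l1: "js = [] \<or> (\<exists>i. js = [i])" if "length js \<le> 1" for js :: "'n list"
      using that by (cases js) auto
    let ?c = "((\<Sum>k\<le>1. real (CARD('n) ^ k)) + real (CARD('n) ^ 1)) * (1 + C0 + B)"
    show thesis
    proof (rule that[of ?c])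
      show "0 < ?c" using C0 B by (intro mult_pos_pos add_nonneg_pos sum_nonneg) auto
      fix u :: "real^'n \<Rightarrow> real" and M K
      assume u: "continuous_on UNIV u" and M: "\<And>x. \<bar>u x\<bar> \<le> M" and K0: "0 \<le> K"
        and K: "\<And>a b c x. \<bar>incr a (incr b (incr c u)) x\<bar> \<le> K * max (norm a) (max (norm b) (norm c)) powr \<theta>"
      have M0: "0 \<le> M" using M[of 0] by simp
      note step = C0(2)[of u, OF M K0 K]
      let ?b = "(1 + C0 + B) * (M + K)"
      have b: "M \<le> ?b" "C0 * (M + K) \<le> ?b" "B * (M + K) \<le> ?b"
        using C0 B M0 K0 by (simp_all add: algebra_simps add_nonneg_nonneg add_increasing)
      have inc: "\<bar>incr h (partial i u) x\<bar> \<le> B * (M + K) * norm h powr (\<theta> - 1)" for i h x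
      proof -
        have th1: "\<theta> - 1 < 1" using 3 by simp
        have "\<bar>incr h (incr h (partial i u)) x\<bar> \<le> C0 * (M + K) * norm h powr (\<theta> - 1)" for h x
        proof -
          have "\<bar>incr h (incr h (partial i u)) x\<bar> \<le> C0 * (M + K) * max (norm h) (norm h) powr (\<theta> - 1)" using step by blast
          then show ?thesis by simp
        qed
        moreover have "\<bar>partial i u x\<bar> \<le> C0 * (M + K)" for x using step by blast
        moreover have "0 \<le> C0 * (M + K)" using C0 M0 K0 by simp
        ultimately have "\<bar>incr h (partial i u) x\<bar> \<le> C0 * (M + K) / (2 - 2 powr (\<theta> - 1)) * norm h powr (\<theta> - 1)"
          using marchaud_first[of "\<theta> - 1" "C0 * (M + K)" "partial i u" "C0 * (M + K)" h x] th1 by blast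
        then show ?thesis by (simp add: B_def)
      qed
      have ub: "\<bar>partials js u x\<bar> \<le> ?b" if "length js \<le> 1" for js x
        using l1[OF that] order_trans[OF M b(1)] order_trans[OF _ b(2)] step by auto
      have "u \<in> hoelder_space \<theta> \<and> hoelder_norm \<theta> u \<le> ((\<Sum>k\<le>1. real (CARD('n) ^ k)) + real (CARD('n) ^ 1)) * ?b"
      proof (rule hoelder_spaceI[OF n _ ub])
        show "u \<in> Cnb 1" by (rule CnbI[OF _ ub]) (use u step l1 in fastforce)+
        fix js :: "'n list" and x h :: "real^'n" assume "length js = 1"
        then obtain i where "js = [i]" using l1[of js] by auto
        then show "\<bar>partials js u (x + h) - partials js u x\<bar> \<le> ?b * norm h powr frac \<theta>"
          using order_trans[OF inc[of h i x] mult_right_mono[OF b(3), of "norm h powr (\<theta> - 1)"]] by (simp add: incr_def fr)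
      qed
      moreover have "\<theta> \<noteq> real k" for k
      proof
        assume "\<theta> = real k"
        then have "1 < k" "k < 2" using 3 by auto
        then show False by simp
      qed
      ultimately show "(\<theta> \<notin> {1, 2} \<longrightarrow> u \<in> hoelder_space \<theta> \<and> hoelder_norm \<theta> u \<le> ?c * (M + K)) \<and>
        (\<forall>k::nat. \<theta> = real k \<longrightarrow> u \<in> zygmund_space k \<and> zygmund_norm k u \<le> ?c * (M + K))"
        by (metis mult.assoc)
    qed
  next
    case 4
    obtain C0 where C0: "C0 > 0" "\<And>(u :: real^'n \<Rightarrow> real) M K. (\<And>x. \<bar>u x\<bar> \<le> M) \<Longrightarrow> 0 \<le> K \<Longrightarrow>
      (\<And>a b c x. \<bar>incr a (incr b (incr c u)) x\<bar> \<le> K * max (norm a) (max (norm b) (norm c)) powr \<theta>) \<Longrightarrow>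
      (\<forall>x. u differentiable at x) \<and> (\<forall>i. continuous_on UNIV (partial i u) \<and>
         (\<forall>x. \<bar>partial i u x\<bar> \<le> C0 * (M + K)) \<and>
         (\<forall>a b x. \<bar>incr a (incr b (partial i u)) x\<bar> \<le> C0 * (M + K) * max (norm a) (norm b) powr (\<theta> - 1)))"
      using regularity_step[where 'n='n, OF _ \<theta>(2)] 4 by (metis one_less_numeral_iff semiring_norm(76))
    have l1: "js = [] \<or> (\<exists>i. js = [i])" if "length js \<le> 1" for js :: "'n list"
      using that by (cases js) auto
    let ?c = "((\<Sum>k\<le>1. real (CARD('n) ^ k)) + real (CARD('n) ^ 1)) * (1 + C0)"
    show thesis
    proof (rule that[of ?c])
      show "0 < ?c" using C0 by (intro mult_pos_pos add_nonneg_pos sum_nonneg) auto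
      fix u :: "real^'n \<Rightarrow> real" and M K
      assume u: "continuous_on UNIV u" and M: "\<And>x. \<bar>u x\<bar> \<le> M" and K0: "0 \<le> K"
        and K: "\<And>a b c x. \<bar>incr a (incr b (incr c u)) x\<bar> \<le> K * max (norm a) (max (norm b) (norm c)) powr \<theta>"
      have M0: "0 \<le> M" using M[of 0] by simp
      note step = C0(2)[of u, OF M K0 K]
      let ?b = "(1 + C0) * (M + K)"
      have b: "M \<le> ?b" "C0 * (M + K) \<le> ?b"
        using C0 M0 K0 by (simp_all add: algebra_simps add_nonneg_nonneg add_increasing)
      have ub: "\<bar>partials js u x\<bar> \<le> ?b" if "length js \<le> 1" for js x
        using l1[OF that] order_trans[OF M b(1)] order_trans[OF _ b(2)] step by auto
      have "u \<in> zygmund_space 2 \<and> zygmund_norm 2 u \<le> ((\<Sum>k\<le>1. real (CARD('n) ^ k)) + real (CARD('n) ^ 1)) * ?b"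
      proof (rule zygmund_spaceI[OF _ _ ub])
        show "u \<in> Cnb 1" by (rule CnbI[OF _ ub]) (use u step l1 in fastforce)+
        fix js :: "'n list" and x h :: "real^'n" assume "length js = 1"
        then obtain i where i: "js = [i]" using l1[of js] by auto
        have "\<bar>incr h (incr h (partial i u)) x\<bar> \<le> C0 * (M + K) * max (norm h) (norm h) powr (\<theta> - 1)"
          using step by blast
        also have "\<dots> = C0 * (M + K) * norm h" using 4 by simp
        also have "\<dots> \<le> ?b * norm h" using b(2) by (rule mult_right_mono) simp
        finally show "\<bar>incr h (incr h (partials js u)) x\<bar> \<le> ?b * norm h" using i by simp
      qed auto
      moreover have "k = 2" if "\<theta> = real k" for k using that 4 by simp
      ultimately show "(\<theta> \<notin> {1, 2} \<longrightarrow> u \<in> hoelder_space \<theta> \<and> hoelder_norm \<theta> u \<le> ?c * (M + K)) \<and>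
        (\<forall>k::nat. \<theta> = real k \<longrightarrow> u \<in> zygmund_space k \<and> zygmund_norm k u \<le> ?c * (M + K))"
        using 4 by (metis insertCI mult.assoc)
    qed
  next
    case 5
    have \<theta>1: "1 < \<theta>" "1 < \<theta> - 1" "\<theta> - 1 < 3" using 5 \<theta> by auto
    obtain C0 where C0: "C0 > 0" "\<And>(u :: real^'n \<Rightarrow> real) M K. (\<And>x. \<bar>u x\<bar> \<le> M) \<Longrightarrow> 0 \<le> K \<Longrightarrow>
      (\<And>a b c x. \<bar>incr a (incr b (incr c u)) x\<bar> \<le> K * max (norm a) (max (norm b) (norm c)) powr \<theta>) \<Longrightarrow>
      (\<forall>x. u differentiable at x) \<and> (\<forall>i. continuous_on UNIV (partial i u) \<and>
         (\<forall>x. \<bar>partial i u x\<bar> \<le> C0 * (M + K)) \<and>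
         (\<forall>a b x. \<bar>incr a (incr b (partial i u)) x\<bar> \<le> C0 * (M + K) * max (norm a) (norm b) powr (\<theta> - 1)))"
      using regularity_step[where 'n='n, OF \<theta>1(1) \<theta>(2)] by blast
    obtain C1 where C1: "C1 > 0" "\<And>(u :: real^'n \<Rightarrow> real) M K. (\<And>x. \<bar>u x\<bar> \<le> M) \<Longrightarrow> 0 \<le> K \<Longrightarrow>
      (\<And>a b c x. \<bar>incr a (incr b (incr c u)) x\<bar> \<le> K * max (norm a) (max (norm b) (norm c)) powr (\<theta> - 1)) \<Longrightarrow>
      (\<forall>x. u differentiable at x) \<and> (\<forall>i. continuous_on UNIV (partial i u) \<and>
         (\<forall>x. \<bar>partial i u x\<bar> \<le> C1 * (M + K)) \<and>
         (\<forall>a b x. \<bar>incr a (incr b (partial i u)) x\<bar> \<le> C1 * (M + K) * max (norm a) (norm b) powr (\<theta> - 1 - 1)))"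
      using regularity_step[where 'n='n, OF \<theta>1(2) \<theta>1(3)] by blast
    \<comment> \<open>A partial derivative enters the second step with bound
      \<open>C0 * (M + K)\<close> and, its third differences being differences of two second
      differences, with third difference constant \<open>2 * C0 * (M + K)\<close>.\<close>
    define C2 where "C2 = C1 * (C0 + 2 * C0)"
    define B where "B = C2 / (2 - 2 powr (\<theta> - 1 - 1))"
    have C2: "0 < C2" using C0 C1 by (simp add: C2_def)
    have "2 powr (\<theta> - 1 - 1) < (2::real) powr 1" using \<theta> by (intro powr_less_mono) auto
    then have B: "0 < B" using C2 by (simp add: B_def)
    have "\<lfloor>\<theta>\<rfloor> = 2" using 5 \<theta> by (simp add: floor_eq_iff)
    then have n: "2 = nat \<lfloor>\<theta>\<rfloor>" by simp
    have fr: "frac \<theta> = \<theta> - 1 - 1" using 5 \<theta> by (simp add: frac_unique_iff)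
    have l2: "js = [] \<or> (\<exists>i. js = [i]) \<or> (\<exists>i j. js = [i, j])" if "length js \<le> 2" for js :: "'n list"
      using that by (cases js; cases "tl js") auto
    let ?c = "((\<Sum>k\<le>2. real (CARD('n) ^ k)) + real (CARD('n) ^ 2)) * (1 + C0 + C2 + B)"
    show thesis
    proof (rule that[of ?c])
      show "0 < ?c" using C0 C2 B by (intro mult_pos_pos add_nonneg_pos sum_nonneg) auto
      fix u :: "real^'n \<Rightarrow> real" and M K
      assume u: "continuous_on UNIV u" and M: "\<And>x. \<bar>u x\<bar> \<le> M" and K0: "0 \<le> K"
        and K: "\<And>a b c x. \<bar>incr a (incr b (incr c u)) x\<bar> \<le> K * max (norm a) (max (norm b) (norm c)) powr \<theta>"
      have M0: "0 \<le> M" using M[of 0] by simp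
      note step = C0(2)[of u, OF M K0 K]
      have step2: "(\<forall>x. partial i u differentiable at x) \<and> (\<forall>j. continuous_on UNIV (partial j (partial i u)) \<and>
         (\<forall>x. \<bar>partial j (partial i u) x\<bar> \<le> C2 * (M + K)) \<and>
         (\<forall>a b x. \<bar>incr a (incr b (partial j (partial i u))) x\<bar> \<le> C2 * (M + K) * max (norm a) (norm b) powr (\<theta> - 1 - 1)))" for i
      proof -
        let ?v = "partial i u" and ?K = "C0 * (M + K)"
        have K0': "0 \<le> ?K" using C0 M0 K0 by simp
        have third: "\<bar>incr a (incr b (incr c ?v)) x\<bar> \<le> 2 * ?K * max (norm a) (max (norm b) (norm c)) powr (\<theta> - 1)" for a b c x
        proof -
          have "\<bar>incr b (incr c ?v) y\<bar> \<le> ?K * max (norm a) (max (norm b) (norm c)) powr (\<theta> - 1)" for y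
          proof -
            have "\<bar>incr b (incr c ?v) y\<bar> \<le> ?K * max (norm b) (norm c) powr (\<theta> - 1)" using step by blast
            also have "\<dots> \<le> ?K * max (norm a) (max (norm b) (norm c)) powr (\<theta> - 1)"
              using \<theta>1 K0' by (intro mult_left_mono powr_mono2) (auto simp: le_max_iff_disj)
            finally show ?thesis .
          qed
          from this[of x] this[of "x + a"] show ?thesis unfolding incr_def[of a] by linarith
        qed
        have "C1 * (?K + 2 * ?K) = C2 * (M + K)" by (simp add: C2_def algebra_simps)
        moreover have "0 \<le> 2 * ?K" using K0' by simp
        moreover have "\<bar>?v x\<bar> \<le> ?K" for x using step by blast
        ultimately show ?thesis using C1(2)[of ?v ?K "2 * ?K", OF _ _ third] by metis
      qed
      let ?b = "(1 + C0 + C2 + B) * (M + K)"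
      have b: "M \<le> ?b" "C0 * (M + K) \<le> ?b" "C2 * (M + K) \<le> ?b" "B * (M + K) \<le> ?b"
      proof -
        have z: "0 \<le> C0 * (M + K)" "0 \<le> C2 * (M + K)" "0 \<le> B * (M + K)" using C0 C2 B M0 K0 by auto
        have "?b = M + K + C0 * (M + K) + C2 * (M + K) + B * (M + K)" by (simp add: distrib_right)
        then show "M \<le> ?b" "C0 * (M + K) \<le> ?b" "C2 * (M + K) \<le> ?b" "B * (M + K) \<le> ?b"
          using z M0 K0 by linarith+
      qed
      have inc: "\<bar>incr h (partial j (partial i u)) x\<bar> \<le> B * (M + K) * norm h powr (\<theta> - 1 - 1)" for i j h x
      proof -
        have th1: "\<theta> - 1 - 1 < 1" using \<theta> by simp
        have "\<bar>incr h (incr h (partial j (partial i u))) x\<bar> \<le> C2 * (M + K) * norm h powr (\<theta> - 1 - 1)" for h x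
        proof -
          have "\<bar>incr h (incr h (partial j (partial i u))) x\<bar> \<le> C2 * (M + K) * max (norm h) (norm h) powr (\<theta> - 1 - 1)" using step2 by blast
          then show ?thesis by simp
        qed
        moreover have "\<bar>partial j (partial i u) x\<bar> \<le> C2 * (M + K)" for x using step2 by blast
        moreover have "0 \<le> C2 * (M + K)" using C2 M0 K0 by simp
        ultimately have "\<bar>incr h (partial j (partial i u)) x\<bar> \<le> C2 * (M + K) / (2 - 2 powr (\<theta> - 1 - 1)) * norm h powr (\<theta> - 1 - 1)"
          using marchaud_first[of "\<theta> - 1 - 1" "C2 * (M + K)" "partial j (partial i u)" "C2 * (M + K)" h x] th1 by blast
        then show ?thesis by (simp add: B_def)
      qed
      have ub: "\<bar>partials js u x\<bar> \<le> ?b" if "length js \<le> 2" for js x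
        using l2[OF that] order_trans[OF M b(1)] order_trans[OF _ b(2)] order_trans[OF _ b(3)] step step2 by auto
      have "u \<in> hoelder_space \<theta> \<and> hoelder_norm \<theta> u \<le> ((\<Sum>k\<le>2. real (CARD('n) ^ k)) + real (CARD('n) ^ 2)) * ?b"
      proof (rule hoelder_spaceI[OF n _ ub])
        show "u \<in> Cnb 2"
        proof (rule CnbI[OF _ ub])
          fix js :: "'n list" assume "length js \<le> 2"
          from l2[OF this] show "continuous_on UNIV (partials js u)" using u step step2 by auto
        next
          fix js :: "'n list" and x assume js: "length js < 2"
          then have "length js \<le> 2" by simp
          from l2[OF this] js show "partials js u differentiable at x" using step step2 by auto
        qed
        fix js :: "'n list" and x h :: "real^'n" assume "length js = 2"
        then obtain i j where "js = [j, i]" using l2[of js] by auto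
        then show "\<bar>partials js u (x + h) - partials js u x\<bar> \<le> ?b * norm h powr frac \<theta>"
          using order_trans[OF inc[of h j i x] mult_right_mono[OF b(4), of "norm h powr (\<theta> - 1 - 1)"]] unfolding fr by (simp add: incr_def)
      qed
      moreover have "\<theta> \<noteq> real k" for k
      proof
        assume "\<theta> = real k"
        then have "2 < k" "k < 3" using 5 \<theta> by auto
        then show False by simp
      qed
      ultimately show "(\<theta> \<notin> {1, 2} \<longrightarrow> u \<in> hoelder_space \<theta> \<and> hoelder_norm \<theta> u \<le> ?c * (M + K)) \<and>
        (\<forall>k::nat. \<theta> = real k \<longrightarrow> u \<in> zygmund_space k \<and> zygmund_norm k u \<le> ?c * (M + K))"
        by (metis mult.assoc)
    qed
  qed
qed

section \<open>Third differences along the semigroup\<close>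

lemma continuous_incr:
  fixes f :: "'a::real_normed_vector \<Rightarrow> real"
  assumes "continuous_on UNIV f"
  shows "continuous_on UNIV (incr h f)"
proof -
  have "continuous_on UNIV (\<lambda>x. x + h)" by (intro continuous_intros)
  then have "continuous_on UNIV (\<lambda>x. f (x + h))" by (rule continuous_on_compose2[OF assms]) simp
  then show ?thesis unfolding incr_def[abs_def] using assms by (rule continuous_on_diff)
qed

lemma incr_bound:
  assumes "\<And>x. \<bar>f x\<bar> \<le> S"
  shows "\<bar>incr h f x\<bar> \<le> 2 * S"
  using assms[of x] assms[of "x + h"] unfolding incr_def by linarith

lemma incr_integral:
  assumes "\<And>x. set_integrable lborel W (\<lambda>t. e t * (G t x :: real))"
  shows "set_integrable lborel W (\<lambda>t. e t * incr h (G t) x)"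
    "incr h (\<lambda>x. LINT t:W|lborel. e t * G t x) = (\<lambda>x. LINT t:W|lborel. e t * incr h (G t) x)"
  unfolding incr_def right_diff_distrib
  by (rule set_integral_diff[OF assms assms]) (rule ext, rule set_integral_diff(2)[OF assms assms, symmetric])

text \<open>The infimum of the cones of slope \<open>L\<close> placed on the graph of
  \<open>f\<close> is Lipschitz and lies below \<open>f\<close>; the hypothesis says precisely that
  no cone dips more than \<open>D\<close> below \<open>f\<close>.\<close>

lemma inf_convolution:
  fixes f :: "'a::real_normed_vector \<Rightarrow> real"
  assumes L: "0 \<le> L" and low: "\<And>x y. f x - D \<le> f y + L * norm (x - y)"
  obtains g where "\<And>x. g x \<le> f x" "\<And>x. f x - D \<le> g x" "\<And>x y. \<bar>g x - g y\<bar> \<le> L * norm (x - y)"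
proof -
  define g where "g x = (INF y. f y + L * norm (x - y))" for x
  have bdd: "bdd_below (range (\<lambda>y. f y + L * norm (x - y)))" for x
    by (rule bdd_belowI[of _ "f x - D"]) (use low in auto)
  have le: "g x \<le> f y + L * norm (x - y)" for x y
    unfolding g_def by (rule cINF_lower[OF bdd]) simp
  have lip: "g x - L * norm (x - y) \<le> g y" for x y
    unfolding g_def[of y]
  proof (rule cINF_greatest)
    fix z
    have "L * norm (x - z) \<le> L * (norm (x - y) + norm (y - z))"
      using norm_triangle_ineq[of "x - y" "y - z"] L by (intro mult_left_mono) auto
    then show "g x - L * norm (x - y) \<le> f z + L * norm (y - z)"
      using le[of x z] by (simp add: distrib_left)
  qed simp
  have "\<bar>g x - g y\<bar> \<le> L * norm (x - y)" for x y
    using lip[of x y] lip[of y x] by (simp add: norm_minus_commute abs_le_iff)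
  moreover have "g x \<le> f x" for x using le[of x x] by simp
  moreover have "f x - D \<le> g x" for x
    unfolding g_def by (rule cINF_greatest) (use low in auto)
  ultimately show thesis using that by blast
qed

context ou
begin

lemma incr_P:
  assumes "0 \<le> t" "continuous_on UNIV f" "\<And>y. \<bar>f y\<bar> \<le> S"
  shows "incr h (P t f) = P t (incr (flow t h) f)"
  unfolding incr_def[abs_def]
  using P_translate[OF assms(1) borel_measurable_continuous_onI[OF assms(2)] assms(3)] by auto

text \<open>With \<open>\<epsilon> = t powr (1 / (2 * s))\<close> the remainder \<open>f - g\<close>
  has size \<open>\<epsilon> powr \<alpha>\<close> and is smoothed at cost
  \<open>1 / \<epsilon>\<close>, while \<open>g\<close> has slope
  \<open>\<epsilon> powr (\<alpha> - 1)\<close> and is merely transported; up to constants both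
  contributions are \<open>\<epsilon> powr (\<alpha> - 1)\<close>.\<close>

lemma P_hoelder_increment:
  assumes \<alpha>: "0 \<le> \<alpha>" "\<alpha> < 1"
  obtains C where "C > 0" "\<And>t h f F x. 0 < t \<Longrightarrow> t \<le> 1 \<Longrightarrow> continuous_on UNIV f \<Longrightarrow> (\<And>y. \<bar>f y\<bar> \<le> F) \<Longrightarrow>
    (\<And>y z. \<bar>f y - f z\<bar> \<le> 2 * F * norm (y - z) powr \<alpha>) \<Longrightarrow>
    \<bar>P t f (x + h) - P t f x\<bar> \<le> C * norm h * t powr ((\<alpha> - 1) / (2 * s)) * F"
proof -
  obtain K where K: "K > 0" "\<And>t h f S x. 0 < t \<Longrightarrow> t \<le> 1 \<Longrightarrow> continuous_on UNIV f \<Longrightarrow> (\<And>y. \<bar>f y\<bar> \<le> S) \<Longrightarrow>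
    \<bar>P t f (x + h) - P t f x\<bar> \<le> K * norm h * t powr (- 1 / (2 * s)) * S"
    using smoothing by blast
  define C where "C = 2 * K + 2 * exp \<beta>"
  have "\<bar>P t f (x + h) - P t f x\<bar> \<le> C * norm h * t powr ((\<alpha> - 1) / (2 * s)) * F"
    if t: "0 < t" "t \<le> 1" and f: "continuous_on UNIV f" and F: "\<And>y. \<bar>f y\<bar> \<le> F"
      and H: "\<And>y z. \<bar>f y - f z\<bar> \<le> 2 * F * norm (y - z) powr \<alpha>" for t h f F x
  proof -
    have F0: "0 \<le> F" using F[of 0] by simp
    define \<epsilon> where "\<epsilon> = t powr (1 / (2 * s))"
    have \<epsilon>: "0 < \<epsilon>" "\<epsilon> \<le> 1" using t s by (auto simp: \<epsilon>_def powr_le1)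
    define L where "L = 2 * F * \<epsilon> powr (\<alpha> - 1)"
    define D where "D = 2 * F * \<epsilon> powr \<alpha>"
    have L0: "0 \<le> L" and D0: "0 \<le> D" using F0 by (auto simp: L_def D_def)
    have "\<epsilon> powr \<alpha> \<le> 1" using \<epsilon> \<alpha> by (intro powr_le1) auto
    then have D1: "D \<le> 2 * F" using F0 mult_left_mono[of "\<epsilon> powr \<alpha>" 1 "2 * F"] by (simp add: D_def)
    have low: "f y - D \<le> f z + L * norm (y - z)" for y z
    proof -
      have "norm (y - z) powr \<alpha> \<le> \<epsilon> powr \<alpha> + \<epsilon> powr (\<alpha> - 1) * norm (y - z)"
      proof (cases "norm (y - z) \<le> \<epsilon>")
        case True
        then have "norm (y - z) powr \<alpha> \<le> \<epsilon> powr \<alpha>" using \<alpha> by (intro powr_mono2) auto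
        then show ?thesis by (simp add: add_increasing2)
      next
        case False
        then have r: "\<epsilon> \<le> norm (y - z)" "0 < norm (y - z)" using \<epsilon> by auto
        have "norm (y - z) powr \<alpha> = norm (y - z) powr (\<alpha> - 1) * norm (y - z)"
          using r(2) by (simp add: powr_diff)
        also have "\<dots> \<le> \<epsilon> powr (\<alpha> - 1) * norm (y - z)"
          using r \<epsilon> \<alpha> by (intro mult_right_mono powr_mono2') auto
        finally show ?thesis by (simp add: add_increasing)
      qed
      from mult_left_mono[OF this, of "2 * F"] F0
      have "2 * F * norm (y - z) powr \<alpha> \<le> D + L * norm (y - z)"
        by (simp add: D_def L_def algebra_simps)
      then show ?thesis using H[of y z] by linarith
    qed
    obtain g where g: "\<And>x. g x \<le> f x" "\<And>x. f x - D \<le> g x" "\<And>x y. \<bar>g x - g y\<bar> \<le> L * norm (x - y)"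
      using inf_convolution[of L f D, OF L0 low] by blast
    have "L-lipschitz_on UNIV g"
      by (rule lipschitz_onI) (use g(3) L0 in \<open>auto simp: dist_norm\<close>)
    then have gc: "continuous_on UNIV g" by (rule lipschitz_on_continuous_on)
    have gb: "\<bar>g y\<bar> \<le> 3 * F" for y using g(1,2)[of y] F[of y] D1 unfolding abs_le_iff by linarith
    note mf = borel_measurable_continuous_onI[OF f] and mg = borel_measurable_continuous_onI[OF gc]
    have t0: "0 \<le> t" using t by simp
    have dec: "P t f y = P t (\<lambda>y. f y - g y) y + P t g y" for y
      using P_diff[OF t0 mf F mg gb, of y] by simp
    have fg: "\<bar>f y - g y\<bar> \<le> D" for y using g(1,2)[of y] unfolding abs_le_iff by linarith
    have "\<bar>P t (\<lambda>y. f y - g y) (x + h) - P t (\<lambda>y. f y - g y) x\<bar> \<le> K * norm h * t powr (- 1 / (2 * s)) * D"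
      by (rule K(2)[OF t continuous_on_diff[OF f gc] fg])
    also have "\<dots> = 2 * K * norm h * t powr ((\<alpha> - 1) / (2 * s)) * F"
    proof -
      have "(\<alpha> - 1) / (2 * s) = - 1 / (2 * s) + 1 / (2 * s) * \<alpha>" by (simp add: diff_divide_distrib)
      then have "t powr ((\<alpha> - 1) / (2 * s)) = t powr (- 1 / (2 * s)) * \<epsilon> powr \<alpha>"
        by (simp only: \<epsilon>_def powr_powr powr_add)
      then show ?thesis by (simp add: D_def)
    qed
    finally have 1: "\<bar>P t (\<lambda>y. f y - g y) (x + h) - P t (\<lambda>y. f y - g y) x\<bar> \<le> 2 * K * norm h * t powr ((\<alpha> - 1) / (2 * s)) * F" .
    have "norm (flow t h) \<le> exp \<beta> * norm h"
    proof -
      have "exp (\<bar>t\<bar> * \<beta>) \<le> exp \<beta>" using t \<beta>_nonneg by (simp add: mult_left_le_one_le)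
      then show ?thesis using norm_flow[of t h] mult_right_mono[of "exp (\<bar>t\<bar> * \<beta>)" "exp \<beta>" "norm h"] by simp
    qed
    then have "L * norm (flow t h) \<le> L * (exp \<beta> * norm h)" using L0 by (rule mult_left_mono)
    moreover have "\<bar>g (y + flow t h) - g y\<bar> \<le> L * norm (flow t h)" for y using g(3)[of "y + flow t h" y] by simp
    ultimately have "\<bar>g (y + flow t h) - g y\<bar> \<le> L * (exp \<beta> * norm h)" for y by (rule order_trans[rotated])
    then have "\<bar>P t g (x + h) - P t g x\<bar> \<le> L * (exp \<beta> * norm h)"
      unfolding P_translate[OF t0 mg gb] by (rule P_bound[OF t0])
    also have "\<dots> = 2 * exp \<beta> * norm h * t powr ((\<alpha> - 1) / (2 * s)) * F"
    proof -
      have "\<epsilon> powr (\<alpha> - 1) = t powr ((\<alpha> - 1) / (2 * s))" by (simp add: \<epsilon>_def powr_powr)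
      then show ?thesis by (simp add: L_def)
    qed
    finally have 2: "\<bar>P t g (x + h) - P t g x\<bar> \<le> 2 * exp \<beta> * norm h * t powr ((\<alpha> - 1) / (2 * s)) * F" .
    have gen: "\<bar>(p + q) - (p' + q')\<bar> \<le> A + B" if "\<bar>p - p'\<bar> \<le> A" "\<bar>q - q'\<bar> \<le> B" for p q p' q' A B :: real
      using that by linarith
    show ?thesis unfolding dec[of x] dec[of "x + h"]
      by (rule order_trans[OF gen[OF 1 2]]) (simp add: C_def algebra_simps)
  qed
  moreover have "0 < C" using K(1) by (simp add: C_def add_pos_pos)
  ultimately show thesis using that by blast
qed

text \<open>The time is cut into thirds and each third absorbs one increment, which the flow carries
  inwards through the outer factors. The innermost third acts on \<open>f\<close> itself and has the
  Hoelder gain; the others act on functions controlled in the sup norm. The exponents add up to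
  \<open>(\<alpha> - 3) / (2 * s)\<close>.\<close>

lemma P_third_difference:
  assumes \<alpha>: "0 \<le> \<alpha>" "\<alpha> < 1"
  obtains C where "C > 0" "\<And>t a b c f F x. 0 < t \<Longrightarrow> t \<le> 1 \<Longrightarrow> continuous_on UNIV f \<Longrightarrow> (\<And>y. \<bar>f y\<bar> \<le> F) \<Longrightarrow>
    (\<And>y z. \<bar>f y - f z\<bar> \<le> 2 * F * norm (y - z) powr \<alpha>) \<Longrightarrow>
    \<bar>incr a (incr b (incr c (P t f))) x\<bar> \<le> C * (norm a * norm b * norm c) * t powr ((\<alpha> - 3) / (2 * s)) * F"
proof -
  obtain K where K: "K > 0" "\<And>t h f S x. 0 < t \<Longrightarrow> t \<le> 1 \<Longrightarrow> continuous_on UNIV f \<Longrightarrow> (\<And>y. \<bar>f y\<bar> \<le> S) \<Longrightarrow>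
    \<bar>P t f (x + h) - P t f x\<bar> \<le> K * norm h * t powr (- 1 / (2 * s)) * S"
    using smoothing by blast
  obtain C1 where C1: "C1 > 0" "\<And>t h f F x. 0 < t \<Longrightarrow> t \<le> 1 \<Longrightarrow> continuous_on UNIV f \<Longrightarrow> (\<And>y. \<bar>f y\<bar> \<le> F) \<Longrightarrow>
    (\<And>y z. \<bar>f y - f z\<bar> \<le> 2 * F * norm (y - z) powr \<alpha>) \<Longrightarrow>
    \<bar>P t f (x + h) - P t f x\<bar> \<le> C1 * norm h * t powr ((\<alpha> - 1) / (2 * s)) * F"
    using P_hoelder_increment[OF \<alpha>] by blast
  define E where "E = exp \<beta>"
  define C where "C = K * K * C1 * (E * E * E) * (1 / 3) powr ((\<alpha> - 3) / (2 * s))"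
  have E: "0 < E" by (simp add: E_def)
  have "\<bar>incr a (incr b (incr c (P t f))) x\<bar> \<le> C * (norm a * norm b * norm c) * t powr ((\<alpha> - 3) / (2 * s)) * F"
    if t: "0 < t" "t \<le> 1" and f: "continuous_on UNIV f" and F: "\<And>y. \<bar>f y\<bar> \<le> F"
      and H: "\<And>y z. \<bar>f y - f z\<bar> \<le> 2 * F * norm (y - z) powr \<alpha>" for t a b c f F x
  proof -
    have F0: "0 \<le> F" using F[of 0] by simp
    define r where "r = t / 3"
    have r: "0 < r" "r \<le> 1" "0 \<le> r" using t by (auto simp: r_def)
    have fl: "norm (flow r h) \<le> E * norm h" for h
    proof -
      have "exp (\<bar>r\<bar> * \<beta>) \<le> exp \<beta>" using r \<beta>_nonneg by (simp add: mult_left_le_one_le)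
      then show ?thesis using norm_flow[of r h] mult_right_mono[of "exp (\<bar>r\<bar> * \<beta>)" "exp \<beta>" "norm h"] by (simp add: E_def)
    qed
    define f1 where "f1 = P r f"
    define f2 where "f2 = P r f1"
    have c1: "continuous_on UNIV f1" unfolding f1_def by (rule continuous_P[OF r(3) f F])
    have b1: "\<bar>f1 y\<bar> \<le> F" for y unfolding f1_def by (rule P_bound[OF r(3) F])
    have c2: "continuous_on UNIV f2" unfolding f2_def by (rule continuous_P[OF r(3) c1 b1])
    have b2: "\<bar>f2 y\<bar> \<le> F" for y unfolding f2_def by (rule P_bound[OF r(3) b1])
    have split: "P t f = P r f2"
    proof
      fix y
      have "f2 = P (r + r) f" unfolding f2_def f1_def by (rule ext) (rule semigroup[OF r(3) r(3) f F])
      then have "P r f2 y = P (r + (r + r)) f y" using semigroup[OF r(3) _ f F, of "r + r" y] r by simp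
      then show "P t f y = P r f2 y" by (simp add: r_def)
    qed
    define c' where "c' = flow r (flow r c)"
    define V where "V = incr c' f1"
    define S1 where "S1 = C1 * norm c' * r powr ((\<alpha> - 1) / (2 * s)) * F"
    have cV: "continuous_on UNIV V" unfolding V_def by (rule continuous_incr[OF c1])
    have bV: "\<bar>V y\<bar> \<le> S1" for y
      unfolding V_def S1_def incr_def f1_def by (rule C1(2)[OF r(1,2) f F H])
    have PV: "continuous_on UNIV (P r V)" by (rule continuous_P[OF r(3) cV bV])
    have PVb: "\<bar>P r V y\<bar> \<le> S1" for y by (rule P_bound[OF r(3) bV])
    define W where "W = incr (flow r b) (P r V)"
    define S2 where "S2 = K * norm (flow r b) * r powr (- 1 / (2 * s)) * S1"
    have cW: "continuous_on UNIV W" unfolding W_def by (rule continuous_incr[OF PV])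
    have bW: "\<bar>W y\<bar> \<le> S2" for y
      unfolding W_def S2_def incr_def by (rule K(2)[OF r(1,2) cV bV])
    have "incr c (P t f) = P r (P r V)"
      unfolding split incr_P[OF r(3) c2 b2] unfolding f2_def incr_P[OF r(3) c1 b1] V_def c'_def ..
    then have "incr b (incr c (P t f)) = P r W"
      by (simp only: incr_P[OF r(3) PV PVb] W_def)
    then have "\<bar>incr a (incr b (incr c (P t f))) x\<bar> = \<bar>P r W (x + a) - P r W x\<bar>"
      by (simp only: incr_def[of a])
    also have "\<dots> \<le> K * norm a * r powr (- 1 / (2 * s)) * S2" by (rule K(2)[OF r(1,2) cW bW])
    also have "\<dots> = K * K * C1 * (norm a * norm (flow r b) * norm c') * (r powr (- 1 / (2 * s)) * r powr (- 1 / (2 * s)) * r powr ((\<alpha> - 1) / (2 * s))) * F"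
      by (simp only: S1_def S2_def mult_ac)
    also have "r powr (- 1 / (2 * s)) * r powr (- 1 / (2 * s)) * r powr ((\<alpha> - 1) / (2 * s)) = r powr ((\<alpha> - 3) / (2 * s))"
    proof -
      have "- 1 / (2 * s) + - 1 / (2 * s) + (\<alpha> - 1) / (2 * s) = (\<alpha> - 3) / (2 * s)"
        unfolding add_divide_distrib[symmetric] by simp
      then show ?thesis by (simp only: powr_add[symmetric])
    qed
    also have "r powr ((\<alpha> - 3) / (2 * s)) = (1 / 3) powr ((\<alpha> - 3) / (2 * s)) * t powr ((\<alpha> - 3) / (2 * s))"
      unfolding r_def using powr_mult[of "1 / 3" t] t by simp
    also have "K * K * C1 * (norm a * norm (flow r b) * norm c') * ((1 / 3) powr ((\<alpha> - 3) / (2 * s)) * t powr ((\<alpha> - 3) / (2 * s))) * F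
        = (K * K * C1 * ((1 / 3) powr ((\<alpha> - 3) / (2 * s)) * t powr ((\<alpha> - 3) / (2 * s))) * F) * (norm a * (norm (flow r b) * norm c'))"
      by (simp only: mult_ac)
    also have "\<dots> \<le> (K * K * C1 * ((1 / 3) powr ((\<alpha> - 3) / (2 * s)) * t powr ((\<alpha> - 3) / (2 * s))) * F) * (norm a * ((E * norm b) * (E * (E * norm c))))"
    proof (rule mult_left_mono)
      have "norm c' \<le> E * (E * norm c)"
        unfolding c'_def using order_trans[OF fl mult_left_mono[OF fl]] E by simp
      then show "norm a * (norm (flow r b) * norm c') \<le> norm a * ((E * norm b) * (E * (E * norm c)))"
        using fl[of b] E by (intro mult_left_mono[OF mult_mono]) auto
      show "0 \<le> K * K * C1 * ((1 / 3) powr ((\<alpha> - 3) / (2 * s)) * t powr ((\<alpha> - 3) / (2 * s))) * F"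
        using K(1) C1(1) F0 by simp
    qed
    also have "\<dots> = C * (norm a * norm b * norm c) * t powr ((\<alpha> - 3) / (2 * s)) * F"
      by (simp only: C_def mult_ac)
    finally show ?thesis .
  qed
  moreover have "0 < C" using K(1) C1(1) E by (simp add: C_def)
  ultimately show thesis using that by blast
qed

text \<open>The increment \<open>c\<close> meets the Hoelder bound; the other two cost a factor 2
  each. This serves the times too short for smoothing to help.\<close>

lemma P_third_difference_coarse:
  assumes \<alpha>: "0 \<le> \<alpha>" "\<alpha> < 1" and t: "0 \<le> t" "t \<le> 1" and f: "continuous_on UNIV f" and F: "\<And>y. \<bar>f y\<bar> \<le> F"
    and H: "\<And>y z. \<bar>f y - f z\<bar> \<le> 2 * F * norm (y - z) powr \<alpha>" and m: "norm c \<le> m"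
  shows "\<bar>incr a (incr b (incr c (P t f))) x\<bar> \<le> 8 * exp \<beta> * m powr \<alpha> * F"
proof -
  have F0: "0 \<le> F" using F[of 0] by simp
  have m0: "0 \<le> m" using norm_ge_zero[of c] m by linarith
  have "\<bar>incr (flow t c) f z\<bar> \<le> 2 * F * (exp \<beta> * m powr \<alpha>)" for z
  proof -
    have "exp (\<bar>t\<bar> * \<beta>) \<le> exp \<beta>" using t \<beta>_nonneg by (simp add: mult_left_le_one_le)
    then have "norm (flow t c) \<le> exp \<beta> * m"
      by (rule order_trans[OF norm_flow mult_mono[OF _ m]]) auto
    then have "norm (flow t c) powr \<alpha> \<le> (exp \<beta> * m) powr \<alpha>" using \<alpha> by (intro powr_mono2) auto
    also have "\<dots> = exp \<beta> powr \<alpha> * m powr \<alpha>" using m0 by (simp add: powr_mult)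
    also have "\<dots> \<le> exp \<beta> * m powr \<alpha>"
    proof (rule mult_right_mono)
      have "exp \<beta> powr \<alpha> \<le> exp \<beta> powr 1" using \<alpha> \<beta>_nonneg by (intro powr_mono) auto
      then show "exp \<beta> powr \<alpha> \<le> exp \<beta>" by simp
    qed simp
    finally have "2 * F * norm (flow t c) powr \<alpha> \<le> 2 * F * (exp \<beta> * m powr \<alpha>)"
      using F0 by (intro mult_left_mono) auto
    then show ?thesis using H[of "z + flow t c" z] unfolding incr_def by simp
  qed
  then have "\<bar>incr c (P t f) y\<bar> \<le> 2 * F * (exp \<beta> * m powr \<alpha>)" for y
    unfolding incr_P[OF t(1) f F] by (rule P_bound[OF t(1)])
  then have "\<bar>incr a (incr b (incr c (P t f))) x\<bar> \<le> 2 * (2 * (2 * F * (exp \<beta> * m powr \<alpha>)))"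
    by (intro incr_bound)
  then show ?thesis by (simp add: mult_ac)
qed

lemma P_third_difference_le:
  assumes \<alpha>: "0 \<le> \<alpha>" "\<alpha> < 1"
  obtains C where "C > 0" "\<And>t a b c m f F x. 0 \<le> t \<Longrightarrow> 0 < m \<Longrightarrow> norm a \<le> m \<Longrightarrow> norm b \<le> m \<Longrightarrow> norm c \<le> m \<Longrightarrow>
    continuous_on UNIV f \<Longrightarrow> (\<And>y. \<bar>f y\<bar> \<le> F) \<Longrightarrow> (\<And>y z. \<bar>f y - f z\<bar> \<le> 2 * F * norm (y - z) powr \<alpha>) \<Longrightarrow>
    \<bar>incr a (incr b (incr c (P t f))) x\<bar> \<le> C * F *
      (if t \<le> 1 then if t \<le> m powr (2 * s) then m powr \<alpha> else m ^ 3 * t powr ((\<alpha> - 3) / (2 * s))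
       else m powr (\<alpha> + 2 * s))"
proof -
  obtain C1 where C1: "C1 > 0" "\<And>t a b c f F x. 0 < t \<Longrightarrow> t \<le> 1 \<Longrightarrow> continuous_on UNIV f \<Longrightarrow> (\<And>y. \<bar>f y\<bar> \<le> F) \<Longrightarrow>
    (\<And>y z. \<bar>f y - f z\<bar> \<le> 2 * F * norm (y - z) powr \<alpha>) \<Longrightarrow>
    \<bar>incr a (incr b (incr c (P t f))) x\<bar> \<le> C1 * (norm a * norm b * norm c) * t powr ((\<alpha> - 3) / (2 * s)) * F"
    using P_third_difference[OF \<alpha>] by blast
  obtain C0 where C0: "C0 > 0" "\<And>t a b c f F x. 0 < t \<Longrightarrow> t \<le> 1 \<Longrightarrow> continuous_on UNIV f \<Longrightarrow> (\<And>y. \<bar>f y\<bar> \<le> F) \<Longrightarrow>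
    (\<And>y z. \<bar>f y - f z\<bar> \<le> 2 * F * norm (y - z) powr 0) \<Longrightarrow>
    \<bar>incr a (incr b (incr c (P t f))) x\<bar> \<le> C0 * (norm a * norm b * norm c) * t powr ((0 - 3) / (2 * s)) * F"
    using P_third_difference[OF order_refl zero_less_one] by blast
  define C where "C = C1 + C0 + 8 * exp \<beta>"
  have "\<bar>incr a (incr b (incr c (P t f))) x\<bar> \<le> C * F *
      (if t \<le> 1 then if t \<le> m powr (2 * s) then m powr \<alpha> else m ^ 3 * t powr ((\<alpha> - 3) / (2 * s))
       else m powr (\<alpha> + 2 * s))"
    if t: "0 \<le> t" and m: "0 < m" and abc: "norm a \<le> m" "norm b \<le> m" "norm c \<le> m" and f: "continuous_on UNIV f"
      and F: "\<And>y. \<bar>f y\<bar> \<le> F" and H: "\<And>y z. \<bar>f y - f z\<bar> \<le> 2 * F * norm (y - z) powr \<alpha>" for t a b c m f F x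
  proof -
    have F0: "0 \<le> F" using F[of 0] by simp
    have abc3: "norm a * norm b * norm c \<le> m ^ 3"
      unfolding power3_eq_cube using abc m by (intro mult_mono) auto
    have up: "D * Y \<le> C * F * Y" if "D \<le> (C1 + C0 + 8 * exp \<beta>) * F" "0 \<le> Y" for D Y
      unfolding C_def using that by (rule mult_right_mono)
    have CF: "8 * exp \<beta> * F \<le> (C1 + C0 + 8 * exp \<beta>) * F" "C1 * F \<le> (C1 + C0 + 8 * exp \<beta>) * F"
      "C0 * F \<le> (C1 + C0 + 8 * exp \<beta>) * F"
      using F0 C1(1) C0(1) by (intro mult_right_mono; simp add: add_nonneg_nonneg)+
    show ?thesis
    proof (cases "t \<le> 1")
      case True
      show ?thesis
      proof (cases "t \<le> m powr (2 * s)")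
        case T: True
        have "\<bar>incr a (incr b (incr c (P t f))) x\<bar> \<le> 8 * exp \<beta> * m powr \<alpha> * F"
          by (rule P_third_difference_coarse[OF \<alpha> t True f F H abc(3)])
        also have "\<dots> = 8 * exp \<beta> * F * m powr \<alpha>" by simp
        also have "\<dots> \<le> C * F * m powr \<alpha>" by (rule up[OF CF(1)]) simp
        finally show ?thesis using True T by simp
      next
        case T: False
        then have t: "0 < t" using powr_ge_zero[of m "2 * s"] by linarith
        have "\<bar>incr a (incr b (incr c (P t f))) x\<bar> \<le> C1 * (norm a * norm b * norm c) * t powr ((\<alpha> - 3) / (2 * s)) * F"
          by (rule C1(2)[OF t True f F H])
        also have "\<dots> \<le> C1 * m ^ 3 * t powr ((\<alpha> - 3) / (2 * s)) * F"
          using abc3 C1(1) F0 by (intro mult_right_mono mult_left_mono) auto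
        also have "\<dots> = C1 * F * (m ^ 3 * t powr ((\<alpha> - 3) / (2 * s)))" by simp
        also have "\<dots> \<le> C * F * (m ^ 3 * t powr ((\<alpha> - 3) / (2 * s)))" by (rule up[OF CF(2)]) (use m in simp)
        finally show ?thesis using True T by simp
      qed
    next
      case False
      \<comment> \<open>Smoothing is known for times up to 1, so the last unit of time does the work
        and \<open>P (t - 1) f\<close> is treated as merely bounded, that is, with exponent 0. For
        \<open>m <= 1\<close> the resulting \<open>m^3\<close> is below
        \<open>m powr (\<alpha> + 2 * s)\<close>; for larger \<open>m\<close> that power exceeds 1
        and the sup bound suffices.\<close>
      define g where "g = P (t - 1) f"
      have t1: "0 \<le> t - 1" using False by simp
      have gc: "continuous_on UNIV g" unfolding g_def by (rule continuous_P[OF t1 f F])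
      have gb: "\<bar>g y\<bar> \<le> F" for y unfolding g_def by (rule P_bound[OF t1 F])
      have gH: "\<bar>g y - g z\<bar> \<le> 2 * F * norm (y - z) powr 0" for y z
        using gb[of y] gb[of z] by (cases "y = z") auto
      have Pg: "P t f = P 1 g"
      proof
        fix y
        have "P 1 (P (t - 1) f) y = P (1 + (t - 1)) f y" by (rule semigroup[OF _ t1 f F]) simp
        then show "P t f y = P 1 g y" by (simp add: g_def)
      qed
      have "\<bar>incr a (incr b (incr c (P 1 g))) x\<bar> \<le> C * F * m powr (\<alpha> + 2 * s)"
      proof (cases "m \<le> 1")
        case True
        have "\<bar>incr a (incr b (incr c (P 1 g))) x\<bar> \<le> C0 * (norm a * norm b * norm c) * 1 powr ((0 - 3) / (2 * s)) * F"
          by (rule C0(2)[OF _ _ gc gb gH]) auto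
        also have "\<dots> = C0 * F * (norm a * norm b * norm c)" by simp
        also have "\<dots> \<le> C0 * F * m powr (\<alpha> + 2 * s)"
        proof (rule mult_left_mono)
          have "m ^ 3 = m powr 3" using m by simp
          also have "\<dots> \<le> m powr (\<alpha> + 2 * s)" using m True \<alpha> s by (intro powr_mono') auto
          finally show "norm a * norm b * norm c \<le> m powr (\<alpha> + 2 * s)" using abc3 by simp
        qed (use C0(1) F0 in simp)
        also have "\<dots> \<le> C * F * m powr (\<alpha> + 2 * s)" by (rule up[OF CF(3)]) simp
        finally show ?thesis .
      next
        case False
        have "\<bar>incr a (incr b (incr c (P 1 g))) x\<bar> \<le> 8 * exp \<beta> * m powr 0 * F"
          by (rule P_third_difference_coarse[OF _ _ _ _ gc gb gH abc(3)]) auto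
        also have "\<dots> = 8 * exp \<beta> * F * 1" using m by simp
        also have "\<dots> \<le> 8 * exp \<beta> * F * m powr (\<alpha> + 2 * s)"
          using False \<alpha> s F0 by (intro mult_left_mono ge_one_powr_ge_zero) auto
        also have "\<dots> \<le> C * F * m powr (\<alpha> + 2 * s)" by (rule up[OF CF(1)]) simp
        finally show ?thesis .
      qed
      then show ?thesis using False Pg by simp
    qed
  qed
  moreover have "0 < C" using C1(1) C0(1) by (simp add: C_def add_pos_pos)
  ultimately show thesis using that by blast
qed

text \<open>For \<open>t\<close> below \<open>m powr (2 * s)\<close>, with \<open>m\<close> the size of the increments, the Hoelder bound on \<open>f\<close> is used, and above
  it the smoothing of three steps of the semigroup: \<open>t powr ((\<alpha> - 3) / (2 * s))\<close> is integrable at infinity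
  because \<open>\<alpha> + 2 * s < 3\<close>.\<close>

lemma Rs_third_difference:
  assumes \<alpha>: "0 \<le> \<alpha>" "\<alpha> < 1" and l: "0 < l"
  obtains C where "C > 0" "\<And>a b c f F x. continuous_on UNIV f \<Longrightarrow> (\<And>y. \<bar>f y\<bar> \<le> F) \<Longrightarrow>
    (\<And>y z. \<bar>f y - f z\<bar> \<le> 2 * F * norm (y - z) powr \<alpha>) \<Longrightarrow>
    \<bar>incr a (incr b (incr c (Rs l f))) x\<bar> \<le> C * F * max (norm a) (max (norm b) (norm c)) powr (\<alpha> + 2 * s)"
proof -
  obtain C1 where C1: "C1 > 0" "\<And>t a b c m f F x. 0 \<le> t \<Longrightarrow> 0 < m \<Longrightarrow> norm a \<le> m \<Longrightarrow> norm b \<le> m \<Longrightarrow> norm c \<le> m \<Longrightarrow>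
    continuous_on UNIV f \<Longrightarrow> (\<And>y. \<bar>f y\<bar> \<le> F) \<Longrightarrow> (\<And>y z. \<bar>f y - f z\<bar> \<le> 2 * F * norm (y - z) powr \<alpha>) \<Longrightarrow>
    \<bar>incr a (incr b (incr c (P t f))) x\<bar> \<le> C1 * F *
      (if t \<le> 1 then if t \<le> m powr (2 * s) then m powr \<alpha> else m ^ 3 * t powr ((\<alpha> - 3) / (2 * s))
       else m powr (\<alpha> + 2 * s))"
    using P_third_difference_le[OF \<alpha>] by blast
  define \<gamma> where "\<gamma> = (3 - \<alpha>) / (2 * s)"
  have \<gamma>: "1 < \<gamma>" using \<alpha> s by (simp add: \<gamma>_def pos_less_divide_eq)
  have \<gamma>': "(\<alpha> - 3) / (2 * s) = - \<gamma>" by (simp add: \<gamma>_def minus_divide_left)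
  have s\<gamma>: "2 * s * \<gamma> = 3 - \<alpha>" using s by (simp add: \<gamma>_def)
  define C where "C = C1 * (1 + 1 / (\<gamma> - 1) + 1 / l)"
  have "\<bar>incr a (incr b (incr c (Rs l f))) x\<bar> \<le> C * F * max (norm a) (max (norm b) (norm c)) powr (\<alpha> + 2 * s)"
    if f: "continuous_on UNIV f" and F: "\<And>y. \<bar>f y\<bar> \<le> F"
      and H: "\<And>y z. \<bar>f y - f z\<bar> \<le> 2 * F * norm (y - z) powr \<alpha>" for a b c f F x
  proof -
    have F0: "0 \<le> F" using F[of 0] by simp
    define m where "m = max (norm a) (max (norm b) (norm c))"
    have abc: "norm a \<le> m" "norm b \<le> m" "norm c \<le> m" by (auto simp: m_def)
    have C1F: "0 \<le> C1 * F" using C1(1) F0 by simp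
    have "\<bar>incr a (incr b (incr c (Rs l f))) x\<bar> \<le> C * F * m powr (\<alpha> + 2 * s)"
    proof (cases "0 < m")
      case False
      then have "norm a \<le> 0" using abc(1) by linarith
      then have "a = 0" by simp
      moreover have "0 \<le> C * F" using C1(1) \<gamma> l F0 by (simp add: C_def)
      ultimately show ?thesis by (simp add: incr_def)
    next
      case m: True
      \<comment> \<open>At this time the short-time bound \<open>m powr \<alpha>\<close> and the
        smoothing bound agree, so both integrals have the size
        \<open>m powr (\<alpha> + 2 * s)\<close>.\<close>
      define T where "T = m powr (2 * s)"
      have T: "0 < T" using m by (simp add: T_def)
      define X where "X t = incr a (incr b (incr c (P (max 0 t) f))) x" for t
      have i0: "set_integrable lborel {0..} (\<lambda>t. exp (- l * t) * P (max 0 t) f y)" for y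
        by (rule Rs_integrable[OF l f F])
      have i1: "set_integrable lborel {0..} (\<lambda>t. exp (- l * t) * incr c (P (max 0 t) f) y)" for y
        by (rule incr_integral(1)[OF i0])
      have i2: "set_integrable lborel {0..} (\<lambda>t. exp (- l * t) * incr b (incr c (P (max 0 t) f)) y)" for y
        by (rule incr_integral(1)[OF i1])
      have i3: "set_integrable lborel {0..} (\<lambda>t. exp (- l * t) * X t)"
        unfolding X_def by (rule incr_integral(1)[OF i2])
      have "Rs l f = (\<lambda>x. LINT t:{0..}|lborel. exp (- l * t) * P (max 0 t) f x)" by (rule ext) (rule Rs_max)
      then have eq: "incr a (incr b (incr c (Rs l f))) x = (LINT t:{0..}|lborel. exp (- l * t) * X t)"
        by (simp only: incr_integral(2)[OF i0] incr_integral(2)[OF i1] incr_integral(2)[OF i2] X_def)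
      \<comment> \<open>The three majorants are taken over their full ranges: \<open>g1\<close> and
        \<open>g2\<close> are not cut at time 1, and \<open>g3\<close> starts at 0. This only
        enlarges the sum and keeps each integral explicit.\<close>
      define g1 where "g1 t = m powr \<alpha> * indicator {0..T} t" for t :: real
      define g2 where "g2 t = m ^ 3 * (indicator {T..} t *\<^sub>R t powr (- 1 - (\<gamma> - 1)))" for t :: real
      define g3 where "g3 t = m powr (\<alpha> + 2 * s) * (indicator {0..} t *\<^sub>R exp (- l * t))" for t :: real
      have g0: "0 \<le> g1 t" "0 \<le> g2 t" "0 \<le> g3 t" for t using m by (auto simp: g1_def g2_def g3_def)
      have "has_bochner_integral lborel (indicator {0..T} :: real \<Rightarrow> real) T"
        using has_bochner_integral_real_indicator[of "{0..T}" lborel] T by simp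
      then have h1: "has_bochner_integral lborel g1 (m powr \<alpha> * T)"
        unfolding g1_def[abs_def] by (intro has_bochner_integral_mult_right)
      have "has_bochner_integral lborel (\<lambda>t. indicator {T..} t *\<^sub>R t powr (- 1 - (\<gamma> - 1))) (T powr (- (\<gamma> - 1)) / (\<gamma> - 1))"
        using levy_mass_atLeast[of "\<gamma> - 1" T] \<gamma> T unfolding levy_mass_def set_integrable_def set_lebesgue_integral_def
        by (simp add: has_bochner_integral_iff)
      then have h2: "has_bochner_integral lborel g2 (m ^ 3 * (T powr (- (\<gamma> - 1)) / (\<gamma> - 1)))"
        unfolding g2_def[abs_def] by (intro has_bochner_integral_mult_right)
      have "has_bochner_integral lborel (\<lambda>t. indicator {0..} t *\<^sub>R exp (- l * t)) (1 / l)"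
        using exp_integral[OF l] unfolding set_integrable_def set_lebesgue_integral_def
        by (simp add: has_bochner_integral_iff)
      then have h3: "has_bochner_integral lborel g3 (m powr (\<alpha> + 2 * s) * (1 / l))"
        unfolding g3_def[abs_def] by (intro has_bochner_integral_mult_right)
      define G where "G t = C1 * F * (g1 t + g2 t + g3 t)" for t
      have G: "has_bochner_integral lborel G (C1 * F * (m powr \<alpha> * T + m ^ 3 * (T powr (- (\<gamma> - 1)) / (\<gamma> - 1)) + m powr (\<alpha> + 2 * s) * (1 / l)))"
        unfolding G_def[abs_def] by (intro has_bochner_integral_mult_right has_bochner_integral_add h1 h2 h3)
      have le: "\<bar>indicator {0..} t *\<^sub>R (exp (- l * t) * X t)\<bar> \<le> G t" for t
      proof (cases "0 \<le> t")
        case False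
        then show ?thesis using C1F g0[of t] by (simp add: G_def)
      next
        case t: True
        define Y where "Y = (if t \<le> 1 then if t \<le> m powr (2 * s) then m powr \<alpha> else m ^ 3 * t powr ((\<alpha> - 3) / (2 * s))
          else m powr (\<alpha> + 2 * s))"
        have Y0: "0 \<le> Y" using m by (simp add: Y_def)
        have XY: "\<bar>X t\<bar> \<le> C1 * F * Y"
          using C1(2)[OF t m abc f F H] t by (simp add: X_def Y_def)
        have e: "0 \<le> exp (- l * t)" "exp (- l * t) \<le> 1" using l t by auto
        have eY: "exp (- l * t) * Y \<le> g1 t + g2 t + g3 t"
        proof (cases "t \<le> 1")
          case t1: True
          have "exp (- l * t) * Y \<le> Y" using e Y0 by (simp add: mult_left_le_one_le)
          also have "Y \<le> g1 t + g2 t"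
          proof (cases "t \<le> T")
            case True
            then have "Y = g1 t" using t t1 by (simp add: Y_def g1_def T_def)
            then show ?thesis using g0[of t] by simp
          next
            case False
            then have "Y = g2 t" using t1 by (simp add: Y_def g2_def T_def \<gamma>')
            then show ?thesis using g0[of t] by simp
          qed
          finally show ?thesis using g0[of t] by simp
        next
          case False
          then have "exp (- l * t) * Y = g3 t" using t by (simp add: Y_def g3_def)
          then show ?thesis using g0[of t] by simp
        qed
        have "\<bar>indicator {0..} t *\<^sub>R (exp (- l * t) * X t)\<bar> = exp (- l * t) * \<bar>X t\<bar>"
          using t by (simp add: abs_mult)
        also have "\<dots> \<le> exp (- l * t) * (C1 * F * Y)" using XY e(1) by (rule mult_left_mono)
        also have "\<dots> = C1 * F * (exp (- l * t) * Y)" by simp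
        also have "\<dots> \<le> G t" unfolding G_def using eY C1F by (rule mult_left_mono)
        finally show ?thesis .
      qed
      have "\<bar>LINT t:{0..}|lborel. exp (- l * t) * X t\<bar> \<le> integral\<^sup>L lborel G"
        using integral_abs_bound_integral[of lborel "\<lambda>t. indicator {0..} t *\<^sub>R (exp (- l * t) * X t)" G] i3 le
          has_bochner_integral_iff[THEN iffD1, OF G]
        unfolding set_integrable_def set_lebesgue_integral_def by blast
      also have "integral\<^sup>L lborel G = C1 * F * (m powr \<alpha> * T + m ^ 3 * (T powr (- (\<gamma> - 1)) / (\<gamma> - 1)) + m powr (\<alpha> + 2 * s) * (1 / l))"
        by (rule has_bochner_integral_integral_eq[OF G])
      also have "m powr \<alpha> * T = m powr (\<alpha> + 2 * s)" by (simp add: T_def powr_add)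
      also have "m ^ 3 * (T powr (- (\<gamma> - 1)) / (\<gamma> - 1)) = m powr (\<alpha> + 2 * s) * (1 / (\<gamma> - 1))"
      proof -
        have "2 * s * - (\<gamma> - 1) = \<alpha> + 2 * s - 3" using s\<gamma> by (simp add: algebra_simps)
        then have "T powr (- (\<gamma> - 1)) = m powr (\<alpha> + 2 * s - 3)" by (simp only: T_def powr_powr)
        moreover have "m ^ 3 = m powr 3" using m by simp
        ultimately have "m ^ 3 * T powr (- (\<gamma> - 1)) = m powr (\<alpha> + 2 * s)" by (simp only: powr_add[symmetric]) simp
        then show ?thesis by simp
      qed
      also have "C1 * F * (m powr (\<alpha> + 2 * s) + m powr (\<alpha> + 2 * s) * (1 / (\<gamma> - 1)) + m powr (\<alpha> + 2 * s) * (1 / l)) = C * F * m powr (\<alpha> + 2 * s)"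
        unfolding C_def by (simp only: distrib_left distrib_right mult_ac mult_1_right mult_1_left)
      finally show ?thesis by (simp only: eq)
    qed
    then show ?thesis by (simp only: m_def)
  qed
  moreover have "0 < C" using C1(1) \<gamma> l by (simp add: C_def add_pos_pos)
  ultimately show thesis using that by blast
qed

section \<open>Regularity of solutions\<close>

lemma Rs_regularity:
  assumes \<alpha>: "0 \<le> \<alpha>" "\<alpha> < 1" and l: "0 < l"
  obtains C where "C > 0" "\<And>f F. continuous_on UNIV f \<Longrightarrow> (\<And>y. \<bar>f y\<bar> \<le> F) \<Longrightarrow>
    (\<And>y z. \<bar>f y - f z\<bar> \<le> 2 * F * norm (y - z) powr \<alpha>) \<Longrightarrow>
    (\<alpha> + 2 * s \<notin> {1, 2} \<longrightarrow> Rs l f \<in> hoelder_space (\<alpha> + 2 * s) \<and> hoelder_norm (\<alpha> + 2 * s) (Rs l f) \<le> C * F) \<and>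
    (\<forall>k::nat. \<alpha> + 2 * s = real k \<longrightarrow> Rs l f \<in> zygmund_space k \<and> zygmund_norm k (Rs l f) \<le> C * F)"
proof -
  obtain C1 where C1: "C1 > 0" "\<And>a b c f F x. continuous_on UNIV f \<Longrightarrow> (\<And>y. \<bar>f y\<bar> \<le> F) \<Longrightarrow>
    (\<And>y z. \<bar>f y - f z\<bar> \<le> 2 * F * norm (y - z) powr \<alpha>) \<Longrightarrow>
    \<bar>incr a (incr b (incr c (Rs l f))) x\<bar> \<le> C1 * F * max (norm a) (max (norm b) (norm c)) powr (\<alpha> + 2 * s)"
    using Rs_third_difference[OF \<alpha> l] by blast
  have \<theta>: "0 < \<alpha> + 2 * s" "\<alpha> + 2 * s < 3" using \<alpha> s by auto
  obtain C2 where C2: "C2 > 0" "\<And>(u :: real^'n \<Rightarrow> real) M K. continuous_on UNIV u \<Longrightarrow> (\<And>x. \<bar>u x\<bar> \<le> M) \<Longrightarrow> 0 \<le> K \<Longrightarrow>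
      (\<And>a b c x. \<bar>incr a (incr b (incr c u)) x\<bar> \<le> K * max (norm a) (max (norm b) (norm c)) powr (\<alpha> + 2 * s)) \<Longrightarrow>
      (\<alpha> + 2 * s \<notin> {1, 2} \<longrightarrow> u \<in> hoelder_space (\<alpha> + 2 * s) \<and> hoelder_norm (\<alpha> + 2 * s) u \<le> C2 * (M + K)) \<and>
      (\<forall>k::nat. \<alpha> + 2 * s = real k \<longrightarrow> u \<in> zygmund_space k \<and> zygmund_norm k u \<le> C2 * (M + K))"
    using third_difference_regularity[where 'n='n, OF \<theta>] by blast
  show thesis
  proof (rule that[of "C2 * (1 / l + C1)"])
    show "0 < C2 * (1 / l + C1)" using C1(1) C2(1) l by (simp add: add_pos_pos)
    fix f :: "real^'n \<Rightarrow> real" and F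
    assume f: "continuous_on UNIV f" and F: "\<And>y. \<bar>f y\<bar> \<le> F"
      and H: "\<And>y z. \<bar>f y - f z\<bar> \<le> 2 * F * norm (y - z) powr \<alpha>"
    have "0 \<le> F" using F[of 0] by simp
    then have "0 \<le> C1 * F" using C1(1) by simp
    note C2(2)[OF continuous_Rs[OF l f F] Rs_bound[OF l F] this C1(2)[OF f F H]]
    moreover have "C2 * (1 / l + C1) * F = C2 * (F / l + C1 * F)" by (simp add: algebra_simps)
    ultimately show "(\<alpha> + 2 * s \<notin> {1, 2} \<longrightarrow> Rs l f \<in> hoelder_space (\<alpha> + 2 * s) \<and>
        hoelder_norm (\<alpha> + 2 * s) (Rs l f) \<le> C2 * (1 / l + C1) * F) \<and>
      (\<forall>k::nat. \<alpha> + 2 * s = real k \<longrightarrow> Rs l f \<in> zygmund_space k \<and> zygmund_norm k (Rs l f) \<le> C2 * (1 / l + C1) * F)"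
      by (simp only:)
  qed
qed

end

lemma hoelder_spaceD:
  fixes f :: "real^'n \<Rightarrow> real"
  assumes \<alpha>: "0 < \<alpha>" "\<alpha> < 1" and f: "f \<in> hoelder_space \<alpha>"
  shows "\<bar>f x\<bar> \<le> hoelder_norm \<alpha> f" "\<bar>f x - f y\<bar> \<le> hoelder_norm \<alpha> f * norm (x - y) powr \<alpha>"
proof -
  have "\<lfloor>\<alpha>\<rfloor> = 0" using \<alpha> by (simp add: floor_eq_iff)
  then have fl: "nat \<lfloor>\<alpha>\<rfloor> = 0" by simp
  have fr: "frac \<alpha> = \<alpha>" using \<alpha> by (simp add: frac_eq)
  have "{js :: 'n list. length js = 0} = {[]}" by auto
  then have tn: "tensor_norm 0 T = \<bar>T []\<bar>" for T :: "'n list \<Rightarrow> real" by (simp add: tensor_norm_def)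
  have q: "hoelder_quot 0 \<alpha> f (z, h) = \<bar>f (z + h) - f z\<bar> / norm h powr \<alpha>" for z h
    by (simp add: hoelder_quot_def tn)
  let ?S = "SUP p\<in>UNIV \<times> (- {0}). hoelder_quot 0 \<alpha> f p"
  have bdd: "bdd_above (hoelder_quot 0 \<alpha> f ` (UNIV \<times> (- {0})))" and cnb: "f \<in> Cnb 0"
    using f by (auto simp: hoelder_space_def fl fr)
  have qS: "\<bar>f (z + h) - f z\<bar> / norm h powr \<alpha> \<le> ?S" if "h \<noteq> 0" for z h
    unfolding q[symmetric] by (rule cSUP_upper[OF _ bdd]) (use that in auto)
  have S0: "0 \<le> ?S"
    \<comment> \<open>The sign of a supremum needs a witness: a coordinate vector is a nonzero
      increment, and its quotient is a nonnegative lower bound.\<close>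
    using order_trans[OF _ qS[of "axis undefined 1" 0]] by (simp add: axis_eq_0_iff)
  have "bounded (range f)" using cnb by (auto simp: Cnb_def)
  then obtain M where "\<And>z. \<bar>f z\<bar> \<le> M" unfolding bounded_iff by auto
  then have "bdd_above (range (\<lambda>z. \<bar>f z\<bar>))" by (intro bdd_aboveI[of _ M]) auto
  then have fS: "\<bar>f z\<bar> \<le> (SUP z. \<bar>f z\<bar>)" for z by (intro cSUP_upper) auto
  have N: "hoelder_norm \<alpha> f = (SUP z. \<bar>f z\<bar>) + ?S"
    by (simp add: hoelder_norm_def Cnb_norm_def fl fr tn)
  show "\<bar>f x\<bar> \<le> hoelder_norm \<alpha> f" using fS[of x] S0 N by linarith
  have SN: "?S \<le> hoelder_norm \<alpha> f" using fS[of x] N by linarith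
  show "\<bar>f x - f y\<bar> \<le> hoelder_norm \<alpha> f * norm (x - y) powr \<alpha>"
  proof (cases "x = y")
    case False
    then have "\<bar>f x - f y\<bar> / norm (x - y) powr \<alpha> \<le> hoelder_norm \<alpha> f"
      using order_trans[OF qS[of "x - y" y] SN] by simp
    then show ?thesis using False by (simp add: pos_divide_le_eq)
  qed simp
qed

theorem theorem4p4:
  fixes Q B :: "real^'n^'n" and s lam :: real
  assumes "symmetric_mat Q" and "pos_def_mat Q"
    and "0 < s" and "s < 1" and "0 < lam"
  shows
    "(s \<noteq> 1/2 \<longrightarrow>
        (\<exists>C>0. \<forall>f :: (real^'n) \<Rightarrow>\<^sub>C real.
           (\<exists>!u. solves_resolvent_eq (ou_generator Q B s) lam f u) \<and>
           (\<forall>u. solves_resolvent_eq (ou_generator Q B s) lam f u \<longrightarrow>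
              apply_bcontfun u \<in> hoelder_space (2 * s) \<and>
              hoelder_norm (2 * s) (apply_bcontfun u) \<le> C * norm f))) \<and>
     (s = 1/2 \<longrightarrow>
        (\<exists>C>0. \<forall>f :: (real^'n) \<Rightarrow>\<^sub>C real.
           (\<exists>!u. solves_resolvent_eq (ou_generator Q B s) lam f u) \<and>
           (\<forall>u. solves_resolvent_eq (ou_generator Q B s) lam f u \<longrightarrow>
              apply_bcontfun u \<in> zygmund_space 1 \<and>
              zygmund_norm 1 (apply_bcontfun u) \<le> C * norm f))) \<and>
     (\<forall>\<alpha>. 0 < \<alpha> \<and> \<alpha> < 1 \<and> \<alpha> + 2 * s \<notin> {1, 2} \<longrightarrow>
        (\<exists>C>0. \<forall>f u :: (real^'n) \<Rightarrow>\<^sub>C real.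
           apply_bcontfun f \<in> hoelder_space \<alpha> \<and>
           solves_resolvent_eq (ou_generator Q B s) lam f u \<longrightarrow>
              apply_bcontfun u \<in> hoelder_space (\<alpha> + 2 * s) \<and>
              hoelder_norm (\<alpha> + 2 * s) (apply_bcontfun u)
                \<le> C * hoelder_norm \<alpha> (apply_bcontfun f))) \<and>
     (\<forall>\<alpha> (k::nat). 0 < \<alpha> \<and> \<alpha> < 1 \<and> k \<in> {1, 2} \<and> \<alpha> + 2 * s = real k \<longrightarrow>
        (\<exists>C>0. \<forall>f u :: (real^'n) \<Rightarrow>\<^sub>C real.
           apply_bcontfun f \<in> hoelder_space \<alpha> \<and>
           solves_resolvent_eq (ou_generator Q B s) lam f u \<longrightarrow>
              apply_bcontfun u \<in> zygmund_space k \<and>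
              zygmund_norm k (apply_bcontfun u)
                \<le> C * hoelder_norm \<alpha> (apply_bcontfun f)))"
proof -
  interpret ou Q B s by unfold_locales (use assms in auto)
  note sol = ou_generator_solves[OF assms(5)]
  have app: "apply_bcontfun (Rc lam f) = Rs lam (apply_bcontfun f)" for f :: "(real^'n) \<Rightarrow>\<^sub>C real"
    by (rule ext) (rule Rc_apply[OF assms(5)])
  note cont = continuous_bcontfun
  \<comment> \<open>For (a) and (b) the exponent is 0 and \<open>F\<close> will be
    \<open>norm f\<close>: two values of \<open>f\<close> differ by at most twice the sup
    norm.\<close>
  obtain C where C: "C > 0" "\<And>f F. continuous_on UNIV f \<Longrightarrow> (\<And>y. \<bar>f y\<bar> \<le> F) \<Longrightarrow>
    (\<And>y z. \<bar>f y - f z\<bar> \<le> 2 * F * norm (y - z) powr 0) \<Longrightarrow>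
    (0 + 2 * s \<notin> {1, 2} \<longrightarrow> Rs lam f \<in> hoelder_space (0 + 2 * s) \<and> hoelder_norm (0 + 2 * s) (Rs lam f) \<le> C * F) \<and>
    (\<forall>k::nat. 0 + 2 * s = real k \<longrightarrow> Rs lam f \<in> zygmund_space k \<and> zygmund_norm k (Rs lam f) \<le> C * F)"
    using Rs_regularity[OF order_refl zero_less_one assms(5)] by blast
  have zero: "(2 * s \<notin> {1, 2} \<longrightarrow> apply_bcontfun (Rc lam f) \<in> hoelder_space (2 * s) \<and>
        hoelder_norm (2 * s) (apply_bcontfun (Rc lam f)) \<le> C * norm f) \<and>
      (\<forall>k::nat. 2 * s = real k \<longrightarrow> apply_bcontfun (Rc lam f) \<in> zygmund_space k \<and>
        zygmund_norm k (apply_bcontfun (Rc lam f)) \<le> C * norm f)" for f :: "(real^'n) \<Rightarrow>\<^sub>C real"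
  proof -
    have "\<bar>apply_bcontfun f y - apply_bcontfun f z\<bar> \<le> 2 * norm f * norm (y - z) powr 0" for y z
      using abs_bcontfun_le[of f y] abs_bcontfun_le[of f z] by (cases "y = z") auto
    from C(2)[OF cont abs_bcontfun_le this] show ?thesis unfolding app add_0 .
  qed
  have pos: "\<exists>C>0. \<forall>f :: (real^'n) \<Rightarrow>\<^sub>C real. apply_bcontfun f \<in> hoelder_space \<alpha> \<longrightarrow>
      (\<alpha> + 2 * s \<notin> {1, 2} \<longrightarrow> apply_bcontfun (Rc lam f) \<in> hoelder_space (\<alpha> + 2 * s) \<and>
        hoelder_norm (\<alpha> + 2 * s) (apply_bcontfun (Rc lam f)) \<le> C * hoelder_norm \<alpha> (apply_bcontfun f)) \<and>
      (\<forall>k::nat. \<alpha> + 2 * s = real k \<longrightarrow> apply_bcontfun (Rc lam f) \<in> zygmund_space k \<and>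
        zygmund_norm k (apply_bcontfun (Rc lam f)) \<le> C * hoelder_norm \<alpha> (apply_bcontfun f))"
    if \<alpha>: "0 < \<alpha>" "\<alpha> < 1" for \<alpha>
  proof -
    obtain C where C: "C > 0" "\<And>f F. continuous_on UNIV f \<Longrightarrow> (\<And>y. \<bar>f y\<bar> \<le> F) \<Longrightarrow>
      (\<And>y z. \<bar>f y - f z\<bar> \<le> 2 * F * norm (y - z) powr \<alpha>) \<Longrightarrow>
      (\<alpha> + 2 * s \<notin> {1, 2} \<longrightarrow> Rs lam f \<in> hoelder_space (\<alpha> + 2 * s) \<and> hoelder_norm (\<alpha> + 2 * s) (Rs lam f) \<le> C * F) \<and>
      (\<forall>k::nat. \<alpha> + 2 * s = real k \<longrightarrow> Rs lam f \<in> zygmund_space k \<and> zygmund_norm k (Rs lam f) \<le> C * F)"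
      using Rs_regularity[OF less_imp_le[OF \<alpha>(1)] \<alpha>(2) assms(5)] by blast
    show ?thesis
    proof (intro exI[of _ C] conjI allI impI)
      fix f :: "(real^'n) \<Rightarrow>\<^sub>C real"
      assume f: "apply_bcontfun f \<in> hoelder_space \<alpha>"
      \<comment> \<open>For (c) and (d) the whole Hoelder norm plays the part of \<open>F\<close>,
        since it bounds both the values and the Hoelder quotients.\<close>
      let ?N = "hoelder_norm \<alpha> (apply_bcontfun f)"
      note b = hoelder_spaceD[OF \<alpha> f]
      have N0: "0 \<le> ?N" using b(1)[of 0] by simp
      have "\<bar>apply_bcontfun f y - apply_bcontfun f z\<bar> \<le> 2 * ?N * norm (y - z) powr \<alpha>" for y z
      proof -
        have "?N * norm (y - z) powr \<alpha> \<le> 2 * ?N * norm (y - z) powr \<alpha>" using N0 by (intro mult_right_mono) auto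
        then show ?thesis using b(2)[of y z] by linarith
      qed
      note reg = C(2)[OF cont b(1) this]
      {
        assume "\<alpha> + 2 * s \<notin> {1, 2}"
        then show "apply_bcontfun (Rc lam f) \<in> hoelder_space (\<alpha> + 2 * s)"
          "hoelder_norm (\<alpha> + 2 * s) (apply_bcontfun (Rc lam f)) \<le> C * ?N"
          using reg unfolding app by blast+
      next
        fix k :: nat assume "\<alpha> + 2 * s = real k"
        then show "apply_bcontfun (Rc lam f) \<in> zygmund_space k"
          "zygmund_norm k (apply_bcontfun (Rc lam f)) \<le> C * ?N"
          using reg unfolding app by blast+
      }
    qed (rule C(1))
  qed
  show ?thesis
    \<comment> \<open>Solving the equation now means being equal to \<open>Rc lam f\<close>, so
      existence and uniqueness are immediate and only the estimates remain.\<close>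
    unfolding sol
  proof (intro conjI impI allI)
    assume "s \<noteq> 1 / 2"
    then have "2 * s \<notin> {1, 2}" using assms(4) by auto
    then show "\<exists>C>0. \<forall>f. (\<exists>!u. u = Rc lam f) \<and> (\<forall>u. u = Rc lam f \<longrightarrow>
        apply_bcontfun u \<in> hoelder_space (2 * s) \<and> hoelder_norm (2 * s) (apply_bcontfun u) \<le> C * norm f)"
      using C(1) zero by (intro exI[of _ C]) simp
  next
    assume "s = 1 / 2"
    then have "2 * s = real 1" by simp
    then show "\<exists>C>0. \<forall>f. (\<exists>!u. u = Rc lam f) \<and> (\<forall>u. u = Rc lam f \<longrightarrow>
        apply_bcontfun u \<in> zygmund_space 1 \<and> zygmund_norm 1 (apply_bcontfun u) \<le> C * norm f)"
      using C(1) zero by (intro exI[of _ C]) (auto simp only:)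
  next
    fix \<alpha> assume "0 < \<alpha> \<and> \<alpha> < 1 \<and> \<alpha> + 2 * s \<notin> {1, 2}"
    then show "\<exists>C>0. \<forall>f u. apply_bcontfun f \<in> hoelder_space \<alpha> \<and> u = Rc lam f \<longrightarrow>
        apply_bcontfun u \<in> hoelder_space (\<alpha> + 2 * s) \<and>
        hoelder_norm (\<alpha> + 2 * s) (apply_bcontfun u) \<le> C * hoelder_norm \<alpha> (apply_bcontfun f)"
      using pos[of \<alpha>] by blast
  next
    fix \<alpha> and k :: nat assume "0 < \<alpha> \<and> \<alpha> < 1 \<and> k \<in> {1, 2} \<and> \<alpha> + 2 * s = real k"
    then show "\<exists>C>0. \<forall>f u. apply_bcontfun f \<in> hoelder_space \<alpha> \<and> u = Rc lam f \<longrightarrow>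
        apply_bcontfun u \<in> zygmund_space k \<and>
        zygmund_norm k (apply_bcontfun u) \<le> C * hoelder_norm \<alpha> (apply_bcontfun f)"
      using pos[of \<alpha>] by blast
  qed
qed

end
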